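(* Let $K$ be a number field and let $\varphi:\mathbb{P}^1\to\mathbb{P}^1$ be a rational map of degree $d\ge 2$ defined over $K$. Suppose the Dynamical Lehmer's Conjecture holds for $\varphi$ over $K$ with constant $C=C(\varphi,K)>0$, i.e. $$\hat{h}_\varphi(\alpha)>\frac{C}{[K(\alpha):K]}$$ for every $\alpha\in\overline{K}$ that is not preperiodic for $\varphi$. Suppose $\beta\in K$ is not preperiodic for $\varphi$. Then for every $n\ge 1$, $$\mu_{\varphi,\beta}(n)\le\frac{\hat{h}_\varphi(\beta)}{C}.$$ Consequently, the number of Galois orbits of $\varphi^{-n}(\beta)$ over $K$ is at most $\hat{h}_\varphi(\beta)/C$.
   Context: $\varphi^n$ denotes the $n$-th iterate and $\varphi^{-n}(\beta)\subset\mathbb{P}^1(\overline{K})$ the set of preimages of $\beta$ under $\varphi^n$. A point is preperiodic for $\varphi$ if its forward orbit under iteration of $\varphi$ is finite. Galois orbits over $K$ are orbits of $\mathrm{Gal}(\overline{K}/K)$. Write $\varphi^n(z)=f_n(z)/g_n(z)$ with $f_n,g_n\in K[z]$ relatively prime; $\mu_{\varphi,\beta}(n)$ is the number of (distinct, up to scalars) irreducible factors over $K$ of $\varphi_{n,\beta}(z)=f_n(z)-\beta g_n(z)$. For $\gamma=(\gamma_1:\gamma_2)\in\mathbb{P}^1(\overline{K})$ with $\gamma_1,\gamma_2$ in a number field $L$, the absolute logarithmic height is $h(\gamma)=\sum_{v\in M_L}\log\max\{|\gamma_1|_v,|\gamma_2|_v\}$, where for each place $v$ of $L$ above a place $p$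 of $\mathbb{Q}$ (including the archimedean one), $|x|_v=|N_{L_v/\mathbb{Q}_p}(x)|_p^{1/[L:\mathbb{Q}]}$ with $|p|_p=1/p$ for primes $p$ and $|\cdot|_\infty$ the usual absolute value. The canonical height associated to $\varphi$ is $\hat{h}_\varphi(\gamma)=\lim_{n\to\infty}h(\varphi^n(\gamma))/d^n$. *)

theory Defs
  imports
    "HOL-Algebra.Generated_Fields"
    "HOL-Algebra.QuotRing"
    "HOL-Algebra.Algebraic_Closure_Type"
    "HOL-Combinatorics.Permutations"
    "HOL-Analysis.Infinite_Sum"
begin

text \<open>
  The number field \<open>K\<close> is a type \<open>'k\<close> of characteristic \<open>0\<close> that is finite dimensional over
  \<open>\<rat>\<close>; its algebraic closure is \<open>'k alg_closure\<close>, with embedding \<open>to_ac\<close>. All other number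
  fields are subfields of \<open>'k alg_closure\<close>, given as sets.
\<close>

definition number_field :: "'k::field_char_0 itself \<Rightarrow> bool" where
  "number_field _ \<longleftrightarrow> ring.finite_dimension (ring_of_type_algebra :: 'k ring) \<rat> UNIV"

definition number_subfield :: "'a::field_char_0 set \<Rightarrow> bool" where
  "number_subfield L \<longleftrightarrow>
     subfield L ring_of_type_algebra \<and> ring.finite_dimension ring_of_type_algebra \<rat> L"

definition field_degree :: "'a::field set \<Rightarrow> 'a set \<Rightarrow> nat" where
  "field_degree F E = ring.dim ring_of_type_algebra F E"

definition adjoin :: "'k::field alg_closure \<Rightarrow> 'k alg_closure set" where
  "adjoin \<alpha> = generate_field ring_of_type_algebra (insert \<alpha> (range to_ac))"

definition galois_group :: "('k::field alg_closure \<Rightarrow> 'k alg_closure) set" where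
  "galois_group = {\<sigma> \<in> ring_iso ring_of_type_algebra ring_of_type_algebra.
                     \<forall>a. \<sigma> (to_ac a) = to_ac a}"

text \<open>\<open>\<PP>\<^sup>1(F)\<close> is \<open>F \<union> {\<infinity>}\<close>; \<open>P1_point x y\<close> is the point \<open>(x : y)\<close>, for \<open>(x, y) \<noteq> (0, 0)\<close>.\<close>

datatype 'a P1 = Affine 'a | Infinity

definition P1_point :: "'a::field \<Rightarrow> 'a \<Rightarrow> 'a P1" where
  "P1_point x y = (if y = 0 then Infinity else Affine (x / y))"

text \<open>
  The self-map of \<open>\<PP>\<^sup>1\<close> given by \<open>f/g\<close> with \<open>f\<close> and \<open>g\<close> coprime. At infinity one evaluates the
  homogenizations of degree \<open>max (deg f) (deg g)\<close> at \<open>(1 : 0)\<close>.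
\<close>

fun quotient_map :: "'k::field poly \<Rightarrow> 'k poly \<Rightarrow> 'k alg_closure P1 \<Rightarrow> 'k alg_closure P1" where
  "quotient_map f g (Affine z) = P1_point (poly (map_poly to_ac f) z) (poly (map_poly to_ac g) z)"
| "quotient_map f g Infinity =
     (let d = max (Polynomial.degree f) (Polynomial.degree g)
      in P1_point (to_ac (Polynomial.coeff f d)) (to_ac (Polynomial.coeff g d)))"

definition rational_map :: "('k::field alg_closure P1 \<Rightarrow> 'k alg_closure P1) \<Rightarrow> nat \<Rightarrow> bool" where
  "rational_map \<phi> d \<longleftrightarrow>
     (\<exists>f g. coprime f g \<and> max (Polynomial.degree f) (Polynomial.degree g) = d \<and>
       \<phi> = quotient_map f g)"

definition preperiodic :: "('a \<Rightarrow> 'a) \<Rightarrow> 'a \<Rightarrow> bool" where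
  "preperiodic \<phi> \<gamma> \<longleftrightarrow> finite (range (\<lambda>n. (\<phi> ^^ n) \<gamma>))"

definition preimages :: "('k::field alg_closure P1 \<Rightarrow> 'k alg_closure P1) \<Rightarrow> 'k \<Rightarrow> nat
    \<Rightarrow> 'k alg_closure P1 set" where
  "preimages \<phi> \<beta> n = {\<gamma>. (\<phi> ^^ n) \<gamma> = Affine (to_ac \<beta>)}"

definition galois_orbits :: "'k::field alg_closure P1 set \<Rightarrow> 'k alg_closure P1 set set" where
  "galois_orbits S = (\<lambda>\<gamma>. (\<lambda>\<sigma>. map_P1 \<sigma> \<gamma>) ` galois_group) ` S"

text \<open>
  \<open>\<phi>\<^sup>n = f\<^sub>n / g\<^sub>n\<close> in lowest terms; the pair \<open>(f\<^sub>n, g\<^sub>n)\<close> is determined up to a common factor in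
  \<open>K\<^sup>\<times>\<close>, which does not affect the irreducible factors of \<open>f\<^sub>n - \<beta> g\<^sub>n\<close>.
\<close>

definition iterate_fraction :: "('k::field alg_closure P1 \<Rightarrow> 'k alg_closure P1) \<Rightarrow> nat
    \<Rightarrow> 'k poly \<times> 'k poly" where
  "iterate_fraction \<phi> n =
     (SOME fg. coprime (fst fg) (snd fg) \<and> \<phi> ^^ n = quotient_map (fst fg) (snd fg))"

definition preimage_poly :: "('k::field alg_closure P1 \<Rightarrow> 'k alg_closure P1) \<Rightarrow> 'k \<Rightarrow> nat
    \<Rightarrow> 'k poly" where
  "preimage_poly \<phi> \<beta> n = (case iterate_fraction \<phi> n of (f, g) \<Rightarrow> f - smult \<beta> g)"

definition irreducible_factors :: "'k::field poly \<Rightarrow> 'k poly set set" where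
  "irreducible_factors F =
     {p. Factorial_Ring.irreducible p \<and> p dvd F} // {(p, q). \<exists>c. c \<noteq> 0 \<and> q = smult c p}"

definition mu :: "('k::field alg_closure P1 \<Rightarrow> 'k alg_closure P1) \<Rightarrow> 'k \<Rightarrow> nat \<Rightarrow> nat" where
  "mu \<phi> \<beta> n = card (irreducible_factors (preimage_poly \<phi> \<beta> n))"

definition absolute_value_on :: "'a::field set \<Rightarrow> ('a \<Rightarrow> real) \<Rightarrow> bool" where
  "absolute_value_on L v \<longleftrightarrow>
     (\<forall>x\<in>L. 0 \<le> v x \<and> (v x = 0 \<longleftrightarrow> x = 0)) \<and>
     (\<forall>x\<in>L. \<forall>y\<in>L. v (x * y) = v x * v y \<and> v (x + y) \<le> v x + v y)"

definition padic_abs :: "nat \<Rightarrow> rat \<Rightarrow> real" where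
  "padic_abs p q =
     (if q = 0 then 0 else case quotient_of q of (a, b) \<Rightarrow>
        real p powi (int (multiplicity (int p) b) - int (multiplicity (int p) a)))"

definition rat_places :: "(rat \<Rightarrow> real) set" where
  "rat_places = insert (\<lambda>q. of_rat \<bar>q\<bar>) (padic_abs ` {p. Factorial_Ring.prime p})"

text \<open>
  A place of \<open>L\<close> is represented by the unique absolute value in its equivalence class that extends
  one of the standard absolute values of \<open>\<rat>\<close>. Extensionality makes this representative unique as
  a total function.
\<close>

definition places :: "'a::field_char_0 set \<Rightarrow> ('a \<Rightarrow> real) set" where
  "places L = {v \<in> extensional L. absolute_value_on L v \<and> (\<lambda>q. v (of_rat q)) \<in> rat_places}"

definition cauchy_ring :: "'a::field set \<Rightarrow> ('a \<Rightarrow> real) \<Rightarrow> (nat \<Rightarrow> 'a) ring" where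
  "cauchy_ring L v =
     \<lparr>carrier = {s. range s \<subseteq> L \<and> (\<forall>e>0. \<exists>N. \<forall>m\<ge>N. \<forall>n\<ge>N. v (s m - s n) < e)},
      monoid.mult = (\<lambda>s t n. s n * t n), one = (\<lambda>_. 1),
      ring.zero = (\<lambda>_. 0), add = (\<lambda>s t n. s n + t n)\<rparr>"

definition null_sequences :: "'a::field set \<Rightarrow> ('a \<Rightarrow> real) \<Rightarrow> (nat \<Rightarrow> 'a) set" where
  "null_sequences L v = {s. range s \<subseteq> L \<and> (\<lambda>n. v (s n)) \<longlonglongrightarrow> 0}"

definition completion :: "'a::field set \<Rightarrow> ('a \<Rightarrow> real) \<Rightarrow> (nat \<Rightarrow> 'a) set ring" where
  "completion L v = cauchy_ring L v Quot null_sequences L v"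

definition to_completion :: "'a::field set \<Rightarrow> ('a \<Rightarrow> real) \<Rightarrow> (nat \<Rightarrow> 'a) \<Rightarrow> (nat \<Rightarrow> 'a) set" where
  "to_completion L v s = null_sequences L v +>\<^bsub>cauchy_ring L v\<^esub> s"

text \<open>
  The closure of \<open>\<rat>\<close> in \<open>L\<^sub>v\<close>, which is the canonical copy of \<open>\<rat>\<^sub>p\<close> for \<open>v\<close> above \<open>p \<le> \<infinity>\<close>.
\<close>

definition completion_rat :: "'a::field_char_0 set \<Rightarrow> ('a \<Rightarrow> real) \<Rightarrow> (nat \<Rightarrow> 'a) set set" where
  "completion_rat L v = to_completion L v ` {s \<in> carrier (cauchy_ring L v). range s \<subseteq> \<rat>}"

text \<open>The extension of \<open>v\<close> to \<open>L\<^sub>v\<close>; on \<open>completion_rat L v\<close> it is the absolute value of \<open>\<rat>\<^sub>p\<close>.\<close>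

definition completion_abs :: "('a \<Rightarrow> real) \<Rightarrow> (nat \<Rightarrow> 'a) set \<Rightarrow> real" where
  "completion_abs v S = (THE r. \<exists>s\<in>S. (\<lambda>n. v (s n)) \<longlonglongrightarrow> r)"

definition leibniz_det :: "('b, 'm) ring_scheme \<Rightarrow> nat \<Rightarrow> (nat \<Rightarrow> nat \<Rightarrow> 'b) \<Rightarrow> 'b" where
  "leibniz_det R n A =
     (\<Oplus>\<^bsub>R\<^esub>\<pi>\<in>{\<pi>. \<pi> permutes {..<n}}. [sign \<pi>] \<cdot>\<^bsub>R\<^esub> (\<Otimes>\<^bsub>R\<^esub>i\<in>{..<n}. A i (\<pi> i)))"

text \<open>
  The norm \<open>N\<^bsub>R/F\<^esub>(x)\<close> of a finite field extension \<open>R/F\<close>: the determinant of multiplication by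
  \<open>x\<close> in some \<open>F\<close>-basis of \<open>R\<close>.
\<close>

definition field_norm :: "('b, 'm) ring_scheme \<Rightarrow> 'b set \<Rightarrow> 'b \<Rightarrow> 'b" where
  "field_norm R F x =
     (let us = (SOME us. set us \<subseteq> carrier R \<and> ring.independent R F us \<and>
                         ring.Span R F us = carrier R);
          n = length us;
          A = (SOME A. \<forall>j<n. (\<forall>i<n. A i j \<in> F) \<and>
                 x \<otimes>\<^bsub>R\<^esub> us ! j = (\<Oplus>\<^bsub>R\<^esub>i\<in>{..<n}. A i j \<otimes>\<^bsub>R\<^esub> us ! i))
      in leibniz_det R n A)"

text \<open>\<open>|x|\<^sub>v = |N(x)|\<^sub>p\<close> to the power \<open>1/[L:\<rat>]\<close>, where \<open>N\<close> is the norm from \<open>L\<^sub>v\<close> to \<open>\<rat>\<^sub>p\<close>.\<close>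

definition normalized_abs :: "'a::field_char_0 set \<Rightarrow> ('a \<Rightarrow> real) \<Rightarrow> 'a \<Rightarrow> real" where
  "normalized_abs L v x =
     completion_abs v
       (field_norm (completion L v) (completion_rat L v) (to_completion L v (\<lambda>_. x)))
     powr (1 / real (field_degree \<rat> L))"

definition height_over :: "'a::field_char_0 set \<Rightarrow> 'a \<Rightarrow> 'a \<Rightarrow> real" where
  "height_over L x y =
     (\<Sum>\<^sub>\<infinity>v\<in>places L. ln (max (normalized_abs L v x) (normalized_abs L v y)))"

text \<open>The value does not depend on the number field or on the homogeneous coordinates.\<close>

definition height :: "'a::field_char_0 P1 \<Rightarrow> real" where
  "height \<gamma> = (THE h. \<exists>L x y. number_subfield L \<and> x \<in> L \<and> y \<in> L \<and> (x, y) \<noteq> (0, 0) \<and>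
                               \<gamma> = P1_point x y \<and> h = height_over L x y)"

definition canonical_height :: "('a::field_char_0 P1 \<Rightarrow> 'a P1) \<Rightarrow> nat \<Rightarrow> 'a P1 \<Rightarrow> real" where
  "canonical_height \<phi> d \<gamma> = lim (\<lambda>n. height ((\<phi> ^^ n) \<gamma>) / real d ^ n)"

definition dynamical_lehmer ::
    "('k::field_char_0 alg_closure P1 \<Rightarrow> 'k alg_closure P1) \<Rightarrow> nat \<Rightarrow> real \<Rightarrow> bool" where
  "dynamical_lehmer \<phi> d C \<longleftrightarrow>
     C > 0 \<and>
     (\<forall>\<alpha>. \<not> preperiodic \<phi> (Affine \<alpha>) \<longrightarrow>
        canonical_height \<phi> d (Affine \<alpha>) > C / real (field_degree (range to_ac) (adjoin \<alpha>)))"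

end

theory Submission
  imports Defs "Jordan_Normal_Form.Determinant" "HOL-Real_Asymp.Real_Asymp"
begin

text \<open>
  Put \<open>D = d\<^sup>n\<close> and let \<open>H\<close> be the canonical height of \<open>\<beta>\<close>. Every \<open>\<alpha>\<close> with \<open>\<phi>\<^sup>n(\<alpha>) = \<beta>\<close> has canonical
  height \<open>H / D\<close>, so Lehmer's conjecture gives \<open>[K(\<alpha>) : K] > C D / H\<close>. The degrees of the distinct
  irreducible factors of \<open>f\<^sub>n - \<beta> g\<^sub>n\<close>, which correspond to the Galois orbits of the affine preimages, add
  up to at most \<open>D\<close>; hence there are at most \<open>H / C\<close> of them. If \<open>\<infinity>\<close> is a preimage as well, then
  \<open>f\<^sub>n - \<beta> g\<^sub>n\<close> has degree less than \<open>D\<close>, and a pole \<open>\<alpha>\<close> of \<open>\<phi>\<close>, which has degree at most \<open>d\<close> and satisfies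
  \<open>\<phi>\<^sup>n\<^sup>+\<^sup>1(\<alpha>) = \<beta>\<close>, shows that \<open>H \<ge> C D\<close>, which pays for the orbit of \<open>\<infinity>\<close>.

  The limit defining \<open>H\<close> exists because \<open>h(\<phi>(P)) - d h(P)\<close> is bounded on \<open>\<PP>\<^sup>1(K)\<close>, and only points
  of \<open>\<PP>\<^sup>1(K)\<close> matter, as \<open>\<phi>\<^sup>n(\<alpha>)\<close> is one. To make the height accessible, fix an extension to the
  algebraic closure of every absolute value \<open>u\<close> of \<open>\<rat>\<close>. A place \<open>v\<close> of \<open>L\<close> over \<open>u\<close> is induced by exactly
  \<open>[L\<^sub>v : \<rat>\<^sub>u]\<close> embeddings \<open>\<tau>\<close> of \<open>L\<close>, so \<open>h(x : y)\<close> is the average over \<open>\<tau>\<close> of the finite sums of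
  \<open>ln (max (u (\<tau> x)) (u (\<tau> y)))\<close> over \<open>u\<close>; its independence of the coordinates then reduces to the
  product formula for \<open>\<rat>\<close>.
\<close>

section \<open>Automorphisms of an algebraic closure\<close>

text \<open>The definition of height refers to norms from abstract completions \<open>L_v\<close>,
  in a basis picked by choice. Classically their degrees come from decomposing the tensor product of
  L with Q_u into completions. Here the trace form of \<open>L\<close> plays that role. For dual
  bases \<open>e\<close> and \<open>dual\<close>, summing \<open>\<tau> (e i * dual i)\<close> over
  \<open>i\<close> and over a set of embeddings counts the set. An element of \<open>L\<close> close
  to 1 at \<open>v\<close> and close to 0 under the embeddings that do not induce \<open>v\<close>
  replaces the idempotent of the factor \<open>L_v\<close>. Coordinates in \<open>L_v\<close> become
  limits of rational traces, and the local degree appears as the trace of the identity.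

  Of the extension \<open>w\<close> of \<open>u\<close> to the closure only existence is used. It
  arises from a minimal seminorm, without completeness or Hensel's lemma. That every place over
  \<open>u\<close> is induced by this one \<open>w\<close> follows from the approximation argument
  in \<open>T_nonempty\<close>.

  Infinity is handled through a pole because the Lehmer bound speaks of affine points. One further
  step backwards gains a factor \<open>d\<close>, which balances the degree of the pole.\<close>

definition is_subfield :: "'a::field set \<Rightarrow> bool" where
  "is_subfield F \<longleftrightarrow> 0 \<in> F \<and> 1 \<in> F \<and>
     (\<forall>x\<in>F. \<forall>y\<in>F. x + y \<in> F \<and> x * y \<in> F) \<and> (\<forall>x\<in>F. - x \<in> F \<and> inverse x \<in> F)"

lemma is_subfieldD:
  assumes "is_subfield F"
  shows "0 \<in> F" "1 \<in> F" "x \<in> F \<Longrightarrow> y \<in> F \<Longrightarrow> x + y \<in> F"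
    "x \<in> F \<Longrightarrow> y \<in> F \<Longrightarrow> x * y \<in> F" "x \<in> F \<Longrightarrow> - x \<in> F" "x \<in> F \<Longrightarrow> inverse x \<in> F"
    "x \<in> F \<Longrightarrow> y \<in> F \<Longrightarrow> x - y \<in> F" "x \<in> F \<Longrightarrow> y \<in> F \<Longrightarrow> x / y \<in> F"
proof -
  show 0: "0 \<in> F" "1 \<in> F" "x \<in> F \<Longrightarrow> y \<in> F \<Longrightarrow> x + y \<in> F" "x \<in> F \<Longrightarrow> y \<in> F \<Longrightarrow> x * y \<in> F"
    "x \<in> F \<Longrightarrow> - x \<in> F" "x \<in> F \<Longrightarrow> inverse x \<in> F" for x y
    using assms unfolding is_subfield_def by auto
  show "x \<in> F \<Longrightarrow> y \<in> F \<Longrightarrow> x - y \<in> F" "x \<in> F \<Longrightarrow> y \<in> F \<Longrightarrow> x / y \<in> F"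
    using 0(3)[of x "- y"] 0(5)[of y] 0(4)[of x "inverse y"] 0(6)[of y] by (simp_all add: divide_inverse)
qed

lemma is_subfield_power: "is_subfield F \<Longrightarrow> x \<in> F \<Longrightarrow> x ^ n \<in> F"
  by (induction n) (auto simp: is_subfieldD)

lemma is_subfield_sum: "is_subfield F \<Longrightarrow> (\<And>i. i \<in> I \<Longrightarrow> f i \<in> F) \<Longrightarrow> (\<Sum>i\<in>I. f i) \<in> F"
  by (induction I rule: infinite_finite_induct) (auto simp: is_subfieldD)

lemma is_subfield_Rats: "is_subfield (\<rat> :: 'a::field_char_0 set)"
  unfolding is_subfield_def by (auto intro: Rats_inverse)

lemma is_subfield_of_rat: "is_subfield (F :: 'a::field_char_0 set) \<Longrightarrow> of_rat q \<in> F"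
proof -
  assume F: "is_subfield F"
  have n: "of_nat n \<in> F" for n by (induction n) (auto simp: is_subfieldD[OF F])
  have i: "of_int m \<in> F" for m
    by (cases m rule: int_cases2) (auto simp: is_subfieldD[OF F] n)
  show ?thesis
    by (cases q) (auto simp: of_rat_rat is_subfieldD[OF F] i)
qed

section \<open>Partial embeddings and their one-element extensions\<close>

definition algebraic_over :: "'a::field set \<Rightarrow> bool" where
  "algebraic_over F \<longleftrightarrow> (\<forall>x. \<exists>p. p \<noteq> 0 \<and> (\<forall>i. coeff p i \<in> F) \<and> poly p x = 0)"

definition field_aut :: "'a::field set \<Rightarrow> ('a \<Rightarrow> 'a) set" where
  "field_aut F = {\<sigma>. bij \<sigma> \<and> (\<forall>x y. \<sigma> (x + y) = \<sigma> x + \<sigma> y) \<and> (\<forall>x y. \<sigma> (x * y) = \<sigma> x * \<sigma> y) \<and>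
                     (\<forall>c\<in>F. \<sigma> c = c)}"

text \<open>
  The graph of an embedding over \<open>F\<close> of a subring of \<open>'a\<close>; graphs rather than functions, because
  the union of a chain of graphs is a graph.
\<close>

definition embedding_graph :: "'a::field set \<Rightarrow> ('a \<times> 'a) set \<Rightarrow> bool" where
  "embedding_graph F G \<longleftrightarrow> (\<forall>c\<in>F. (c, c) \<in> G) \<and>
     (\<forall>a b c d. (a, b) \<in> G \<longrightarrow> (c, d) \<in> G \<longrightarrow> (a + c, b + d) \<in> G \<and> (a * c, b * d) \<in> G) \<and>
     (\<forall>a b. (a, b) \<in> G \<longrightarrow> (- a, - b) \<in> G) \<and> (\<forall>z. (0, z) \<in> G \<longrightarrow> z = 0)"

definition poly_rel :: "('a::field \<times> 'a) set \<Rightarrow> 'a poly \<Rightarrow> 'a poly \<Rightarrow> bool" where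
  "poly_rel G p q \<longleftrightarrow> (\<forall>i. (coeff p i, coeff q i) \<in> G)"

context
  fixes F :: "'a::field set" and G :: "('a \<times> 'a) set"
  assumes F: "is_subfield F" and alg: "algebraic_over F" and G: "embedding_graph F G"
begin

lemma graph_const: "c \<in> F \<Longrightarrow> (c, c) \<in> G"
  and graph_add: "(a, b) \<in> G \<Longrightarrow> (c, d) \<in> G \<Longrightarrow> (a + c, b + d) \<in> G"
  and graph_mult: "(a, b) \<in> G \<Longrightarrow> (c, d) \<in> G \<Longrightarrow> (a * c, b * d) \<in> G"
  and graph_uminus: "(a, b) \<in> G \<Longrightarrow> (- a, - b) \<in> G"
  and graph_0: "(0, z) \<in> G \<Longrightarrow> z = 0"
  using G unfolding embedding_graph_def by auto

lemma graph_diff: "(a, b) \<in> G \<Longrightarrow> (c, d) \<in> G \<Longrightarrow> (a - c, b - d) \<in> G"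
  using graph_add[OF _ graph_uminus, of a b c d] by simp

lemma graph_unique: "(a, b) \<in> G \<Longrightarrow> (a, c) \<in> G \<Longrightarrow> b = c"
  using graph_diff[of a b a c] graph_0[of "b - c"] by simp

lemma graph_sum: "(\<And>i. i \<in> I \<Longrightarrow> (f i, g i) \<in> G) \<Longrightarrow> (\<Sum>i\<in>I. f i, \<Sum>i\<in>I. g i) \<in> G"
  by (induction I rule: infinite_finite_induct)
     (auto intro: graph_add graph_const is_subfieldD[OF F])

lemma graph_power: "(a, b) \<in> G \<Longrightarrow> (a ^ n, b ^ n) \<in> G"
  by (induction n) (auto intro: graph_mult graph_const is_subfieldD[OF F])

lemma graph_poly: "(\<And>i. coeff p i \<in> F) \<Longrightarrow> (a, b) \<in> G \<Longrightarrow> (poly p a, poly p b) \<in> G"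
  unfolding poly_altdef by (intro graph_sum graph_mult graph_power graph_const) auto

text \<open>In a relation of least degree the constant term cannot vanish, because for
  \<open>x \<noteq> 0\<close> one could cancel a factor of the indeterminate. The nonzero constant
  term is what makes \<open>graph_inj\<close> work.\<close>

lemma algebraic_nonzero_const:
  assumes "x \<noteq> 0"
  shows "\<exists>p. (\<forall>i. coeff p i \<in> F) \<and> poly p x = 0 \<and> coeff p 0 \<noteq> 0"
proof -
  define P where "P = (\<lambda>p. p \<noteq> 0 \<and> (\<forall>i. coeff p i \<in> F) \<and> poly p x = 0)"
  obtain p0 where "P p0" using alg unfolding algebraic_over_def P_def by blast
  then obtain p where p: "P p" and min: "\<And>q. P q \<Longrightarrow> degree p \<le> degree q"
    using ex_has_least_nat[of P p0 degree] by blast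
  have "coeff p 0 \<noteq> 0"
  proof
    assume "coeff p 0 = 0"
    then obtain q where q: "p = pCons 0 q" by (cases p) auto
    have "coeff q i \<in> F" for i
      using p unfolding P_def q by (metis coeff_pCons_Suc)
    then have "P q" using p assms unfolding P_def q by auto
    moreover have "q \<noteq> 0" using p unfolding P_def q by auto
    ultimately show False using min[of q] unfolding q by auto
  qed
  then show ?thesis using p unfolding P_def by blast
qed

text \<open>A graph is single-valued by definition, but its domain is only a ring, so injectivity
  cannot come from inverses. It comes from algebraicity: carrying a relation of \<open>x\<close>
  through \<open>G\<close> would send 0 to its nonzero constant term.\<close>

lemma graph_inj: assumes "(x, 0) \<in> G" shows "x = 0"
proof (rule ccontr)
  assume "x \<noteq> 0"
  then obtain p where p: "\<And>i. coeff p i \<in> F" "poly p x = 0" "coeff p 0 \<noteq> 0"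
    using algebraic_nonzero_const by blast
  then have "(poly p x, poly p 0) \<in> G" using graph_poly assms by blast
  then show False using p graph_0 by (simp add: poly_0_coeff_0)
qed

lemma poly_rel_mult: "poly_rel G p p' \<Longrightarrow> poly_rel G q q' \<Longrightarrow> poly_rel G (p * q) (p' * q')"
  unfolding poly_rel_def coeff_mult by (auto intro!: graph_sum graph_mult)

lemma poly_rel_add: "poly_rel G p p' \<Longrightarrow> poly_rel G q q' \<Longrightarrow> poly_rel G (p + q) (p' + q')"
  and poly_rel_diff: "poly_rel G p p' \<Longrightarrow> poly_rel G q q' \<Longrightarrow> poly_rel G (p - q) (p' - q')"
  and poly_rel_uminus: "poly_rel G p p' \<Longrightarrow> poly_rel G (- p) (- p')"
  unfolding poly_rel_def by (auto intro: graph_add graph_uminus graph_diff)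

lemma poly_rel_monom: "(a, b) \<in> G \<Longrightarrow> poly_rel G (Polynomial.monom a n) (Polynomial.monom b n)"
  unfolding poly_rel_def by (auto intro: graph_const is_subfieldD[OF F])

lemma poly_rel_degree: assumes "poly_rel G p p'" shows "degree p' = degree p"
proof -
  have "coeff p i = 0 \<longleftrightarrow> coeff p' i = 0" for i
    using assms unfolding poly_rel_def by (metis graph_0 graph_inj)
  then show ?thesis unfolding degree_def by simp
qed

text \<open>A relation satisfied by \<open>x\<close> is divisible by a relation of least degree, so \<open>y\<close> satisfies it.\<close>

lemma poly_rel_root_transfer:
  assumes p: "poly_rel G p p'" "p \<noteq> 0" "poly p x = 0" "poly p' y = 0"
    and min: "\<And>q q'. poly_rel G q q' \<Longrightarrow> q \<noteq> 0 \<Longrightarrow> poly q x = 0 \<Longrightarrow> degree p \<le> degree q"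
  shows "poly_rel G q q' \<Longrightarrow> poly q x = 0 \<Longrightarrow> poly q' y = 0"
proof (induction "degree q" arbitrary: q q' rule: less_induct)
  case (less q q')
  show ?case
  proof (cases "q = 0")
    case True
    then have "q' = 0" using less.prems unfolding poly_rel_def by (auto intro!: poly_eqI graph_0)
    then show ?thesis by simp
  next
    case q0: False
    define k where "k = degree q - degree p"
    have k: "k + degree p = degree q" using min[OF less.prems(1) q0 less.prems(2)] k_def by simp
    \<comment> \<open>Pseudo-division: cross-multiplying by the leading coefficients cancels the top
      terms without dividing, since the domain of \<open>G\<close> need not contain
      inverses.\<close>
    define h where "h = Polynomial.monom (lead_coeff p) 0 * q - Polynomial.monom (lead_coeff q) k * p"
    define h' where "h' = Polynomial.monom (lead_coeff p') 0 * q' - Polynomial.monom (lead_coeff q') k * p'"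
    have d: "degree p' = degree p" "degree q' = degree q" using poly_rel_degree p less.prems by auto
    have lead: "(lead_coeff p, lead_coeff p') \<in> G" "(lead_coeff q, lead_coeff q') \<in> G"
      using p less.prems unfolding poly_rel_def d by auto
    have rel: "poly_rel G h h'" unfolding h_def h'_def
      by (intro poly_rel_diff poly_rel_mult poly_rel_monom lead p less.prems)
    have hx: "poly h x = 0" unfolding h_def using p less.prems by simp
    have hdeg: "h = 0 \<or> degree h < degree q"
    proof -
      have "coeff h i = 0" if "i \<ge> degree q" for i
      proof (cases "i = degree q")
        case True
        then show ?thesis unfolding h_def using k[symmetric] by (simp add: coeff_monom_mult monom_0)
      next
        case False
        then have "i > degree q" "i - k > degree p" using that k by auto
        then show ?thesis unfolding h_def by (simp add: coeff_monom_mult monom_0 coeff_eq_0)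
      qed
      then show ?thesis by (metis leading_coeff_0_iff not_less)
    qed
    have "poly h' y = 0"
    proof (cases "h = 0")
      case True
      then have "h' = 0" using rel unfolding poly_rel_def by (auto intro!: poly_eqI graph_0)
      then show ?thesis by simp
    next
      case False
      then show ?thesis using less.hyps hdeg rel hx by blast
    qed
    \<comment> \<open>Injectivity of \<open>G\<close> keeps the leading coefficient nonzero, so the
      equation \<open>h'(y) = 0\<close> can be solved for \<open>poly q' y\<close>.\<close>
    moreover have "lead_coeff p' \<noteq> 0" using lead graph_inj p by (metis leading_coeff_0_iff)
    ultimately show ?thesis using p unfolding h'_def by (simp add: poly_monom)
  qed
qed

definition graph_adjoin :: "'a \<Rightarrow> 'a \<Rightarrow> ('a \<times> 'a) set" where
  "graph_adjoin x y = {(poly q x, poly q' y) | q q'. poly_rel G q q'}"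

text \<open>The hypothesis is exactly the single-valuedness of the enlarged graph at 0; closure
  under the ring operations is inherited from related pairs of polynomials.\<close>

lemma graph_adjoin:
  assumes "\<And>q q'. poly_rel G q q' \<Longrightarrow> poly q x = 0 \<Longrightarrow> poly q' y = 0"
  shows "embedding_graph F (graph_adjoin x y)" "G \<subseteq> graph_adjoin x y" "(x, y) \<in> graph_adjoin x y"
proof -
  have const: "(a, b) \<in> graph_adjoin x y" if "(a, b) \<in> G" for a b
    using poly_rel_monom[OF that, of 0] unfolding graph_adjoin_def by (force simp: poly_monom monom_0)
  then show sub: "G \<subseteq> graph_adjoin x y" by auto
  have "poly_rel G (Polynomial.monom 1 1) (Polynomial.monom 1 1)"
    by (intro poly_rel_monom graph_const is_subfieldD[OF F])
  then show "(x, y) \<in> graph_adjoin x y"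
    unfolding graph_adjoin_def by (force simp: poly_monom)
  show "embedding_graph F (graph_adjoin x y)"
    unfolding embedding_graph_def
  proof (intro conjI allI impI ballI)
    fix c assume "c \<in> F" then show "(c, c) \<in> graph_adjoin x y" using sub graph_const by auto
  next
    fix a b c d assume "(a, b) \<in> graph_adjoin x y" "(c, d) \<in> graph_adjoin x y"
    then obtain p p' q q' where "poly_rel G p p'" "poly_rel G q q'" 
      "a = poly p x" "b = poly p' y" "c = poly q x" "d = poly q' y" unfolding graph_adjoin_def by auto
    then show "(a + c, b + d) \<in> graph_adjoin x y" "(a * c, b * d) \<in> graph_adjoin x y"
      using poly_rel_add poly_rel_mult unfolding graph_adjoin_def
      by (auto, metis poly_add, metis poly_mult)
  next
    fix a b assume "(a, b) \<in> graph_adjoin x y"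
    then show "(- a, - b) \<in> graph_adjoin x y"
      unfolding graph_adjoin_def using poly_rel_uminus by (auto, metis poly_minus)
  next
    fix z assume "(0, z) \<in> graph_adjoin x y"
    then show "z = 0" unfolding graph_adjoin_def using assms by auto
  qed
qed

end

text \<open>A relation for \<open>x\<close> of least degree is carried by \<open>G\<close> to a
  polynomial of the same positive degree, which has a root since the field is algebraically closed.
  By \<open>poly_rel_root_transfer\<close> every such root is an admissible value at
  \<open>x\<close>.\<close>

lemma graph_extend:
  fixes F :: "'a::alg_closed_field set"
  assumes F: "is_subfield F" and alg: "algebraic_over F" and G: "embedding_graph F G"
  obtains G' y where "embedding_graph F G'" "G \<subseteq> G'" "(x, y) \<in> G'"
proof -
  define P where "P = (\<lambda>p. p \<noteq> 0 \<and> (\<exists>p'. poly_rel G p p') \<and> poly p x = 0)"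
  obtain p0 where "p0 \<noteq> 0" "\<forall>i. coeff p0 i \<in> F" "poly p0 x = 0" using alg unfolding algebraic_over_def by blast
  then have "P p0" unfolding P_def poly_rel_def using graph_const[OF F alg G] by blast
  then obtain p where p: "P p" and min: "\<And>q. P q \<Longrightarrow> degree p \<le> degree q"
    using ex_has_least_nat[of P p0 degree] by blast
  obtain p' where p': "poly_rel G p p'" using p P_def by blast
  have "degree p > 0"
  proof (rule gr0I)
    assume "degree p = 0"
    then obtain c where "p = [:c:]" by (rule degree_eq_zeroE)
    then show False using p unfolding P_def by auto
  qed
  then have "degree p' > 0" using poly_rel_degree[OF F alg G p'] by simp
  then obtain y where y: "poly p' y = 0" using alg_closed_imp_poly_has_root by blast
  have "poly q' y = 0" if "poly_rel G q q'" "poly q x = 0" for q q'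
    using poly_rel_root_transfer[OF F alg G p' _ _ y _ that] p min unfolding P_def by blast
  then show thesis using that graph_adjoin[OF F alg G, of x y] by blast
qed

section \<open>Automorphisms from maximal graphs, and the fixed field\<close>

lemma embedding_graph_Union:
  assumes "subset.chain (Collect (embedding_graph F)) C" "C \<noteq> {}"
  shows "embedding_graph F (\<Union>C)"
proof -
  have C: "\<And>G. G \<in> C \<Longrightarrow> embedding_graph F G" and lin: "\<And>G H. G \<in> C \<Longrightarrow> H \<in> C \<Longrightarrow> G \<subseteq> H \<or> H \<subseteq> G"
    using assms unfolding subset.chain_def by auto
  show ?thesis
    unfolding embedding_graph_def
  proof (intro conjI allI impI ballI)
    fix c assume "c \<in> F" then show "(c, c) \<in> \<Union>C" using assms(2) C unfolding embedding_graph_def by blast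
  next
    fix a b c d assume "(a, b) \<in> \<Union>C" "(c, d) \<in> \<Union>C"
    then obtain G where "G \<in> C" "(a, b) \<in> G" "(c, d) \<in> G" using lin by blast
    then have "(a + c, b + d) \<in> G" "(a * c, b * d) \<in> G" using C unfolding embedding_graph_def by blast+
    then show "(a + c, b + d) \<in> \<Union>C" "(a * c, b * d) \<in> \<Union>C" using \<open>G \<in> C\<close> by auto
  next
    fix a b assume "(a, b) \<in> \<Union>C"
    then show "(- a, - b) \<in> \<Union>C" using C unfolding embedding_graph_def by blast
  next
    fix z assume "(0, z) \<in> \<Union>C"
    then show "z = 0" using C unfolding embedding_graph_def by blast
  qed
qed

text \<open>A maximal graph is total by \<open>graph_extend\<close>. It is onto because an injective
  ring map fixing \<open>F\<close> permutes the finite root set of any polynomial over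
  \<open>F\<close>, and every element lies in such a set.\<close>

lemma embedding_extends_to_automorphism:
  fixes F :: "'a::alg_closed_field set"
  assumes F: "is_subfield F" and alg: "algebraic_over F" and G0: "embedding_graph F G0"
  obtains \<sigma> where "\<sigma> \<in> field_aut F" "\<And>x y. (x, y) \<in> G0 \<Longrightarrow> \<sigma> x = y"
proof -
  define A where "A = {G. embedding_graph F G \<and> G0 \<subseteq> G}"
  have "\<exists>M\<in>A. \<forall>N\<in>A. M \<subseteq> N \<longrightarrow> N = M"
  proof (rule subset_Zorn_nonempty)
    show "A \<noteq> {}" using G0 A_def by auto
    fix C assume C: "C \<noteq> {}" "subset.chain A C"
    then have "subset.chain (Collect (embedding_graph F)) C" unfolding subset.chain_def A_def by blast
    then have "embedding_graph F (\<Union>C)" using embedding_graph_Union C by blast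
    then show "\<Union>C \<in> A" using C unfolding A_def subset.chain_def by blast
  qed
  then obtain M where M: "embedding_graph F M" "G0 \<subseteq> M" and max: "\<And>N. embedding_graph F N \<Longrightarrow> M \<subseteq> N \<Longrightarrow> N = M"
    unfolding A_def by (smt (verit) mem_Collect_eq subset_trans)
  note Mr = F alg M(1)
  have ex: "\<exists>y. (x, y) \<in> M" for x
    using graph_extend[OF Mr, of x] max by metis
  define \<sigma> where "\<sigma> x = (THE y. (x, y) \<in> M)" for x
  have \<sigma>: "(x, \<sigma> x) \<in> M" for x
    unfolding \<sigma>_def using ex[of x] graph_unique[OF Mr] by (metis theI)
  have \<sigma>I: "(x, y) \<in> M \<Longrightarrow> \<sigma> x = y" for x y
    using \<sigma> graph_unique[OF Mr] by blast
  have add: "\<sigma> (x + y) = \<sigma> x + \<sigma> y" and mult: "\<sigma> (x * y) = \<sigma> x * \<sigma> y" for x y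
    using graph_add[OF Mr \<sigma> \<sigma>] graph_mult[OF Mr \<sigma> \<sigma>] \<sigma>I by auto
  have fixF: "\<sigma> c = c" if "c \<in> F" for c using graph_const[OF Mr that] \<sigma>I by blast
  have inj: "inj \<sigma>"
  proof (rule injI)
    fix x y assume "\<sigma> x = \<sigma> y"
    then have "(x - y, 0) \<in> M" using graph_diff[OF Mr \<sigma>[of x] \<sigma>[of y]] by simp
    then show "x = y" using graph_inj[OF Mr] by fastforce
  qed
  have "y \<in> range \<sigma>" for y
  proof -
    obtain p where p: "p \<noteq> 0" "\<forall>i. coeff p i \<in> F" "poly p y = 0" using alg unfolding algebraic_over_def by blast
    let ?R = "{z. poly p z = 0}"
    have fin: "finite ?R" using p poly_roots_finite by blast
    have "\<sigma> ` ?R \<subseteq> ?R"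
    proof safe
      fix z assume "poly p z = 0"
      then have "(0, poly p (\<sigma> z)) \<in> M" using graph_poly[OF Mr, of p z "\<sigma> z"] p \<sigma> by auto
      then show "poly p (\<sigma> z) = 0" using graph_0[OF Mr] by blast
    qed
    then have "\<sigma> ` ?R = ?R" using fin inj by (meson endo_inj_surj inj_on_subset subset_UNIV)
    then show ?thesis using p by blast
  qed
  then have "\<sigma> \<in> field_aut F" unfolding field_aut_def using add mult fixF inj by (auto simp: bij_def)
  then show thesis using that \<sigma>I M by blast
qed

lemma diagonal_embedding_graph:
  "is_subfield F \<Longrightarrow> embedding_graph F {(c, c) |c. c \<in> F}"
  unfolding embedding_graph_def using is_subfieldD[of F] by auto

text \<open>Start from the identity on \<open>F\<close>: polynomials related by the diagonal graph
  are equal with coefficients in \<open>F\<close>, so the assumption on \<open>x\<close> and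
  \<open>y\<close> allows \<open>x\<close> to be adjoined with value \<open>y\<close>.\<close>

lemma conjugate_automorphism:
  fixes F :: "'a::alg_closed_field set"
  assumes F: "is_subfield F" and alg: "algebraic_over F"
    and xy: "\<And>q. (\<And>i. coeff q i \<in> F) \<Longrightarrow> poly q x = 0 \<Longrightarrow> poly q y = 0"
  obtains \<sigma> where "\<sigma> \<in> field_aut F" "\<sigma> x = y"
proof -
  let ?D = "{(c, c) |c. c \<in> F}"
  note D = F alg diagonal_embedding_graph[OF F]
  have "poly q' y = 0" if "poly_rel ?D q q'" "poly q x = 0" for q q'
  proof -
    have "q = q'" "\<And>i. coeff q i \<in> F" using that(1) unfolding poly_rel_def by (auto intro: poly_eqI)
    then show ?thesis using xy that by blast
  qed
  then have rel: "\<And>q q'. poly_rel ?D q q' \<Longrightarrow> poly q x = 0 \<Longrightarrow> poly q' y = 0" by blast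
  then have G: "embedding_graph F (graph_adjoin ?D x y)" "(x, y) \<in> graph_adjoin ?D x y"
    using graph_adjoin[OF D, of x y] by blast+
  obtain \<sigma> where "\<sigma> \<in> field_aut F" "\<And>a b. (a, b) \<in> graph_adjoin ?D x y \<Longrightarrow> \<sigma> a = b"
    using embedding_extends_to_automorphism[OF F alg G(1)] by blast
  then show thesis using that G(2) by blast
qed

text \<open>All roots of a minimal relation \<open>p\<close> of \<open>x\<close> are conjugates of
  \<open>x\<close>, hence equal to \<open>x\<close>. In characteristic 0 the derivative of
  \<open>p\<close> is nonzero of smaller degree, so the root is simple and \<open>p\<close> is
  linear; the quotient of its two coefficients puts \<open>x\<close> into \<open>F\<close>.\<close>

lemma fixed_field:
  fixes F :: "'a::{alg_closed_field, field_char_0} set"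
  assumes F: "is_subfield F" and alg: "algebraic_over F"
    and fixed: "\<And>\<sigma>. \<sigma> \<in> field_aut F \<Longrightarrow> \<sigma> x = x"
  shows "x \<in> F"
proof -
  define P where "P = (\<lambda>p. p \<noteq> 0 \<and> (\<forall>i. coeff p i \<in> F) \<and> poly p x = 0)"
  obtain p0 where "P p0" using alg unfolding algebraic_over_def P_def by blast
  then obtain p where p: "P p" and min: "\<And>q. P q \<Longrightarrow> degree p \<le> degree q"
    using ex_has_least_nat[of P p0 degree] by blast
  let ?D = "{(c, c) |c. c \<in> F}"
  note D = F alg diagonal_embedding_graph[OF F]
  have rel: "poly_rel ?D q q" if "\<And>i. coeff q i \<in> F" for q using that unfolding poly_rel_def by auto
  have relD: "q' = q \<and> (\<forall>i. coeff q i \<in> F)" if "poly_rel ?D q q'" for q q' 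
    using that unfolding poly_rel_def by (auto intro: poly_eqI)
  have only: "y = x" if y: "poly p y = 0" for y
  proof -
    have "poly q y = 0" if "\<And>i. coeff q i \<in> F" "poly q x = 0" for q
      using poly_rel_root_transfer[OF D rel, of p x y q q] p min y that relD rel[OF that(1)]
      unfolding P_def by blast
    then obtain \<sigma> where "\<sigma> \<in> field_aut F" "\<sigma> x = y" using conjugate_automorphism[OF F alg] by blast
    then show ?thesis using fixed by auto
  qed
  obtain s where s: "p = [:-x, 1:] * s" using p unfolding P_def by (auto simp: poly_eq_0_iff_dvd)
  have s0: "s \<noteq> 0" using s p P_def by auto
  have dp: "degree p = Suc (degree s)" using s0 unfolding s by (subst degree_mult_eq) auto
  have "pderiv p \<noteq> 0" using dp by (simp add: pderiv_eq_0_iff)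
  moreover have "coeff (pderiv p) i \<in> F" for i
    unfolding coeff_pderiv using p is_subfieldD(4)[OF F] is_subfield_of_rat[OF F, of "of_nat (Suc i)"] 
    unfolding P_def by (simp del: of_nat_Suc)
  ultimately have "poly (pderiv p) x \<noteq> 0" using min[of "pderiv p"] dp unfolding P_def by (auto simp: degree_pderiv)
  then have "poly s x \<noteq> 0" unfolding s pderiv_mult by (simp add: pderiv_pCons)
  moreover have "poly s y = 0 \<Longrightarrow> y = x" for y using only[of y] s by simp
  ultimately have "degree s = 0" using alg_closed_imp_poly_has_root[of s] by blast
  then obtain c where c: "s = [:c:]" by (rule degree_eq_zeroE)
  have "coeff p 0 \<in> F" "coeff p 1 \<in> F" using p P_def by auto
  then have "- x * c \<in> F" "c \<in> F" unfolding s c by (auto simp: mult.commute)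
  then have "- (- x * c) / c \<in> F" using is_subfieldD(5,8)[OF F] by blast
  then show ?thesis using s0 c by simp
qed

section \<open>Extension of absolute values\<close>

text \<open>
  An absolute value on \<open>\<rat>\<close> extends to every algebraic extension: a minimal power-multiplicative
  seminorm is multiplicative, and a first seminorm is the growth rate of the coefficients of the
  powers of an element with respect to finite spanning families.
\<close>

definition power_seminorm :: "('a::field \<Rightarrow> real) \<Rightarrow> bool" where
  "power_seminorm N \<longleftrightarrow> (\<forall>x. 0 \<le> N x) \<and> N 1 = 1 \<and> N 0 = 0 \<and> (\<forall>x y. N (x + y) \<le> N x + N y) \<and>
     (\<forall>x y. N (x * y) \<le> N x * N y) \<and> (\<forall>x k. N (x ^ k) = N x ^ k)"

lemma power_seminormD:
  assumes "power_seminorm N"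
  shows "0 \<le> N x" "N 1 = 1" "N 0 = 0" "N (x + y) \<le> N x + N y" "N (x * y) \<le> N x * N y" "N (x ^ k) = N x ^ k"
  using assms unfolding power_seminorm_def by auto

text \<open>Smoothing at \<open>a\<close>: by submultiplicativity the quotients decrease, and in the
  limit multiplication by \<open>a\<close> scales by exactly \<open>N a\<close>. The result lies
  below \<open>N\<close>, so a minimal \<open>N\<close> is unchanged by the procedure and is
  multiplicative.\<close>

lemma power_seminorm_limit:
  assumes N: "power_seminorm N" and a: "N a \<noteq> 0"
  defines "N' \<equiv> (\<lambda>x. lim (\<lambda>n. N (x * a ^ n) / N a ^ n))"
  shows "power_seminorm N'" "N' x \<le> N x" "N' x * N a = N' (x * a)"
    "(\<lambda>n. N (x * a ^ n) / N a ^ n) \<longlonglongrightarrow> N' x" "N' x * N a \<le> N (x * a)"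
proof -
  note D = power_seminormD[OF N]
  have D1: "0 \<le> N z" for z by (rule D(1))
  have pos: "N a > 0" using a D(1)[of a] by simp
  define f where "f x n = N (x * a ^ n) / N a ^ n" for x n
  have f0: "0 \<le> f x n" for x n unfolding f_def using D1 by (intro divide_nonneg_nonneg zero_le_power)
  have dec: "decseq (f x)" for x
  proof (rule decseq_SucI)
    fix n
    have "N (x * a ^ Suc n) \<le> N (x * a ^ n) * N a" using D(5)[of "x * a ^ n" a] by (simp only: power_Suc2 mult.assoc)
    then have "f x (Suc n) \<le> (N (x * a ^ n) * N a) / N a ^ Suc n"
      unfolding f_def using D1 by (intro divide_right_mono zero_le_power)
    also have "\<dots> = f x n" unfolding f_def using pos by simp
    finally show "f x (Suc n) \<le> f x n" .
  qed
  have lim: "f x \<longlonglongrightarrow> N' x" for x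
  proof -
    have "\<forall>i. 0 \<le> f x i" using f0 by simp
    from decseq_convergent[OF dec this] obtain L where "f x \<longlonglongrightarrow> L" .
    then have "convergent (f x)" by (rule convergentI)
    then have "f x \<longlonglongrightarrow> lim (f x)" by (simp only: convergent_LIMSEQ_iff)
    moreover have "f x = (\<lambda>n. N (x * a ^ n) / N a ^ n)" by (rule ext) (simp only: f_def)
    ultimately show ?thesis unfolding N'_def by simp
  qed
  show "(\<lambda>n. N (x * a ^ n) / N a ^ n) \<longlonglongrightarrow> N' x" using lim unfolding f_def .
  have le: "N' x \<le> f x n" for x n using decseq_ge[OF dec lim] .
  have "f x 0 = N x" unfolding f_def by simp
  then show "N' x \<le> N x" using le[of x 0] by (rule subst)
  show "N' x * N a \<le> N (x * a)" using le[of x 1] pos unfolding f_def by (simp add: pos_le_divide_eq)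
  have "(\<lambda>n. f x (Suc n) * N a) \<longlonglongrightarrow> N' x * N a"
    by (intro tendsto_mult_right LIMSEQ_Suc lim)
  moreover have "(\<lambda>n. f x (Suc n) * N a) = f (x * a)"
    unfolding f_def by (simp add: fun_eq_iff field_simps pos less_imp_neq[symmetric])
  ultimately have "f (x * a) \<longlonglongrightarrow> N' x * N a" by simp
  then show "N' x * N a = N' (x * a)" using LIMSEQ_unique[OF lim] by metis
  show "power_seminorm N'"
    unfolding power_seminorm_def
  proof (intro conjI allI)
    show "0 \<le> N' x" for x by (rule LIMSEQ_le_const[OF lim]) (use f0 in auto)
    have "f 1 = (\<lambda>_. 1)" unfolding f_def using pos by (auto simp: D(6))
    then have "f 1 \<longlonglongrightarrow> 1" by simp
    then show "N' 1 = 1" using LIMSEQ_unique[OF lim] by blast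
    have "f 0 = (\<lambda>_. 0)" unfolding f_def by (auto simp: D(3))
    then have "f 0 \<longlonglongrightarrow> 0" by simp
    then show "N' 0 = 0" using LIMSEQ_unique[OF lim] by blast
    show "N' (x + y) \<le> N' x + N' y" for x y
    proof (rule LIMSEQ_le[OF lim tendsto_add[OF lim lim]], intro exI allI impI)
      fix n
      have "N ((x + y) * a ^ n) \<le> N (x * a ^ n) + N (y * a ^ n)" using D(4) by (simp add: distrib_right)
      then show "f (x + y) n \<le> f x n + f y n"
        unfolding f_def add_divide_distrib[symmetric] by (intro divide_right_mono) (auto simp: pos less_imp_le)
    qed
    show "N' (x * y) \<le> N' x * N' y" for x y
    proof (rule LIMSEQ_le_const[OF tendsto_mult[OF lim lim]], intro exI allI impI)
      fix n
      \<comment> \<open>The exponent \<open>n + n\<close> is split evenly between \<open>x\<close>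
        and \<open>y\<close>; the limit lies below every term, in particular below the one of index
        \<open>n + n\<close>.\<close>
      have "N (x * y * a ^ (n + n)) = N ((x * a ^ n) * (y * a ^ n))" by (simp add: power_add algebra_simps)
      also have "\<dots> \<le> N (x * a ^ n) * N (y * a ^ n)" by (rule D(5))
      finally have "f (x * y) (n + n) \<le> f x n * f y n"
        unfolding f_def times_divide_times_eq power_add using pos by (intro divide_right_mono) auto
      then show "N' (x * y) \<le> f x n * f y n" using le[of "x * y" "n + n"] by linarith
    qed
    show "N' (x ^ k) = N' x ^ k" for x k
    proof (cases "k = 0")
      case True
      then show ?thesis using \<open>N' 1 = 1\<close> by simp
    next
      case False
      \<comment> \<open>Along multiples of \<open>k\<close> the sequence for \<open>x ^ k\<close> is
        the \<open>k\<close>-th power of the one for \<open>x\<close>, so a subsequence identifies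
        the limit.\<close>
      have "(\<lambda>n. f (x ^ k) (k * n)) = (\<lambda>n. f x n ^ k)"
      proof
        fix n
        have "x ^ k * a ^ (k * n) = (x * a ^ n) ^ k" by (simp add: power_mult_distrib power_mult[symmetric] mult.commute)
        then show "f (x ^ k) (k * n) = f x n ^ k"
          unfolding f_def by (simp add: D(6) power_divide power_mult[symmetric] mult.commute)
      qed
      moreover have "(\<lambda>n. f (x ^ k) (k * n)) \<longlonglongrightarrow> N' (x ^ k)"
        using LIMSEQ_subseq_LIMSEQ[OF lim, of "\<lambda>n. k * n"] False
        by (auto simp: strict_mono_def o_def)
      ultimately have "(\<lambda>n. f x n ^ k) \<longlonglongrightarrow> N' (x ^ k)" by simp
      then show ?thesis using LIMSEQ_unique[OF _ tendsto_power[OF lim]] by blast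
    qed
  qed
qed

lemma minimal_power_seminorm_multiplicative:
  assumes N: "power_seminorm N" and min: "\<And>N'. power_seminorm N' \<Longrightarrow> (\<And>x. N' x \<le> N x) \<Longrightarrow> N' = N"
  shows "N (x * y) = N x * N y"
proof (cases "N y = 0")
  case True
  then show ?thesis using power_seminormD(1,5)[OF N, of "x * y"] power_seminormD(5)[OF N, of x y] by simp
next
  case False
  let ?M = "\<lambda>x. lim (\<lambda>n. N (x * y ^ n) / N y ^ n)"
  have eq: "?M = N"
    by (rule min) (rule power_seminorm_limit(1,2)[OF N False])+
  have M: "lim (\<lambda>n. N (z * y ^ n) / N y ^ n) = N z" for z by (rule fun_cong[OF eq])
  show ?thesis
    using power_seminorm_limit(3)[OF N False, of x] unfolding M by (rule sym)
qed

text \<open>In a chain one member can approximate the infimum at two points at once, namely the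
  smaller of two members chosen separately. Inequalities that involve a pair of elements therefore
  survive the passage to the infimum.\<close>

lemma power_seminorm_Inf_chain:
  assumes C: "C \<noteq> {}" and pn: "\<And>N. N \<in> C \<Longrightarrow> power_seminorm N"
    and lin: "\<And>N M. N \<in> C \<Longrightarrow> M \<in> C \<Longrightarrow> (\<forall>x. N x \<le> M x) \<or> (\<forall>x. M x \<le> N x)"
  shows "power_seminorm (\<lambda>x. INF N\<in>C. N x)" "N \<in> C \<Longrightarrow> (INF N\<in>C. N x) \<le> N x"
proof -
  have bdd: "bdd_below ((\<lambda>N. N x) ` C)" for x using pn power_seminormD(1) by (intro bdd_belowI2[of _ 0]) auto
  show le: "(INF N\<in>C. N x) \<le> N x" if "N \<in> C" for N x by (rule cINF_lower[OF bdd that])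
  have ge: "c \<le> (INF N\<in>C. N x)" if "\<And>N. N \<in> C \<Longrightarrow> c \<le> N x" for c x by (rule cINF_greatest[OF C that])
  let ?I = "\<lambda>x. INF N\<in>C. N x"
  have nonneg: "0 \<le> ?I x" for x using ge pn power_seminormD(1) by blast
  have approx: "\<exists>N\<in>C. N x < ?I x + e \<and> N y < ?I y + e" if e: "e > 0" for x y e
  proof -
    obtain N where N: "N \<in> C" "N x < ?I x + e" using cINF_less_iff[OF C bdd, of x "?I x + e"] e by auto
    obtain M where M: "M \<in> C" "M y < ?I y + e" using cINF_less_iff[OF C bdd, of y "?I y + e"] e by auto
    show ?thesis using lin[OF N(1) M(1)] N M by (meson le_less_trans)
  qed
  have seq: "\<exists>f. (\<forall>n. f n \<in> C) \<and> (\<lambda>n. f n x) \<longlonglongrightarrow> ?I x \<and> (\<lambda>n. f n y) \<longlonglongrightarrow> ?I y" for x y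
  proof -
    have "\<forall>n. \<exists>N\<in>C. N x < ?I x + inverse (real (Suc n)) \<and> N y < ?I y + inverse (real (Suc n))"
      using approx by simp
    then obtain f where f: "\<And>n. f n \<in> C" "\<And>n. f n x < ?I x + inverse (real (Suc n))" "\<And>n. f n y < ?I y + inverse (real (Suc n))"
      by metis
    have z: "(\<lambda>n. ?I z + inverse (real (Suc n))) \<longlonglongrightarrow> ?I z" for z
      using tendsto_add[OF tendsto_const LIMSEQ_inverse_real_of_nat, of "?I z"] by simp
    have "(\<lambda>n. f n x) \<longlonglongrightarrow> ?I x" 
      by (rule tendsto_sandwich[OF _ _ tendsto_const z]) (use f le in \<open>auto intro!: always_eventually less_imp_le\<close>)
    moreover have "(\<lambda>n. f n y) \<longlonglongrightarrow> ?I y" 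
      by (rule tendsto_sandwich[OF _ _ tendsto_const z]) (use f le in \<open>auto intro!: always_eventually less_imp_le\<close>)
    ultimately show ?thesis using f by blast
  qed
  have const: "?I z = c" if "\<And>N. N \<in> C \<Longrightarrow> N z = c" for z c
  proof -
    have "(\<lambda>N. N z) ` C = {c}" using that C by auto
    then show ?thesis by simp
  qed
  show "power_seminorm ?I"
    unfolding power_seminorm_def
  proof (intro conjI allI nonneg)
    show "?I 1 = 1" "?I 0 = 0" by (rule const, simp add: power_seminormD(2,3)[OF pn])+
    fix x y
    obtain f where f: "\<And>n. f n \<in> C" "(\<lambda>n. f n x) \<longlonglongrightarrow> ?I x" "(\<lambda>n. f n y) \<longlonglongrightarrow> ?I y" using seq by blast
    have D: "f n (x + y) \<le> f n x + f n y" "f n (x * y) \<le> f n x * f n y" for n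
      using power_seminormD[OF pn[OF f(1)]] by blast+
    show "?I (x + y) \<le> ?I x + ?I y"
      by (rule LIMSEQ_le_const[OF tendsto_add[OF f(2,3)]]) (use D le[OF f(1)] order_trans in blast)
    show "?I (x * y) \<le> ?I x * ?I y"
      by (rule LIMSEQ_le_const[OF tendsto_mult[OF f(2,3)]]) (use D le[OF f(1)] order_trans in blast)
  next
    fix x k
    obtain f where f: "\<And>n. f n \<in> C" "(\<lambda>n. f n x) \<longlonglongrightarrow> ?I x" "(\<lambda>n. f n (x ^ k)) \<longlonglongrightarrow> ?I (x ^ k)" using seq by blast
    have "(\<lambda>n. f n (x ^ k)) = (\<lambda>n. f n x ^ k)" using power_seminormD(6)[OF pn[OF f(1)]] by auto
    then show "?I (x ^ k) = ?I x ^ k" using f(3) tendsto_power[OF f(2), of k] LIMSEQ_unique by metis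
  qed
qed

lemma multiplicative_seminorm_below:
  assumes N0: "power_seminorm N0"
  obtains N where "power_seminorm N" "\<And>x. N x \<le> N0 x" "\<And>x y. N (x * y) = N x * N y"
proof -
  define A where "A = {N. power_seminorm N \<and> (\<forall>x. N x \<le> N0 x)}"
  \<comment> \<open>The order is reversed: an \<open>r\<close>-maximal element is a minimal
    seminorm.\<close>
  define r where "r = {(N, M). N \<in> A \<and> M \<in> A \<and> (\<forall>x. M x \<le> N x)}"
  have rI: "(N, M) \<in> r \<longleftrightarrow> N \<in> A \<and> M \<in> A \<and> (\<forall>x. M x \<le> N x)" for N M
    unfolding r_def by simp
  have "Field r = A" unfolding Field_def Domain_iff Range_iff set_eq_iff Un_iff rI by blast
  moreover have "r \<subseteq> A \<times> A" unfolding r_def by blast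
  moreover have "antisym r" by (rule antisymI) (auto simp: rI intro!: ext antisym)
  moreover have "trans r" by (rule transI) (unfold rI, meson order_trans)
  ultimately have "Partial_order r"
    unfolding partial_order_on_def preorder_on_def refl_on_def by (auto simp: rI)
  have "\<exists>M\<in>Field r. \<forall>N\<in>Field r. (M, N) \<in> r \<longrightarrow> N = M"
  proof (rule Zorns_po_lemma[OF \<open>Partial_order r\<close>])
    fix C assume "C \<in> Chains r"
    then have CA: "C \<subseteq> A" and lin: "\<And>N M. N \<in> C \<Longrightarrow> M \<in> C \<Longrightarrow> (\<forall>x. N x \<le> M x) \<or> (\<forall>x. M x \<le> N x)"
      unfolding Chains_def r_def by auto
    show "\<exists>u\<in>Field r. \<forall>N\<in>C. (N, u) \<in> r"
    proof (cases "C = {}")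
      case True
      then show ?thesis using N0 unfolding \<open>Field r = A\<close> A_def by auto
    next
      case False
      let ?I = "\<lambda>x. INF N\<in>C. N x"
      have I: "power_seminorm ?I" "\<And>N x. N \<in> C \<Longrightarrow> ?I x \<le> N x"
        using power_seminorm_Inf_chain[OF False _ lin] CA unfolding A_def by blast+
      obtain N1 where "N1 \<in> C" using False by blast
      then have "?I x \<le> N0 x" for x using I(2)[of N1 x] CA unfolding A_def by (auto intro: order_trans)
      then have "?I \<in> A" using I(1) unfolding A_def by simp
      moreover have "(N, ?I) \<in> r" if "N \<in> C" for N
        unfolding rI using that CA \<open>?I \<in> A\<close> I(2) by (intro conjI allI) auto
      ultimately show ?thesis unfolding \<open>Field r = A\<close> by (intro bexI[of _ ?I] ballI)
    qed
  qed
  then obtain M where M: "M \<in> A" "\<forall>N\<in>A. (M, N) \<in> r \<longrightarrow> N = M"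
    unfolding \<open>Field r = A\<close> by auto
  have MA: "power_seminorm M" "M x \<le> N0 x" for x using M(1) unfolding A_def by auto
  have min: "N' = M" if N': "power_seminorm N'" "\<And>x. N' x \<le> M x" for N'
  proof -
    have "N' x \<le> N0 x" for x using N'(2) MA(2) by (rule order_trans)
    then have "N' \<in> A" using N' unfolding A_def by simp
    then show ?thesis using M N'(2) unfolding rI by simp
  qed
  have "M (x * y) = M x * M y" for x y
    by (rule minimal_power_seminorm_multiplicative[OF MA(1) min])
  then show thesis using that[OF MA] by simp
qed


section \<open>Coefficient growth of powers over the valued rationals\<close>

lemma absolute_valueD:
  fixes u :: "'a::field \<Rightarrow> real"
  assumes "absolute_value_on UNIV u"
  shows "0 \<le> u x" "u x = 0 \<longleftrightarrow> x = 0" "u (x * y) = u x * u y" "u (x + y) \<le> u x + u y"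
    "u 1 = 1" "u (x ^ k) = u x ^ k" "u (- x) = u x" "u (inverse x) = inverse (u x)"
    "u (x / y) = u x / u y" "u (x - y) \<le> u x + u y" "u 0 = 0"
proof -
  note ax = assms[unfolded absolute_value_on_def]
  have nonneg: "0 \<le> u x" for x using ax by simp
  have zero: "u x = 0 \<longleftrightarrow> x = 0" for x using ax by simp
  have mult: "u (x * y) = u x * u y" for x y using ax by simp
  have add: "u (x + y) \<le> u x + u y" for x y using ax by simp
  show "0 \<le> u x" by (rule nonneg)
  show "u x = 0 \<longleftrightarrow> x = 0" by (rule zero)
  show "u (x * y) = u x * u y" by (rule mult)
  show "u (x + y) \<le> u x + u y" by (rule add)
  show z0: "u 0 = 0" using zero[of 0] by simp
  have "u 1 * u 1 = u 1" using mult[of 1 1] by simp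
  then show one: "u 1 = 1" using zero[of 1] by simp
  show "u (x ^ k) = u x ^ k" by (induction k) (simp_all add: one mult)
  have "u (- 1) * u (- 1) = 1" using mult[of "-1" "-1"] one by simp
  then have m1: "u (- 1) = 1" using nonneg[of "- 1"] by (simp add: square_eq_1_iff)
  then show neg: "u (- x) = u x" for x using mult[of "- 1" x] by simp
  show inv: "u (inverse x) = inverse (u x)" for x
  proof (cases "x = 0")
    case True
    then show ?thesis using z0 by simp
  next
    case False
    then have "u x * u (inverse x) = 1" using mult[of x "inverse x"] one by simp
    then show ?thesis by (rule inverse_unique[symmetric])
  qed
  show "u (x / y) = u x / u y" unfolding divide_inverse mult inv by simp
  show "u (x - y) \<le> u x + u y" using add[of x "- y"] neg[of y] by simp
qed

text \<open>The family \<open>e\<close> may be dependent. This freedom lets products of families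
  serve for sums and products of elements.\<close>

definition powers_bounded :: "(rat \<Rightarrow> real) \<Rightarrow> 'a::field_char_0 \<Rightarrow> real \<Rightarrow> bool" where
  "powers_bounded u a r \<longleftrightarrow> (\<exists>m e c K. \<forall>n. a ^ n = (\<Sum>i<(m::nat). of_rat (c n i) * e i) \<and>
     (\<forall>i<m. u (c n i) \<le> K * r ^ n))"

definition growth_norm :: "(rat \<Rightarrow> real) \<Rightarrow> 'a::field_char_0 \<Rightarrow> real" where
  "growth_norm u a = Inf {r. r > 0 \<and> powers_bounded u a r}"

lemma powers_boundedI:
  fixes I :: "'i set" and e :: "'i \<Rightarrow> 'a::field_char_0"
  assumes I: "finite I" and c: "\<And>n. a ^ n = (\<Sum>i\<in>I. of_rat (c n i) * e i)" "\<And>n i. i \<in> I \<Longrightarrow> u (c n i) \<le> K * r ^ n"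
  shows "powers_bounded u a r"
proof -
  obtain h where h: "bij_betw h {..<card I} I" using ex_bij_betw_nat_finite[OF I] by (auto simp: atLeast0LessThan)
  have "a ^ n = (\<Sum>i<card I. of_rat (c n (h i)) * e (h i)) \<and> (\<forall>i<card I. u (c n (h i)) \<le> K * r ^ n)" for n
    using c(2) bij_betwE[OF h] unfolding c(1) by (auto simp: sum.reindex_bij_betw[OF h, of "\<lambda>i. of_rat (c n i) * e i"])
  then show ?thesis unfolding powers_bounded_def
    by (intro exI[of _ "card I"] exI[of _ "\<lambda>i. e (h i)"] exI[of _ "\<lambda>n i. c n (h i)"] exI[of _ K]) simp
qed

lemma powers_boundedE:
  assumes "powers_bounded u a r" "absolute_value_on UNIV u" "r > 0"
  obtains m e c K where "\<And>n. a ^ n = (\<Sum>i<(m::nat). of_rat (c n i) * e i)"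
    "\<And>n i. i < m \<Longrightarrow> u (c n i) \<le> K * r ^ n" "K \<ge> 0"
proof -
  obtain m e c K where "\<forall>n. a ^ n = (\<Sum>i<(m::nat). of_rat (c n i) * e i) \<and> (\<forall>i<m. u (c n i) \<le> K * r ^ n)"
    using assms(1) unfolding powers_bounded_def by (elim exE)
  then have mec: "\<And>n. a ^ n = (\<Sum>i<(m::nat). of_rat (c n i) * e i)"
    "\<And>n i. i < m \<Longrightarrow> u (c n i) \<le> K * r ^ n" by simp_all
  show thesis
  proof (rule that[OF mec(1)])
    show "u (c n i) \<le> \<bar>K\<bar> * r ^ n" if "i < m" for n i
      by (rule order_trans[OF mec(2)[OF that]], rule mult_right_mono) (use assms(3) in auto)
  qed auto
qed

context
  fixes u :: "rat \<Rightarrow> real"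
  assumes u: "absolute_value_on UNIV u"
begin

lemma abs_of_nat_le: "u (of_nat n) \<le> real n"
proof (induction n)
  case (Suc n)
  have "u (of_nat (Suc n)) \<le> u (of_nat n) + u 1" using absolute_valueD(4)[OF u, of "of_nat n" 1] by (simp add: add.commute)
  then show ?case using Suc absolute_valueD(5)[OF u] by simp
qed (simp add: absolute_valueD[OF u])

lemma abs_sum_le: "u (\<Sum>i\<in>I. f i) \<le> (\<Sum>i\<in>I. u (f i))"
proof (induction I rule: infinite_finite_induct)
  case (insert x F)
  then show ?case using absolute_valueD(4)[OF u, of "f x" "\<Sum>i\<in>F. f i"] by simp
qed (simp_all add: absolute_valueD(11)[OF u])

lemma powers_bounded_mono:
  assumes "powers_bounded u a r" "0 < r" "r \<le> s"
  shows "powers_bounded u a s"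
proof -
  obtain m e c K where *: "\<And>n. a ^ n = (\<Sum>i<(m::nat). of_rat (c n i) * e i)"
    "\<And>n i. i < m \<Longrightarrow> u (c n i) \<le> K * r ^ n" "K \<ge> 0"
    by (rule powers_boundedE[OF assms(1) u assms(2)]) (rule that)
  show ?thesis
  proof (rule powers_boundedI[of "{..<m}" a c e u K])
    show "u (c n i) \<le> K * s ^ n" if "i \<in> {..<m}" for n i
      using *(2)[of i n] that *(3) power_mono[OF assms(3), of n] assms(2) 
      by (meson lessThan_iff less_imp_le mult_left_mono order_trans)
  qed (use * in auto)
qed

lemma powers_bounded_mult:
  assumes "powers_bounded u a r" "0 < r" "powers_bounded u b s" "0 < s"
  shows "powers_bounded u (a * b) (r * s)"
proof -
  obtain m e c K where 1: "\<And>n. a ^ n = (\<Sum>i<(m::nat). of_rat (c n i) * e i)"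
    "\<And>n i. i < m \<Longrightarrow> u (c n i) \<le> K * r ^ n" "K \<ge> 0"
    by (rule powers_boundedE[OF assms(1) u assms(2)]) (rule that)
  obtain m' e' c' K' where 2: "\<And>n. b ^ n = (\<Sum>i<(m'::nat). of_rat (c' n i) * e' i)"
    "\<And>n i. i < m' \<Longrightarrow> u (c' n i) \<le> K' * s ^ n" "K' \<ge> 0"
    by (rule powers_boundedE[OF assms(3) u assms(4)]) (rule that)
  show ?thesis
  proof (rule powers_boundedI[of "{..<m} \<times> {..<m'}" _ "\<lambda>n (i, j). c n i * c' n j" "\<lambda>(i, j). e i * e' j" u "K * K'"])
    show "(a * b) ^ n = (\<Sum>x\<in>{..<m} \<times> {..<m'}. of_rat (case x of (i, j) \<Rightarrow> c n i * c' n j) * (case x of (i, j) \<Rightarrow> e i * e' j))" for n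
      unfolding power_mult_distrib 1(1) 2(1) sum_product sum.cartesian_product
      by (intro sum.cong) (auto simp: of_rat_mult algebra_simps)
    fix n x assume "x \<in> {..<m} \<times> {..<m'}"
    then obtain i j where x: "x = (i, j)" "i < m" "j < m'" by auto
    have "u (c n i) * u (c' n j) \<le> (K * r ^ n) * (K' * s ^ n)"
      using 1 2 x assms by (intro mult_mono) (auto simp: absolute_valueD[OF u])
    then show "u (case x of (i, j) \<Rightarrow> c n i * c' n j) \<le> K * K' * (r * s) ^ n"
      unfolding x by (simp add: absolute_valueD(3)[OF u] power_mult_distrib algebra_simps)
  qed auto
qed

text \<open>The binomial theorem expands \<open>(a + b) ^ n\<close> in the products of the two
  families. Since \<open>u\<close> of a natural number is at most that number, the bounds
  \<open>r ^ k * s ^ (n - k)\<close> are weighted by binomial coefficients and add up to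
  \<open>(r + s) ^ n\<close>.\<close>

lemma powers_bounded_add:
  assumes "powers_bounded u a r" "0 < r" "powers_bounded u b s" "0 < s"
  shows "powers_bounded u (a + b) (r + s)"
proof -
  obtain m e c K where 1: "\<And>n. a ^ n = (\<Sum>i<(m::nat). of_rat (c n i) * e i)"
    "\<And>n i. i < m \<Longrightarrow> u (c n i) \<le> K * r ^ n" "K \<ge> 0"
    by (rule powers_boundedE[OF assms(1) u assms(2)]) (rule that)
  obtain m' e' c' K' where 2: "\<And>n. b ^ n = (\<Sum>i<(m'::nat). of_rat (c' n i) * e' i)"
    "\<And>n i. i < m' \<Longrightarrow> u (c' n i) \<le> K' * s ^ n" "K' \<ge> 0"
    by (rule powers_boundedE[OF assms(3) u assms(4)]) (rule that)
  define C where "C n = (\<lambda>(i, j). \<Sum>k\<le>n. of_nat (n choose k) * c k i * c' (n - k) j)" for n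
  show ?thesis
  proof (rule powers_boundedI[of "{..<m} \<times> {..<m'}" _ C "\<lambda>(i, j). e i * e' j" u "K * K'"])
    fix n
    have "(a + b) ^ n = (\<Sum>k\<le>n. of_nat (n choose k) * ((\<Sum>i<m. of_rat (c k i) * e i) * (\<Sum>j<m'. of_rat (c' (n - k) j) * e' j)))"
      unfolding binomial_ring 1(1) 2(1) by (simp add: mult.assoc)
    also have "\<dots> = (\<Sum>k\<le>n. \<Sum>x\<in>{..<m} \<times> {..<m'}. of_rat (of_nat (n choose k) * c k (fst x) * c' (n - k) (snd x)) * (e (fst x) * e' (snd x)))"
    proof (rule sum.cong[OF refl])
      fix k
      show "of_nat (n choose k) * ((\<Sum>i<m. of_rat (c k i) * e i) * (\<Sum>j<m'. of_rat (c' (n - k) j) * e' j)) =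
        (\<Sum>x\<in>{..<m} \<times> {..<m'}. of_rat (of_nat (n choose k) * c k (fst x) * c' (n - k) (snd x)) * (e (fst x) * e' (snd x)))"
        unfolding sum_product sum.cartesian_product unfolding sum_distrib_left
        by (intro sum.cong refl) (simp add: split_beta of_rat_mult algebra_simps)
    qed
    also have "\<dots> = (\<Sum>x\<in>{..<m} \<times> {..<m'}. of_rat (C n x) * (case x of (i, j) \<Rightarrow> e i * e' j))"
      unfolding C_def by (subst sum.swap) (simp add: split_beta of_rat_sum sum_distrib_right)
    finally show "(a + b) ^ n = (\<Sum>x\<in>{..<m} \<times> {..<m'}. of_rat (C n x) * (case x of (i, j) \<Rightarrow> e i * e' j))" .
    fix x assume "x \<in> {..<m} \<times> {..<m'}"
    then obtain i j where x: "x = (i, j)" "i < m" "j < m'" by auto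
    have "u (C n x) \<le> (\<Sum>k\<le>n. u (of_nat (n choose k) * c k i * c' (n - k) j))"
      unfolding C_def x by (simp add: abs_sum_le)
    also have "\<dots> \<le> (\<Sum>k\<le>n. real (n choose k) * (K * r ^ k) * (K' * s ^ (n - k)))"
      unfolding absolute_valueD(3)[OF u]
      using 1 2 x assms by (intro sum_mono mult_mono abs_of_nat_le) (auto simp: absolute_valueD(1)[OF u])
    also have "\<dots> = K * K' * (r + s) ^ n"
      unfolding binomial_ring sum_distrib_left by (intro sum.cong) (auto simp: algebra_simps)
    finally show "u (C n x) \<le> K * K' * (r + s) ^ n" .
  qed auto
qed

lemma powers_bounded_power:
  assumes "powers_bounded u a r" "0 < r"
  shows "powers_bounded u (a ^ k) (r ^ k)"
proof -
  obtain m e c K where *: "\<And>n. a ^ n = (\<Sum>i<(m::nat). of_rat (c n i) * e i)"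
    "\<And>n i. i < m \<Longrightarrow> u (c n i) \<le> K * r ^ n" "K \<ge> 0"
    by (rule powers_boundedE[OF assms(1) u assms(2)]) (rule that)
  show ?thesis
  proof (rule powers_boundedI[of "{..<m}" _ "\<lambda>n. c (k * n)" e u K])
    show "(a ^ k) ^ n = (\<Sum>i<m. of_rat (c (k * n) i) * e i)" for n
      unfolding power_mult[symmetric] by (rule *(1))
    show "u (c (k * n) i) \<le> K * (r ^ k) ^ n" if "i \<in> {..<m}" for n i
      unfolding power_mult[symmetric] using *(2) that by simp
  qed simp
qed

text \<open>Write \<open>a ^ n\<close> as \<open>a ^ (n mod k)\<close> times a power of
  \<open>a ^ k\<close>, and enlarge the family by the finitely many \<open>a ^ j\<close> with
  \<open>j < k\<close>. The loss \<open>inverse (r ^ (n mod k))\<close> is absorbed by the constant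
  \<open>L\<close>.\<close>

lemma powers_bounded_root:
  assumes "powers_bounded u (a ^ k) (r ^ k)" "0 < r" "0 < k"
  shows "powers_bounded u a r"
proof -
  obtain m e c K where *: "\<And>n. (a ^ k) ^ n = (\<Sum>i<(m::nat). of_rat (c n i) * e i)"
    "\<And>n i. i < m \<Longrightarrow> u (c n i) \<le> K * (r ^ k) ^ n" "K \<ge> 0"
    by (rule powers_boundedE[OF assms(1) u zero_less_power[OF assms(2)]]) (rule that)
  define L where "L = (\<Sum>j<k. inverse (r ^ j))"
  have L: "inverse (r ^ j) \<le> L" if "j < k" for j
    unfolding L_def using that assms(2) by (intro member_le_sum) (auto simp: less_imp_le)
  have "0 \<le> L" unfolding L_def using assms(2) by (intro sum_nonneg) (auto simp: less_imp_le)
  define C where "C n = (\<lambda>(j, i). if j = n mod k then c (n div k) i else 0)" for n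
  show ?thesis
  proof (rule powers_boundedI[of "{..<k} \<times> {..<m}" _ C "\<lambda>(j, i). a ^ j * e i" u "K * L"])
    fix n
    have "a ^ n = a ^ (n mod k) * (a ^ k) ^ (n div k)"
      unfolding power_mult[symmetric] power_add[symmetric] by simp
    also have "\<dots> = (\<Sum>i<m. of_rat (c (n div k) i) * (a ^ (n mod k) * e i))"
      unfolding * sum_distrib_left by (simp add: algebra_simps)
    also have "\<dots> = (\<Sum>j<k. if j = n mod k then (\<Sum>i<m. of_rat (c (n div k) i) * (a ^ j * e i)) else 0)"
      using assms(3) by (subst sum.delta) auto
    also have "\<dots> = (\<Sum>j<k. \<Sum>i<m. of_rat (C n (j, i)) * (a ^ j * e i))"
      unfolding C_def by (intro sum.cong refl) auto
    finally show "a ^ n = (\<Sum>x\<in>{..<k} \<times> {..<m}. of_rat (C n x) * (case x of (j, i) \<Rightarrow> a ^ j * e i))"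
      unfolding sum.cartesian_product by (simp add: split_beta)
    fix x assume "x \<in> {..<k} \<times> {..<m}"
    then obtain j i where x: "x = (j, i)" "j < k" "i < m" by auto
    show "u (C n x) \<le> K * L * r ^ n"
    proof (cases "j = n mod k")
      case True
      have "u (c (n div k) i) \<le> K * (r ^ k) ^ (n div k)" using * x by auto
      also have "(r ^ k) ^ (n div k) = r ^ n * inverse (r ^ (n mod k))"
      proof -
        have "r ^ n = r ^ (n mod k) * (r ^ k) ^ (n div k)" unfolding power_mult[symmetric] power_add[symmetric] by simp
        then show ?thesis using assms(2) by simp
      qed
      also have "K * (r ^ n * inverse (r ^ (n mod k))) \<le> K * (r ^ n * L)"
        using L[of "n mod k"] assms *(3) by (intro mult_left_mono) auto
      finally show ?thesis unfolding C_def x using True by (simp add: algebra_simps)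
    next
      case False
      then show ?thesis unfolding C_def x using *(3) \<open>0 \<le> L\<close> assms(2) by (simp add: absolute_valueD(11)[OF u])
    qed
  qed auto
qed

lemma powers_bounded_of_rat: assumes "u q \<le> r" shows "powers_bounded u (of_rat q) r"
  by (rule powers_boundedI[of "{()}" _ "\<lambda>n _. q ^ n" "\<lambda>_. 1" u 1])
     (use assms in \<open>auto simp: absolute_valueD[OF u] of_rat_power intro!: power_mono\<close>)

text \<open>Guards against a collapse of the growth norm, giving it the value 1 at 1. A
  rational-linear functional taking 1 to 1 turns the expansions of \<open>1 ^ n\<close> into
  scalars; for \<open>r < 1\<close> their values would tend to 0.\<close>

lemma powers_bounded_1:
  assumes "powers_bounded u (1::'a::field_char_0) r" "0 < r"
  shows "1 \<le> r"
proof (rule ccontr)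
  assume "\<not> 1 \<le> r"
  then have r: "r < 1" by simp
  obtain m e c K where *: "\<And>n. (1::'a) ^ n = (\<Sum>i<(m::nat). of_rat (c n i) * e i)"
    "\<And>n i. i < m \<Longrightarrow> u (c n i) \<le> K * r ^ n" "K \<ge> 0"
    by (rule powers_boundedE[OF assms(1) u assms(2)]) (rule that)
  interpret V: vector_space_pair "\<lambda>q (x::'a). of_rat q * x" "\<lambda>q (x::rat). q * x"
    by unfold_locales (auto simp: algebra_simps of_rat_add of_rat_mult)
  have "V.vs1.independent {1}" by (subst V.vs1.dependent_single) auto
  from V.linear_independent_extend[OF this, of "\<lambda>_. 1"]
  obtain l where l: "Vector_Spaces.linear (\<lambda>q (x::'a). of_rat q * x) (\<lambda>q (x::rat). q * x) l" "l 1 = 1" by auto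
  interpret l: Vector_Spaces.linear "\<lambda>q (x::'a). of_rat q * x" "\<lambda>q (x::rat). q * x" l by (rule l)
  have "1 \<le> (\<Sum>i<m. u (l (e i))) * K * r ^ n" for n
  proof -
    have "l (1 ^ n) = (\<Sum>i<m. c n i * l (e i))" unfolding * by (simp add: l.sum l.scale)
    then have "1 = u (\<Sum>i<m. c n i * l (e i))" using l(2) by (simp add: absolute_valueD(5)[OF u])
    also have "\<dots> \<le> (\<Sum>i<m. u (c n i * l (e i)))" by (rule abs_sum_le)
    also have "\<dots> \<le> (\<Sum>i<m. K * r ^ n * u (l (e i)))"
      unfolding absolute_valueD(3)[OF u] using * by (intro sum_mono mult_right_mono) (auto simp: absolute_valueD(1)[OF u])
    finally show ?thesis by (simp add: sum_distrib_left[symmetric] algebra_simps)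
  qed
  moreover have "(\<lambda>n. (\<Sum>i<m. u (l (e i))) * K * r ^ n) \<longlonglongrightarrow> 0"
    by (rule tendsto_mult_right_zero, rule LIMSEQ_realpow_zero) (use r assms in auto)
  ultimately have "1 \<le> (0::real)" by (intro LIMSEQ_le_const) auto
  then show False by simp
qed

lemma powers_bounded_algebraic:
  fixes a :: "'a::field_char_0"
  assumes alg: "algebraic_over (\<rat> :: 'a set)"
  shows "\<exists>r>0. powers_bounded u a r"
proof -
  obtain p where p: "p \<noteq> 0" "\<And>i. coeff p i \<in> \<rat>" "poly p a = 0" using alg unfolding algebraic_over_def by metis
  define m where "m = degree p"
  have m: "m > 0"
  proof (rule gr0I)
    assume "m = 0"
    then obtain c where "p = [:c:]" unfolding m_def by (rule degree_eq_zeroE)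
    then show False using p by auto
  qed
  have "\<forall>i. \<exists>b. - coeff p i / lead_coeff p = of_rat b"
    using p(2) by (metis Rats_cases Rats_divide Rats_minus_iff)
  then obtain q where q: "\<And>i. - coeff p i / lead_coeff p = of_rat (q i)" by metis
  have am: "a ^ m = (\<Sum>i<m. of_rat (q i) * a ^ i)"
  proof -
    have "0 = (\<Sum>i\<le>m. coeff p i * a ^ i)" using p(3) unfolding poly_altdef m_def by simp
    also have "\<dots> = (\<Sum>i<m. coeff p i * a ^ i) + lead_coeff p * a ^ m"
      unfolding m_def by (simp add: lessThan_Suc_atMost[symmetric])
    finally have "a ^ m = - (\<Sum>i<m. coeff p i * a ^ i) / lead_coeff p"
      using p(1) by (simp add: field_simps eq_neg_iff_add_eq_0)
    also have "\<dots> = (\<Sum>i<m. of_rat (q i) * a ^ i)"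
      unfolding q[symmetric] by (simp add: sum_negf sum_divide_distrib)
    finally show ?thesis .
  qed
  \<comment> \<open>Multiplication by \<open>a\<close> shifts the coordinates with respect to
    \<open>1, a, ..., a ^ (m - 1)\<close> and adds \<open>c k * q i\<close>, where
    \<open>k = m - 1\<close>. One step thus costs at most a factor \<open>1 + u (q i)\<close>, which
    is below \<open>r\<close>.\<close>
  define r where "r = 1 + (\<Sum>i<m. u (q i))"
  have ge0: "0 \<le> u x" for x by (rule absolute_valueD(1)[OF u])
  have r: "1 + u (q i) \<le> r" if "i < m" for i
    unfolding r_def using that ge0 by (intro add_left_mono member_le_sum) auto
  have r1: "1 \<le> r" unfolding r_def using ge0 by (simp add: sum_nonneg)
  have "\<exists>c. a ^ n = (\<Sum>i<m. of_rat (c i) * a ^ i) \<and> (\<forall>i<m. u (c i) \<le> r ^ n)" for n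
  proof (induction n)
    case 0
    show ?case
    proof (intro exI[of _ "\<lambda>i. if i = 0 then 1 else 0"] conjI allI impI)
      have "(\<Sum>i<m. of_rat (if i = 0 then 1 else 0) * a ^ i) = (\<Sum>i<m. if i = 0 then 1 else 0)"
        by (intro sum.cong) auto
      then show "a ^ 0 = (\<Sum>i<m. of_rat (if i = 0 then 1 else 0) * a ^ i)" using m by simp
    qed (auto simp: absolute_valueD(5,11)[OF u])
  next
    case (Suc n)
    then obtain c where c: "a ^ n = (\<Sum>i<m. of_rat (c i) * a ^ i)" "\<And>i. i < m \<Longrightarrow> u (c i) \<le> r ^ n" by auto
    obtain k where k: "m = Suc k" using m by (cases m) auto
    define c' where "c' i = (case i of 0 \<Rightarrow> 0 | Suc j \<Rightarrow> c j) + c k * q i" for i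
    have "a ^ Suc n = (\<Sum>i<m. of_rat (c i) * a ^ Suc i)" using c(1) by (simp add: sum_distrib_left algebra_simps)
    also have "\<dots> = (\<Sum>i<k. of_rat (c i) * a ^ Suc i) + of_rat (c k) * a ^ m" unfolding k by simp
    also have "(\<Sum>i<k. of_rat (c i) * a ^ Suc i) = (\<Sum>i<m. of_rat (case i of 0 \<Rightarrow> 0 | Suc j \<Rightarrow> c j) * a ^ i)"
      unfolding k by (subst sum.lessThan_Suc_shift) simp
    also have "of_rat (c k) * a ^ m = (\<Sum>i<m. of_rat (c k * q i) * a ^ i)"
      unfolding am by (simp add: sum_distrib_left of_rat_mult mult.assoc)
    finally have "a ^ Suc n = (\<Sum>i<m. of_rat (c' i) * a ^ i)"
      unfolding c'_def by (simp add: of_rat_add distrib_right sum.distrib)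
    moreover have "u (c' i) \<le> r ^ Suc n" if i: "i < m" for i
    proof -
      have "u (case i of 0 \<Rightarrow> 0 | Suc j \<Rightarrow> c j) \<le> r ^ n"
        using c(2) i r1 by (cases i) (auto simp: absolute_valueD(11)[OF u])
      moreover have "u (c k * q i) \<le> r ^ n * u (q i)"
        unfolding absolute_valueD(3)[OF u] using c(2)[of k] ge0 k by (intro mult_right_mono) auto
      ultimately have "u (c' i) \<le> r ^ n + r ^ n * u (q i)"
        using absolute_valueD(4)[OF u] unfolding c'_def by (meson add_mono order_trans)
      also have "\<dots> = r ^ n * (1 + u (q i))" by (simp add: algebra_simps)
      also have "\<dots> \<le> r ^ n * r" using r[OF i] r1 by (intro mult_left_mono) auto
      finally show ?thesis by (simp add: mult.commute)
    qed
    ultimately show ?case by (intro exI[of _ c']) simp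
  qed
  then have "\<forall>n. \<exists>c. a ^ n = (\<Sum>i<m. of_rat (c i) * a ^ i) \<and> (\<forall>i<m. u (c i) \<le> r ^ n)" ..
  from choice[OF this] obtain c where c: "\<forall>n. a ^ n = (\<Sum>i<m. of_rat (c n i) * a ^ i) \<and> (\<forall>i<m. u (c n i) \<le> r ^ n)" ..
  have "powers_bounded u a r"
  proof (rule powers_boundedI[of "{..<m}" a c "\<lambda>i. a ^ i" u 1 r])
    show "a ^ n = (\<Sum>i<m. of_rat (c n i) * a ^ i)" for n using c by (rule allE) (erule conjunct1)
    show "u (c n i) \<le> 1 * r ^ n" if "i \<in> {..<m}" for n i
      using conjunct2[OF c[THEN spec, of n]] that by simp
  qed simp
  then show ?thesis using r1 by (intro exI[of _ r]) auto
qed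

lemma growth_norm_le: "0 < r \<Longrightarrow> powers_bounded u a r \<Longrightarrow> growth_norm u a \<le> r"
  unfolding growth_norm_def by (rule cInf_lower) (auto intro: bdd_belowI[of _ 0])

lemma growth_norm_less:
  fixes a :: "'a::field_char_0"
  assumes "algebraic_over (\<rat> :: 'a set)" "growth_norm u a < r"
  shows "powers_bounded u a r"
proof -
  let ?S = "{r. r > 0 \<and> powers_bounded u a r}"
  have "?S \<noteq> {}" using powers_bounded_algebraic[OF assms(1), of a] by auto
  moreover have "bdd_below ?S" by (auto intro: bdd_belowI[of _ 0])
  ultimately obtain s where "s \<in> ?S" "s < r" using assms(2) unfolding growth_norm_def by (auto simp: cInf_less_iff)
  then show ?thesis using powers_bounded_mono[of a s r] by auto
qed

text \<open>Bounds for elements combine by the lemmas above with an arbitrarily small excess. Exact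
  power-multiplicativity holds because bounds for \<open>x\<close> and for \<open>x ^ k\<close> are
  convertible in both directions.\<close>

lemma growth_norm_power_seminorm:
  assumes alg: "algebraic_over (\<rat> :: 'a::field_char_0 set)"
  shows "power_seminorm (growth_norm u :: 'a \<Rightarrow> real)"
proof -
  let ?N = "growth_norm u :: 'a \<Rightarrow> real"
  have nonneg: "0 \<le> ?N a" for a
    unfolding growth_norm_def using powers_bounded_algebraic[OF alg, of a] by (intro cInf_greatest) auto
  have pb: "powers_bounded u a (?N a + e)" "0 < ?N a + e" if "e > 0" for a e
    using growth_norm_less[OF alg, of a "?N a + e"] nonneg[of a] that by auto
  have of_rat: "?N (of_rat q) \<le> u q" for q
  proof (rule field_le_epsilon)
    fix e :: real assume "e > 0"
    then show "?N (of_rat q) \<le> u q + e"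
      using growth_norm_le[of "u q + e" "of_rat q"] powers_bounded_of_rat[of q "u q + e"] absolute_valueD(1)[OF u, of q] by auto
  qed
  show ?thesis
    unfolding power_seminorm_def
  proof (intro conjI allI)
    show "0 \<le> ?N x" for x by (rule nonneg)
    show "?N 0 = 0" using of_rat[of 0] nonneg[of 0] absolute_valueD(11)[OF u] by simp
    have "?N 1 \<le> 1" using of_rat[of 1] absolute_valueD(5)[OF u] by simp
    moreover have "1 \<le> ?N 1"
    proof (rule field_le_epsilon)
      fix e :: real assume "e > 0"
      then show "1 \<le> ?N 1 + e" using powers_bounded_1[OF pb] by simp
    qed
    ultimately show "?N 1 = 1" by simp
    show "?N (x + y) \<le> ?N x + ?N y" for x y
    proof (rule field_le_epsilon)
      fix e :: real assume e: "e > 0"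
      then have "e / 2 > 0" by simp
      from growth_norm_le[OF _ powers_bounded_add[OF pb[OF this, of x] pb[OF this, of y]]] pb(2)[OF this, of x] pb(2)[OF this, of y]
      have "?N (x + y) \<le> (?N x + e / 2) + (?N y + e / 2)" by simp
      then show "?N (x + y) \<le> ?N x + ?N y + e" by simp
    qed
    show "?N (x * y) \<le> ?N x * ?N y" for x y
    proof -
      have le: "?N (x * y) \<le> (?N x + inverse (real (Suc n))) * (?N y + inverse (real (Suc n)))" for n
      proof -
        have e: "inverse (real (Suc n)) > 0" by simp
        show ?thesis
          using growth_norm_le[OF _ powers_bounded_mult[OF pb[OF e, of x] pb[OF e, of y]]] pb(2)[OF e, of x] pb(2)[OF e, of y] by simp
      qed
      have "(\<lambda>n. (?N x + inverse (real (Suc n))) * (?N y + inverse (real (Suc n)))) \<longlonglongrightarrow> (?N x + 0) * (?N y + 0)"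
        by (intro tendsto_intros LIMSEQ_inverse_real_of_nat)
      then show ?thesis using le by (auto dest: LIMSEQ_le_const)
    qed
    show "?N (x ^ k) = ?N x ^ k" for x k
    proof (cases "k = 0")
      case True
      then show ?thesis using \<open>?N 1 = 1\<close> by simp
    next
      case k: False
      show ?thesis
      proof (rule antisym)
        have le: "?N (x ^ k) \<le> (?N x + inverse (real (Suc n))) ^ k" for n
        proof -
          have e: "inverse (real (Suc n)) > 0" by simp
          show ?thesis using growth_norm_le[OF _ powers_bounded_power[OF pb[OF e, of x], of k]] pb(2)[OF e, of x] by simp
        qed
        have "(\<lambda>n. (?N x + inverse (real (Suc n))) ^ k) \<longlonglongrightarrow> (?N x + 0) ^ k"
          by (intro tendsto_intros LIMSEQ_inverse_real_of_nat)
        then show "?N (x ^ k) \<le> ?N x ^ k" using le by (auto dest: LIMSEQ_le_const)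
        show "?N x ^ k \<le> ?N (x ^ k)"
        proof (rule field_le_epsilon)
          fix e :: real assume e: "e > 0"
          define s where "s = ?N (x ^ k) + e"
          have s: "s > 0" "powers_bounded u (x ^ k) s" unfolding s_def using pb[OF e] by auto
          \<comment> \<open>The lower bound: a growth bound for \<open>x ^ k\<close> yields its
            \<open>k\<close>-th root as a growth bound for \<open>x\<close>.\<close>
          have "root k s > 0" "root k s ^ k = s" using k s by (auto simp: real_root_gt_zero)
          moreover from this have "powers_bounded u x (root k s)" using powers_bounded_root[of x k "root k s"] s k by auto
          ultimately have "?N x \<le> root k s" by (intro growth_norm_le)
          then have "?N x ^ k \<le> root k s ^ k" using nonneg by (intro power_mono)
          then show "?N x ^ k \<le> ?N (x ^ k) + e" using \<open>root k s ^ k = s\<close> unfolding s_def by simp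
        qed
      qed
    qed
  qed
qed

text \<open>By construction the multiplicative seminorm is at most \<open>u\<close> on the
  rationals. The same bound at \<open>inverse q\<close>, together with multiplicativity, forces
  equality at \<open>q\<close>.\<close>

theorem absolute_value_extends:
  assumes alg: "algebraic_over (\<rat> :: 'a::field_char_0 set)"
  shows "\<exists>w :: 'a \<Rightarrow> real. absolute_value_on UNIV w \<and> (\<forall>q. w (of_rat q) = u q)"
proof -
  obtain w :: "'a \<Rightarrow> real" where w: "power_seminorm w" "\<And>x. w x \<le> growth_norm u x" "\<And>x y. w (x * y) = w x * w y"
    using multiplicative_seminorm_below[OF growth_norm_power_seminorm[OF alg]] by metis
  note D = power_seminormD[OF w(1)]
  have le: "w (of_rat q) \<le> u q" for q
  proof (rule field_le_epsilon)
    fix e :: real assume "e > 0"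
    then have "growth_norm u (of_rat q :: 'a) \<le> u q + e"
      using growth_norm_le[of "u q + e" "of_rat q :: 'a"] powers_bounded_of_rat[of q "u q + e"] absolute_valueD(1)[OF u, of q] by auto
    then show "w (of_rat q) \<le> u q + e" using w(2)[of "of_rat q"] by simp
  qed
  have inv: "w x * w (inverse x) = 1" if "x \<noteq> 0" for x
    using w(3)[of x "inverse x"] D(2) that by simp
  have "w (of_rat q) = u q" for q
  proof (cases "q = 0")
    case True
    then show ?thesis using D(3) absolute_valueD(11)[OF u] by simp
  next
    case False
    have "w (of_rat q) * w (of_rat (inverse q)) = 1" using inv[of "of_rat q"] False by (simp add: of_rat_inverse)
    moreover have "w (of_rat (inverse q)) \<le> inverse (u q)" using le[of "inverse q"] absolute_valueD(8)[OF u] by simp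
    moreover have "u q > 0" using absolute_valueD(1,2)[OF u, of q] False by simp
    ultimately have "1 \<le> w (of_rat q) * inverse (u q)" "u q > 0"
      using mult_left_mono[OF _ D(1)[of "of_rat q"]] by fastforce+
    then have "u q \<le> w (of_rat q)" by (simp add: field_simps)
    then show ?thesis using le[of q] by simp
  qed
  moreover have "w x = 0 \<longleftrightarrow> x = 0" for x using inv[of x] D(3) by (cases "x = 0") auto
  ultimately show ?thesis using D w(3) unfolding absolute_value_on_def by (intro exI[of _ w]) auto
qed

end

section \<open>Embeddings and traces\<close>

lemma type_algebra_simps [simp]:
  fixes x y :: "'a::field"
  shows "carrier (ring_of_type_algebra :: 'a ring) = UNIV" "x \<oplus>\<^bsub>ring_of_type_algebra\<^esub> y = x + y"
    "x \<otimes>\<^bsub>ring_of_type_algebra\<^esub> y = x * y" "\<zero>\<^bsub>ring_of_type_algebra\<^esub> = (0::'a)" "\<one>\<^bsub>ring_of_type_algebra\<^esub> = (1::'a)"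
  by (simp_all add: ring_of_type_algebra_def)

lemma combine_type_algebra:
  "length Ks = length Us \<Longrightarrow> ring.combine (ring_of_type_algebra :: 'a::field ring) Ks Us = (\<Sum>i<length Us. Ks ! i * Us ! i)"
proof (induction Ks Us rule: list_induct2)
  case Nil
  interpret ring "ring_of_type_algebra :: 'a ring" by (rule ring_from_type_algebra)
  show ?case by simp
next
  case (Cons k Ks u Us)
  interpret ring "ring_of_type_algebra :: 'a ring" by (rule ring_from_type_algebra)
  show ?case using Cons by (simp add: sum.lessThan_Suc_shift del: sum.lessThan_Suc)
qed

lemma subfield_type_algebra:
  "subfield F (ring_of_type_algebra :: 'a::field ring) \<longleftrightarrow> is_subfield F"
proof
  let ?R = "ring_of_type_algebra :: 'a ring"
  interpret R: field ?R by (rule field_from_type_algebra)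
  have neg: "\<ominus>\<^bsub>?R\<^esub> x = - x" for x by (rule R.minus_equality) simp_all
  have inv: "inv\<^bsub>?R\<^esub> x = inverse x" if "x \<noteq> 0" for x
    using that by (intro R.comm_inv_char) simp_all
  {
    assume F: "subfield F ?R"
    note sr = subringE[OF subfieldE(1)[OF F], simplified]
    have "inverse x \<in> F" if "x \<in> F" for x
      using R.subfield_m_inv(1)[OF F, of x] inv[of x] that sr by (cases "x = 0") auto
    then show "is_subfield F"
      unfolding is_subfield_def using sr by (auto simp: neg)
  }
  {
    assume F: "is_subfield F"
    note D = is_subfieldD[OF F]
    have "subring F ?R"
      using D by (intro R.subringI) (auto simp: neg)
    then show "subfield F ?R" 
      by (rule R.subfieldI') (simp add: inv D(6))
  }
qed

lemma number_subfield_basis: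
  fixes L :: "'a::field_char_0 set"
  assumes "number_subfield L"
  obtains e where "\<And>i. i < field_degree \<rat> L \<Longrightarrow> e i \<in> L"
    "\<And>x. x \<in> L \<Longrightarrow> \<exists>c. x = (\<Sum>i<field_degree \<rat> L. of_rat (c i) * e i)"
    "\<And>c. (\<Sum>i<field_degree \<rat> L. of_rat (c i) * e i) = 0 \<Longrightarrow> \<forall>i<field_degree \<rat> L. c i = 0"
proof -
  let ?R = "ring_of_type_algebra :: 'a ring"
  interpret R: field ?R by (rule field_from_type_algebra)
  have Q: "subfield \<rat> ?R" using subfield_type_algebra is_subfield_Rats by blast
  have fin: "R.finite_dimension \<rat> L" using assms unfolding number_subfield_def by blast
  define n where "n = field_degree \<rat> L"
  have "R.dimension n \<rat> L"
    using R.finite_dimensionE[OF Q fin] unfolding n_def field_degree_def over_def .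
  then obtain us where us: "R.independent \<rat> us" "length us = n" "R.Span \<rat> us = L"
    using R.exists_base[OF Q] by metis
  have car: "set us \<subseteq> carrier ?R" by (simp add: ring_of_type_algebra_def)
  have mem: "us ! i \<in> L" if "i < n" for i
    using R.Span_base_incl[OF Q car] us that by auto
  have span: "\<exists>c. x = (\<Sum>i<n. of_rat (c i) * us ! i)" if "x \<in> L" for x
  proof -
    have "x \<in> R.Span \<rat> us" using that us(3) by (simp only:)
    then obtain Ks where Ks: "set Ks \<subseteq> \<rat>" "length Ks = n" "x = R.combine Ks us"
      unfolding R.Span_mem_iff_length_version[OF Q car] us(2) by blast
    have "\<forall>i. \<exists>q. i < n \<longrightarrow> Ks ! i = of_rat q" using Ks by (metis Rats_cases nth_mem subsetD)
    then obtain c where "\<forall>i<n. Ks ! i = of_rat (c i)" by metis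
    then show ?thesis using Ks us by (intro exI[of _ c]) (simp add: combine_type_algebra)
  qed
  have ind: "\<forall>i<n. c i = 0" if "(\<Sum>i<n. of_rat (c i) * us ! i) = 0" for c
  proof -
    let ?Ks = "map (\<lambda>i. of_rat (c i)) [0..<n] :: 'a list"
    have "R.combine ?Ks us = \<zero>\<^bsub>?R\<^esub>" using that us(2) by (simp add: combine_type_algebra)
    moreover have "set ?Ks \<subseteq> \<rat>" by auto
    ultimately have "set (take (length us) ?Ks) \<subseteq> {\<zero>\<^bsub>?R\<^esub>}"
      by (intro R.independent_imp_trivial_combine[OF Q us(1)])
    then show ?thesis using us(2) by (auto simp: image_subset_iff)
  qed
  show thesis by (rule that[of "\<lambda>i. us ! i"]) (use mem span ind n_def in auto)
qed

text \<open>If the type is algebraically closed and algebraic over \<open>\<rat>\<close>, every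
  embedding of a subfield \<open>L\<close> extends to an automorphism, so these are all embeddings
  of \<open>L\<close>. Restriction identifies automorphisms that agree on \<open>L\<close>, and
  composition with automorphisms acts on the set.\<close>

definition embeddings :: "'a::field_char_0 set \<Rightarrow> ('a \<Rightarrow> 'a) set" where
  "embeddings L = (\<lambda>\<sigma>. restrict \<sigma> L) ` field_aut \<rat>"

definition rat_trace :: "'a::field_char_0 set \<Rightarrow> 'a \<Rightarrow> rat" where
  "rat_trace L x = (SOME q. of_rat q = (\<Sum>\<tau>\<in>embeddings L. \<tau> x))"

lemma field_autD:
  assumes "\<sigma> \<in> field_aut F" "is_subfield F"
  shows "\<sigma> (x + y) = \<sigma> x + \<sigma> y" "\<sigma> (x * y) = \<sigma> x * \<sigma> y" "\<sigma> 0 = 0" "\<sigma> 1 = 1" "bij \<sigma>" "\<sigma> (- x) = - \<sigma> x"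
    "\<sigma> (inverse x) = inverse (\<sigma> x)" "\<sigma> (\<Sum>i\<in>I. f i) = (\<Sum>i\<in>I. \<sigma> (f i))" "\<sigma> (x ^ k) = \<sigma> x ^ k" "\<sigma> x = 0 \<longleftrightarrow> x = 0"
    "c \<in> F \<Longrightarrow> \<sigma> c = c" "\<sigma> (\<Prod>i\<in>I. f i) = (\<Prod>i\<in>I. \<sigma> (f i))"
proof -
  have add: "\<sigma> (x + y) = \<sigma> x + \<sigma> y" and mult: "\<sigma> (x * y) = \<sigma> x * \<sigma> y" and bij: "bij \<sigma>" and fixF: "c \<in> F \<Longrightarrow> \<sigma> c = c" for x y c
    using assms unfolding field_aut_def by auto
  have one: "\<sigma> 1 = 1" and zero: "\<sigma> 0 = 0" using fixF is_subfieldD[OF assms(2)] by auto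
  have z: "\<sigma> x = 0 \<longleftrightarrow> x = 0" for x using bij zero by (metis bij_pointE)
  show "\<sigma> (x + y) = \<sigma> x + \<sigma> y" "\<sigma> (x * y) = \<sigma> x * \<sigma> y" "\<sigma> 0 = 0" "\<sigma> 1 = 1" "bij \<sigma>" "\<sigma> x = 0 \<longleftrightarrow> x = 0" "c \<in> F \<Longrightarrow> \<sigma> c = c"
    by (fact add mult zero one bij z fixF)+
  have "\<sigma> x + \<sigma> (- x) = 0" using add[of x "- x"] zero by simp
  then show "\<sigma> (- x) = - \<sigma> x" by (simp add: eq_neg_iff_add_eq_0 add.commute)
  show "\<sigma> (inverse x) = inverse (\<sigma> x)"
  proof (cases "x = 0")
    case False
    then have "\<sigma> x * \<sigma> (inverse x) = 1" using mult[of x "inverse x"] one by simp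
    then show ?thesis by (rule inverse_unique[symmetric])
  qed (simp add: zero)
  show "\<sigma> (\<Sum>i\<in>I. f i) = (\<Sum>i\<in>I. \<sigma> (f i))" by (induction I rule: infinite_finite_induct) (simp_all add: add zero)
  show "\<sigma> (\<Prod>i\<in>I. f i) = (\<Prod>i\<in>I. \<sigma> (f i))" by (induction I rule: infinite_finite_induct) (simp_all add: mult one)
  show "\<sigma> (x ^ k) = \<sigma> x ^ k" by (induction k) (simp_all add: mult one)
qed

lemma field_aut_compose: "\<sigma> \<in> field_aut F \<Longrightarrow> \<tau> \<in> field_aut F \<Longrightarrow> \<sigma> \<circ> \<tau> \<in> field_aut F"
  unfolding field_aut_def by (auto intro: bij_comp)

lemma field_aut_inv:
  assumes "\<sigma> \<in> field_aut F" shows "inv_into UNIV \<sigma> \<in> field_aut F"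
proof -
  have b: "bij \<sigma>" and h: "\<And>x y. \<sigma> (x + y) = \<sigma> x + \<sigma> y" "\<And>x y. \<sigma> (x * y) = \<sigma> x * \<sigma> y" "\<And>c. c \<in> F \<Longrightarrow> \<sigma> c = c"
    using assms unfolding field_aut_def by auto
  have i: "\<sigma> (inv_into UNIV \<sigma> x) = x" for x using b by (simp add: bij_is_surj surj_f_inv_f)
  have eq: "inv_into UNIV \<sigma> x = y" if "x = \<sigma> y" for x y using that b by (simp add: bij_is_inj)
  show ?thesis unfolding field_aut_def
    using b by (auto intro!: bij_imp_bij_inv eq simp: h i)
qed

text \<open>Compare the relation at \<open>x * y\<close> with \<open>\<rho> y\<close> times the
  relation at \<open>x\<close>: the term of \<open>\<rho>\<close> drops out, and every other
  coefficient gains the factor \<open>\<tau> y - \<rho> y\<close>. Some \<open>y\<close> makes this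
  factor nonzero, since distinct extensional functions differ on \<open>L\<close>.\<close>

lemma dedekind_independence:
  fixes L :: "'a::field set"
  assumes fin: "finite S" and L: "is_subfield L"
    and ext: "\<And>\<tau>. \<tau> \<in> S \<Longrightarrow> \<tau> \<in> extensional L"
    and mult: "\<And>\<tau> x y. \<tau> \<in> S \<Longrightarrow> x \<in> L \<Longrightarrow> y \<in> L \<Longrightarrow> \<tau> (x * y) = \<tau> x * \<tau> y"
    and one: "\<And>\<tau>. \<tau> \<in> S \<Longrightarrow> \<tau> 1 = (1::'a)"
    and zero: "\<And>x. x \<in> L \<Longrightarrow> (\<Sum>\<tau>\<in>S. c \<tau> * \<tau> x) = 0"
  shows "\<forall>\<tau>\<in>S. c \<tau> = 0"
  using fin ext mult one zero
proof (induction S arbitrary: c rule: finite_induct)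
  case (insert \<rho> S)
  have z: "c \<rho> * \<rho> x + (\<Sum>\<tau>\<in>S. c \<tau> * \<tau> x) = 0" if "x \<in> L" for x
    using insert.prems(4)[OF that] insert.hyps by simp
  have S0: "\<forall>\<tau>\<in>S. c \<tau> * (\<tau> y - \<rho> y) = 0" if y: "y \<in> L" for y
  proof (rule insert.IH)
    fix x assume x: "x \<in> L"
    then have xy: "x * y \<in> L" using y is_subfieldD(4)[OF L] by blast
    have "(\<Sum>\<tau>\<in>S. c \<tau> * (\<tau> y - \<rho> y) * \<tau> x) = (\<Sum>\<tau>\<in>S. c \<tau> * \<tau> (x * y)) - \<rho> y * (\<Sum>\<tau>\<in>S. c \<tau> * \<tau> x)"
      unfolding sum_distrib_left sum_subtractf[symmetric]
      by (intro sum.cong refl) (simp add: insert.prems(2)[OF _ x y] algebra_simps)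
    also have "\<dots> = 0"
    proof -
      have "(\<Sum>\<tau>\<in>S. c \<tau> * \<tau> (x * y)) = - (c \<rho> * \<rho> (x * y))" "(\<Sum>\<tau>\<in>S. c \<tau> * \<tau> x) = - (c \<rho> * \<rho> x)"
        using z[OF xy] z[OF x] by (simp_all add: eq_neg_iff_add_eq_0 add.commute)
      then show ?thesis using insert.prems(2)[of \<rho> x y] x y by simp
    qed
    finally show "(\<Sum>\<tau>\<in>S. c \<tau> * (\<tau> y - \<rho> y) * \<tau> x) = 0" .
  qed (use insert.prems in auto)
  have cS: "c \<tau> = 0" if "\<tau> \<in> S" for \<tau>
  proof -
    have "\<tau> \<noteq> \<rho>" using insert.hyps that by auto
    have "\<exists>y\<in>L. \<tau> y \<noteq> \<rho> y"
    proof (rule ccontr)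
      assume "\<not> (\<exists>y\<in>L. \<tau> y \<noteq> \<rho> y)"
      then have "\<tau> = \<rho>"
        by (intro extensionalityI[of \<tau> L \<rho>] insert.prems(1)) (use that in auto)
      then show False using \<open>\<tau> \<noteq> \<rho>\<close> by simp
    qed
    then show ?thesis using S0 that by auto
  qed
  then have "c \<rho> * \<rho> 1 = 0" using z[of 1] is_subfieldD(2)[OF L] by simp
  then show ?case using cS insert.prems(3)[of \<rho>] by simp
qed simp

section \<open>Trace form and dual basis of a number field\<close>

locale rational_basis =
  fixes L :: "'a::{alg_closed_field, field_char_0} set" and n :: nat and e :: "nat \<Rightarrow> 'a"
  assumes alg: "algebraic_over (\<rat> :: 'a set)" and L: "is_subfield L"
    and basis_mem: "\<And>i. i < n \<Longrightarrow> e i \<in> L"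
    and basis_span: "\<And>x. x \<in> L \<Longrightarrow> \<exists>c. x = (\<Sum>i<n. of_rat (c i) * e i)"
    and basis_indep: "\<And>c. (\<Sum>i<n. of_rat (c i) * e i) = 0 \<Longrightarrow> \<forall>i<n. c i = 0"
begin

abbreviation "J \<equiv> embeddings L"
abbreviation "tr \<equiv> rat_trace L"

lemma emb:
  assumes "\<tau> \<in> J"
  shows "\<tau> \<in> extensional L" "x \<in> L \<Longrightarrow> y \<in> L \<Longrightarrow> \<tau> (x + y) = \<tau> x + \<tau> y" "x \<in> L \<Longrightarrow> y \<in> L \<Longrightarrow> \<tau> (x * y) = \<tau> x * \<tau> y"
    "\<tau> (of_rat q) = of_rat q" "\<tau> 1 = 1" "\<tau> 0 = 0" "x \<in> L \<Longrightarrow> \<tau> x = 0 \<longleftrightarrow> x = 0" "x \<in> L \<Longrightarrow> \<tau> (inverse x) = inverse (\<tau> x)"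
    "(\<And>i. i \<in> I \<Longrightarrow> f i \<in> L) \<Longrightarrow> \<tau> (\<Sum>i\<in>I. f i) = (\<Sum>i\<in>I. \<tau> (f i))" "x \<in> L \<Longrightarrow> \<tau> (x ^ k) = \<tau> x ^ k"
    "x \<in> L \<Longrightarrow> y \<in> L \<Longrightarrow> \<tau> (x - y) = \<tau> x - \<tau> y"
proof -
  obtain \<sigma> where \<sigma>: "\<sigma> \<in> field_aut \<rat>" and \<tau>: "\<tau> = restrict \<sigma> L" using assms unfolding embeddings_def by auto
  note D = field_autD[OF \<sigma> is_subfield_Rats] and LD = is_subfieldD[OF L]
  have r: "\<tau> x = \<sigma> x" if "x \<in> L" for x using that unfolding \<tau> by simp
  have minus: "\<sigma> (x - y) = \<sigma> x - \<sigma> y" for x y using D(1)[of x "- y"] D(6)[of y] by simp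
  show "\<tau> \<in> extensional L" unfolding \<tau> by simp
  show "x \<in> L \<Longrightarrow> y \<in> L \<Longrightarrow> \<tau> (x + y) = \<tau> x + \<tau> y" "x \<in> L \<Longrightarrow> y \<in> L \<Longrightarrow> \<tau> (x * y) = \<tau> x * \<tau> y"
    "\<tau> (of_rat q) = of_rat q" "\<tau> 1 = 1" "\<tau> 0 = 0" "x \<in> L \<Longrightarrow> \<tau> x = 0 \<longleftrightarrow> x = 0" "x \<in> L \<Longrightarrow> \<tau> (inverse x) = inverse (\<tau> x)"
    "x \<in> L \<Longrightarrow> \<tau> (x ^ k) = \<tau> x ^ k" "x \<in> L \<Longrightarrow> y \<in> L \<Longrightarrow> \<tau> (x - y) = \<tau> x - \<tau> y"
    by (simp_all add: r LD(1-4,6,7) D(1-4,7,9,10) D(11)[OF Rats_of_rat] minus is_subfield_of_rat[OF L] is_subfield_power[OF L])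
  assume f: "\<And>i. i \<in> I \<Longrightarrow> f i \<in> L"
  then have "(\<Sum>i\<in>I. f i) \<in> L" by (rule is_subfield_sum[OF L])
  then show "\<tau> (\<Sum>i\<in>I. f i) = (\<Sum>i\<in>I. \<tau> (f i))" using f by (simp add: r D(8))
qed

lemma emb_determined:
  assumes "\<tau> \<in> J" "\<tau>' \<in> J" "\<And>i. i < n \<Longrightarrow> \<tau> (e i) = \<tau>' (e i)"
  shows "\<tau> = \<tau>'"
proof (rule extensionalityI[of _ L])
  show "\<tau> \<in> extensional L" "\<tau>' \<in> extensional L" using emb assms by blast+
  fix x assume "x \<in> L"
  then obtain c where x: "x = (\<Sum>i<n. of_rat (c i) * e i)" using basis_span by blast
  have m: "of_rat (c i) * e i \<in> L" if "i < n" for i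
    using is_subfieldD(4)[OF L is_subfield_of_rat[OF L]] basis_mem[OF that] by blast
  have "\<rho> x = (\<Sum>i<n. of_rat (c i) * \<rho> (e i))" if "\<rho> \<in> J" for \<rho>
  proof -
    have "\<rho> x = (\<Sum>i<n. \<rho> (of_rat (c i) * e i))" unfolding x by (rule emb(9)[OF that]) (use m in auto)
    then show ?thesis using emb(3,4)[OF that] basis_mem is_subfield_of_rat[OF L] by simp
  qed
  from this[OF assms(1)] this[OF assms(2)] show "\<tau> x = \<tau>' x" using assms(3) by simp
qed

text \<open>An embedding is determined by the images of the basis elements, and each image is a root
  of a fixed rational polynomial.\<close>

lemma finite_embeddings: "finite J"
proof -
  have "\<forall>i. \<exists>p. p \<noteq> 0 \<and> (\<forall>k. coeff p k \<in> \<rat>) \<and> poly p (e i) = 0"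
    using alg unfolding algebraic_over_def by blast
  from choice[OF this] obtain p where p: "\<forall>i. p i \<noteq> 0 \<and> (\<forall>k. coeff (p i) k \<in> \<rat>) \<and> poly (p i) (e i) = 0" ..
  define \<Phi> where "\<Phi> \<tau> = restrict (\<lambda>i. \<tau> (e i)) {..<n}" for \<tau> :: "'a \<Rightarrow> 'a"
  have "inj_on \<Phi> J"
  proof (rule inj_onI)
    fix \<tau> \<tau>' assume a: "\<tau> \<in> J" "\<tau>' \<in> J" "\<Phi> \<tau> = \<Phi> \<tau>'"
    show "\<tau> = \<tau>'"
    proof (rule emb_determined[OF a(1,2)])
      fix i assume "i < n"
      then show "\<tau> (e i) = \<tau>' (e i)" using fun_cong[OF a(3), of i] unfolding \<Phi>_def by simp
    qed
  qed
  moreover have "\<Phi> ` J \<subseteq> (\<Pi>\<^sub>E i\<in>{..<n}. {z. poly (p i) z = 0})"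
  proof (rule image_subsetI)
    fix \<tau> assume "\<tau> \<in> J"
    then obtain \<sigma> where \<sigma>: "\<sigma> \<in> field_aut \<rat>" and \<tau>: "\<tau> = restrict \<sigma> L" unfolding embeddings_def by auto
    note D = field_autD[OF \<sigma> is_subfield_Rats]
    have "poly (p i) (\<sigma> (e i)) = \<sigma> (poly (p i) (e i))" for i
      unfolding poly_altdef using p by (simp add: D)
    then have "poly (p i) (\<sigma> (e i)) = 0" for i using p D(3) by simp
    then show "\<Phi> \<tau> \<in> (\<Pi>\<^sub>E i\<in>{..<n}. {z. poly (p i) z = 0})"
      unfolding \<Phi>_def \<tau> using basis_mem by auto
  qed
  moreover have "finite (\<Pi>\<^sub>E i\<in>{..<n}. {z. poly (p i) z = 0})"
    using p by (intro finite_PiE poly_roots_finite) auto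
  ultimately show ?thesis using finite_subset finite_imageD by metis
qed

lemma aut_permutes_embeddings:
  assumes "\<sigma> \<in> field_aut \<rat>"
  shows "bij_betw (\<lambda>\<tau>. restrict (\<sigma> \<circ> \<tau>) L) J J"
proof (rule bij_betw_byWitness[where f' = "\<lambda>\<tau>. restrict (inv_into UNIV \<sigma> \<circ> \<tau>) L"])
  have s: "\<sigma> (inv_into UNIV \<sigma> x) = x" "inv_into UNIV \<sigma> (\<sigma> x) = x" for x
    using assms unfolding field_aut_def by (simp_all add: bij_is_inj bij_is_surj surj_f_inv_f)
  show "\<forall>\<tau>\<in>J. restrict (inv_into UNIV \<sigma> \<circ> restrict (\<sigma> \<circ> \<tau>) L) L = \<tau>" "\<forall>\<tau>\<in>J. restrict (\<sigma> \<circ> restrict (inv_into UNIV \<sigma> \<circ> \<tau>) L) L = \<tau>"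
    by (auto intro!: extensionalityI[of _ L] simp: s emb(1))
  have "restrict (\<rho> \<circ> \<tau>) L \<in> J" if \<rho>: "\<rho> \<in> field_aut \<rat>" and \<tau>: "\<tau> \<in> J" for \<rho> \<tau>
  proof -
    obtain \<upsilon> where "\<upsilon> \<in> field_aut \<rat>" "\<tau> = restrict \<upsilon> L" using \<tau> unfolding embeddings_def by auto
    then have "restrict (\<rho> \<circ> \<tau>) L = restrict (\<rho> \<circ> \<upsilon>) L" "\<rho> \<circ> \<upsilon> \<in> field_aut \<rat>"
      using field_aut_compose[OF \<rho>] by (auto simp: fun_eq_iff restrict_def)
    then show ?thesis unfolding embeddings_def by auto
  qed
  then show "(\<lambda>\<tau>. restrict (\<sigma> \<circ> \<tau>) L) ` J \<subseteq> J" "(\<lambda>\<tau>. restrict (inv_into UNIV \<sigma> \<circ> \<tau>) L) ` J \<subseteq> J"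
    using assms field_aut_inv[OF assms] by auto
qed

lemma invariant_rational:
  fixes y :: 'a
  assumes f: "\<And>\<sigma>. \<sigma> \<in> field_aut \<rat> \<Longrightarrow> \<sigma> y = y"
  shows "\<exists>q. y = of_rat q"
proof -
  have "y \<in> \<rat>" by (rule fixed_field[OF is_subfield_Rats alg]) (rule f)
  then show ?thesis by (auto elim: Rats_cases)
qed

lemma of_rat_trace:
  assumes x: "x \<in> L" shows "of_rat (tr x) = (\<Sum>\<tau>\<in>J. \<tau> x)"
proof -
  have "\<sigma> (\<Sum>\<tau>\<in>J. \<tau> x) = (\<Sum>\<tau>\<in>J. \<tau> x)" if \<sigma>: "\<sigma> \<in> field_aut \<rat>" for \<sigma>
  proof -
    have "\<sigma> (\<Sum>\<tau>\<in>J. \<tau> x) = (\<Sum>\<tau>\<in>J. restrict (\<sigma> \<circ> \<tau>) L x)"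
      using x by (simp add: field_autD(8)[OF \<sigma> is_subfield_Rats])
    also have "\<dots> = (\<Sum>\<tau>\<in>J. \<tau> x)"
      by (rule sum.reindex_bij_betw[OF aut_permutes_embeddings[OF \<sigma>]])
    finally show ?thesis .
  qed
  then obtain q where "of_rat q = (\<Sum>\<tau>\<in>J. \<tau> x)" using invariant_rational[of "\<Sum>\<tau>\<in>J. \<tau> x"] by metis
  then show ?thesis unfolding rat_trace_def by (rule someI)
qed

lemma norm_rational:
  assumes x: "x \<in> L" shows "\<exists>q. of_rat q = (\<Prod>\<tau>\<in>J. \<tau> x)"
proof -
  have "\<sigma> (\<Prod>\<tau>\<in>J. \<tau> x) = (\<Prod>\<tau>\<in>J. \<tau> x)" if \<sigma>: "\<sigma> \<in> field_aut \<rat>" for \<sigma>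
  proof -
    have "\<sigma> (\<Prod>\<tau>\<in>J. \<tau> x) = (\<Prod>\<tau>\<in>J. restrict (\<sigma> \<circ> \<tau>) L x)"
      using x by (simp add: field_autD(12)[OF \<sigma> is_subfield_Rats])
    also have "\<dots> = (\<Prod>\<tau>\<in>J. \<tau> x)"
      by (rule prod.reindex_bij_betw[OF aut_permutes_embeddings[OF \<sigma>]])
    finally show ?thesis .
  qed
  then show ?thesis using invariant_rational[of "\<Prod>\<tau>\<in>J. \<tau> x"] by metis
qed

lemma trace_add: "x \<in> L \<Longrightarrow> y \<in> L \<Longrightarrow> tr (x + y) = tr x + tr y"
proof -
  assume xy: "x \<in> L" "y \<in> L"
  then have "of_rat (tr (x + y)) = (of_rat (tr x + tr y) :: 'a)"
    using is_subfieldD(3)[OF L xy] by (simp add: of_rat_trace of_rat_add emb(2) sum.distrib)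
  then show ?thesis by (simp only: of_rat_eq_iff)
qed

lemma trace_scale: "x \<in> L \<Longrightarrow> tr (of_rat c * x) = c * tr x"
proof -
  assume x: "x \<in> L"
  then have "of_rat (tr (of_rat c * x)) = (of_rat (c * tr x) :: 'a)"
    using is_subfieldD(4)[OF L is_subfield_of_rat[OF L] x] is_subfield_of_rat[OF L]
    by (simp add: of_rat_trace of_rat_mult emb(3,4) sum_distrib_left)
  then show ?thesis by (simp only: of_rat_eq_iff)
qed

lemma trace_0: "tr 0 = 0"
  using trace_scale[of 0 0] is_subfieldD(1)[OF L] by simp

lemma trace_sum: "(\<And>i. i \<in> I \<Longrightarrow> f i \<in> L) \<Longrightarrow> tr (\<Sum>i\<in>I. f i) = (\<Sum>i\<in>I. tr (f i))"
proof (induction I rule: infinite_finite_induct)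
  case (insert i I)
  then show ?case using trace_add[of "f i" "\<Sum>i\<in>I. f i"] is_subfield_sum[OF L, of I f] by simp
qed (simp_all add: trace_0)

text \<open>The inverse of \<open>x\<close> serves as \<open>y\<close>: the trace of 1 is the number
  of embeddings, a nonzero number in characteristic 0.\<close>

lemma trace_nondegenerate:
  assumes x: "x \<in> L" "x \<noteq> 0" obtains y where "y \<in> L" "tr (x * y) \<noteq> 0"
proof (rule that)
  show "inverse x \<in> L" using x is_subfieldD(6)[OF L] by blast
  have "of_rat (tr (x * inverse x)) = (of_nat (card J) :: 'a)"
    using x is_subfieldD(2)[OF L] by (simp add: of_rat_trace emb(5))
  moreover have "J \<noteq> {}" unfolding embeddings_def field_aut_def
    using bij_id by (auto simp: id_def)
  ultimately show "tr (x * inverse x) \<noteq> 0" using finite_embeddings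
    by (metis card_0_eq of_nat_eq_0_iff of_rat_0)
qed

text \<open>The Gram matrix of the trace form is invertible, since a kernel vector would be an
  element orthogonal to a basis. The columns of the inverse matrix are the coordinates of the dual
  basis.\<close>

lemma dual_basis_exists:
  "\<exists>e'. (\<forall>i<n. e' i \<in> L) \<and> (\<forall>i<n. \<forall>j<n. tr (e i * e' j) = (if i = j then 1 else 0))"
proof -
  define A where "A = mat n n (\<lambda>(i, j). tr (e i * e j))"
  have A: "A \<in> carrier_mat n n" unfolding A_def by simp
  have ee: "e i * e j \<in> L" if "i < n" "j < n" for i j using is_subfieldD(4)[OF L] basis_mem that by blast
  have mem: "(\<Sum>j<n. of_rat (c j) * e j) \<in> L" for c
    by (intro is_subfield_sum[OF L] is_subfieldD(4)[OF L] is_subfield_of_rat[OF L] basis_mem) auto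
  have tr_sum: "tr (e i * (\<Sum>j<n. of_rat (c j) * e j)) = (\<Sum>j<n. c j * tr (e i * e j))" if "i < n" for i c
  proof -
    have "e i * (\<Sum>j<n. of_rat (c j) * e j) = (\<Sum>j<n. of_rat (c j) * (e i * e j))"
      unfolding sum_distrib_left by (simp add: algebra_simps)
    also have "tr \<dots> = (\<Sum>j<n. tr (of_rat (c j) * (e i * e j)))"
      by (rule trace_sum) (use is_subfieldD(4)[OF L is_subfield_of_rat[OF L]] ee that in auto)
    also have "\<dots> = (\<Sum>j<n. c j * tr (e i * e j))"
      by (intro sum.cong refl trace_scale ee) (use that in auto)
    finally show ?thesis .
  qed
  have "det A \<noteq> 0"
  proof
    assume "det A = 0"
    then obtain v where v: "v \<in> carrier_vec n" "v \<noteq> 0\<^sub>v n" "A *\<^sub>v v = 0\<^sub>v n"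
      using det_0_iff_vec_prod_zero_field[OF A] by blast
    define y where "y = (\<Sum>j<n. of_rat (v $ j) * e j)"
    have yL: "y \<in> L" unfolding y_def by (rule mem)
    have ty: "tr (e i * y) = 0" if "i < n" for i
    proof -
      have "0 = (A *\<^sub>v v) $ i" using v that by simp
      also have "\<dots> = (\<Sum>j<n. v $ j * tr (e i * e j))"
        using carrier_vecD[OF v(1)] that unfolding A_def by (simp add: scalar_prod_def atLeast0LessThan mult.commute)
      finally show ?thesis using tr_sum[OF that, of "\<lambda>j. v $ j"] unfolding y_def by simp
    qed
    have "y = 0"
    proof (rule ccontr)
      assume "y \<noteq> 0"
      then obtain z where z: "z \<in> L" "tr (y * z) \<noteq> 0" using trace_nondegenerate yL by blast
      obtain c where c: "z = (\<Sum>i<n. of_rat (c i) * e i)" using basis_span[OF z(1)] by blast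
      have "y * z = (\<Sum>i<n. of_rat (c i) * (e i * y))" unfolding c sum_distrib_left by (simp add: algebra_simps)
      also have "tr \<dots> = (\<Sum>i<n. tr (of_rat (c i) * (e i * y)))"
        by (rule trace_sum) (use is_subfieldD(4)[OF L] is_subfield_of_rat[OF L] basis_mem yL in auto)
      also have "\<dots> = 0" using ty trace_scale is_subfieldD(4)[OF L] basis_mem yL by (intro sum.neutral) auto
      finally show False using z by simp
    qed
    then have "\<forall>j<n. v $ j = 0" using basis_indep[of "\<lambda>j. v $ j"] unfolding y_def by simp
    then show False using v by (auto intro: eq_vecI)
  qed
  then have "A \<in> Units (ring_mat TYPE(rat) n ())" by (rule det_non_zero_imp_unit[OF A])
  then obtain B where B: "B \<in> carrier_mat n n" "A * B = 1\<^sub>m n"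
    unfolding Units_def ring_mat_def by auto
  define e' where "e' j = (\<Sum>k<n. of_rat (B $$ (k, j)) * e k)" for j
  have "tr (e i * e' j) = (if i = j then 1 else 0)" if ij: "i < n" "j < n" for i j
  proof -
    have "tr (e i * e' j) = (\<Sum>k<n. B $$ (k, j) * tr (e i * e k))" unfolding e'_def by (rule tr_sum[OF ij(1)])
    also have "\<dots> = (A * B) $$ (i, j)"
      using B(1) ij unfolding A_def by (simp add: scalar_prod_def atLeast0LessThan mult.commute)
    also have "\<dots> = (if i = j then 1 else 0)" unfolding B(2) using ij by simp
    finally show ?thesis .
  qed
  moreover have "e' j \<in> L" for j unfolding e'_def by (rule mem)
  ultimately show ?thesis by (intro exI[of _ e']) simp
qed

definition "dual = (SOME e'. (\<forall>i<n. e' i \<in> L) \<and> (\<forall>i<n. \<forall>j<n. tr (e i * e' j) = (if i = j then 1 else 0)))"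

lemma dual: "i < n \<Longrightarrow> dual i \<in> L" "i < n \<Longrightarrow> j < n \<Longrightarrow> tr (e i * dual j) = (if i = j then 1 else 0)"
  using someI_ex[OF dual_basis_exists] unfolding dual_def[symmetric] by auto

lemma trace_expansion:
  assumes x: "x \<in> L" shows "x = (\<Sum>i<n. of_rat (tr (x * dual i)) * e i)"
proof -
  obtain c where c: "x = (\<Sum>i<n. of_rat (c i) * e i)" using basis_span[OF x] by blast
  have "tr (x * dual i) = c i" if i: "i < n" for i
  proof -
    have "x * dual i = (\<Sum>j<n. of_rat (c j) * (e j * dual i))" unfolding c sum_distrib_right by (simp add: algebra_simps)
    also have "tr \<dots> = (\<Sum>j<n. tr (of_rat (c j) * (e j * dual i)))"
      by (rule trace_sum) (use is_subfieldD(4)[OF L] is_subfield_of_rat[OF L] basis_mem dual i in auto)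
    also have "\<dots> = (\<Sum>j<n. if j = i then c j else 0)"
      using trace_scale is_subfieldD(4)[OF L] basis_mem dual i by (intro sum.cong refl) auto
    also have "\<dots> = c i" using i by simp
    finally show ?thesis .
  qed
  then show ?thesis using c by simp
qed

text \<open>Applying \<open>\<sigma>\<close> to the trace expansion of \<open>x\<close> expresses
  \<open>\<sigma> x\<close> as a combination of all \<open>\<tau> x\<close>, whose coefficients are
  the sums in question and do not depend on \<open>x\<close>. Dedekind independence then compares
  coefficients.\<close>

lemma dual_orthogonal:
  assumes \<sigma>: "\<sigma> \<in> J" and \<tau>: "\<tau> \<in> J"
  shows "(\<Sum>i<n. \<sigma> (e i) * \<tau> (dual i)) = (if \<sigma> = \<tau> then 1 else 0)"
proof -
  define c where "c \<tau> = (\<Sum>i<n. \<sigma> (e i) * \<tau> (dual i)) - (if \<sigma> = \<tau> then 1 else 0)" for \<tau>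
  have "\<forall>\<tau>\<in>J. c \<tau> = 0"
  proof (rule dedekind_independence[OF finite_embeddings L])
    fix x assume x: "x \<in> L"
    have xd: "x * dual i \<in> L" if "i < n" for i using x dual that is_subfieldD(4)[OF L] by blast
    have "\<sigma> x = \<sigma> (\<Sum>i<n. of_rat (tr (x * dual i)) * e i)" using trace_expansion[OF x] by simp
    also have "\<dots> = (\<Sum>i<n. \<sigma> (of_rat (tr (x * dual i)) * e i))"
      by (rule emb(9)[OF \<sigma>]) (use is_subfieldD(4)[OF L is_subfield_of_rat[OF L]] basis_mem in auto)
    also have "\<dots> = (\<Sum>i<n. (\<Sum>\<tau>\<in>J. \<tau> x * \<tau> (dual i)) * \<sigma> (e i))"
    proof (intro sum.cong refl)
      fix i assume "i \<in> {..<n}"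
      then have i: "i < n" by simp
      have "\<sigma> (of_rat (tr (x * dual i)) * e i) = of_rat (tr (x * dual i)) * \<sigma> (e i)"
        using emb(3,4)[OF \<sigma>] is_subfield_of_rat[OF L] basis_mem[OF i] by simp
      then show "\<sigma> (of_rat (tr (x * dual i)) * e i) = (\<Sum>\<tau>\<in>J. \<tau> x * \<tau> (dual i)) * \<sigma> (e i)"
        using of_rat_trace[OF xd[OF i]] x dual(1)[OF i] by (simp add: emb(3))
    qed
    also have "\<dots> = (\<Sum>\<tau>\<in>J. (\<Sum>i<n. \<sigma> (e i) * \<tau> (dual i)) * \<tau> x)"
      unfolding sum_distrib_right by (subst sum.swap) (simp add: algebra_simps)
    finally have 1: "(\<Sum>\<tau>\<in>J. (\<Sum>i<n. \<sigma> (e i) * \<tau> (dual i)) * \<tau> x) = \<sigma> x" by simp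
    have 2: "(\<Sum>\<tau>\<in>J. (if \<sigma> = \<tau> then 1 else 0) * \<tau> x) = \<sigma> x"
    proof -
      have "(\<Sum>\<tau>\<in>J. (if \<sigma> = \<tau> then 1 else 0) * \<tau> x) = (\<Sum>\<tau>\<in>J. if \<sigma> = \<tau> then \<tau> x else 0)"
        by (intro sum.cong) auto
      then show ?thesis using \<sigma> finite_embeddings by simp
    qed
    show "(\<Sum>\<tau>\<in>J. c \<tau> * \<tau> x) = 0" unfolding c_def left_diff_distrib sum_subtractf 1 2 by simp
  qed (use emb in auto)
  then show ?thesis using \<tau> unfolding c_def by simp
qed

text \<open>Counts a set of embeddings by a partial trace. For all of \<open>J\<close> it gives the
  degree \<open>n\<close>; for the embeddings that induce a place it will give the local
  degree.\<close>

lemma sum_dual_over: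
  assumes "S \<subseteq> J" shows "(\<Sum>i<n. \<Sum>\<tau>\<in>S. \<tau> (e i * dual i)) = of_nat (card S)"
proof -
  have "(\<Sum>i<n. \<Sum>\<tau>\<in>S. \<tau> (e i * dual i)) = (\<Sum>i<n. \<Sum>\<tau>\<in>S. \<tau> (e i) * \<tau> (dual i))"
    using assms by (intro sum.cong refl emb(3) basis_mem dual) auto
  also have "\<dots> = (\<Sum>\<tau>\<in>S. \<Sum>i<n. \<tau> (e i) * \<tau> (dual i))" by (rule sum.swap)
  also have "\<dots> = (\<Sum>\<tau>\<in>S. 1)" using assms by (intro sum.cong refl) (auto simp: dual_orthogonal subset_iff)
  finally show ?thesis by simp
qed

lemma card_embeddings: "card J = n"
proof -
  have "of_nat (card J) = (\<Sum>i<n. \<Sum>\<tau>\<in>J. \<tau> (e i * dual i))" using sum_dual_over[of J] by simp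
  also have "\<dots> = (\<Sum>i<n. of_rat (tr (e i * dual i)))"
    by (intro sum.cong refl of_rat_trace[symmetric] is_subfieldD(4)[OF L] basis_mem dual) auto
  also have "\<dots> = (of_nat n :: 'a)" using dual(2) by simp
  finally show ?thesis by (simp only: of_nat_eq_iff)
qed

end

section \<open>Weak approximation\<close>

lemma null_sequence_bound:
  fixes f g :: "nat \<Rightarrow> real"
  assumes "\<And>m. \<bar>f m\<bar> \<le> g m" "g \<longlonglongrightarrow> 0"
  shows "f \<longlonglongrightarrow> 0"
proof -
  have "(\<lambda>m. \<bar>f m\<bar>) \<longlonglongrightarrow> 0"
    by (rule tendsto_sandwich[OF _ _ tendsto_const assms(2)]) (use assms(1) in auto)
  then show ?thesis by (simp add: tendsto_rabs_zero_iff)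
qed

section \<open>Absolute values on a subfield\<close>

locale valued_subfield =
  fixes L :: "'a::field_char_0 set" and v :: "'a \<Rightarrow> real"
  assumes L: "is_subfield L" and v: "absolute_value_on L v"
begin

lemma v_nonneg: "x \<in> L \<Longrightarrow> 0 \<le> v x" and v_eq_0: "x \<in> L \<Longrightarrow> v x = 0 \<longleftrightarrow> x = 0"
  and v_mult: "x \<in> L \<Longrightarrow> y \<in> L \<Longrightarrow> v (x * y) = v x * v y"
  and v_add: "x \<in> L \<Longrightarrow> y \<in> L \<Longrightarrow> v (x + y) \<le> v x + v y"
  using v unfolding absolute_value_on_def by auto

lemma v_0: "v 0 = 0" using v_eq_0 is_subfieldD(1)[OF L] by simp

lemma v_1: "v 1 = 1"
proof -
  have 1: "1 \<in> L" by (rule is_subfieldD(2)[OF L])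
  have "v 1 * v 1 = v 1" using v_mult[OF 1 1] by simp
  then show ?thesis using v_eq_0[OF 1] by simp
qed

lemma v_power: "x \<in> L \<Longrightarrow> v (x ^ k) = v x ^ k"
  by (induction k) (simp_all add: v_1 v_mult is_subfield_power[OF L])

lemma v_minus_1: "v (- 1) = 1"
proof -
  have 1: "- 1 \<in> L" using is_subfieldD(2,5)[OF L] by blast
  have "v (- 1) * v (- 1) = 1" using v_mult[OF 1 1] v_1 by simp
  then show ?thesis using v_nonneg[OF 1] by (simp add: square_eq_1_iff)
qed

lemma v_uminus: "x \<in> L \<Longrightarrow> v (- x) = v x"
  using v_mult[of "- 1" x] v_minus_1 is_subfieldD(2,5)[OF L] by simp

lemma v_diff: "x \<in> L \<Longrightarrow> y \<in> L \<Longrightarrow> v (x - y) \<le> v x + v y"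
  using v_add[of x "- y"] v_uminus[of y] is_subfieldD(5)[OF L] by simp

lemma v_diff_commute: "x \<in> L \<Longrightarrow> y \<in> L \<Longrightarrow> v (x - y) = v (y - x)"
  using v_uminus[of "x - y"] is_subfieldD(7)[OF L, of x y] by simp

lemma v_inverse: "x \<in> L \<Longrightarrow> v (inverse x) = inverse (v x)"
proof (cases "x = 0")
  case False
  assume x: "x \<in> L"
  then have "v x * v (inverse x) = 1"
    using v_mult[of x "inverse x"] is_subfieldD(6)[OF L x] False v_1 by simp
  then show ?thesis by (rule inverse_unique[symmetric])
qed (simp add: v_0)

lemma v_divide: "x \<in> L \<Longrightarrow> y \<in> L \<Longrightarrow> v (x / y) = v x / v y"
  unfolding divide_inverse by (simp add: v_mult v_inverse is_subfieldD(6)[OF L])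

lemma v_pos: "x \<in> L \<Longrightarrow> x \<noteq> 0 \<Longrightarrow> 0 < v x"
  using v_nonneg[of x] v_eq_0[of x] by simp

lemma v_triangle_rev: assumes "x \<in> L" "y \<in> L" shows "\<bar>v x - v y\<bar> \<le> v (x - y)"
proof -
  have d: "x - y \<in> L" "y - x \<in> L" using assms is_subfieldD(7)[OF L] by auto
  have "v x \<le> v (x - y) + v y" "v y \<le> v (y - x) + v x"
    using v_add[OF d(1) assms(2)] v_add[OF d(2) assms(1)] by simp_all
  then show ?thesis using v_diff_commute[OF assms] by simp
qed

lemma v_sum_le: "(\<And>i. i \<in> I \<Longrightarrow> f i \<in> L) \<Longrightarrow> v (\<Sum>i\<in>I. f i) \<le> (\<Sum>i\<in>I. v (f i))"
proof (induction I rule: infinite_finite_induct)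
  case (insert x F)
  then have "v (\<Sum>i\<in>insert x F. f i) \<le> v (f x) + v (\<Sum>i\<in>F. f i)"
    using v_add[of "f x" "\<Sum>i\<in>F. f i"] is_subfield_sum[OF L, of F f] by simp
  then show ?case using insert by (simp add: insert.hyps)
qed (simp_all add: v_0)

lemma one_plus_power:
  assumes z: "z \<in> L" and ne: "v z \<noteq> 1" and m: "m > 0" shows "1 + z ^ m \<noteq> 0"
proof
  assume "1 + z ^ m = 0"
  then have "z ^ m = - 1" by (simp add: eq_neg_iff_add_eq_0 add.commute)
  then have "v z ^ m = 1" using v_power[OF z, of m] v_minus_1 by simp
  then show False using ne power_eq_iff_eq_base[OF m v_nonneg[OF z], of 1] by simp
qed

text \<open>The classical separating sequence \<open>z ^ m / (1 + z ^ m)\<close>: it tends to 1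
  where \<open>z\<close> has value above 1, because its distance from 1 is the value of
  \<open>inverse (1 + z ^ m)\<close>, and to 0 where \<open>z\<close> has value below 1, which is
  \<open>approx_0\<close>.\<close>

lemma approx_1:
  assumes z: "z \<in> L" and gt: "v z > 1"
  shows "(\<lambda>m. v (z ^ m / (1 + z ^ m) - 1)) \<longlonglongrightarrow> 0"
proof (rule tendsto_sandwich[OF _ _ tendsto_const])
  have zm: "z ^ m \<in> L" for m using is_subfield_power[OF L z] .
  have one: "1 \<in> L" by (rule is_subfieldD(2)[OF L])
  show "\<forall>\<^sub>F m in sequentially. 0 \<le> v (z ^ m / (1 + z ^ m) - 1)"
    by (intro always_eventually allI v_nonneg is_subfieldD[OF L] zm)
  have top: "filterlim (\<lambda>m. v z ^ m - 1) at_top sequentially"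
    using gt by real_asymp
  then show "(\<lambda>m. inverse (v z ^ m - 1)) \<longlonglongrightarrow> 0" by (rule tendsto_inverse_0_at_top)
  show "\<forall>\<^sub>F m in sequentially. v (z ^ m / (1 + z ^ m) - 1) \<le> inverse (v z ^ m - 1)"
    using eventually_gt_at_top[of 0]
  proof eventually_elim
    case (elim m)
    have nz: "1 + z ^ m \<noteq> 0" using one_plus_power[OF z _ elim] gt by simp
    have mem: "1 + z ^ m \<in> L" using is_subfieldD(3)[OF L one zm] .
    have "z ^ m / (1 + z ^ m) - 1 = - inverse (1 + z ^ m)" using nz by (simp add: field_simps)
    then have eq: "v (z ^ m / (1 + z ^ m) - 1) = inverse (v (1 + z ^ m))"
      using v_uminus[OF is_subfieldD(6)[OF L mem]] v_inverse[OF mem] by simp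
    have "v z ^ m - 1 \<le> v (1 + z ^ m)"
      using v_diff[OF mem one] v_power[OF z, of m] v_1 by simp
    moreover have "v z ^ m > 1" using gt elim by simp
    ultimately show ?case unfolding eq by (intro le_imp_inverse_le) auto
  qed
qed

lemma approx_0:
  assumes z: "z \<in> L" and lt: "v z < 1"
  shows "(\<lambda>m. v (z ^ m / (1 + z ^ m))) \<longlonglongrightarrow> 0"
proof (rule tendsto_sandwich[OF _ _ tendsto_const])
  have zm: "z ^ m \<in> L" for m using is_subfield_power[OF L z] .
  have one: "1 \<in> L" by (rule is_subfieldD(2)[OF L])
  show "\<forall>\<^sub>F m in sequentially. 0 \<le> v (z ^ m / (1 + z ^ m))"
    by (intro always_eventually allI v_nonneg is_subfieldD[OF L] zm)
  have "(\<lambda>m. v z ^ m) \<longlonglongrightarrow> 0" by (rule LIMSEQ_realpow_zero[OF v_nonneg[OF z] lt])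
  from tendsto_divide[OF this tendsto_diff[OF tendsto_const[of 1] this]]
  show "(\<lambda>m. v z ^ m / (1 - v z ^ m)) \<longlonglongrightarrow> 0" by simp
  show "\<forall>\<^sub>F m in sequentially. v (z ^ m / (1 + z ^ m)) \<le> v z ^ m / (1 - v z ^ m)"
    using eventually_gt_at_top[of 0]
  proof eventually_elim
    case (elim m)
    have mem: "1 + z ^ m \<in> L" using is_subfieldD(3)[OF L one zm] .
    have "v 1 \<le> v (1 + z ^ m) + v (z ^ m)" using v_diff[OF mem zm[of m]] by simp
    then have "1 - v z ^ m \<le> v (1 + z ^ m)" using v_power[OF z, of m] v_1 by simp
    moreover have "v z ^ m < 1" using lt elim v_nonneg[OF z] by (simp add: power_less_one_iff)
    ultimately show ?case unfolding v_divide[OF zm mem] v_power[OF z]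
      using v_nonneg[OF z] by (intro divide_left_mono mult_pos_pos) auto
  qed
qed

end

section \<open>Separation of the extensions of one absolute value\<close>

definition nontrivial_abs :: "(rat \<Rightarrow> real) \<Rightarrow> bool" where
  "nontrivial_abs u \<longleftrightarrow> absolute_value_on UNIV u \<and> (\<exists>q. u q > 1)"

definition extends_abs :: "(rat \<Rightarrow> real) \<Rightarrow> 'a::field_char_0 set \<Rightarrow> ('a \<Rightarrow> real) \<Rightarrow> bool" where
  "extends_abs u L v \<longleftrightarrow> absolute_value_on L v \<and> (\<forall>q. v (of_rat q) = u q)"

text \<open>Distinct extensions are separated because the values \<open>u q\<close>, up to roots, are dense in the positive reals.\<close>

lemma separate_two_aux:
  assumes L: "is_subfield L" and u: "nontrivial_abs u" and v: "extends_abs u L v" and v': "extends_abs u L v'"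
    and x: "x \<in> L" "x \<noteq> 0" "v' x < v x"
  shows "\<exists>y\<in>L. v y > 1 \<and> v' y < 1"
proof -
  interpret V: valued_subfield L v using L v unfolding extends_abs_def by unfold_locales auto
  interpret V': valued_subfield L v' using L v' unfolding extends_abs_def by unfold_locales auto
  obtain t where t: "u t > 1" using u unfolding nontrivial_abs_def by auto
  have uu: "absolute_value_on UNIV u" using u unfolding nontrivial_abs_def by auto
  have t0: "t \<noteq> 0" using t absolute_valueD(11)[OF uu] by auto
  define c where "c = ln (u t)"
  have c: "c > 0" using t unfolding c_def by simp
  define A where "A = ln (v' x)" define B where "B = ln (v x)"
  have pos: "v x > 0" "v' x > 0" using V.v_pos V'.v_pos x by auto
  have AB: "A < B" using pos x(3) unfolding A_def B_def by simp
  obtain j :: nat where j: "real j * (B - A) > c" using reals_Archimedean3[of "B - A"] AB by auto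
  \<comment> \<open>The interval from \<open>j * A\<close> to \<open>j * B\<close> is longer than
    \<open>c\<close>, so it contains a multiple \<open>k * c\<close>, the logarithm of
    \<open>u (t powi k)\<close>. Taking the floor plus one makes the lower inequality strict.
    Dividing \<open>x ^ j\<close> by this rational moves 1 between the two values.\<close>
  define k where "k = \<lfloor>real j * A / c\<rfloor> + 1"
  have k1: "real j * A < real_of_int k * c" 
    using c unfolding k_def by (simp add: pos_divide_less_eq[symmetric])
  have "real_of_int k \<le> real j * A / c + 1" unfolding k_def by simp
  then have "real_of_int k * c \<le> real j * A + c" using c by (simp add: field_simps)
  then have k2: "real_of_int k * c < real j * B" using j by (simp add: algebra_simps)
  define q where "q = t powi k"
  have uq: "u q = exp (real_of_int k * c)"
  proof (cases k rule: int_cases2)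
    case (nonneg n)
    then show ?thesis unfolding q_def c_def using t by (simp add: absolute_valueD(6)[OF uu] exp_of_nat_mult)
  next
    case (nonpos n)
    then show ?thesis unfolding q_def c_def using t
      by (simp add: absolute_valueD(6,8)[OF uu] exp_of_nat_mult exp_minus power_int_minus)
  qed
  have q: "u q > 0" unfolding uq by simp
  have vx: "v x ^ j = exp (real j * B)" "v' x ^ j = exp (real j * A)"
    using pos by (simp_all add: A_def B_def exp_of_nat_mult)
  have qL: "of_rat q \<in> L" by (rule is_subfield_of_rat[OF L])
  show ?thesis
  proof (intro bexI conjI)
    show "x ^ j / of_rat q \<in> L" using is_subfieldD(8)[OF L is_subfield_power[OF L x(1)] qL] .
    show "v (x ^ j / of_rat q) > 1"
      using V.v_divide[OF is_subfield_power[OF L x(1)] qL, of j] V.v_power[OF x(1), of j] v q k2 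
      unfolding extends_abs_def vx by (simp add: uq less_divide_eq)
    show "v' (x ^ j / of_rat q) < 1"
      using V'.v_divide[OF is_subfield_power[OF L x(1)] qL, of j] V'.v_power[OF x(1), of j] v' q k1
      unfolding extends_abs_def vx by (simp add: uq divide_less_eq)
  qed
qed

lemma separate_two:
  assumes L: "is_subfield L" and u: "nontrivial_abs u" and v: "extends_abs u L v" and v': "extends_abs u L v'"
    and x: "x \<in> L" "v' x \<noteq> v x"
  shows "\<exists>y\<in>L. v y > 1 \<and> v' y < 1"
proof -
  interpret V: valued_subfield L v using L v unfolding extends_abs_def by unfold_locales auto
  interpret V': valued_subfield L v' using L v' unfolding extends_abs_def by unfold_locales auto
  have x0: "x \<noteq> 0" using x V.v_0 V'.v_0 by auto
  show ?thesis
  proof (cases "v' x < v x")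
    case True
    then show ?thesis using separate_two_aux[OF L u v v'] x x0 by blast
  next
    case False
    then have lt: "v x < v' x" using x by simp
    have i: "inverse x \<in> L" using is_subfieldD(6)[OF L x(1)] .
    have "v' (inverse x) < v (inverse x)"
      unfolding V.v_inverse[OF x(1)] V'.v_inverse[OF x(1)] using lt V.v_pos[OF x(1) x0] by (rule less_imp_inverse_less)
    then show ?thesis using separate_two_aux[OF L u v v' i] x0 by simp
  qed
qed

text \<open>Artin-Whaples induction, with \<open>z\<close> separating \<open>v\<close> from
  \<open>V\<close> and \<open>y\<close> separating \<open>v\<close> from \<open>v1\<close>. If
  \<open>v1 z \<le> 1\<close>, then \<open>z ^ m * y\<close> works for large \<open>m\<close>.
  Otherwise \<open>z ^ m / (1 + z ^ m) * y\<close> does, being close to \<open>y\<close> at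
  \<open>v\<close> and \<open>v1\<close> and close to 0 on \<open>V\<close>.\<close>

lemma separate_many:
  assumes L: "is_subfield L" and u: "nontrivial_abs u" and v: "extends_abs u L v"
    and fin: "finite V" and V: "\<And>v'. v' \<in> V \<Longrightarrow> extends_abs u L v'"
    and ne: "\<And>v'. v' \<in> V \<Longrightarrow> \<exists>x\<in>L. v' x \<noteq> v x"
  shows "\<exists>z\<in>L. v z > 1 \<and> (\<forall>v'\<in>V. v' z < 1)"
  using fin V ne
proof (induction V rule: finite_induct)
  case empty
  obtain t where "u t > 1" using u unfolding nontrivial_abs_def by auto
  then show ?case using v is_subfield_of_rat[OF L, of t] unfolding extends_abs_def by (intro bexI[of _ "of_rat t"]) auto
next
  case (insert v1 V)
  interpret V: valued_subfield L v using L v unfolding extends_abs_def by unfold_locales auto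
  have int: "valued_subfield L v'" if "v' \<in> insert v1 V" for v'
    using L insert.prems(1)[OF that] unfolding extends_abs_def by unfold_locales auto
  interpret V1: valued_subfield L v1 by (rule int) simp
  obtain z where z: "z \<in> L" "v z > 1" "\<And>v'. v' \<in> V \<Longrightarrow> v' z < 1" using insert.IH insert.prems by auto
  obtain x where x: "x \<in> L" "v1 x \<noteq> v x" using insert.prems(2)[of v1] by auto
  obtain y where y: "y \<in> L" "v y > 1" "v1 y < 1"
    using separate_two[OF L u v insert.prems(1)[OF insertI1] x] by auto
  have zm: "z ^ m \<in> L" for m using is_subfield_power[OF L z(1)] .
  have one: "1 \<in> L" by (rule is_subfieldD(2)[OF L])
  show ?case
  proof (cases "v1 z \<le> 1")
    case True
    have "\<forall>\<^sub>F m in sequentially. \<forall>v'\<in>V. v' (z ^ m * y) < 1"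
    proof (intro eventually_ball_finite insert.hyps ballI)
      fix v' assume v': "v' \<in> V"
      interpret W: valued_subfield L v' by (rule int) (use v' in simp)
      have "(\<lambda>m. v' z ^ m * v' y) \<longlonglongrightarrow> 0" 
        by (intro tendsto_mult_left_zero LIMSEQ_realpow_zero W.v_nonneg z v')
      then have "\<forall>\<^sub>F m in sequentially. v' z ^ m * v' y < 1" by (rule order_tendstoD) simp
      then show "\<forall>\<^sub>F m in sequentially. v' (z ^ m * y) < 1"
        by (simp add: W.v_mult[OF zm y(1)] W.v_power[OF z(1)])
    qed
    then obtain m where m: "\<forall>v'\<in>V. v' (z ^ m * y) < 1" by (auto simp: eventually_sequentially)
    have "v1 z ^ m * v1 y \<le> 1 * v1 y"
      using True V1.v_nonneg[OF z(1)] V1.v_nonneg[OF y(1)] by (intro mult_right_mono power_le_one)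
    then have "v1 (z ^ m * y) < 1" using y by (simp add: V1.v_mult[OF zm y(1)] V1.v_power[OF z(1)])
    moreover have "1 * v y \<le> v z ^ m * v y" using z y by (intro mult_right_mono one_le_power) auto
    from less_le_trans[OF y(2) this[unfolded mult_1]]
    have "v (z ^ m * y) > 1" by (simp only: V.v_mult[OF zm y(1)] V.v_power[OF z(1)])
    ultimately show ?thesis using m is_subfieldD(4)[OF L zm y(1)] by (intro bexI[of _ "z ^ m * y"]) auto
  next
    case False
    define r where "r m = z ^ m / (1 + z ^ m)" for m
    have r: "r m \<in> L" for m unfolding r_def using is_subfieldD(3,8)[OF L] zm one by simp
    have lim1: "(\<lambda>m. v'' (r m)) \<longlonglongrightarrow> 1" if "valued_subfield L v''" "v'' z > 1" for v''
    proof -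
      interpret W: valued_subfield L v'' by fact
      have "(\<lambda>m. v'' (r m) - 1) \<longlonglongrightarrow> 0"
      proof (rule null_sequence_bound)
        show "\<bar>v'' (r m) - 1\<bar> \<le> v'' (r m - 1)" for m
          using W.v_triangle_rev[OF r one] W.v_1 by simp
        show "(\<lambda>m. v'' (r m - 1)) \<longlonglongrightarrow> 0" unfolding r_def by (rule W.approx_1[OF z(1) that(2)])
      qed
      then show ?thesis by (simp add: LIM_zero_iff)
    qed
    have "\<forall>\<^sub>F m in sequentially. \<forall>v'\<in>V. v' (r m * y) < 1"
    proof (intro eventually_ball_finite insert.hyps ballI)
      fix v' assume v': "v' \<in> V"
      interpret W: valued_subfield L v' by (rule int) (use v' in simp)
      have "(\<lambda>m. v' (r m) * v' y) \<longlonglongrightarrow> 0" 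
        unfolding r_def by (intro tendsto_mult_left_zero W.approx_0 z v')
      then have "\<forall>\<^sub>F m in sequentially. v' (r m) * v' y < 1" by (rule order_tendstoD) simp
      then show "\<forall>\<^sub>F m in sequentially. v' (r m * y) < 1" by (simp add: W.v_mult[OF r y(1)])
    qed
    moreover have "\<forall>\<^sub>F m in sequentially. v1 (r m * y) < 1"
    proof -
      have "(\<lambda>m. v1 (r m) * v1 y) \<longlonglongrightarrow> 1 * v1 y" using False
        by (intro tendsto_intros lim1 V1.valued_subfield_axioms) auto
      then have "\<forall>\<^sub>F m in sequentially. v1 (r m) * v1 y < 1" by (rule order_tendstoD) (use y in simp)
      then show ?thesis by (simp add: V1.v_mult[OF r y(1)])
    qed
    moreover have "\<forall>\<^sub>F m in sequentially. v (r m * y) > 1"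
    proof -
      have "(\<lambda>m. v (r m) * v y) \<longlonglongrightarrow> 1 * v y"
        by (intro tendsto_intros lim1 V.valued_subfield_axioms z)
      then have "\<forall>\<^sub>F m in sequentially. v (r m) * v y > 1" by (rule order_tendstoD) (use y in simp)
      then show ?thesis by (simp add: V.v_mult[OF r y(1)])
    qed
    ultimately have "\<forall>\<^sub>F m in sequentially. v (r m * y) > 1 \<and> (\<forall>v'\<in>insert v1 V. v' (r m * y) < 1)"
      by eventually_elim auto
    then obtain m where "v (r m * y) > 1 \<and> (\<forall>v'\<in>insert v1 V. v' (r m * y) < 1)" by (auto simp: eventually_sequentially)
    then show ?thesis using is_subfieldD(4)[OF L r y(1)] by (intro bexI[of _ "r m * y"]) auto
  qed
qed

lemma weak_approximation:
  assumes L: "is_subfield L" and u: "nontrivial_abs u" and v: "extends_abs u L v"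
    and fin: "finite V" and V: "\<And>v'. v' \<in> V \<Longrightarrow> extends_abs u L v'"
    and ne: "\<And>v'. v' \<in> V \<Longrightarrow> \<exists>x\<in>L. v' x \<noteq> v x"
  obtains r where "\<And>m. r m \<in> L" "(\<lambda>m. v (r m - 1)) \<longlonglongrightarrow> 0" "\<And>v'. v' \<in> V \<Longrightarrow> (\<lambda>m. v' (r m)) \<longlonglongrightarrow> 0"
proof -
  interpret V: valued_subfield L v using L v unfolding extends_abs_def by unfold_locales auto
  obtain z where z: "z \<in> L" "v z > 1" "\<And>v'. v' \<in> V \<Longrightarrow> v' z < 1" using separate_many[OF assms] by auto
  show thesis
  proof (rule that[of "\<lambda>m. z ^ m / (1 + z ^ m)"])
    show "z ^ m / (1 + z ^ m) \<in> L" for m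
      using is_subfieldD(2,3,8)[OF L] is_subfield_power[OF L z(1)] by simp
    show "(\<lambda>m. v (z ^ m / (1 + z ^ m) - 1)) \<longlonglongrightarrow> 0" by (rule V.approx_1[OF z(1,2)])
    fix v' assume v': "v' \<in> V"
    interpret W: valued_subfield L v' using L V[OF v'] unfolding extends_abs_def by unfold_locales auto
    show "(\<lambda>m. v' (z ^ m / (1 + z ^ m))) \<longlonglongrightarrow> 0" by (rule W.approx_0[OF z(1) z(3)[OF v']])
  qed
qed

section \<open>Local degrees\<close>

definition cauchy_on :: "'a::field set \<Rightarrow> ('a \<Rightarrow> real) \<Rightarrow> (nat \<Rightarrow> 'a) \<Rightarrow> bool" where
  "cauchy_on L v s \<longleftrightarrow> range s \<subseteq> L \<and> (\<forall>e>0. \<exists>N. \<forall>m\<ge>N. \<forall>n\<ge>N. v (s m - s n) < e)"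

definition null_on :: "('a \<Rightarrow> real) \<Rightarrow> (nat \<Rightarrow> 'a) \<Rightarrow> bool" where
  "null_on v s \<longleftrightarrow> (\<lambda>r. v (s r)) \<longlonglongrightarrow> 0"

context valued_subfield
begin

lemma null_add:
  assumes "\<And>r. s r \<in> L" "\<And>r. t r \<in> L" "null_on v s" "null_on v t"
  shows "null_on v (\<lambda>r. s r + t r)"
  unfolding null_on_def
proof (rule null_sequence_bound)
  show "\<bar>v (s r + t r)\<bar> \<le> v (s r) + v (t r)" for r
    using v_add[of "s r" "t r"] v_nonneg[of "s r + t r"] assms is_subfieldD(3)[OF L] by simp
  show "(\<lambda>r. v (s r) + v (t r)) \<longlonglongrightarrow> 0"
    using tendsto_add[of _ 0 _ _ 0] assms(3,4) unfolding null_on_def by fastforce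
qed

lemma null_uminus: "(\<And>r. s r \<in> L) \<Longrightarrow> null_on v s \<Longrightarrow> null_on v (\<lambda>r. - s r)"
  unfolding null_on_def by (simp add: v_uminus)

lemma null_diff:
  assumes "\<And>r. s r \<in> L" "\<And>r. t r \<in> L" "null_on v s" "null_on v t"
  shows "null_on v (\<lambda>r. s r - t r)"
  using null_add[of s "\<lambda>r. - t r"] null_uminus[of t] assms is_subfieldD(5)[OF L] by simp

lemma null_zero: "null_on v (\<lambda>r. 0)" unfolding null_on_def by (simp add: v_0)

lemma null_sum:
  assumes "\<And>i r. i \<in> I \<Longrightarrow> s i r \<in> L" "\<And>i. i \<in> I \<Longrightarrow> null_on v (s i)"
  shows "null_on v (\<lambda>r. \<Sum>i\<in>I. s i r)"
  using assms
proof (induction I rule: infinite_finite_induct)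
  case (insert i I)
  have "null_on v (\<lambda>r. s i r + (\<Sum>i\<in>I. s i r))"
    by (rule null_add) (use insert in \<open>auto intro: is_subfield_sum[OF L]\<close>)
  then show ?case using insert.hyps by simp
qed (simp_all add: null_zero)

lemma null_mult:
  assumes "\<And>r. s r \<in> L" "\<And>r. t r \<in> L" "null_on v s" "\<And>r. v (t r) \<le> B"
  shows "null_on v (\<lambda>r. s r * t r)"
  unfolding null_on_def
proof (rule null_sequence_bound)
  show "\<bar>v (s r * t r)\<bar> \<le> v (s r) * B" for r
    using v_mult[of "s r" "t r"] v_nonneg[of "t r"] v_nonneg[of "s r"] assms(1,2,4) by (simp add: mult_left_mono)
  show "(\<lambda>r. v (s r) * B) \<longlonglongrightarrow> 0" using assms(3) unfolding null_on_def by (rule tendsto_mult_left_zero)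
qed

lemma cauchy_mem: "cauchy_on L v s \<Longrightarrow> s r \<in> L" unfolding cauchy_on_def by auto

lemma cauchy_const: "x \<in> L \<Longrightarrow> cauchy_on L v (\<lambda>r. x)" unfolding cauchy_on_def by (auto simp: v_0)

lemma cauchy_convergent:
  assumes "cauchy_on L v s" obtains l where "(\<lambda>r. v (s r)) \<longlonglongrightarrow> l"
proof -
  have "Cauchy (\<lambda>r. v (s r))"
  proof (rule metric_CauchyI)
    fix e :: real assume "0 < e"
    then obtain N where N: "\<forall>m\<ge>N. \<forall>n\<ge>N. v (s m - s n) < e" using assms unfolding cauchy_on_def by blast
    have "dist (v (s m)) (v (s n)) < e" if "m \<ge> N" "n \<ge> N" for m n
    proof -
      have "dist (v (s m)) (v (s n)) \<le> v (s m - s n)"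
        unfolding dist_real_def by (rule v_triangle_rev) (use assms cauchy_mem in auto)
      also have "\<dots> < e" using N that by simp
      finally show ?thesis .
    qed
    then show "\<exists>M. \<forall>m\<ge>M. \<forall>n\<ge>M. dist (v (s m)) (v (s n)) < e" by blast
  qed
  then have "convergent (\<lambda>r. v (s r))" by (rule Cauchy_convergent)
  then show thesis using that unfolding convergent_def by blast
qed

lemma cauchy_bounded:
  assumes "cauchy_on L v s" obtains B where "\<And>r. v (s r) \<le> B" "B > 0"
proof -
  obtain l where "(\<lambda>r. v (s r)) \<longlonglongrightarrow> l" using cauchy_convergent[OF assms] .
  then have "Bseq (\<lambda>r. v (s r))" by (intro convergent_imp_Bseq convergentI)
  then obtain K where "K > 0" "\<And>r. norm (v (s r)) \<le> K" by (auto elim: BseqE)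
  then show thesis using that[of K] by (metis abs_le_D1 real_norm_def)
qed

lemma null_mult_cauchy:
  assumes "\<And>r. s r \<in> L" "null_on v s" "cauchy_on L v t"
  shows "null_on v (\<lambda>r. s r * t r)" "null_on v (\<lambda>r. t r * s r)"
proof -
  obtain B where "\<And>r. v (t r) \<le> B" using cauchy_bounded[OF assms(3)] by metis
  then show "null_on v (\<lambda>r. s r * t r)" by (intro null_mult[of s t B] assms cauchy_mem[OF assms(3)])
  then show "null_on v (\<lambda>r. t r * s r)" by (simp add: mult.commute)
qed

lemma cauchy_add:
  assumes s: "cauchy_on L v s" and t: "cauchy_on L v t" shows "cauchy_on L v (\<lambda>r. s r + t r)"
  unfolding cauchy_on_def
proof (intro conjI allI impI)
  show "range (\<lambda>r. s r + t r) \<subseteq> L" using cauchy_mem[OF s] cauchy_mem[OF t] is_subfieldD(3)[OF L] by auto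
  fix e :: real assume "0 < e"
  then have e2: "0 < e / 2" by simp
  obtain N where N: "\<forall>m\<ge>N. \<forall>n\<ge>N. v (s m - s n) < e / 2" using s e2 unfolding cauchy_on_def by blast
  obtain M where M: "\<forall>m\<ge>M. \<forall>n\<ge>M. v (t m - t n) < e / 2" using t e2 unfolding cauchy_on_def by blast
  have "v (s m + t m - (s n + t n)) < e" if "m \<ge> max N M" "n \<ge> max N M" for m n
  proof -
    have "v ((s m - s n) + (t m - t n)) \<le> v (s m - s n) + v (t m - t n)"
      by (intro v_add is_subfieldD(7)[OF L] cauchy_mem[OF s] cauchy_mem[OF t])
    also have "\<dots> < e / 2 + e / 2" using N M that by (intro add_strict_mono) auto
    finally show ?thesis by (simp add: algebra_simps)
  qed
  then show "\<exists>N. \<forall>m\<ge>N. \<forall>n\<ge>N. v (s m + t m - (s n + t n)) < e" by blast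
qed

lemma cauchy_mult:
  assumes s: "cauchy_on L v s" and t: "cauchy_on L v t" shows "cauchy_on L v (\<lambda>r. s r * t r)"
  unfolding cauchy_on_def
proof (intro conjI allI impI)
  note sm = cauchy_mem[OF s] and tm = cauchy_mem[OF t]
  show "range (\<lambda>r. s r * t r) \<subseteq> L" using sm tm is_subfieldD(4)[OF L] by auto
  obtain A where A: "\<And>r. v (s r) \<le> A" "A > 0" by (rule cauchy_bounded[OF s]) (rule that)
  obtain B where B: "\<And>r. v (t r) \<le> B" "B > 0" by (rule cauchy_bounded[OF t]) (rule that)
  fix e :: real assume "0 < e"
  then have e: "0 < e / (2 * B)" "0 < e / (2 * A)" using A B by simp_all
  obtain N where N: "\<forall>m\<ge>N. \<forall>n\<ge>N. v (s m - s n) < e / (2 * B)" using s e unfolding cauchy_on_def by blast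
  obtain M where M: "\<forall>m\<ge>M. \<forall>n\<ge>M. v (t m - t n) < e / (2 * A)" using t e unfolding cauchy_on_def by blast
  have "v (s m * t m - s n * t n) < e" if mn: "m \<ge> max N M" "n \<ge> max N M" for m n
  proof -
    have ds: "s m - s n \<in> L" and dt: "t m - t n \<in> L" using sm tm is_subfieldD(7)[OF L] by auto
    have "v (s m * t m - s n * t n) = v ((s m - s n) * t m + s n * (t m - t n))" by (simp add: algebra_simps)
    also have "\<dots> \<le> v (s m - s n) * v (t m) + v (s n) * v (t m - t n)"
      using v_add[OF is_subfieldD(4)[OF L ds tm[of m]] is_subfieldD(4)[OF L sm[of n] dt]] v_mult[OF ds tm[of m]] v_mult[OF sm[of n] dt] by simp
    also have "\<dots> \<le> v (s m - s n) * B + A * v (t m - t n)"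
      using A B v_nonneg[OF ds] v_nonneg[OF dt] by (intro add_mono mult_left_mono mult_right_mono) auto
    also have "\<dots> < e / (2 * B) * B + A * (e / (2 * A))"
      using N M mn A B by (intro add_strict_mono mult_strict_right_mono mult_strict_left_mono) auto
    also have "\<dots> = e" using A(2) B(2) by simp
    finally show ?thesis .
  qed
  then show "\<exists>N. \<forall>m\<ge>N. \<forall>n\<ge>N. v (s m * t m - s n * t n) < e" by blast
qed

lemma cauchy_uminus: "cauchy_on L v s \<Longrightarrow> cauchy_on L v (\<lambda>r. - s r)"
  using cauchy_mult[OF cauchy_const[of "- 1"]] is_subfieldD(2,5)[OF L] by simp

lemma cauchy_diff: "cauchy_on L v s \<Longrightarrow> cauchy_on L v t \<Longrightarrow> cauchy_on L v (\<lambda>r. s r - t r)"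
  using cauchy_add[of s "\<lambda>r. - t r"] cauchy_uminus[of t] by simp

lemma cauchy_sum: "(\<And>i. i \<in> I \<Longrightarrow> cauchy_on L v (s i)) \<Longrightarrow> cauchy_on L v (\<lambda>r. \<Sum>i\<in>I. s i r)"
  by (induction I rule: infinite_finite_induct) (simp_all add: cauchy_const is_subfieldD(1)[OF L] cauchy_add)

lemma cauchy_prod: "(\<And>i. i \<in> I \<Longrightarrow> cauchy_on L v (s i)) \<Longrightarrow> cauchy_on L v (\<lambda>r. \<Prod>i\<in>I. s i r)"
  by (induction I rule: infinite_finite_induct) (simp_all add: cauchy_const is_subfieldD(2)[OF L] cauchy_mult)

lemma null_cauchy:
  assumes mem: "\<And>r. s r \<in> L" and n: "null_on v s" shows "cauchy_on L v s"
  unfolding cauchy_on_def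
proof (intro conjI allI impI)
  show "range s \<subseteq> L" using mem by auto
  fix e :: real assume "0 < e"
  then have "0 < e / 2" by simp
  with n have "\<forall>\<^sub>F r in sequentially. v (s r) < e / 2" unfolding null_on_def by (rule order_tendstoD)
  then obtain N where N: "\<forall>r\<ge>N. v (s r) < e / 2" by (auto simp: eventually_sequentially)
  have "v (s m - s n) < e" if "m \<ge> N" "n \<ge> N" for m n
  proof -
    have "v (s m) < e / 2" "v (s n) < e / 2" using N that by auto
    then show ?thesis using v_diff[OF mem[of m] mem[of n]] by simp
  qed
  then show "\<exists>N. \<forall>m\<ge>N. \<forall>n\<ge>N. v (s m - s n) < e" by blast
qed

lemma null_limit_eq:
  assumes "\<And>r. s r \<in> L" "\<And>r. t r \<in> L" "null_on v (\<lambda>r. s r - t r)" "(\<lambda>r. v (t r)) \<longlonglongrightarrow> l"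
  shows "(\<lambda>r. v (s r)) \<longlonglongrightarrow> l"
proof -
  have "(\<lambda>r. v (s r) - v (t r)) \<longlonglongrightarrow> 0"
    by (rule null_sequence_bound[OF v_triangle_rev]) (use assms in \<open>auto simp: null_on_def\<close>)
  from tendsto_add[OF this assms(4)] show ?thesis by simp
qed

text \<open>Exchange the factors one at a time; the remaining products are Cauchy, hence bounded,
  and preserve null sequences.\<close>

lemma null_prod_diff:
  assumes "finite I" "\<And>i. i \<in> I \<Longrightarrow> cauchy_on L v (s i)" "\<And>i. i \<in> I \<Longrightarrow> cauchy_on L v (t i)"
    "\<And>i. i \<in> I \<Longrightarrow> null_on v (\<lambda>r. s i r - t i r)"
  shows "null_on v (\<lambda>r. (\<Prod>i\<in>I. s i r) - (\<Prod>i\<in>I. t i r))"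
  using assms
proof (induction I rule: finite_induct)
  case (insert i I)
  have P: "cauchy_on L v (\<lambda>r. \<Prod>i\<in>I. s i r)" "cauchy_on L v (\<lambda>r. \<Prod>i\<in>I. t i r)"
    using insert.prems by (auto intro!: cauchy_prod)
  have st: "cauchy_on L v (s i)" "cauchy_on L v (t i)" using insert.prems by auto
  have IH: "null_on v (\<lambda>r. (\<Prod>i\<in>I. s i r) - (\<Prod>i\<in>I. t i r))" using insert by auto
  have d: "(\<Prod>i\<in>I. s i r) - (\<Prod>i\<in>I. t i r) \<in> L" "s i r - t i r \<in> L" for r
    using cauchy_mem[OF cauchy_diff[OF P]] cauchy_mem[OF cauchy_diff[OF st]] by auto
  have N: "null_on v (\<lambda>r. (s i r - t i r) * (\<Prod>i\<in>I. s i r))" "null_on v (\<lambda>r. t i r * ((\<Prod>i\<in>I. s i r) - (\<Prod>i\<in>I. t i r)))"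
    using null_mult_cauchy(1)[OF d(2) _ P(1)] null_mult_cauchy(2)[OF d(1) IH st(2)] insert.prems(3) by auto
  have "null_on v (\<lambda>r. (s i r - t i r) * (\<Prod>i\<in>I. s i r) + t i r * ((\<Prod>i\<in>I. s i r) - (\<Prod>i\<in>I. t i r)))"
    by (rule null_add[OF _ _ N]) (use d cauchy_mem[OF P(1)] cauchy_mem[OF st(2)] is_subfieldD(4)[OF L] in auto)
  then show ?case using insert.hyps by (simp add: algebra_simps)
qed (simp add: null_zero)

end

text \<open>The rational counterpart of \<open>leibniz_det\<close>, to be applied termwise to
  sequences of rational approximations of matrix entries.\<close>

definition leibniz :: "nat \<Rightarrow> (nat \<Rightarrow> nat \<Rightarrow> rat) \<Rightarrow> rat" where
  "leibniz m A = (\<Sum>p\<in>{p. p permutes {..<m}}. of_int (sign p) * (\<Prod>i<m. A i (p i)))"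

lemma leibniz_eq_det: "leibniz m A = det (mat m m (\<lambda>(i, j). A i j))"
proof -
  have "det (mat m m (\<lambda>(i, j). A i j)) = (\<Sum>p\<in>{p. p permutes {0..<m}}. signof p * (\<Prod>i = 0..<m. mat m m (\<lambda>(i, j). A i j) $$ (i, p i)))"
    by (rule det_def') simp
  also have "\<dots> = leibniz m A" unfolding leibniz_def atLeast0LessThan
  proof (rule sum.cong[OF refl])
    fix p assume "p \<in> {p. p permutes {..<m}}"
    then have "p i < m" if "i < m" for i using that permutes_in_image[of p "{..<m}" i] by simp
    then show "signof p * (\<Prod>i<m. mat m m (\<lambda>(i, j). A i j) $$ (i, p i)) = of_int (sign p) * (\<Prod>i<m. A i (p i))"
      by (intro arg_cong2[where f = "(*)"] prod.cong) (auto simp: sign_def)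
  qed
  finally show ?thesis by simp
qed

lemma leibniz_mult: "leibniz m (\<lambda>i j. \<Sum>k<m. A i k * B k j) = leibniz m A * leibniz m B"
proof -
  have "mat m m (\<lambda>(i, j). \<Sum>k<m. A i k * B k j) = mat m m (\<lambda>(i, j). A i j) * mat m m (\<lambda>(i, j). B i j)"
    by (rule eq_matI) (auto simp: scalar_prod_def atLeast0LessThan)
  then show ?thesis unfolding leibniz_eq_det by (simp add: det_mult[of _ m])
qed

lemma leibniz_one: "leibniz m (\<lambda>i j. if i = j then 1 else 0) = 1"
proof -
  have "mat m m (\<lambda>(i, j). if i = j then 1 else 0) = (1\<^sub>m m :: rat mat)" by (rule eq_matI) auto
  then show ?thesis unfolding leibniz_eq_det by simp
qed

section \<open>Coordinates in the completion at a place\<close>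

locale local_field = rational_basis L n e
  for L :: "'a::{alg_closed_field, field_char_0} set" and n e +
  fixes u :: "rat \<Rightarrow> real" and w :: "'a \<Rightarrow> real" and v :: "'a \<Rightarrow> real"
  assumes u: "nontrivial_abs u" and w: "extends_abs u UNIV w" and v: "extends_abs u L v"
begin

text \<open>The embeddings through which \<open>w\<close> induces \<open>v\<close>; their number
  turns out to be the local degree.\<close>

definition "T = {\<tau> \<in> J. \<forall>x\<in>L. w (\<tau> x) = v x}"

sublocale W: valued_subfield UNIV w
  using w unfolding extends_abs_def by unfold_locales (auto simp: is_subfield_def)

sublocale V: valued_subfield L v
  using v L unfolding extends_abs_def by unfold_locales auto

sublocale U: valued_subfield UNIV u
  using u unfolding nontrivial_abs_def by unfold_locales (auto simp: is_subfield_def)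

lemma w_rat: "w (of_rat q) = u q" and v_rat: "v (of_rat q) = u q"
  using v w unfolding extends_abs_def by auto

lemma T_sub: "T \<subseteq> J" and finite_T: "finite T" and T_eq: "\<tau> \<in> T \<Longrightarrow> x \<in> L \<Longrightarrow> w (\<tau> x) = v x"
  unfolding T_def using finite_embeddings by auto

lemma extends_emb: assumes "\<tau> \<in> J" shows "extends_abs u L (\<lambda>x. w (\<tau> x))"
  unfolding extends_abs_def absolute_value_on_def
  using emb[OF assms] W.v_nonneg W.v_eq_0 W.v_mult W.v_add w_rat by simp

lemma of_rat_mem: "of_rat q \<in> L" by (rule is_subfield_of_rat[OF L])

lemma cauchy_of_rat_iff: "cauchy_on L v (\<lambda>r. of_rat (c r)) \<longleftrightarrow> cauchy_on UNIV u c"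
  unfolding cauchy_on_def using of_rat_mem by (auto simp: of_rat_diff[symmetric] v_rat)

lemmas cauchy_of_rat = cauchy_of_rat_iff[THEN iffD2]

text \<open>Weak approximation for \<open>v\<close> against the finitely many other absolute values
  that \<open>w\<close> induces through embeddings. In the decomposition of the tensor product of L
  with Q_u, the sequence \<open>z\<close> approximates the idempotent of the factor
  \<open>L_v\<close>.\<close>

lemma approximate_idempotent:
  obtains z where "\<And>r. z r \<in> L" "(\<lambda>r. v (z r - 1)) \<longlonglongrightarrow> 0" "\<And>\<tau>. \<tau> \<in> J - T \<Longrightarrow> (\<lambda>r. w (\<tau> (z r))) \<longlonglongrightarrow> 0"
proof -
  let ?V = "(\<lambda>\<tau> x. w (\<tau> x)) ` (J - T)"
  have ext: "extends_abs u L v'" if "v' \<in> ?V" for v' using that extends_emb by auto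
  have ne: "\<exists>x\<in>L. v' x \<noteq> v x" if "v' \<in> ?V" for v' using that unfolding T_def by auto
  obtain z where z: "\<And>r. z r \<in> L" "(\<lambda>r. v (z r - 1)) \<longlonglongrightarrow> 0" "\<And>v'. v' \<in> ?V \<Longrightarrow> (\<lambda>r. v' (z r)) \<longlonglongrightarrow> 0"
  proof (rule weak_approximation[OF L u v])
    show "finite ?V" using finite_embeddings by simp
    show "extends_abs u L v'" if "v' \<in> ?V" for v' by (rule ext[OF that])
    show "\<exists>x\<in>L. v' x \<noteq> v x" if "v' \<in> ?V" for v' by (rule ne[OF that])
  qed (rule that)
  show thesis
  proof (rule that[OF z(1,2)])
    fix \<tau> assume "\<tau> \<in> J - T"
    then show "(\<lambda>r. w (\<tau> (z r))) \<longlonglongrightarrow> 0" by (intro z(3) imageI)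
  qed
qed

lemma T_tau:
  assumes "\<tau> \<in> T" shows "\<tau> \<in> J" using assms T_sub by auto

text \<open>
  The coordinates of an element of \<open>L\<^sub>v\<close> with respect to the rational basis \<open>e\<close>, which spans \<open>L\<^sub>v\<close>
  over \<open>\<rat>\<^sub>p\<close>, obtained by multiplying with an approximate idempotent for \<open>v\<close>.
\<close>

lemma coordinates:
  assumes s: "cauchy_on L v s"
  obtains l where "\<And>i. i < n \<Longrightarrow> cauchy_on UNIV u (l i)"
    "\<And>i. i < n \<Longrightarrow> null_on w (\<lambda>r. of_rat (l i r) - (\<Sum>\<tau>\<in>T. \<tau> (s r * dual i)))"
    "null_on v (\<lambda>r. s r - (\<Sum>i<n. of_rat (l i r) * e i))"
proof -
  note sm = V.cauchy_mem[OF s]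
  note LD = is_subfieldD[OF L]
  obtain z where z: "\<And>r. z r \<in> L" "(\<lambda>r. v (z r - 1)) \<longlonglongrightarrow> 0" "\<And>\<tau>. \<tau> \<in> J - T \<Longrightarrow> (\<lambda>r. w (\<tau> (z r))) \<longlonglongrightarrow> 0"
    using approximate_idempotent by blast
  obtain B where B: "\<And>r. v (s r) \<le> B" "B > 0" by (rule V.cauchy_bounded[OF s]) (rule that)
  \<comment> \<open>The index \<open>k\<close> must depend on \<open>r\<close>: the sequence
    \<open>s\<close> is Cauchy for \<open>v\<close> alone and may be unbounded under the embeddings
    outside \<open>T\<close>, so the smallness of \<open>z\<close> there has to be chosen relative
    to \<open>s r\<close>.\<close>
  have "\<exists>k. v (z k - 1) < inverse (real (Suc r)) \<and> (\<forall>\<tau>\<in>J - T. w (\<tau> (s r)) * w (\<tau> (z k)) < inverse (real (Suc r)))" for r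
  proof -
    have "\<forall>\<^sub>F k in sequentially. v (z k - 1) < inverse (real (Suc r))"
      by (rule order_tendstoD[OF z(2)]) simp
    moreover have "\<forall>\<^sub>F k in sequentially. \<forall>\<tau>\<in>J - T. w (\<tau> (s r)) * w (\<tau> (z k)) < inverse (real (Suc r))"
    proof (intro eventually_ball_finite ballI)
      show "finite (J - T)" using finite_embeddings by simp
      fix \<tau> assume "\<tau> \<in> J - T"
      then have "(\<lambda>k. w (\<tau> (s r)) * w (\<tau> (z k))) \<longlonglongrightarrow> 0" using z(3) by (intro tendsto_mult_right_zero)
      then show "\<forall>\<^sub>F k in sequentially. w (\<tau> (s r)) * w (\<tau> (z k)) < inverse (real (Suc r))"
        by (rule order_tendstoD) simp
    qed
    ultimately have "\<forall>\<^sub>F k in sequentially. v (z k - 1) < inverse (real (Suc r)) \<and>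
        (\<forall>\<tau>\<in>J - T. w (\<tau> (s r)) * w (\<tau> (z k)) < inverse (real (Suc r)))" by (rule eventually_conj)
    then show ?thesis by (auto simp: eventually_sequentially)
  qed
  then have "\<forall>r. \<exists>k. v (z k - 1) < inverse (real (Suc r)) \<and> (\<forall>\<tau>\<in>J - T. w (\<tau> (s r)) * w (\<tau> (z k)) < inverse (real (Suc r)))" ..
  from choice[OF this] obtain k where k: "\<forall>r. v (z (k r) - 1) < inverse (real (Suc r)) \<and>
      (\<forall>\<tau>\<in>J - T. w (\<tau> (s r)) * w (\<tau> (z (k r))) < inverse (real (Suc r)))" ..
  define y where "y r = z (k r)" for r
  have y: "y r \<in> L" "v (y r - 1) \<le> inverse (real (Suc r))" for r using z(1) k unfolding y_def by (auto intro: less_imp_le)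
  have y_off: "w (\<tau> (s r)) * w (\<tau> (y r)) \<le> inverse (real (Suc r))" if "\<tau> \<in> J" "\<tau> \<notin> T" for \<tau> r
    using k that unfolding y_def by (auto intro: less_imp_le)
  have y1: "null_on v (\<lambda>r. y r - 1)" unfolding null_on_def
    by (rule null_sequence_bound[OF _ LIMSEQ_inverse_real_of_nat]) (use y V.v_nonneg[of "y _ - 1"] LD in auto)
  define l where "l i r = tr (s r * y r * dual i)" for i r
  have mem: "s r * y r \<in> L" "i < n \<Longrightarrow> s r * y r * dual i \<in> L" "i < n \<Longrightarrow> s r * dual i \<in> L" "s r * (y r - 1) \<in> L" for r i
    using sm y LD dual by simp_all
  have near: "null_on w (\<lambda>r. of_rat (l i r) - (\<Sum>\<tau>\<in>T. \<tau> (s r * dual i)))" if i: "i < n" for i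
  proof -
    \<comment> \<open>The global trace splits. Over \<open>T\<close> the factor \<open>y r\<close>
      is close to 1, and outside \<open>T\<close> the product \<open>s r * y r\<close> is small, so
      what remains in the limit is the local trace.\<close>
    have eq: "of_rat (l i r) - (\<Sum>\<tau>\<in>T. \<tau> (s r * dual i)) =
        (\<Sum>\<tau>\<in>T. \<tau> (s r * (y r - 1) * dual i)) + (\<Sum>\<tau>\<in>J - T. \<tau> (s r * y r * dual i))" for r
    proof -
      have "of_rat (l i r) = (\<Sum>\<tau>\<in>J. \<tau> (s r * y r * dual i))" unfolding l_def by (rule of_rat_trace[OF mem(2)[OF i]])
      also have "\<dots> = (\<Sum>\<tau>\<in>J - T. \<tau> (s r * y r * dual i)) + (\<Sum>\<tau>\<in>T. \<tau> (s r * y r * dual i))"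
        by (rule sum.subset_diff[OF T_sub finite_embeddings])
      finally have "of_rat (l i r) - (\<Sum>\<tau>\<in>T. \<tau> (s r * dual i)) =
          (\<Sum>\<tau>\<in>J - T. \<tau> (s r * y r * dual i)) + (\<Sum>\<tau>\<in>T. \<tau> (s r * y r * dual i) - \<tau> (s r * dual i))"
        by (simp add: sum_subtractf)
      also have "(\<Sum>\<tau>\<in>T. \<tau> (s r * y r * dual i) - \<tau> (s r * dual i)) = (\<Sum>\<tau>\<in>T. \<tau> (s r * (y r - 1) * dual i))"
      proof (intro sum.cong refl)
        fix \<tau> assume "\<tau> \<in> T"
        then show "\<tau> (s r * y r * dual i) - \<tau> (s r * dual i) = \<tau> (s r * (y r - 1) * dual i)"
          using emb(11)[OF T_tau mem(2)[OF i] mem(3)[OF i], of \<tau> r r] by (simp add: algebra_simps)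
      qed
      finally show ?thesis by (simp add: add.commute)
    qed
    have n1: "null_on w (\<lambda>r. \<Sum>\<tau>\<in>T. \<tau> (s r * (y r - 1) * dual i))"
    proof (rule W.null_sum)
      fix \<tau> assume t: "\<tau> \<in> T"
      have "null_on v (\<lambda>r. s r * (y r - 1))"
        by (rule V.null_mult_cauchy(2)[OF _ y1 s]) (use y LD in auto)
      then have "null_on v (\<lambda>r. s r * (y r - 1) * dual i)"
        by (rule V.null_mult_cauchy(1)[OF mem(4) _ V.cauchy_const[OF dual(1)[OF i]]])
      then show "null_on w (\<lambda>r. \<tau> (s r * (y r - 1) * dual i))"
        unfolding null_on_def using T_eq[OF t LD(4)[OF mem(4) dual(1)[OF i]]] by simp
    qed simp
    have n2: "null_on w (\<lambda>r. \<Sum>\<tau>\<in>J - T. \<tau> (s r * y r * dual i))"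
    proof (rule W.null_sum)
      fix \<tau> assume t: "\<tau> \<in> J - T"
      show "null_on w (\<lambda>r. \<tau> (s r * y r * dual i))"
        unfolding null_on_def
      proof (rule null_sequence_bound)
        show "(\<lambda>r. inverse (real (Suc r)) * w (\<tau> (dual i))) \<longlonglongrightarrow> 0"
          by (rule tendsto_mult_left_zero[OF LIMSEQ_inverse_real_of_nat])
        fix r
        have "w (\<tau> (s r * y r * dual i)) = w (\<tau> (s r)) * w (\<tau> (y r)) * w (\<tau> (dual i))"
          using t sm y dual i mem by (simp add: emb(3) W.v_mult)
        then show "\<bar>w (\<tau> (s r * y r * dual i))\<bar> \<le> inverse (real (Suc r)) * w (\<tau> (dual i))"
          using y_off[of \<tau> r] t W.v_nonneg by (simp add: mult_right_mono)
      qed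
    qed simp
    show ?thesis unfolding eq by (rule W.null_add[OF _ _ n1 n2]) auto
  qed
  have cau: "cauchy_on UNIV u (l i)" if i: "i < n" for i
  proof -
    have c1: "cauchy_on UNIV w (\<lambda>r. \<Sum>\<tau>\<in>T. \<tau> (s r * dual i))"
    proof (rule W.cauchy_sum)
      fix \<tau> assume t: "\<tau> \<in> T"
      have c: "cauchy_on L v (\<lambda>r. s r * dual i)" by (rule V.cauchy_mult[OF s V.cauchy_const[OF dual(1)[OF i]]])
      have "w (\<tau> (s m * dual i) - \<tau> (s m' * dual i)) = v (s m * dual i - s m' * dual i)" for m m'
        using T_eq[OF t LD(7)[OF mem(3)[OF i] mem(3)[OF i]]] emb(11)[OF T_tau[OF t] mem(3)[OF i] mem(3)[OF i]] by simp
      then show "cauchy_on UNIV w (\<lambda>r. \<tau> (s r * dual i))" using c unfolding cauchy_on_def by simp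
    qed
    have "cauchy_on UNIV w (\<lambda>r. of_rat (l i r) - (\<Sum>\<tau>\<in>T. \<tau> (s r * dual i)) + (\<Sum>\<tau>\<in>T. \<tau> (s r * dual i)))"
      by (rule W.cauchy_add[OF W.null_cauchy[OF _ near[OF i]] c1]) simp
    then have "cauchy_on UNIV w (\<lambda>r. of_rat (l i r))" by simp
    then show ?thesis unfolding cauchy_on_def by (simp add: of_rat_diff[symmetric] w_rat)
  qed
  have "null_on v (\<lambda>r. s r - (\<Sum>i<n. of_rat (l i r) * e i))"
  proof -
    have "null_on v (\<lambda>r. - (y r - 1) * s r)"
      by (rule V.null_mult_cauchy(1)[OF _ V.null_uminus[OF _ y1] s]) (use y LD in auto)
    moreover have "- (y r - 1) * s r = s r - (\<Sum>i<n. of_rat (l i r) * e i)" for r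
    proof -
      have "- (y r - 1) * s r = s r - s r * y r" by (simp add: algebra_simps)
      also have "s r * y r = (\<Sum>i<n. of_rat (l i r) * e i)" unfolding l_def by (rule trace_expansion[OF mem(1)])
      finally show ?thesis .
    qed
    ultimately show ?thesis by simp
  qed
  then show thesis using that[of l] cau near by blast
qed

text \<open>In the limit a coordinate is the local trace of \<open>s r * dual i\<close>, a sum of
  \<open>card T\<close> terms, and every \<open>\<tau>\<close> in \<open>T\<close> carries
  \<open>v\<close> to \<open>w\<close> isometrically.\<close>

lemma coordinate_bound:
  assumes s: "cauchy_on L v s" and i: "i < n" and l: "null_on w (\<lambda>r. of_rat (l r) - (\<Sum>\<tau>\<in>T. \<tau> (s r * dual i)))"
    and sl: "(\<lambda>r. v (s r)) \<longlonglongrightarrow> \<rho>" and ll: "(\<lambda>r. u (l r)) \<longlonglongrightarrow> lam"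
  shows "lam \<le> card T * v (dual i) * \<rho>"
proof (rule LIMSEQ_le[OF ll])
  note sm = V.cauchy_mem[OF s]
  let ?d = "\<lambda>r. of_rat (l r) - (\<Sum>\<tau>\<in>T. \<tau> (s r * dual i))"
  have "(\<lambda>r. w (?d r) + card T * v (dual i) * v (s r)) \<longlonglongrightarrow> 0 + card T * v (dual i) * \<rho>"
    using l sl unfolding null_on_def by (intro tendsto_intros)
  then show "(\<lambda>r. w (?d r) + card T * v (dual i) * v (s r)) \<longlonglongrightarrow> card T * v (dual i) * \<rho>" by simp
  have "u (l r) \<le> w (?d r) + card T * v (dual i) * v (s r)" for r
  proof -
    have "u (l r) = w (?d r + (\<Sum>\<tau>\<in>T. \<tau> (s r * dual i)))" by (simp add: w_rat)
    also have "\<dots> \<le> w (?d r) + w (\<Sum>\<tau>\<in>T. \<tau> (s r * dual i))" by (rule W.v_add) auto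
    also have "w (\<Sum>\<tau>\<in>T. \<tau> (s r * dual i)) \<le> (\<Sum>\<tau>\<in>T. w (\<tau> (s r * dual i)))" by (rule W.v_sum_le) auto
    also have "\<dots> = (\<Sum>\<tau>\<in>T. v (s r) * v (dual i))"
      by (intro sum.cong refl) (use T_eq is_subfieldD(4)[OF L sm dual(1)[OF i]] V.v_mult[OF sm dual(1)[OF i]] in auto)
    finally show ?thesis by (simp add: algebra_simps)
  qed
  then show "\<exists>N. \<forall>r\<ge>N. u (l r) \<le> w (?d r) + card T * v (dual i) * v (s r)" by blast
qed

text \<open>If no embedding induced \<open>v\<close>, the local traces would be empty sums. The
  coordinates of 1 would then be null sequences, and so would 1 itself.\<close>

lemma T_nonempty: "T \<noteq> {}"
proof
  assume T: "T = {}"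
  have one: "1 \<in> L" by (rule is_subfieldD(2)[OF L])
  obtain l where l: "\<And>i. i < n \<Longrightarrow> cauchy_on UNIV u (l i)"
    "\<And>i. i < n \<Longrightarrow> null_on w (\<lambda>r. of_rat (l i r) - (\<Sum>\<tau>\<in>T. \<tau> (1 * dual i)))"
    "null_on v (\<lambda>r. 1 - (\<Sum>i<n. of_rat (l i r) * e i))"
    using coordinates[OF V.cauchy_const[OF one]] by blast
  have mem: "of_rat (l i r) \<in> L" for i r by (rule is_subfield_of_rat[OF L])
  have "null_on v (\<lambda>r. \<Sum>i<n. of_rat (l i r) * e i)"
  proof (rule V.null_sum)
    fix i assume "i \<in> {..<n}"
    then have i: "i < n" by simp
    have "null_on v (\<lambda>r. of_rat (l i r))" using l(2)[OF i] unfolding T null_on_def by (simp add: w_rat v_rat)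
    then show "null_on v (\<lambda>r. of_rat (l i r) * e i)"
      by (rule V.null_mult_cauchy(1)[OF mem _ V.cauchy_const[OF basis_mem[OF i]]])
  qed (use mem basis_mem is_subfieldD(4)[OF L] in auto)
  from V.null_add[OF _ _ l(3) this] have "null_on v (\<lambda>r. 1)"
    using is_subfield_sum[OF L, of "{..<n}" "\<lambda>i. of_rat (l i _) * e i"] mem basis_mem is_subfieldD(4,7)[OF L] one by simp
  then show False unfolding null_on_def V.v_1 by (simp add: LIMSEQ_const_iff)
qed

end

text \<open>A basis of \<open>L_v\<close> over the closure of \<open>\<rat>\<close>, expressed
  through representatives: scalars are Cauchy sequences of rationals, and equality in
  \<open>L_v\<close> is a null difference.\<close>

locale completion_basis = local_field L n e u w v
  for L :: "'a::{alg_closed_field, field_char_0} set" and n e u w v +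
  fixes m :: nat and b :: "nat \<Rightarrow> nat \<Rightarrow> 'a"
  assumes b_cauchy: "\<And>k. k < m \<Longrightarrow> cauchy_on L v (b k)"
    and b_indep: "\<And>c. (\<And>k. k < m \<Longrightarrow> cauchy_on UNIV u (c k)) \<Longrightarrow>
      null_on v (\<lambda>r. \<Sum>k<m. of_rat (c k r) * b k r) \<Longrightarrow> \<forall>k<m. null_on u (c k)"
    and b_span: "\<And>s. cauchy_on L v s \<Longrightarrow> \<exists>c. (\<forall>k<m. cauchy_on UNIV u (c k)) \<and>
      null_on v (\<lambda>r. s r - (\<Sum>k<m. of_rat (c k r) * b k r))"
begin

lemma b_mem: "k < m \<Longrightarrow> b k r \<in> L" using V.cauchy_mem[OF b_cauchy] by blast

lemma comb_mem: "(\<Sum>k<m. of_rat (c k) * b k r) \<in> L"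
  by (intro is_subfield_sum[OF L] is_subfieldD(4)[OF L] of_rat_mem b_mem) auto

lemma comb_unique:
  assumes "\<And>k. k < m \<Longrightarrow> cauchy_on UNIV u (c k)" "\<And>k. k < m \<Longrightarrow> cauchy_on UNIV u (d k)"
    and "null_on v (\<lambda>r. s r - (\<Sum>k<m. of_rat (c k r) * b k r))" "null_on v (\<lambda>r. s r - (\<Sum>k<m. of_rat (d k r) * b k r))"
    and s: "\<And>r. s r \<in> L" and k: "k < m"
  shows "null_on u (\<lambda>r. c k r - d k r)"
proof -
  have "null_on v (\<lambda>r. (s r - (\<Sum>k<m. of_rat (d k r) * b k r)) - (s r - (\<Sum>k<m. of_rat (c k r) * b k r)))"
    by (rule V.null_diff[OF _ _ assms(4,3)]) (use s comb_mem is_subfieldD(7)[OF L] in auto)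
  moreover have "(s r - (\<Sum>k<m. of_rat (d k r) * b k r)) - (s r - (\<Sum>k<m. of_rat (c k r) * b k r)) =
      (\<Sum>k<m. of_rat (c k r - d k r) * b k r)" for r
    by (simp add: of_rat_diff sum_subtractf left_diff_distrib)
  ultimately have "null_on v (\<lambda>r. \<Sum>k<m. of_rat (c k r - d k r) * b k r)" by simp
  from b_indep[OF _ this] show ?thesis using U.cauchy_diff assms(1,2) k by blast
qed

lemma null_comb:
  assumes c: "\<And>i. i \<in> I \<Longrightarrow> cauchy_on UNIV u (c i)" and s: "\<And>i r. i \<in> I \<Longrightarrow> s i r \<in> L"
    and n: "\<And>i. i \<in> I \<Longrightarrow> null_on v (s i)"
  shows "null_on v (\<lambda>r. \<Sum>i\<in>I. of_rat (c i r) * s i r)"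
proof (rule V.null_sum)
  fix i assume i: "i \<in> I"
  show "of_rat (c i r) * s i r \<in> L" for r using s[OF i] of_rat_mem is_subfieldD(4)[OF L] by blast
  show "null_on v (\<lambda>r. of_rat (c i r) * s i r)"
    by (rule V.null_mult_cauchy(2)[OF s[OF i] n[OF i] cauchy_of_rat[OF c[OF i]]])
qed

text \<open>
  \<open>a\<close> is the matrix, with entries in \<open>\<rat>\<^sub>p\<close> given by Cauchy sequences, of multiplication by \<open>x\<close> in the basis
  \<open>b\<close> of the completion \<open>L\<^sub>v\<close>.
\<close>

definition represents :: "'a \<Rightarrow> (nat \<Rightarrow> nat \<Rightarrow> nat \<Rightarrow> rat) \<Rightarrow> bool" where
  "represents x a \<longleftrightarrow> (\<forall>i<m. \<forall>j<m. cauchy_on UNIV u (a i j)) \<and>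
     (\<forall>j<m. null_on v (\<lambda>r. x * b j r - (\<Sum>i<m. of_rat (a i j r) * b i r)))"

lemma represents_exists: assumes x: "x \<in> L" shows "\<exists>a. represents x a"
proof -
  have "\<forall>j. \<exists>c. j < m \<longrightarrow> (\<forall>k<m. cauchy_on UNIV u (c k)) \<and> null_on v (\<lambda>r. x * b j r - (\<Sum>k<m. of_rat (c k r) * b k r))"
    using b_span[OF V.cauchy_mult[OF V.cauchy_const[OF x] b_cauchy]] by blast
  from choice[OF this] obtain c where c: "\<forall>j. j < m \<longrightarrow> (\<forall>k<m. cauchy_on UNIV u (c j k)) \<and>
      null_on v (\<lambda>r. x * b j r - (\<Sum>k<m. of_rat (c j k r) * b k r))" ..
  show ?thesis unfolding represents_def by (rule exI[of _ "\<lambda>i j. c j i"]) (use c in auto)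
qed

lemma basis_change:
  obtains c where "\<And>i k. i < n \<Longrightarrow> k < m \<Longrightarrow> cauchy_on UNIV u (c i k)"
    "\<And>i. i < n \<Longrightarrow> null_on v (\<lambda>r. e i - (\<Sum>k<m. of_rat (c i k r) * b k r))"
proof -
  have "\<forall>i. \<exists>c. i < n \<longrightarrow> (\<forall>k<m. cauchy_on UNIV u (c k)) \<and> null_on v (\<lambda>r. e i - (\<Sum>k<m. of_rat (c k r) * b k r))"
    using b_span[OF V.cauchy_const[OF basis_mem]] by blast
  from choice[OF this] obtain c where "\<forall>i. i < n \<longrightarrow> (\<forall>k<m. cauchy_on UNIV u (c i k)) \<and>
      null_on v (\<lambda>r. e i - (\<Sum>k<m. of_rat (c i k r) * b k r))" ..
  then show thesis using that[of c] by blast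
qed

text \<open>Substitutes the expansion of each \<open>e i\<close> in \<open>b\<close> into an
  expansion in \<open>e\<close>. The error terms stay null because the coefficients
  \<open>l i\<close> are Cauchy and hence bounded.\<close>

lemma compose_expansions:
  assumes c: "\<And>i k. i < n \<Longrightarrow> k < m \<Longrightarrow> cauchy_on UNIV u (c i k)"
    "\<And>i. i < n \<Longrightarrow> null_on v (\<lambda>r. e i - (\<Sum>k<m. of_rat (c i k r) * b k r))"
    and l: "\<And>i. i < n \<Longrightarrow> cauchy_on UNIV u (l i)" "null_on v (\<lambda>r. s r - (\<Sum>i<n. of_rat (l i r) * e i))"
    and s: "\<And>r. s r \<in> L"
  shows "null_on v (\<lambda>r. s r - (\<Sum>k<m. of_rat (\<Sum>i<n. l i r * c i k r) * b k r))"
proof -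
  have mem: "e i - (\<Sum>k<m. of_rat (c i k r) * b k r) \<in> L" if "i < n" for i r
    by (rule is_subfieldD(7)[OF L basis_mem[OF that] comb_mem])
  have mem2: "(\<Sum>i<n. of_rat (l i r) * e i) \<in> L" for r
    by (intro is_subfield_sum[OF L] is_subfieldD(4)[OF L] of_rat_mem basis_mem) auto
  have "null_on v (\<lambda>r. \<Sum>i<n. of_rat (l i r) * (e i - (\<Sum>k<m. of_rat (c i k r) * b k r)))"
    by (rule null_comb) (use l c mem in auto)
  moreover have mem3: "(\<Sum>i<n. of_rat (l i r) * (e i - (\<Sum>k<m. of_rat (c i k r) * b k r))) \<in> L" for r
    by (intro is_subfield_sum[OF L] is_subfieldD(4)[OF L of_rat_mem mem]) auto
  ultimately have "null_on v (\<lambda>r. s r - (\<Sum>i<n. of_rat (l i r) * e i) + (\<Sum>i<n. of_rat (l i r) * (e i - (\<Sum>k<m. of_rat (c i k r) * b k r))))"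
    by (intro V.null_add l(2) is_subfieldD(7)[OF L s mem2])
  moreover have "s r - (\<Sum>i<n. of_rat (l i r) * e i) + (\<Sum>i<n. of_rat (l i r) * (e i - (\<Sum>k<m. of_rat (c i k r) * b k r))) =
      s r - (\<Sum>k<m. of_rat (\<Sum>i<n. l i r * c i k r) * b k r)" for r
  proof -
    have "(\<Sum>i<n. of_rat (l i r) * (\<Sum>k<m. of_rat (c i k r) * b k r)) = (\<Sum>k<m. of_rat (\<Sum>i<n. l i r * c i k r) * b k r)"
      unfolding sum_distrib_left of_rat_sum sum_distrib_right
      by (subst sum.swap) (simp add: of_rat_mult algebra_simps)
    then show ?thesis by (simp add: right_diff_distrib sum_subtractf)
  qed
  ultimately show ?thesis by simp
qed

text \<open>Both numbers are the trace of the identity of \<open>L_v\<close>. Expanding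
  \<open>b\<close> in \<open>e\<close> and then \<open>e\<close> in \<open>b\<close> gives a matrix
  whose diagonal tends to 1, of limiting trace \<open>m\<close>. Read as local traces, the
  coordinates turn the same sum into that of \<open>\<tau> (e i * dual i)\<close> over
  \<open>T\<close>, which \<open>sum_dual_over\<close> evaluates.\<close>

lemma local_degree: "m = card T"
proof -
  obtain c where c: "\<And>i k. i < n \<Longrightarrow> k < m \<Longrightarrow> cauchy_on UNIV u (c i k)"
    "\<And>i. i < n \<Longrightarrow> null_on v (\<lambda>r. e i - (\<Sum>k<m. of_rat (c i k r) * b k r))" by (rule basis_change) (rule that)
  have "\<forall>k. \<exists>l. k < m \<longrightarrow> (\<forall>i<n. cauchy_on UNIV u (l i)) \<and>
      (\<forall>i<n. null_on w (\<lambda>r. of_rat (l i r) - (\<Sum>\<tau>\<in>T. \<tau> (b k r * dual i)))) \<and>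
      null_on v (\<lambda>r. b k r - (\<Sum>i<n. of_rat (l i r) * e i))"
  proof
    fix k
    show "\<exists>l. k < m \<longrightarrow> (\<forall>i<n. cauchy_on UNIV u (l i)) \<and>
      (\<forall>i<n. null_on w (\<lambda>r. of_rat (l i r) - (\<Sum>\<tau>\<in>T. \<tau> (b k r * dual i)))) \<and>
      null_on v (\<lambda>r. b k r - (\<Sum>i<n. of_rat (l i r) * e i))"
    proof (cases "k < m")
      case True
      show ?thesis by (rule coordinates[OF b_cauchy[OF True]]) blast
    qed simp
  qed
  from choice[OF this] obtain l where l: "\<forall>k. k < m \<longrightarrow> (\<forall>i<n. cauchy_on UNIV u (l k i)) \<and>
      (\<forall>i<n. null_on w (\<lambda>r. of_rat (l k i r) - (\<Sum>\<tau>\<in>T. \<tau> (b k r * dual i)))) \<and>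
      null_on v (\<lambda>r. b k r - (\<Sum>i<n. of_rat (l k i r) * e i))" ..
  define g where "g k j r = (\<Sum>i<n. l k i r * c i j r)" for k j r
  have gc: "cauchy_on UNIV u (g k j)" if "k < m" "j < m" for k j
    unfolding g_def using l c that by (intro U.cauchy_sum U.cauchy_mult) auto
  have diag: "null_on u (\<lambda>r. g k k r - 1)" if k: "k < m" for k
  proof -
    have "null_on v (\<lambda>r. b k r - (\<Sum>j<m. of_rat (g k j r) * b j r))"
      unfolding g_def by (rule compose_expansions[OF c]) (use l k b_mem in auto)
    moreover have "null_on v (\<lambda>r. b k r - (\<Sum>j<m. of_rat (if j = k then 1 else 0) * b j r))"
    proof -
      have "(\<Sum>j<m. of_rat (if j = k then 1 else 0) * b j r) = (\<Sum>j<m. if j = k then b j r else 0)" for r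
        by (intro sum.cong) auto
      then show ?thesis using k V.null_zero by simp
    qed
    ultimately have "null_on u (\<lambda>r. g k k r - (if k = k then 1 else 0))"
      by (intro comb_unique[where c = "g k" and d = "\<lambda>j r. if j = k then 1 else 0" and s = "b k"])
         (use gc k b_mem U.cauchy_const in auto)
    then show ?thesis by simp
  qed
  have wm: "cauchy_on UNIV w (\<lambda>r. of_rat (a r))" if "cauchy_on UNIV u a" for a
    using that unfolding cauchy_on_def by (simp add: of_rat_diff[symmetric] w_rat)
  have N1: "null_on w (\<lambda>r. \<Sum>k<m. (of_rat (g k k r) - 1 :: 'a))"
  proof (rule W.null_sum)
    fix k assume "k \<in> {..<m}"
    then have "null_on u (\<lambda>r. g k k r - 1)" using diag by simp
    then show "null_on w (\<lambda>r. of_rat (g k k r) - 1)" unfolding null_on_def w_rat[symmetric] by (simp add: of_rat_diff)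
  qed simp
  have N2: "null_on w (\<lambda>r. \<Sum>k<m. \<Sum>i<n. of_rat (c i k r) * (of_rat (l k i r) - (\<Sum>\<tau>\<in>T. \<tau> (b k r * dual i))))"
    by (intro W.null_sum W.null_mult_cauchy(2) wm) (use l c in auto)
  have N3: "null_on w (\<lambda>r. \<Sum>i<n. \<Sum>\<tau>\<in>T. \<tau> ((e i - (\<Sum>k<m. of_rat (c i k r) * b k r)) * dual i))"
  proof (intro W.null_sum)
    fix i \<tau> assume "i \<in> {..<n}" and t: "\<tau> \<in> T"
    then have i: "i < n" by simp
    have mem: "e i - (\<Sum>k<m. of_rat (c i k r) * b k r) \<in> L" for r
      by (rule is_subfieldD(7)[OF L basis_mem[OF i] comb_mem])
    have "null_on v (\<lambda>r. (e i - (\<Sum>k<m. of_rat (c i k r) * b k r)) * dual i)"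
      by (rule V.null_mult_cauchy(1)[OF mem c(2)[OF i] V.cauchy_const[OF dual(1)[OF i]]])
    then show "null_on w (\<lambda>r. \<tau> ((e i - (\<Sum>k<m. of_rat (c i k r) * b k r)) * dual i))"
      unfolding null_on_def using T_eq[OF t is_subfieldD(4)[OF L mem dual(1)[OF i]]] by simp
  qed auto
  \<comment> \<open>An exact identity for every \<open>r\<close>, in which all terms except the
    constant \<open>card T - m\<close> are null by \<open>N1\<close>, \<open>N2\<close> and
    \<open>N3\<close>. The constant must therefore vanish.\<close>
  have eq: "(\<Sum>k<m. (of_rat (g k k r) - 1 :: 'a)) =
      (\<Sum>k<m. \<Sum>i<n. of_rat (c i k r) * (of_rat (l k i r) - (\<Sum>\<tau>\<in>T. \<tau> (b k r * dual i))))
      - (\<Sum>i<n. \<Sum>\<tau>\<in>T. \<tau> ((e i - (\<Sum>k<m. of_rat (c i k r) * b k r)) * dual i)) + (of_nat (card T) - of_nat m)" for r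
  proof -
    have 1: "\<tau> ((e i - (\<Sum>k<m. of_rat (c i k r) * b k r)) * dual i) =
        \<tau> (e i * dual i) - (\<Sum>k<m. of_rat (c i k r) * \<tau> (b k r * dual i))" if "\<tau> \<in> T" and i: "i < n" for \<tau> i
    proof -
      note t = T_tau[OF that(1)]
      have bd: "b k r * dual i \<in> L" if "k < m" for k using is_subfieldD(4)[OF L b_mem[OF that] dual(1)[OF i]] .
      have m1: "e i * dual i \<in> L" using is_subfieldD(4)[OF L basis_mem[OF i] dual(1)[OF i]] .
      have m2: "(\<Sum>k<m. of_rat (c i k r) * (b k r * dual i)) \<in> L"
        using bd of_rat_mem is_subfieldD(4)[OF L] by (intro is_subfield_sum[OF L]) auto
      have "(e i - (\<Sum>k<m. of_rat (c i k r) * b k r)) * dual i = e i * dual i - (\<Sum>k<m. of_rat (c i k r) * (b k r * dual i))"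
        by (simp add: left_diff_distrib sum_distrib_right mult.assoc)
      moreover have "\<tau> (\<Sum>k<m. of_rat (c i k r) * (b k r * dual i)) = (\<Sum>k<m. of_rat (c i k r) * \<tau> (b k r * dual i))"
        by (subst emb(9)[OF t]) (use bd of_rat_mem is_subfieldD(4)[OF L] emb(3,4)[OF t] in auto)
      ultimately show ?thesis using emb(11)[OF t m1 m2] by simp
    qed
    have 2: "(\<Sum>i<n. \<Sum>\<tau>\<in>T. \<tau> ((e i - (\<Sum>k<m. of_rat (c i k r) * b k r)) * dual i)) =
        of_nat (card T) - (\<Sum>k<m. \<Sum>i<n. of_rat (c i k r) * (\<Sum>\<tau>\<in>T. \<tau> (b k r * dual i)))"
    proof -
      have "(\<Sum>i<n. \<Sum>\<tau>\<in>T. \<tau> ((e i - (\<Sum>k<m. of_rat (c i k r) * b k r)) * dual i)) =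
          (\<Sum>i<n. \<Sum>\<tau>\<in>T. \<tau> (e i * dual i) - (\<Sum>k<m. of_rat (c i k r) * \<tau> (b k r * dual i)))"
        by (intro sum.cong refl 1) auto
      also have "\<dots> = of_nat (card T) - (\<Sum>i<n. \<Sum>\<tau>\<in>T. \<Sum>k<m. of_rat (c i k r) * \<tau> (b k r * dual i))"
        unfolding sum_subtractf sum_dual_over[OF T_sub] by simp
      also have "(\<Sum>i<n. \<Sum>\<tau>\<in>T. \<Sum>k<m. of_rat (c i k r) * \<tau> (b k r * dual i)) =
          (\<Sum>i<n. \<Sum>k<m. of_rat (c i k r) * (\<Sum>\<tau>\<in>T. \<tau> (b k r * dual i)))"
        unfolding sum_distrib_left by (intro sum.cong refl sum.swap)
      also have "\<dots> = (\<Sum>k<m. \<Sum>i<n. of_rat (c i k r) * (\<Sum>\<tau>\<in>T. \<tau> (b k r * dual i)))" by (rule sum.swap)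
      finally show ?thesis .
    qed
    have 3: "(\<Sum>k<m. (of_rat (g k k r) - 1 :: 'a)) = (\<Sum>k<m. \<Sum>i<n. of_rat (c i k r) * of_rat (l k i r)) - of_nat m"
      unfolding g_def by (simp add: sum_subtractf of_rat_sum of_rat_mult mult.commute)
    show ?thesis unfolding 2 3 by (simp add: right_diff_distrib sum_subtractf)
  qed
  have "null_on w (\<lambda>r. (\<Sum>k<m. (of_rat (g k k r) - 1 :: 'a)) -
      ((\<Sum>k<m. \<Sum>i<n. of_rat (c i k r) * (of_rat (l k i r) - (\<Sum>\<tau>\<in>T. \<tau> (b k r * dual i))))
      - (\<Sum>i<n. \<Sum>\<tau>\<in>T. \<tau> ((e i - (\<Sum>k<m. of_rat (c i k r) * b k r)) * dual i))))"
    by (intro W.null_diff N1 N2 N3) auto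
  then have "null_on w (\<lambda>r. of_nat (card T) - of_nat m)" unfolding eq by simp
  then have "w (of_nat (card T) - of_nat m) = 0" unfolding null_on_def by (simp add: LIMSEQ_const_iff)
  then show ?thesis using W.v_eq_0 by (simp only: right_minus_eq of_nat_eq_iff UNIV_I eq_iff_diff_eq_0[symmetric])
qed

end

section \<open>Norms of elements of the number field at a place\<close>

lemma le_of_powers_le:
  fixes a b C :: real
  assumes "\<And>k. a ^ k \<le> C * b ^ k" "0 \<le> a" "0 \<le> b"
  shows "a \<le> b"
proof (rule ccontr)
  assume "\<not> a \<le> b"
  then have ab: "b < a" by simp
  show False
  proof (cases "b = 0")
    case True
    then show ?thesis using assms(1)[of 1] ab by simp
  next
    case False
    then have b: "b > 0" using assms by simp
    have "(a / b) ^ k \<le> C" for k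
      using assms(1)[of k] b by (simp add: power_divide divide_le_eq)
    moreover obtain k where "C < (a / b) ^ k" using real_arch_pow[of "a / b" C] ab b by auto
    ultimately show ?thesis by (meson not_le)
  qed
qed

context completion_basis
begin

lemma represents_unique:
  assumes "represents x a" "represents x a'" "x \<in> L" "i < m" "j < m"
  shows "null_on u (\<lambda>r. a i j r - a' i j r)"
  by (rule comb_unique[where c = "\<lambda>i. a i j" and d = "\<lambda>i. a' i j" and s = "\<lambda>r. x * b j r"])
     (use assms is_subfieldD(4)[OF L] b_mem in \<open>auto simp: represents_def\<close>)

lemma represents_one: "represents 1 (\<lambda>i j r. if i = j then 1 else 0)"
proof -
  have "(\<Sum>i<m. of_rat (if i = j then 1 else 0) * b i r) = b j r" if "j < m" for j r
  proof -
    have "(\<Sum>i<m. of_rat (if i = j then 1 else 0) * b i r) = (\<Sum>i<m. if i = j then b i r else 0)"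
      by (intro sum.cong) auto
    then show ?thesis using that by simp
  qed
  then show ?thesis unfolding represents_def using V.null_zero by (auto intro: U.cauchy_const)
qed

lemma represents_mult:
  assumes x: "x \<in> L" and y: "y \<in> L" and a: "represents x a" and a': "represents y a'"
  shows "represents (x * y) (\<lambda>i j r. \<Sum>k<m. a i k r * a' k j r)"
  unfolding represents_def
proof (intro conjI allI impI)
  fix i j assume "i < m" "j < m"
  then show "cauchy_on UNIV u (\<lambda>r. \<Sum>k<m. a i k r * a' k j r)"
    using a a' unfolding represents_def by (intro U.cauchy_sum U.cauchy_mult) auto
next
  fix j assume j: "j < m"
  note LD = is_subfieldD[OF L]
  have xb: "x * b k r \<in> L" if "k < m" for k r using LD(4)[OF x b_mem[OF that]] .
  have dx: "x * b k r - (\<Sum>i<m. of_rat (a i k r) * b i r) \<in> L" if "k < m" for k r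
    using LD(7)[OF xb[OF that] comb_mem] .
  have dy: "y * b j r - (\<Sum>k<m. of_rat (a' k j r) * b k r) \<in> L" for r
    using LD(7)[OF LD(4)[OF y b_mem[OF j]] comb_mem] .
  have 1: "null_on v (\<lambda>r. x * (y * b j r - (\<Sum>k<m. of_rat (a' k j r) * b k r)))"
    by (rule V.null_mult_cauchy(2)[OF dy _ V.cauchy_const[OF x]]) (use a' j in \<open>simp add: represents_def\<close>)
  have 2: "null_on v (\<lambda>r. \<Sum>k<m. of_rat (a' k j r) * (x * b k r - (\<Sum>i<m. of_rat (a i k r) * b i r)))"
    by (rule null_comb) (use a a' j dx in \<open>auto simp: represents_def\<close>)
  have "null_on v (\<lambda>r. x * (y * b j r - (\<Sum>k<m. of_rat (a' k j r) * b k r)) +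
      (\<Sum>k<m. of_rat (a' k j r) * (x * b k r - (\<Sum>i<m. of_rat (a i k r) * b i r))))"
    by (rule V.null_add[OF _ _ 1 2])
       (use LD(4)[OF x dy] dx LD(4)[OF of_rat_mem] in \<open>auto intro: is_subfield_sum[OF L]\<close>)
  moreover have "x * (y * b j r - (\<Sum>k<m. of_rat (a' k j r) * b k r)) +
      (\<Sum>k<m. of_rat (a' k j r) * (x * b k r - (\<Sum>i<m. of_rat (a i k r) * b i r))) =
      x * y * b j r - (\<Sum>i<m. of_rat (\<Sum>k<m. a i k r * a' k j r) * b i r)" for r
  proof -
    have "(\<Sum>k<m. of_rat (a' k j r) * (\<Sum>i<m. of_rat (a i k r) * b i r)) = (\<Sum>i<m. of_rat (\<Sum>k<m. a i k r * a' k j r) * b i r)"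
      unfolding sum_distrib_left of_rat_sum sum_distrib_right
      by (subst sum.swap) (simp add: of_rat_mult algebra_simps)
    then show ?thesis by (simp add: right_diff_distrib sum_subtractf sum_distrib_left algebra_simps)
  qed
  ultimately show "null_on v (\<lambda>r. x * y * b j r - (\<Sum>i<m. of_rat (\<Sum>k<m. a i k r * a' k j r) * b i r))" by simp
qed

lemma permutes_less: "p permutes {..<m} \<Longrightarrow> i < m \<Longrightarrow> p i < m"
  using permutes_in_image[of p "{..<m}" i] by simp

lemma leibniz_cauchy:
  assumes "\<And>i j. i < m \<Longrightarrow> j < m \<Longrightarrow> cauchy_on UNIV u (a i j)"
  shows "cauchy_on UNIV u (\<lambda>r. leibniz m (\<lambda>i j. a i j r))"
  unfolding leibniz_def
  by (intro U.cauchy_sum U.cauchy_mult U.cauchy_prod U.cauchy_const assms) (auto simp: permutes_less)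

lemma leibniz_null:
  assumes a: "\<And>i j. i < m \<Longrightarrow> j < m \<Longrightarrow> cauchy_on UNIV u (a i j)"
    and a': "\<And>i j. i < m \<Longrightarrow> j < m \<Longrightarrow> cauchy_on UNIV u (a' i j)"
    and d: "\<And>i j. i < m \<Longrightarrow> j < m \<Longrightarrow> null_on u (\<lambda>r. a i j r - a' i j r)"
  shows "null_on u (\<lambda>r. leibniz m (\<lambda>i j. a i j r) - leibniz m (\<lambda>i j. a' i j r))"
proof -
  have "null_on u (\<lambda>r. \<Sum>p\<in>{p. p permutes {..<m}}. of_int (sign p) * ((\<Prod>i<m. a i (p i) r) - (\<Prod>i<m. a' i (p i) r)))"
    by (intro U.null_sum U.null_mult_cauchy(2) U.cauchy_const U.null_prod_diff a a' d) (auto simp: permutes_less)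
  then show ?thesis unfolding leibniz_def by (simp add: right_diff_distrib sum_subtractf)
qed

text \<open>The crude count of \<open>fact m\<close> permutations is harmless, since a factor
  independent of \<open>x\<close> disappears when the bound is applied to high powers.\<close>

lemma leibniz_bound:
  assumes a: "\<And>i j. i < m \<Longrightarrow> j < m \<Longrightarrow> \<exists>l. (\<lambda>r. u (a i j r)) \<longlonglongrightarrow> l \<and> l \<le> K"
    and lim: "(\<lambda>r. u (leibniz m (\<lambda>i j. a i j r))) \<longlonglongrightarrow> D"
  shows "D \<le> fact m * K ^ m"
proof -
  have "\<forall>i j. \<exists>l. i < m \<and> j < m \<longrightarrow> (\<lambda>r. u (a i j r)) \<longlonglongrightarrow> l \<and> l \<le> K" using a by blast
  then obtain l where l: "\<forall>i j. i < m \<and> j < m \<longrightarrow> (\<lambda>r. u (a i j r)) \<longlonglongrightarrow> l i j \<and> l i j \<le> K" by metis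
  have l0: "0 \<le> l i j" if "i < m" "j < m" for i j
    using LIMSEQ_le_const[of "\<lambda>r. u (a i j r)" "l i j" 0] l that U.v_nonneg by auto
  let ?P = "{p. p permutes {..<m}}"
  have "D \<le> (\<Sum>p\<in>?P. \<Prod>i<m. l i (p i))"
  proof (rule LIMSEQ_le[OF lim])
    show "(\<lambda>r. \<Sum>p\<in>?P. \<Prod>i<m. u (a i (p i) r)) \<longlonglongrightarrow> (\<Sum>p\<in>?P. \<Prod>i<m. l i (p i))"
      using l by (intro tendsto_sum tendsto_prod) (auto simp: permutes_less)
    have up: "u (\<Prod>i\<in>I. f i) = (\<Prod>i\<in>I. u (f i))" for f :: "nat \<Rightarrow> rat" and I
      by (induction I rule: infinite_finite_induct) (simp_all add: U.v_1 U.v_mult)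
    have us: "u (of_int (sign p)) = 1" for p :: "nat \<Rightarrow> nat"
      by (simp add: sign_def U.v_1 U.v_minus_1)
    have "u (leibniz m (\<lambda>i j. a i j r)) \<le> (\<Sum>p\<in>?P. \<Prod>i<m. u (a i (p i) r))" for r
    proof -
      have "u (leibniz m (\<lambda>i j. a i j r)) \<le> (\<Sum>p\<in>?P. u (of_int (sign p) * (\<Prod>i<m. a i (p i) r)))"
        unfolding leibniz_def by (rule U.v_sum_le) simp
      then show ?thesis by (simp add: U.v_mult up us)
    qed
    then show "\<exists>N. \<forall>r\<ge>N. u (leibniz m (\<lambda>i j. a i j r)) \<le> (\<Sum>p\<in>?P. \<Prod>i<m. u (a i (p i) r))" by blast
  qed
  also have "\<dots> \<le> (\<Sum>p\<in>?P. K ^ m)"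
  proof (rule sum_mono)
    fix p assume "p \<in> ?P"
    then have "(\<Prod>i<m. l i (p i)) \<le> (\<Prod>i<m. K)" using l l0 by (intro prod_mono) (auto simp: permutes_less)
    then show "(\<Prod>i<m. l i (p i)) \<le> K ^ m" by simp
  qed
  also have "\<dots> = fact m * K ^ m" by (simp add: card_permutations[of "{..<m}" m])
  finally show ?thesis .
qed

text \<open>The point is that \<open>B\<close> is uniform in \<open>x\<close>. The coordinates of
  \<open>x * b j\<close> in \<open>e\<close> are bounded through \<open>coordinate_bound\<close> by
  a multiple of \<open>v x\<close>, and the change from \<open>e\<close> to \<open>b\<close> does
  not involve \<open>x\<close>.\<close>

lemma matrix_bound:
  obtains B where "B \<ge> 0" "\<And>x a i j. x \<in> L \<Longrightarrow> represents x a \<Longrightarrow> i < m \<Longrightarrow> j < m \<Longrightarrow>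
    \<exists>l. (\<lambda>r. u (a i j r)) \<longlonglongrightarrow> l \<and> l \<le> B * v x"
proof -
  obtain c where c: "\<And>i k. i < n \<Longrightarrow> k < m \<Longrightarrow> cauchy_on UNIV u (c i k)"
    "\<And>i. i < n \<Longrightarrow> null_on v (\<lambda>r. e i - (\<Sum>k<m. of_rat (c i k r) * b k r))" by (rule basis_change) (rule that)
  have "\<exists>l. i < n \<and> k < m \<longrightarrow> (\<lambda>r. u (c i k r)) \<longlonglongrightarrow> l" for i k
    using U.cauchy_convergent[OF c(1)] by metis
  then obtain \<gamma> where \<gamma>: "\<And>i k. i < n \<Longrightarrow> k < m \<Longrightarrow> (\<lambda>r. u (c i k r)) \<longlonglongrightarrow> \<gamma> i k" by metis
  have "\<exists>l. j < m \<longrightarrow> (\<lambda>r. v (b j r)) \<longlonglongrightarrow> l" for j using V.cauchy_convergent[OF b_cauchy] by metis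
  then obtain \<beta> where \<beta>: "\<And>j. j < m \<Longrightarrow> (\<lambda>r. v (b j r)) \<longlonglongrightarrow> \<beta> j" by metis
  have \<gamma>0: "0 \<le> \<gamma> i k" if "i < n" "k < m" for i k
    using LIMSEQ_le_const[OF \<gamma>[OF that], of 0] U.v_nonneg by auto
  have \<beta>0: "0 \<le> \<beta> j" if "j < m" for j
    using LIMSEQ_le_const[OF \<beta>[OF that], of 0] V.v_nonneg[OF b_mem[OF that]] by auto
  have d0: "0 \<le> v (dual i)" if "i < n" for i using V.v_nonneg[OF dual(1)[OF that]] .
  define h where "h k j = (\<Sum>i<n. card T * v (dual i) * \<beta> j * \<gamma> i k)" for k j
  have h0: "0 \<le> h k j" if "k < m" "j < m" for k j
    unfolding h_def using that \<gamma>0 \<beta>0 d0 by (intro sum_nonneg) auto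
  define B where "B = (\<Sum>k<m. \<Sum>j<m. h k j)"
  have hB: "h k j \<le> B" if "k < m" "j < m" for k j
  proof -
    have "h k j \<le> (\<Sum>j<m. h k j)" using that h0 by (intro member_le_sum) auto
    also have "\<dots> \<le> B" unfolding B_def using that h0 by (intro member_le_sum[of k]) (auto intro: sum_nonneg)
    finally show ?thesis .
  qed
  show thesis
  proof (rule that[of B])
    show "B \<ge> 0" unfolding B_def using h0 by (intro sum_nonneg) auto
    fix x a k j assume x: "x \<in> L" and a: "represents x a" and kj: "k < m" "j < m"
    have s: "cauchy_on L v (\<lambda>r. x * b j r)" by (rule V.cauchy_mult[OF V.cauchy_const[OF x] b_cauchy[OF kj(2)]])
    obtain l where l: "\<And>i. i < n \<Longrightarrow> cauchy_on UNIV u (l i)"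
      "\<And>i. i < n \<Longrightarrow> null_on w (\<lambda>r. of_rat (l i r) - (\<Sum>\<tau>\<in>T. \<tau> (x * b j r * dual i)))"
      "null_on v (\<lambda>r. x * b j r - (\<Sum>i<n. of_rat (l i r) * e i))" by (rule coordinates[OF s]) (rule that)
    define g where "g k r = (\<Sum>i<n. l i r * c i k r)" for k r
    have gc: "cauchy_on UNIV u (g k)" if "k < m" for k
      unfolding g_def using l c that by (intro U.cauchy_sum U.cauchy_mult) auto
    have "null_on v (\<lambda>r. x * b j r - (\<Sum>k<m. of_rat (g k r) * b k r))"
      unfolding g_def by (rule compose_expansions[OF c l(1,3)]) (use V.cauchy_mem[OF s] in auto)
    then have null: "null_on u (\<lambda>r. a k j r - g k r)"
      by (intro comb_unique[where c = "\<lambda>k. a k j" and d = g and s = "\<lambda>r. x * b j r"])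
         (use gc kj a V.cauchy_mem[OF s] in \<open>auto simp: represents_def\<close>)
    obtain \<alpha> where \<alpha>: "(\<lambda>r. u (g k r)) \<longlonglongrightarrow> \<alpha>" using U.cauchy_convergent[OF gc[OF kj(1)]] .
    have lim: "(\<lambda>r. u (a k j r)) \<longlonglongrightarrow> \<alpha>" by (rule U.null_limit_eq[OF _ _ null \<alpha>]) auto
    have "\<exists>y. i < n \<longrightarrow> (\<lambda>r. u (l i r)) \<longlonglongrightarrow> y" for i using U.cauchy_convergent[OF l(1)] by metis
    then obtain \<eta> where \<eta>: "\<And>i. i < n \<Longrightarrow> (\<lambda>r. u (l i r)) \<longlonglongrightarrow> \<eta> i" by metis
    have xb: "(\<lambda>r. v (x * b j r)) \<longlonglongrightarrow> v x * \<beta> j"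
      unfolding V.v_mult[OF x b_mem[OF kj(2)]] by (intro tendsto_intros \<beta> kj)
    have \<eta>_le: "\<eta> i \<le> card T * v (dual i) * (v x * \<beta> j)" if "i < n" for i
      by (rule coordinate_bound[OF s that l(2)[OF that] xb \<eta>[OF that]])
    have "\<alpha> \<le> (\<Sum>i<n. \<eta> i * \<gamma> i k)"
    proof (rule LIMSEQ_le[OF \<alpha>])
      show "(\<lambda>r. \<Sum>i<n. u (l i r) * u (c i k r)) \<longlonglongrightarrow> (\<Sum>i<n. \<eta> i * \<gamma> i k)"
        using \<eta> \<gamma> kj by (intro tendsto_sum tendsto_mult) auto
      have "u (g k r) \<le> (\<Sum>i<n. u (l i r) * u (c i k r))" for r
        unfolding g_def using U.v_sum_le[of "{..<n}" "\<lambda>i. l i r * c i k r"] by (simp add: U.v_mult)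
      then show "\<exists>N. \<forall>r\<ge>N. u (g k r) \<le> (\<Sum>i<n. u (l i r) * u (c i k r))" by blast
    qed
    also have "\<dots> \<le> (\<Sum>i<n. card T * v (dual i) * (v x * \<beta> j) * \<gamma> i k)"
      using \<eta>_le \<gamma>0 kj by (intro sum_mono mult_right_mono) auto
    also have "\<dots> = h k j * v x" unfolding h_def sum_distrib_right by (intro sum.cong) (auto simp: algebra_simps)
    also have "\<dots> \<le> B * v x" using hB[OF kj] V.v_nonneg[OF x] by (rule mult_right_mono)
    finally show "\<exists>l. (\<lambda>r. u (a k j r)) \<longlonglongrightarrow> l \<and> l \<le> B * v x" using lim by blast
  qed
qed

lemma represents_cauchy: "represents x a \<Longrightarrow> i < m \<Longrightarrow> j < m \<Longrightarrow> cauchy_on UNIV u (a i j)"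
  unfolding represents_def by blast

text \<open>
  The norm is multiplicative and, up to a constant, at most \<open>v x ^ m\<close>; applying the bound to all
  powers of \<open>x\<close> removes the constant.
\<close>

theorem local_norm:
  assumes x: "x \<in> L" and a: "represents x a"
  shows "(\<lambda>r. u (leibniz m (\<lambda>i j. a i j r))) \<longlonglongrightarrow> v x ^ m"
proof -
  note LD = is_subfieldD[OF L]
  have "\<forall>y. \<exists>a. y \<in> L \<longrightarrow> represents y a" using represents_exists by blast
  from choice[OF this] obtain M where M: "\<forall>y. y \<in> L \<longrightarrow> represents y (M y)" ..
  define D where "D y = lim (\<lambda>r. u (leibniz m (\<lambda>i j. M y i j r)))" for y
  have limM: "(\<lambda>r. u (leibniz m (\<lambda>i j. M y i j r))) \<longlonglongrightarrow> D y" if "y \<in> L" for y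
  proof -
    have "cauchy_on UNIV u (\<lambda>r. leibniz m (\<lambda>i j. M y i j r))"
      by (rule leibniz_cauchy) (use M that represents_cauchy in blast)
    then obtain l where "(\<lambda>r. u (leibniz m (\<lambda>i j. M y i j r))) \<longlonglongrightarrow> l" by (rule U.cauchy_convergent)
    then show ?thesis unfolding D_def by (simp add: limI)
  qed
  have lim: "(\<lambda>r. u (leibniz m (\<lambda>i j. a i j r))) \<longlonglongrightarrow> D y" if y: "y \<in> L" and a: "represents y a" for y a
  proof (rule U.null_limit_eq[OF _ _ _ limM[OF y]])
    show "null_on u (\<lambda>r. leibniz m (\<lambda>i j. a i j r) - leibniz m (\<lambda>i j. M y i j r))"
      by (rule leibniz_null) (use represents_cauchy a M y represents_unique in blast)+
  qed auto
  have D0: "0 \<le> D y" if "y \<in> L" for y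
    using LIMSEQ_le_const[OF limM[OF that], of 0] U.v_nonneg by auto
  have D_mult: "D (y * z) = D y * D z" if y: "y \<in> L" and z: "z \<in> L" for y z
  proof -
    have "(\<lambda>r. u (leibniz m (\<lambda>i j. \<Sum>k<m. M y i k r * M z k j r))) \<longlonglongrightarrow> D (y * z)"
      by (rule lim[OF LD(4)[OF y z] represents_mult[OF y z]]) (use M y z in auto)
    moreover have "(\<lambda>r. u (leibniz m (\<lambda>i j. \<Sum>k<m. M y i k r * M z k j r))) \<longlonglongrightarrow> D y * D z"
      unfolding leibniz_mult by (simp add: U.v_mult tendsto_mult limM y z)
    ultimately show ?thesis by (rule LIMSEQ_unique)
  qed
  have D_1: "D 1 = 1"
    using lim[OF LD(2) represents_one] unfolding leibniz_one by (simp add: U.v_1 LIMSEQ_const_iff)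
  have D_power: "D (y ^ k) = D y ^ k" if "y \<in> L" for y k
    by (induction k) (simp_all add: D_1 D_mult that is_subfield_power[OF L])
  obtain B where B: "B \<ge> 0" "\<And>x a i j. x \<in> L \<Longrightarrow> represents x a \<Longrightarrow> i < m \<Longrightarrow> j < m \<Longrightarrow>
    \<exists>l. (\<lambda>r. u (a i j r)) \<longlonglongrightarrow> l \<and> l \<le> B * v x" by (rule matrix_bound) (rule that)
  have le: "D y \<le> v y ^ m" if y: "y \<in> L" for y
  proof (rule le_of_powers_le)
    fix k
    note yk = is_subfield_power[OF L y, of k]
    have "D (y ^ k) \<le> fact m * (B * v (y ^ k)) ^ m"
    proof (rule leibniz_bound[OF _ limM[OF yk]])
      show "\<exists>l. (\<lambda>r. u (M (y ^ k) i j r)) \<longlonglongrightarrow> l \<and> l \<le> B * v (y ^ k)" if "i < m" "j < m" for i j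
        by (rule B(2)[OF yk _ that]) (use M yk in auto)
    qed
    then show "D y ^ k \<le> (fact m * B ^ m) * (v y ^ m) ^ k"
      unfolding D_power[OF y] V.v_power[OF y] by (simp add: power_mult_distrib power_mult[symmetric] mult.commute mult.left_commute)
  qed (use D0[OF y] V.v_nonneg[OF y] in auto)
  have "D x = v x ^ m"
  proof (cases "x = 0")
    case True
    \<comment> \<open>At \<open>x = 0\<close> the claim is that \<open>D 0\<close> equals
      \<open>0 ^ m\<close>, which is 0 only for positive \<open>m\<close>.\<close>
    have "card T > 0" using T_nonempty finite_T by (simp add: card_gt_0_iff)
    then have "m > 0" using local_degree by simp
    then show ?thesis using le[OF x] D0[OF x] True V.v_0 by (simp add: power_0_left)
  next
    case False
    \<comment> \<open>The reverse inequality: since \<open>D\<close> is multiplicative with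
      \<open>D 1 = 1\<close>, the upper bound at \<open>inverse x\<close> is a lower bound at
      \<open>x\<close>.\<close>
    have i: "inverse x \<in> L" using LD(6)[OF x] .
    have one: "D x * D (inverse x) = 1" using D_mult[OF x i] D_1 False by simp
    have "D (inverse x) \<le> inverse (v x ^ m)" using le[OF i] V.v_inverse[OF x] by (simp add: power_inverse)
    then have "1 \<le> D x * inverse (v x ^ m)" using mult_left_mono[OF _ D0[OF x]] one by metis
    then have "v x ^ m \<le> D x" using V.v_pos[OF x False] by (simp add: field_simps)
    then show ?thesis using le[OF x] by simp
  qed
  then show ?thesis using lim[OF x a] by simp
qed

end

section \<open>Completions and local norms\<close>

context valued_subfield
begin

abbreviation "C \<equiv> cauchy_ring L v"
abbreviation "N \<equiv> null_sequences L v"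
abbreviation "R \<equiv> completion L v"
abbreviation "\<pi> \<equiv> to_completion L v"

lemma cauchy_ring_simps [simp]:
  "s \<in> carrier C \<longleftrightarrow> cauchy_on L v s" "s \<otimes>\<^bsub>C\<^esub> t = (\<lambda>r. s r * t r)" "s \<oplus>\<^bsub>C\<^esub> t = (\<lambda>r. s r + t r)"
  "\<one>\<^bsub>C\<^esub> = (\<lambda>r. 1)" "\<zero>\<^bsub>C\<^esub> = (\<lambda>r. 0)"
  unfolding cauchy_ring_def cauchy_on_def by simp_all

lemma null_sequences_iff: "s \<in> N \<longleftrightarrow> range s \<subseteq> L \<and> null_on v s"
  unfolding null_sequences_def null_on_def by simp

lemma cring_cauchy_ring: "cring C"
proof (rule cringI)
  show "abelian_group C"
  proof (rule abelian_groupI)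
    fix s assume "s \<in> carrier C"
    then show "\<exists>t\<in>carrier C. t \<oplus>\<^bsub>C\<^esub> s = \<zero>\<^bsub>C\<^esub>"
      using cauchy_uminus[of s] by (intro bexI[of _ "\<lambda>r. - s r"]) auto
  qed (auto simp: algebra_simps cauchy_add cauchy_const is_subfieldD[OF L])
  show "comm_monoid C"
    by (rule comm_monoidI) (auto simp: algebra_simps cauchy_mult cauchy_const is_subfieldD[OF L])
qed (auto simp: algebra_simps)

lemma cauchy_ring_minus: "cauchy_on L v s \<Longrightarrow> \<ominus>\<^bsub>C\<^esub> s = (\<lambda>r. - s r)"
proof -
  assume s: "cauchy_on L v s"
  interpret C: cring C by (rule cring_cauchy_ring)
  show ?thesis by (rule C.minus_equality) (use s cauchy_uminus in auto)
qed

lemma ideal_null_sequences: "ideal N C"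
proof -
  interpret C: cring C by (rule cring_cauchy_ring)
  have cau: "cauchy_on L v s" if "s \<in> N" for s using that null_cauchy unfolding null_sequences_iff by auto
  show ?thesis
  proof (rule idealI)
    show "ring C" by (rule C.ring_axioms)
    show "subgroup N (add_monoid C)"
    proof (rule C.add.subgroupI)
      show "N \<subseteq> carrier C" using cau by auto
      show "N \<noteq> {}" using null_zero is_subfieldD(1)[OF L] unfolding null_sequences_iff ex_in_conv[symmetric] 
        by (intro exI[of _ "\<lambda>r. 0"]) auto
      fix s assume s: "s \<in> N"
      have "(\<lambda>r. - s r) \<in> N" using s null_uminus[of s] is_subfieldD(5)[OF L] unfolding null_sequences_iff by auto
      then show "\<ominus>\<^bsub>C\<^esub> s \<in> N" using cauchy_ring_minus[OF cau[OF s]] by simp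
      fix t assume t: "t \<in> N"
      have mem: "s r \<in> L" "t r \<in> L" for r using s t unfolding null_sequences_iff by auto
      have "null_on v (\<lambda>r. s r + t r)" by (rule null_add) (use s t mem in \<open>simp_all add: null_sequences_iff\<close>)
      then show "s \<oplus>\<^bsub>C\<^esub> t \<in> N" using mem is_subfieldD(3)[OF L] unfolding null_sequences_iff by auto
    qed
    fix s t assume s: "s \<in> N" and t: "t \<in> carrier C"
    have "null_on v (\<lambda>r. s r * t r)" "null_on v (\<lambda>r. t r * s r)" 
      using null_mult_cauchy[of s t] s t unfolding null_sequences_iff by auto
    then show "t \<otimes>\<^bsub>C\<^esub> s \<in> N" "s \<otimes>\<^bsub>C\<^esub> t \<in> N"
      using s cauchy_mem[of t] t is_subfieldD(4)[OF L] unfolding null_sequences_iff by auto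
  qed
qed

sublocale N: ideal N C by (rule ideal_null_sequences)

sublocale R: cring R unfolding completion_def by (rule N.quotient_is_cring[OF cring_cauchy_ring])

lemma \<pi>_hom: "\<pi> \<in> Ring.ring_hom C R"
proof -
  have "\<pi> = (\<lambda>s. N +>\<^bsub>C\<^esub> s)" by (rule ext) (simp add: to_completion_def)
  then show ?thesis unfolding completion_def using N.rcos_ring_hom by simp
qed

lemma carrier_R: "x \<in> carrier R \<longleftrightarrow> (\<exists>s. cauchy_on L v s \<and> x = \<pi> s)"
  unfolding completion_def FactRing_def A_RCOSETS_def' to_completion_def by auto

lemma \<pi>_closed [simp]: "cauchy_on L v s \<Longrightarrow> \<pi> s \<in> carrier R" using carrier_R by blast

lemma \<pi>_mult: "cauchy_on L v s \<Longrightarrow> cauchy_on L v t \<Longrightarrow> \<pi> s \<otimes>\<^bsub>R\<^esub> \<pi> t = \<pi> (\<lambda>r. s r * t r)"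
  and \<pi>_add: "cauchy_on L v s \<Longrightarrow> cauchy_on L v t \<Longrightarrow> \<pi> s \<oplus>\<^bsub>R\<^esub> \<pi> t = \<pi> (\<lambda>r. s r + t r)"
  and \<pi>_one: "\<one>\<^bsub>R\<^esub> = \<pi> (\<lambda>r. 1)"
  using Ring.ring_hom_mult[OF \<pi>_hom, of s t] Ring.ring_hom_add[OF \<pi>_hom, of s t] Ring.ring_hom_one[OF \<pi>_hom] by simp_all

lemma \<pi>_zero: "\<zero>\<^bsub>R\<^esub> = \<pi> (\<lambda>r. 0)"
  using Ring.ring_hom_zero[OF \<pi>_hom N.ring_axioms R.ring_axioms] by simp

lemma \<pi>_mem: 
  assumes "cauchy_on L v s" shows "t \<in> \<pi> s \<longleftrightarrow> range t \<subseteq> L \<and> null_on v (\<lambda>r. t r - s r)"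
proof -
  have s: "s r \<in> L" for r using cauchy_mem[OF assms] .
  have "t \<in> \<pi> s \<longleftrightarrow> (\<exists>h\<in>N. t = (\<lambda>r. h r + s r))"
    unfolding to_completion_def a_r_coset_def' by auto
  also have "\<dots> \<longleftrightarrow> (\<lambda>r. t r - s r) \<in> N"
  proof
    assume "\<exists>h\<in>N. t = (\<lambda>r. h r + s r)"
    then show "(\<lambda>r. t r - s r) \<in> N" by auto
  next
    assume "(\<lambda>r. t r - s r) \<in> N"
    then show "\<exists>h\<in>N. t = (\<lambda>r. h r + s r)" by (rule bexI[rotated]) simp
  qed
  also have "\<dots> \<longleftrightarrow> range t \<subseteq> L \<and> null_on v (\<lambda>r. t r - s r)"
    unfolding null_sequences_iff using s is_subfieldD(3,7)[OF L]
    by (metis (no_types, lifting) diff_add_cancel image_subset_iff range_subsetD)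
  finally show ?thesis .
qed

lemma \<pi>_self: "cauchy_on L v s \<Longrightarrow> s \<in> \<pi> s"
  using \<pi>_mem[of s s] cauchy_mem[of s] null_zero by auto

lemma \<pi>_eq:
  assumes s: "cauchy_on L v s" and t: "cauchy_on L v t"
  shows "\<pi> s = \<pi> t \<longleftrightarrow> null_on v (\<lambda>r. s r - t r)"
proof
  assume "\<pi> s = \<pi> t"
  then have "s \<in> \<pi> t" using \<pi>_self[OF s] by simp
  then show "null_on v (\<lambda>r. s r - t r)" using \<pi>_mem[OF t] by simp
next
  assume "null_on v (\<lambda>r. s r - t r)"
  then have "s \<in> \<pi> t" using \<pi>_mem[OF t] cauchy_mem[OF s] by auto
  then have "N +>\<^bsub>C\<^esub> t = N +>\<^bsub>C\<^esub> s"
    using t by (intro N.a_repr_independence') (auto simp: to_completion_def)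
  then show "\<pi> s = \<pi> t" unfolding to_completion_def by simp
qed

text \<open>All representatives of a class share the limit of their absolute values, which makes the
  description in \<open>completion_abs\<close> determinate.\<close>

lemma completion_abs_\<pi>:
  assumes s: "cauchy_on L v s" and l: "(\<lambda>r. v (s r)) \<longlonglongrightarrow> l"
  shows "completion_abs v (\<pi> s) = l"
  unfolding completion_abs_def
proof (rule the_equality)
  show "\<exists>t\<in>\<pi> s. (\<lambda>r. v (t r)) \<longlonglongrightarrow> l" using \<pi>_self[OF s] l by blast
  fix l' assume "\<exists>t\<in>\<pi> s. (\<lambda>r. v (t r)) \<longlonglongrightarrow> l'"
  then obtain t where t: "t \<in> \<pi> s" "(\<lambda>r. v (t r)) \<longlonglongrightarrow> l'" by blast
  have "(\<lambda>r. v (t r)) \<longlonglongrightarrow> l"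
    by (rule null_limit_eq[of t s]) (use t s l \<pi>_mem[OF s] cauchy_mem[OF s] in auto)
  then show "l' = l" using t LIMSEQ_unique by blast
qed

lemma \<pi>_sum:
  "finite I \<Longrightarrow> (\<And>i. i \<in> I \<Longrightarrow> cauchy_on L v (s i)) \<Longrightarrow> (\<Oplus>\<^bsub>R\<^esub>i\<in>I. \<pi> (s i)) = \<pi> (\<lambda>r. \<Sum>i\<in>I. s i r)"
proof (induction I rule: finite_induct)
  case (insert i I)
  then show ?case by (simp add: R.finsum_insert \<pi>_add cauchy_sum)
qed (simp add: \<pi>_zero)

lemma \<pi>_prod:
  "finite I \<Longrightarrow> (\<And>i. i \<in> I \<Longrightarrow> cauchy_on L v (s i)) \<Longrightarrow> (\<Otimes>\<^bsub>R\<^esub>i\<in>I. \<pi> (s i)) = \<pi> (\<lambda>r. \<Prod>i\<in>I. s i r)"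
proof (induction I rule: finite_induct)
  case (insert i I)
  then show ?case by (simp add: R.finprod_insert \<pi>_mult cauchy_prod)
qed (simp add: \<pi>_one)

lemma \<pi>_minus: assumes s: "cauchy_on L v s" shows "\<ominus>\<^bsub>R\<^esub> (\<pi> s) = \<pi> (\<lambda>r. - s r)"
proof (rule R.minus_equality)
  show "\<pi> (\<lambda>r. - s r) \<oplus>\<^bsub>R\<^esub> \<pi> s = \<zero>\<^bsub>R\<^esub>" using \<pi>_add[OF cauchy_uminus[OF s] s] \<pi>_zero by simp
qed (use s cauchy_uminus in auto)

text \<open>A Cauchy sequence that is not null is eventually bounded away from 0. Finitely many zero
  terms at the start cause no trouble: \<open>inverse 0 = 0\<close> keeps the sequence defined, and
  the Cauchy condition only concerns the tail.\<close>

lemma cauchy_inverse: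
  assumes s: "cauchy_on L v s" and nn: "\<not> null_on v s"
  shows "cauchy_on L v (\<lambda>r. inverse (s r))" "null_on v (\<lambda>r. s r * inverse (s r) - 1)"
proof -
  note sm = cauchy_mem[OF s] and LD = is_subfieldD[OF L]
  have im: "inverse (s r) \<in> L" for r using LD(6)[OF sm] .
  obtain l where l: "(\<lambda>r. v (s r)) \<longlonglongrightarrow> l" using cauchy_convergent[OF s] .
  have "l \<ge> 0" by (rule LIMSEQ_le_const[OF l]) (use v_nonneg sm in auto)
  then have l0: "l > 0" using l nn unfolding null_on_def by (cases "l = 0") auto
  define \<delta> where "\<delta> = l / 2"
  have \<delta>: "\<delta> > 0" "\<delta> < l" using l0 unfolding \<delta>_def by auto
  obtain M where M: "\<And>r. r \<ge> M \<Longrightarrow> v (s r) > \<delta>"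
    using order_tendstoD(1)[OF l \<delta>(2)] by (auto simp: eventually_sequentially)
  have nz: "s r \<noteq> 0" if "r \<ge> M" for r using M[OF that] \<delta> v_0 by auto
  show "cauchy_on L v (\<lambda>r. inverse (s r))"
    unfolding cauchy_on_def
  proof (intro conjI allI impI)
    show "range (\<lambda>r. inverse (s r)) \<subseteq> L" using im by auto
    fix e :: real assume "0 < e"
    then have "0 < e * (\<delta> * \<delta>)" using \<delta> by simp
    then obtain K where K: "\<forall>m\<ge>K. \<forall>n\<ge>K. v (s m - s n) < e * (\<delta> * \<delta>)" using s unfolding cauchy_on_def by blast
    have "v (inverse (s m) - inverse (s n)) < e" if mn: "m \<ge> max K M" "n \<ge> max K M" for m n
    proof -
      have nzm: "s m \<noteq> 0" "s n \<noteq> 0" using nz mn by auto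
      have "inverse (s m) - inverse (s n) = (s n - s m) * (inverse (s m) * inverse (s n))"
        using nzm by (simp add: field_simps)
      then have "v (inverse (s m) - inverse (s n)) = v (s n - s m) * (inverse (v (s m)) * inverse (v (s n)))"
        using v_mult[OF LD(7)[OF sm sm] LD(4)[OF im im]] v_mult[OF im im] v_inverse[OF sm] by simp
      also have "\<dots> \<le> v (s n - s m) * (inverse \<delta> * inverse \<delta>)"
      proof (intro mult_left_mono mult_mono)
        show "inverse (v (s m)) \<le> inverse \<delta>" "inverse (v (s n)) \<le> inverse \<delta>"
          using M[of m] M[of n] mn \<delta> by (auto intro!: le_imp_inverse_le less_imp_le)
      qed (use \<delta> v_nonneg[OF sm] v_nonneg[OF LD(7)[OF sm sm]] in auto)
      also have "\<dots> < e * (\<delta> * \<delta>) * (inverse \<delta> * inverse \<delta>)"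
        using K mn \<delta> by (intro mult_strict_right_mono) auto
      also have "\<dots> = e" using \<delta> by (simp add: field_simps)
      finally show ?thesis .
    qed
    then show "\<exists>N. \<forall>m\<ge>N. \<forall>n\<ge>N. v (inverse (s m) - inverse (s n)) < e" by blast
  qed
  show "null_on v (\<lambda>r. s r * inverse (s r) - 1)"
    unfolding null_on_def
  proof (rule tendsto_eventually)
    show "\<forall>\<^sub>F r in sequentially. v (s r * inverse (s r) - 1) = 0"
      using eventually_ge_at_top[of M] by eventually_elim (simp add: nz v_0)
  qed
qed

lemma \<pi>_inverse:
  assumes s: "cauchy_on L v s" and nz: "\<pi> s \<noteq> \<zero>\<^bsub>R\<^esub>"
  shows "cauchy_on L v (\<lambda>r. inverse (s r))" "\<pi> s \<otimes>\<^bsub>R\<^esub> \<pi> (\<lambda>r. inverse (s r)) = \<one>\<^bsub>R\<^esub>"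
proof -
  have one: "cauchy_on L v (\<lambda>r. 1)" and zero: "cauchy_on L v (\<lambda>r. 0)"
    using cauchy_const is_subfieldD(1,2)[OF L] by blast+
  have nn: "\<not> null_on v s" using nz \<pi>_eq[OF s zero] unfolding \<pi>_zero by simp
  show i: "cauchy_on L v (\<lambda>r. inverse (s r))" by (rule cauchy_inverse(1)[OF s nn])
  show "\<pi> s \<otimes>\<^bsub>R\<^esub> \<pi> (\<lambda>r. inverse (s r)) = \<one>\<^bsub>R\<^esub>"
    unfolding \<pi>_mult[OF s i] \<pi>_one \<pi>_eq[OF cauchy_mult[OF s i] one] by (rule cauchy_inverse(2)[OF s nn])
qed

lemma field_R: "field R"
proof (rule R.cring_fieldI2)
  have one: "cauchy_on L v (\<lambda>r. 1)" and zero: "cauchy_on L v (\<lambda>r. 0)"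
    using cauchy_const is_subfieldD(1,2)[OF L] by blast+
  show "\<zero>\<^bsub>R\<^esub> \<noteq> \<one>\<^bsub>R\<^esub>"
  proof
    assume "\<zero>\<^bsub>R\<^esub> = \<one>\<^bsub>R\<^esub>"
    then have "null_on v (\<lambda>r. 0 - 1)" unfolding \<pi>_zero \<pi>_one using \<pi>_eq[OF zero one] by simp
    then show False unfolding null_on_def by (simp add: v_minus_1 LIMSEQ_const_iff)
  qed
  fix a assume a: "a \<in> carrier R" "a \<noteq> \<zero>\<^bsub>R\<^esub>"
  then obtain s where s: "cauchy_on L v s" "a = \<pi> s" unfolding carrier_R by auto
  show "\<exists>b\<in>carrier R. a \<otimes>\<^bsub>R\<^esub> b = \<one>\<^bsub>R\<^esub>"
    using \<pi>_inverse[OF s(1)] a s by (intro bexI[of _ "\<pi> (\<lambda>r. inverse (s r))"]) auto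
qed

lemma completion_rat_iff:
  "x \<in> completion_rat L v \<longleftrightarrow> (\<exists>s. cauchy_on L v s \<and> range s \<subseteq> \<rat> \<and> x = \<pi> s)"
  unfolding completion_rat_def by auto

lemma subfield_completion_rat: "subfield (completion_rat L v) R"
proof -
  interpret R: field R by (rule field_R)
  have one: "cauchy_on L v (\<lambda>r. 1)" using cauchy_const is_subfieldD(2)[OF L] by blast
  show ?thesis
  proof (rule R.subfieldI')
    show "subring (completion_rat L v) R"
    proof (rule R.subringI)
      show "completion_rat L v \<subseteq> carrier R" by (auto simp: completion_rat_iff carrier_R)
      show "\<one>\<^bsub>R\<^esub> \<in> completion_rat L v" unfolding completion_rat_iff \<pi>_one using one by (intro exI[of _ "\<lambda>r. 1"]) auto
      fix x assume "x \<in> completion_rat L v"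
      then obtain s where s: "cauchy_on L v s" "range s \<subseteq> \<rat>" "x = \<pi> s" unfolding completion_rat_iff by auto
      show "\<ominus>\<^bsub>R\<^esub> x \<in> completion_rat L v"
        unfolding completion_rat_iff s(3) \<pi>_minus[OF s(1)] using cauchy_uminus[OF s(1)] s(2)
        by (intro exI[of _ "\<lambda>r. - s r"]) auto
      fix y assume "y \<in> completion_rat L v"
      then obtain t where t: "cauchy_on L v t" "range t \<subseteq> \<rat>" "y = \<pi> t" unfolding completion_rat_iff by auto
      show "x \<otimes>\<^bsub>R\<^esub> y \<in> completion_rat L v"
        unfolding completion_rat_iff s(3) t(3) \<pi>_mult[OF s(1) t(1)] using cauchy_mult[OF s(1) t(1)] s(2) t(2)
        by (intro exI[of _ "\<lambda>r. s r * t r"]) (auto intro: Rats_mult)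
      show "x \<oplus>\<^bsub>R\<^esub> y \<in> completion_rat L v"
        unfolding completion_rat_iff s(3) t(3) \<pi>_add[OF s(1) t(1)] using cauchy_add[OF s(1) t(1)] s(2) t(2)
        by (intro exI[of _ "\<lambda>r. s r + t r"]) (auto intro: Rats_add)
    qed
    fix k assume k: "k \<in> completion_rat L v - {\<zero>\<^bsub>R\<^esub>}"
    then have "k \<in> completion_rat L v" by blast
    then obtain s where s: "cauchy_on L v s" "range s \<subseteq> \<rat>" "k = \<pi> s" unfolding completion_rat_iff by auto
    have nz: "\<pi> s \<noteq> \<zero>\<^bsub>R\<^esub>" using k s by auto
    note i = \<pi>_inverse[OF s(1) nz]
    have "inv\<^bsub>R\<^esub> k = \<pi> (\<lambda>r. inverse (s r))"
      unfolding s(3) by (rule R.comm_inv_char[symmetric, THEN sym]) (use i s in auto)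
    then show "inv\<^bsub>R\<^esub> k \<in> completion_rat L v"
      unfolding completion_rat_iff using i(1) s(2) by (intro exI[of _ "\<lambda>r. inverse (s r)"]) (auto intro: Rats_inverse)
  qed
qed

lemma combine_\<pi>:
  "length ss = length ts \<Longrightarrow> \<forall>s\<in>set ss. cauchy_on L v s \<Longrightarrow> \<forall>t\<in>set ts. cauchy_on L v t \<Longrightarrow>
   R.combine (map \<pi> ss) (map \<pi> ts) = \<pi> (\<lambda>r. \<Sum>i<length ts. (ss ! i) r * (ts ! i) r)"
proof (induction ss ts rule: list_induct2)
  case (Cons s ss t ts)
  have "cauchy_on L v (\<lambda>r. \<Sum>i<length ts. (ss ! i) r * (ts ! i) r)"
    using Cons by (intro cauchy_sum cauchy_mult) auto
  then show ?case using Cons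
    by (simp add: \<pi>_mult \<pi>_add cauchy_mult sum.lessThan_Suc_shift del: sum.lessThan_Suc)
qed (simp add: \<pi>_zero)

lemma combine_\<pi>_upt:
  assumes "\<And>i. i < k \<Longrightarrow> cauchy_on L v (s i)" "\<And>i. i < k \<Longrightarrow> cauchy_on L v (t i)"
  shows "R.combine (map (\<lambda>i. \<pi> (s i)) [0..<k]) (map (\<lambda>i. \<pi> (t i)) [0..<k]) = \<pi> (\<lambda>r. \<Sum>i<k. s i r * t i r)"
  using combine_\<pi>[of "map s [0..<k]" "map t [0..<k]"] assms by (simp add: o_def)

end

lemma add_pow_sign:
  assumes "ring R" "x \<in> carrier R"
  shows "[sign p] \<cdot>\<^bsub>R\<^esub> x = (if sign p = 1 then x else \<ominus>\<^bsub>R\<^esub> x)"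
proof -
  interpret ring R by fact
  have "sign p = 1 \<or> sign p = - 1" by (simp add: sign_def)
  then consider "sign p = 1" | "sign p = - 1" by blast
  then show ?thesis
  proof cases
    case 2
    then show ?thesis using add.int_pow_neg[of x 1] add.int_pow_1[of x] assms(2) by simp
  qed (use add.int_pow_1[of x] assms(2) in simp)
qed

section \<open>The field norm computed on rational representatives\<close>

context local_field
begin

abbreviation "F \<equiv> completion_rat L v"

lemma F_iff: "x \<in> F \<longleftrightarrow> (\<exists>c. cauchy_on UNIV u c \<and> x = V.\<pi> (\<lambda>r. of_rat (c r)))"
proof
  assume "x \<in> F"
  then obtain s where s: "cauchy_on L v s" "range s \<subseteq> \<rat>" "x = V.\<pi> s" unfolding V.completion_rat_iff by auto
  have "\<forall>r. \<exists>q. s r = of_rat q" using s(2) by (auto elim: Rats_cases)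
  then obtain c where c: "\<And>r. s r = of_rat (c r)" by metis
  then have "s = (\<lambda>r. of_rat (c r))" by auto
  then show "\<exists>c. cauchy_on UNIV u c \<and> x = V.\<pi> (\<lambda>r. of_rat (c r))" using s cauchy_of_rat_iff by auto
next
  assume "\<exists>c. cauchy_on UNIV u c \<and> x = V.\<pi> (\<lambda>r. of_rat (c r))"
  then obtain c where "cauchy_on UNIV u c" "x = V.\<pi> (\<lambda>r. of_rat (c r))" by auto
  then show "x \<in> F" unfolding V.completion_rat_iff using cauchy_of_rat
    by (intro exI[of _ "\<lambda>r. of_rat (c r)"]) auto
qed

lemma F_mem: "cauchy_on UNIV u c \<Longrightarrow> V.\<pi> (\<lambda>r. of_rat (c r)) \<in> F"
  unfolding F_iff by (intro exI[of _ c] conjI refl)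

text \<open>The quotient map is a ring homomorphism, so determinants may be formed termwise on
  representing sequences.\<close>

lemma leibniz_det_completion:
  assumes a: "\<And>i j. i < m \<Longrightarrow> j < m \<Longrightarrow> cauchy_on UNIV u (a i j)"
    and A: "\<And>i j. i < m \<Longrightarrow> j < m \<Longrightarrow> A i j = V.\<pi> (\<lambda>r. of_rat (a i j r))"
  shows "leibniz_det V.R m A = V.\<pi> (\<lambda>r. of_rat (leibniz m (\<lambda>i j. a i j r)))"
proof -
  let ?P = "{p. p permutes {..<m}}"
  have less: "p i < m" if "p \<in> ?P" "i < m" for p i using that permutes_in_image[of p "{..<m}" i] by simp
  have ac: "cauchy_on L v (\<lambda>r. \<Prod>i<m. of_rat (a i (p i) r))" if "p \<in> ?P" for p
    by (intro V.cauchy_prod cauchy_of_rat a) (use less[OF that] in auto)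
  have sc: "cauchy_on L v (\<lambda>r. of_int (sign p) * (\<Prod>i<m. of_rat (a i (p i) r)))" if "p \<in> ?P" for p
    using V.cauchy_mult[OF V.cauchy_const[OF of_rat_mem[of "of_int (sign p)"]] ac[OF that]] by simp
  have summand: "[sign p] \<cdot>\<^bsub>V.R\<^esub> (\<Otimes>\<^bsub>V.R\<^esub>i\<in>{..<m}. A i (p i)) = V.\<pi> (\<lambda>r. of_int (sign p) * (\<Prod>i<m. of_rat (a i (p i) r)))"
    if p: "p \<in> ?P" for p
  proof -
    have "(\<Otimes>\<^bsub>V.R\<^esub>i\<in>{..<m}. A i (p i)) = (\<Otimes>\<^bsub>V.R\<^esub>i\<in>{..<m}. V.\<pi> (\<lambda>r. of_rat (a i (p i) r)))"
      by (rule V.R.finprod_cong') (use A less[OF p] a cauchy_of_rat in auto)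
    also have "\<dots> = V.\<pi> (\<lambda>r. \<Prod>i<m. of_rat (a i (p i) r))"
      by (rule V.\<pi>_prod) (use less[OF p] a cauchy_of_rat in auto)
    finally have eq: "(\<Otimes>\<^bsub>V.R\<^esub>i\<in>{..<m}. A i (p i)) = V.\<pi> (\<lambda>r. \<Prod>i<m. of_rat (a i (p i) r))" .
    have "sign p = 1 \<or> sign p = - 1" by (simp add: sign_def)
    then show ?thesis
      unfolding eq add_pow_sign[OF V.R.ring_axioms V.\<pi>_closed[OF ac[OF p]]]
      by (elim disjE) (simp_all add: V.\<pi>_minus[OF ac[OF p]])
  qed
  have "leibniz_det V.R m A = (\<Oplus>\<^bsub>V.R\<^esub>p\<in>?P. V.\<pi> (\<lambda>r. of_int (sign p) * (\<Prod>i<m. of_rat (a i (p i) r))))"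
    unfolding leibniz_det_def by (rule V.R.finsum_cong') (use summand sc in auto)
  also have "\<dots> = V.\<pi> (\<lambda>r. \<Sum>p\<in>?P. of_int (sign p) * (\<Prod>i<m. of_rat (a i (p i) r)))"
    by (rule V.\<pi>_sum) (use sc in \<open>auto simp: finite_permutations\<close>)
  also have "\<dots> = V.\<pi> (\<lambda>r. of_rat (leibniz m (\<lambda>i j. a i j r)))"
  proof -
    have "of_rat (\<Prod>i\<in>I. f i) = (\<Prod>i\<in>I. (of_rat (f i) :: 'a))" for I and f :: "nat \<Rightarrow> rat"
      by (induction I rule: infinite_finite_induct) (simp_all add: of_rat_mult)
    then show ?thesis unfolding leibniz_def by (simp add: of_rat_sum of_rat_mult)
  qed
  finally show ?thesis .
qed

lemma F_listE:
  assumes "set Ks \<subseteq> F"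
  obtains c where "Ks = map (\<lambda>k. V.\<pi> (\<lambda>r. of_rat (c k r))) [0..<length Ks]" "\<forall>k<length Ks. cauchy_on UNIV u (c k)"
proof -
  have "\<forall>k. \<exists>c. k < length Ks \<longrightarrow> cauchy_on UNIV u c \<and> Ks ! k = V.\<pi> (\<lambda>r. of_rat (c r))"
  proof
    fix k
    show "\<exists>c. k < length Ks \<longrightarrow> cauchy_on UNIV u c \<and> Ks ! k = V.\<pi> (\<lambda>r. of_rat (c r))"
    proof (cases "k < length Ks")
      case True
      then have "Ks ! k \<in> F" using assms nth_mem by blast
      then show ?thesis unfolding F_iff by simp
    qed simp
  qed
  from choice[OF this] obtain c where c: "\<forall>k. k < length Ks \<longrightarrow> cauchy_on UNIV u (c k) \<and> Ks ! k = V.\<pi> (\<lambda>r. of_rat (c k r))" ..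
  show thesis
  proof (rule that)
    show "Ks = map (\<lambda>k. V.\<pi> (\<lambda>r. of_rat (c k r))) [0..<length Ks]"
      by (rule nth_equalityI) (use c in simp_all)
  qed (use c in simp)
qed

text \<open>By \<open>coordinates\<close> the constant sequences of the global basis
  \<open>e\<close> span the completion. They are dependent whenever \<open>T\<close> is smaller than
  \<open>J\<close>, so a basis is filtered out of them.\<close>

lemma completion_basis_exists:
  "\<exists>us. set us \<subseteq> carrier V.R \<and> ring.independent V.R F us \<and> ring.Span V.R F us = carrier V.R"
proof -
  define us where "us = map (\<lambda>i. V.\<pi> (\<lambda>r. e i)) [0..<n]"
  have ce: "cauchy_on L v (\<lambda>r. e i)" if "i < n" for i by (rule V.cauchy_const[OF basis_mem[OF that]])
  have us: "set us \<subseteq> carrier V.R" unfolding us_def using ce by auto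
  have "carrier V.R \<subseteq> V.R.Span F us"
  proof
    fix x assume "x \<in> carrier V.R"
    then obtain s where s: "cauchy_on L v s" "x = V.\<pi> s" using V.carrier_R by auto
    obtain l where l: "\<And>i. i < n \<Longrightarrow> cauchy_on UNIV u (l i)"
      "\<And>i. i < n \<Longrightarrow> null_on w (\<lambda>r. of_rat (l i r) - (\<Sum>\<tau>\<in>T. \<tau> (s r * dual i)))"
      "null_on v (\<lambda>r. s r - (\<Sum>i<n. of_rat (l i r) * e i))" by (rule coordinates[OF s(1)]) (rule that)
    let ?Ks = "map (\<lambda>i. V.\<pi> (\<lambda>r. of_rat (l i r))) [0..<n]"
    have comb: "V.R.combine ?Ks us = V.\<pi> (\<lambda>r. \<Sum>i<n. of_rat (l i r) * e i)"
      unfolding us_def by (rule V.combine_\<pi>_upt) (simp_all add: cauchy_of_rat l(1) ce)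
    have sc: "cauchy_on L v (\<lambda>r. \<Sum>i<n. of_rat (l i r) * e i)"
      by (intro V.cauchy_sum V.cauchy_mult cauchy_of_rat l(1) ce) auto
    have "x = V.R.combine ?Ks us" unfolding comb s(2) V.\<pi>_eq[OF s(1) sc] by (rule l(3))
    moreover have "set ?Ks \<subseteq> F" using F_mem[OF l(1)] by (simp add: image_subset_iff)
    moreover have "length ?Ks = length us" unfolding us_def by simp
    ultimately show "x \<in> V.R.Span F us"
      unfolding V.R.Span_mem_iff_length_version[OF V.subfield_completion_rat us] by (intro exI[of _ ?Ks] conjI)
  qed
  then have span: "V.R.Span F us = carrier V.R"
    using V.R.Span_in_carrier[OF subfieldE(3)[OF V.subfield_completion_rat] us] by (simp only: subset_antisym)
  obtain Vs where Vs: "set Vs \<subseteq> carrier V.R" "V.R.independent F Vs" "V.R.Span F Vs = V.R.Span F us"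
    by (rule V.R.filter_base[OF V.subfield_completion_rat us]) (rule that)
  show ?thesis by (rule exI[of _ Vs], unfold Vs(3) span, intro conjI Vs refl)
qed

text \<open>Stated for an arbitrary basis because \<open>field_norm\<close> selects one by choice,
  about which nothing further is known.\<close>

lemma completion_basis_of_list:
  assumes us: "set us \<subseteq> carrier V.R" "ring.independent V.R F us" "ring.Span V.R F us = carrier V.R"
  obtains b where "us = map (\<lambda>k. V.\<pi> (b k)) [0..<length us]" "completion_basis L n e u w v (length us) b"
proof -
  define m where "m = length us"
  have "\<forall>k. \<exists>s. k < m \<longrightarrow> cauchy_on L v s \<and> us ! k = V.\<pi> s"
  proof
    fix k
    show "\<exists>s. k < m \<longrightarrow> cauchy_on L v s \<and> us ! k = V.\<pi> s"
    proof (cases "k < m")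
      case True
      then have "us ! k \<in> carrier V.R" using us(1) nth_mem unfolding m_def by blast
      then show ?thesis unfolding V.carrier_R by simp
    qed simp
  qed
  from choice[OF this] obtain b where b: "\<forall>k. k < m \<longrightarrow> cauchy_on L v (b k) \<and> us ! k = V.\<pi> (b k)" ..
  have us_b: "us = map (\<lambda>k. V.\<pi> (b k)) [0..<m]"
    by (rule nth_equalityI) (use b m_def in simp_all)
  have bc: "cauchy_on L v (b k)" if "k < m" for k using b that by simp
  have zero: "cauchy_on L v (\<lambda>r. 0)" using V.cauchy_const is_subfieldD(1)[OF L] by blast
  have comb: "V.R.combine (map (\<lambda>k. V.\<pi> (\<lambda>r. of_rat (c k r))) [0..<m]) us = V.\<pi> (\<lambda>r. \<Sum>k<m. of_rat (c k r) * b k r)"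
    "cauchy_on L v (\<lambda>r. \<Sum>k<m. of_rat (c k r) * b k r)"
    if "\<forall>k<m. cauchy_on UNIV u (c k)" for c
  proof -
    have c: "cauchy_on UNIV u (c k)" if "k < m" for k using \<open>\<forall>k<m. cauchy_on UNIV u (c k)\<close> that by simp
    show "V.R.combine (map (\<lambda>k. V.\<pi> (\<lambda>r. of_rat (c k r))) [0..<m]) us = V.\<pi> (\<lambda>r. \<Sum>k<m. of_rat (c k r) * b k r)"
      unfolding us_b by (rule V.combine_\<pi>_upt) (simp_all add: cauchy_of_rat c bc)
    show "cauchy_on L v (\<lambda>r. \<Sum>k<m. of_rat (c k r) * b k r)"
      by (intro V.cauchy_sum V.cauchy_mult cauchy_of_rat c bc) auto
  qed
  have "completion_basis L n e u w v m b"
  proof (unfold_locales, goal_cases)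
    case (1 k)
    then show ?case by (rule bc)
  next
    case (2 c)
    let ?Ks = "map (\<lambda>k. V.\<pi> (\<lambda>r. of_rat (c k r))) [0..<m]"
    have cc: "\<forall>k<m. cauchy_on UNIV u (c k)" using 2(1) by simp
    have z: "V.R.combine ?Ks us = \<zero>\<^bsub>V.R\<^esub>"
      unfolding comb(1)[OF cc] V.\<pi>_zero V.\<pi>_eq[OF comb(2)[OF cc] zero] using 2(2) by simp
    have KF: "set ?Ks \<subseteq> F" using F_mem[OF 2(1)] by (simp add: image_subset_iff)
    have "set (take (length us) ?Ks) \<subseteq> {\<zero>\<^bsub>V.R\<^esub>}"
      by (rule V.R.independent_imp_trivial_combine[OF V.subfield_completion_rat us(2) KF z])
    then have triv: "V.\<pi> (\<lambda>r. of_rat (c k r)) = \<zero>\<^bsub>V.R\<^esub>" if "k < m" for k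
      using that unfolding m_def[symmetric] by (simp add: image_subset_iff)
    show ?case
    proof (intro allI impI)
      fix k assume k: "k < m"
      have "null_on v (\<lambda>r. of_rat (c k r) - 0)"
        using triv[OF k] unfolding V.\<pi>_zero V.\<pi>_eq[OF cauchy_of_rat[OF 2(1)[OF k]] zero] .
      then show "null_on u (c k)" unfolding null_on_def by (simp add: v_rat)
    qed
  next
    case (3 s)
    have "V.\<pi> s \<in> V.R.Span F us" unfolding us(3) by (rule V.\<pi>_closed[OF 3])
    then obtain Ks where Ks: "set Ks \<subseteq> F" "length Ks = m" "V.\<pi> s = V.R.combine Ks us"
      unfolding V.R.Span_mem_iff_length_version[OF V.subfield_completion_rat us(1)] m_def[symmetric] by (elim exE conjE) (rule that)
    obtain c where c: "Ks = map (\<lambda>k. V.\<pi> (\<lambda>r. of_rat (c k r))) [0..<m]" "\<forall>k<m. cauchy_on UNIV u (c k)"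
      by (rule F_listE[OF Ks(1), unfolded Ks(2)]) (rule that)
    have "V.\<pi> s = V.\<pi> (\<lambda>r. \<Sum>k<m. of_rat (c k r) * b k r)"
      using Ks(3) unfolding c(1) comb(1)[OF c(2)] .
    then have "null_on v (\<lambda>r. s r - (\<Sum>k<m. of_rat (c k r) * b k r))"
      unfolding V.\<pi>_eq[OF 3 comb(2)[OF c(2)]] .
    then show ?case using c(2) by (intro exI[of _ c]) simp
  qed
  then show thesis using that us_b unfolding m_def by blast
qed

text \<open>For whatever basis and matrix \<open>field_norm\<close> selects, the entries have
  rational Cauchy representatives to which \<open>local_norm\<close> applies. The size of the basis
  is then replaced by \<open>card T\<close>.\<close>

theorem completion_abs_field_norm:
  assumes x: "x \<in> L"
  shows "completion_abs v (field_norm V.R F (V.\<pi> (\<lambda>r. x))) = v x ^ card T"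
proof -
  let ?us = "SOME us. set us \<subseteq> carrier V.R \<and> ring.independent V.R F us \<and> ring.Span V.R F us = carrier V.R"
  define us where "us = ?us"
  define m where "m = length us"
  have us: "set us \<subseteq> carrier V.R" "ring.independent V.R F us" "ring.Span V.R F us = carrier V.R"
    using someI_ex[OF completion_basis_exists] unfolding us_def by blast+
  obtain b where b: "us = map (\<lambda>k. V.\<pi> (b k)) [0..<m]" "completion_basis L n e u w v m b"
    by (rule completion_basis_of_list[OF us, folded m_def]) (rule that)
  interpret B: completion_basis L n e u w v m b by (rule b(2))
  have usk: "us ! k = V.\<pi> (b k)" if "k < m" for k unfolding b(1) using that by simp
  let ?x = "V.\<pi> (\<lambda>r. x)"
  define P where "P A \<longleftrightarrow> (\<forall>j<m. (\<forall>i<m. A i j \<in> F) \<and>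
      ?x \<otimes>\<^bsub>V.R\<^esub> us ! j = (\<Oplus>\<^bsub>V.R\<^esub>i\<in>{..<m}. A i j \<otimes>\<^bsub>V.R\<^esub> us ! i))" for A
  have cx: "cauchy_on L v (\<lambda>r. x)" by (rule V.cauchy_const[OF x])
  have lhs: "?x \<otimes>\<^bsub>V.R\<^esub> us ! j = V.\<pi> (\<lambda>r. x * b j r)" "cauchy_on L v (\<lambda>r. x * b j r)" if "j < m" for j
    using V.\<pi>_mult[OF cx B.b_cauchy[OF that]] V.cauchy_mult[OF cx B.b_cauchy[OF that]] usk[OF that] by simp_all
  have rhs: "(\<Oplus>\<^bsub>V.R\<^esub>i\<in>{..<m}. V.\<pi> (\<lambda>r. of_rat (f i r)) \<otimes>\<^bsub>V.R\<^esub> us ! i) = V.\<pi> (\<lambda>r. \<Sum>i<m. of_rat (f i r) * b i r)"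
    "cauchy_on L v (\<lambda>r. \<Sum>i<m. of_rat (f i r) * b i r)"
    if "\<forall>i<m. cauchy_on UNIV u (f i)" for f
  proof -
    have a: "cauchy_on UNIV u (f i)" if "i < m" for i using \<open>\<forall>i<m. cauchy_on UNIV u (f i)\<close> that by simp
    have c: "cauchy_on L v (\<lambda>r. of_rat (f i r) * b i r)" if "i < m" for i
      by (rule V.cauchy_mult[OF cauchy_of_rat[OF a[OF that]] B.b_cauchy[OF that]])
    have "(\<Oplus>\<^bsub>V.R\<^esub>i\<in>{..<m}. V.\<pi> (\<lambda>r. of_rat (f i r)) \<otimes>\<^bsub>V.R\<^esub> us ! i) = (\<Oplus>\<^bsub>V.R\<^esub>i\<in>{..<m}. V.\<pi> (\<lambda>r. of_rat (f i r) * b i r))"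
    proof (rule V.R.finsum_cong'[OF refl])
      show "(\<lambda>i. V.\<pi> (\<lambda>r. of_rat (f i r) * b i r)) \<in> {..<m} \<rightarrow> carrier V.R" by (intro Pi_I V.\<pi>_closed c) simp
      fix i assume "i \<in> {..<m}"
      then have i: "i < m" by simp
      show "V.\<pi> (\<lambda>r. of_rat (f i r)) \<otimes>\<^bsub>V.R\<^esub> us ! i = V.\<pi> (\<lambda>r. of_rat (f i r) * b i r)"
        unfolding usk[OF i] by (rule V.\<pi>_mult[OF cauchy_of_rat[OF a[OF i]] B.b_cauchy[OF i]])
    qed
    also have "\<dots> = V.\<pi> (\<lambda>r. \<Sum>i<m. of_rat (f i r) * b i r)" by (rule V.\<pi>_sum) (simp_all add: c)
    finally show "(\<Oplus>\<^bsub>V.R\<^esub>i\<in>{..<m}. V.\<pi> (\<lambda>r. of_rat (f i r)) \<otimes>\<^bsub>V.R\<^esub> us ! i) = V.\<pi> (\<lambda>r. \<Sum>i<m. of_rat (f i r) * b i r)" .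
    show "cauchy_on L v (\<lambda>r. \<Sum>i<m. of_rat (f i r) * b i r)"
      by (rule V.cauchy_sum) (use c in auto)
  qed
  obtain a0 where a0: "B.represents x a0" using B.represents_exists[OF x] by blast
  \<comment> \<open>Shows that some matrix of multiplication exists, so that the choice inside
    \<open>field_norm\<close> satisfies its specification. What follows concerns the chosen matrix
    \<open>A\<close>.\<close>
  have "P (\<lambda>i j. V.\<pi> (\<lambda>r. of_rat (a0 i j r)))"
    unfolding P_def
  proof (intro allI impI conjI)
    fix j assume j: "j < m"
    have ca: "\<forall>i<m. cauchy_on UNIV u (a0 i j)" using B.represents_cauchy[OF a0 _ j] by simp
    show "V.\<pi> (\<lambda>r. of_rat (a0 i j r)) \<in> F" if "i < m" for i by (rule F_mem) (use ca that in simp)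
    show "?x \<otimes>\<^bsub>V.R\<^esub> us ! j = (\<Oplus>\<^bsub>V.R\<^esub>i\<in>{..<m}. V.\<pi> (\<lambda>r. of_rat (a0 i j r)) \<otimes>\<^bsub>V.R\<^esub> us ! i)"
      unfolding rhs(1)[of "\<lambda>i. a0 i j", OF ca] lhs(1)[OF j] V.\<pi>_eq[OF lhs(2)[OF j] rhs(2)[of "\<lambda>i. a0 i j", OF ca]]
      using a0 j unfolding B.represents_def by blast
  qed
  then have ex: "Ex P" by blast
  define A where "A = (SOME A. P A)"
  have PA: "P A" unfolding A_def using ex by (rule someI_ex)
  have AF: "A i j \<in> F" if "i < m" "j < m" for i j using PA that unfolding P_def by blast
  have Aeq: "?x \<otimes>\<^bsub>V.R\<^esub> us ! j = (\<Oplus>\<^bsub>V.R\<^esub>i\<in>{..<m}. A i j \<otimes>\<^bsub>V.R\<^esub> us ! i)" if "j < m" for j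
    using PA that unfolding P_def by blast
  \<comment> \<open>Rational Cauchy sequences for the entries of \<open>A\<close>, which the norm
    computation requires.\<close>
  define a where "a i j = (SOME c. cauchy_on UNIV u c \<and> A i j = V.\<pi> (\<lambda>r. of_rat (c r)))" for i j
  have a: "cauchy_on UNIV u (a i j) \<and> A i j = V.\<pi> (\<lambda>r. of_rat (a i j r))" if "i < m" "j < m" for i j
    using AF[OF that] unfolding F_iff a_def by (rule someI_ex)
  have rep: "B.represents x a"
    unfolding B.represents_def
  proof (intro conjI allI impI)
    fix j assume j: "j < m"
    have ca: "\<forall>i<m. cauchy_on UNIV u (a i j)" using a j by simp
    have "(\<Oplus>\<^bsub>V.R\<^esub>i\<in>{..<m}. A i j \<otimes>\<^bsub>V.R\<^esub> us ! i) = (\<Oplus>\<^bsub>V.R\<^esub>i\<in>{..<m}. V.\<pi> (\<lambda>r. of_rat (a i j r)) \<otimes>\<^bsub>V.R\<^esub> us ! i)"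
    proof (rule V.R.finsum_cong'[OF refl])
      show "(\<lambda>i. V.\<pi> (\<lambda>r. of_rat (a i j r)) \<otimes>\<^bsub>V.R\<^esub> us ! i) \<in> {..<m} \<rightarrow> carrier V.R"
        by (intro Pi_I V.R.m_closed V.\<pi>_closed cauchy_of_rat) (simp_all add: usk B.b_cauchy ca)
      show "A i j \<otimes>\<^bsub>V.R\<^esub> us ! i = V.\<pi> (\<lambda>r. of_rat (a i j r)) \<otimes>\<^bsub>V.R\<^esub> us ! i" if "i \<in> {..<m}" for i
        using a that j by simp
    qed
    then have "V.\<pi> (\<lambda>r. x * b j r) = V.\<pi> (\<lambda>r. \<Sum>i<m. of_rat (a i j r) * b i r)"
      using Aeq[OF j] unfolding lhs(1)[OF j] rhs(1)[of "\<lambda>i. a i j", OF ca] by simp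
    then show "null_on v (\<lambda>r. x * b j r - (\<Sum>i<m. of_rat (a i j r) * b i r))"
      unfolding V.\<pi>_eq[OF lhs(2)[OF j] rhs(2)[of "\<lambda>i. a i j", OF ca]] .
  qed (use a in blast)
  have "field_norm V.R F ?x = leibniz_det V.R m A"
    unfolding field_norm_def Let_def us_def[symmetric] m_def[symmetric] A_def P_def ..
  also have "\<dots> = V.\<pi> (\<lambda>r. of_rat (leibniz m (\<lambda>i j. a i j r)))"
    by (rule leibniz_det_completion) (use a in auto)
  finally have fn: "field_norm V.R F ?x = V.\<pi> (\<lambda>r. of_rat (leibniz m (\<lambda>i j. a i j r)))" .
  have lc: "cauchy_on UNIV u (\<lambda>r. leibniz m (\<lambda>i j. a i j r))" by (rule B.leibniz_cauchy) (use a in auto)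
  have "completion_abs v (V.\<pi> (\<lambda>r. of_rat (leibniz m (\<lambda>i j. a i j r)))) = v x ^ m"
    by (rule V.completion_abs_\<pi>[OF cauchy_of_rat[OF lc]]) (use B.local_norm[OF x rep] in \<open>simp add: v_rat\<close>)
  then show ?thesis unfolding fn using B.local_degree by simp
qed

end

section \<open>Places of the rational numbers\<close>

text \<open>Only the difference of the two multiplicities matters, and cancellation does not change
  it. Any fraction may therefore replace the reduced one, which allows common denominators.\<close>

lemma padic_abs_fraction:
  assumes p: "Factorial_Ring.prime p" and a: "a \<noteq> 0" and b: "b \<noteq> 0"
  shows "padic_abs p (of_int a / of_int b) = real p powi (int (multiplicity (int p) b) - int (multiplicity (int p) a))"
proof -
  let ?q = "of_int a / of_int b :: rat"
  obtain c d where cd: "quotient_of ?q = (c, d)" by (cases "quotient_of ?q")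
  have d: "d > 0" using quotient_of_denom_pos[OF cd] .
  have eq: "of_int a / of_int b = (of_int c / of_int d :: rat)" using quotient_of_div[OF cd] .
  then have "of_int a * of_int d = (of_int c * of_int b :: rat)" using b d by (simp add: field_simps)
  then have ad: "a * d = c * b" by (simp only: of_int_mult[symmetric] of_int_eq_iff)
  have c: "c \<noteq> 0" using ad a d by auto
  have pe: "prime_elem (int p)" using p by (simp add: prime_elem_iff_prime_abs)
  have "multiplicity (int p) a + multiplicity (int p) d = multiplicity (int p) c + multiplicity (int p) b"
    using arg_cong[OF ad, of "multiplicity (int p)"] prime_elem_multiplicity_mult_distrib[OF pe] a b c d by simp
  then have "int (multiplicity (int p) d) - int (multiplicity (int p) c) = int (multiplicity (int p) b) - int (multiplicity (int p) a)"
    by linarith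
  moreover have "?q \<noteq> 0" using a b by simp
  ultimately show ?thesis unfolding padic_abs_def cd by simp
qed

lemma rat_common_denominator:
  fixes x y :: rat
  obtains a c b :: int where "x = of_int a / of_int b" "y = of_int c / of_int b" "b \<noteq> 0"
proof -
  obtain a b where x: "quotient_of x = (a, b)" by (cases "quotient_of x")
  obtain c d where y: "quotient_of y = (c, d)" by (cases "quotient_of y")
  have bd: "b > 0" "d > 0" using quotient_of_denom_pos x y by blast+
  have "x = of_int (a * d) / of_int (b * d)" "y = of_int (c * b) / of_int (b * d)"
    using quotient_of_div[OF x] quotient_of_div[OF y] bd by (simp_all add: field_simps)
  then show thesis using that[of "a * d" "b * d" "c * b"] bd by simp
qed

lemma padic_abs_nonneg: "0 \<le> padic_abs p z" and padic_abs_0: "padic_abs p 0 = 0"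
  unfolding padic_abs_def by (auto split: prod.splits)

lemma padic_abs_mult:
  assumes p: "Factorial_Ring.prime p" shows "padic_abs p (x * y) = padic_abs p x * padic_abs p y"
proof (cases "x = 0 \<or> y = 0")
  case True
  then show ?thesis by (auto simp: padic_abs_def)
next
  case False
  obtain a c b where xy: "x = of_int a / of_int b" "y = of_int c / of_int b" "b \<noteq> 0" by (rule rat_common_denominator)
  have ac: "a \<noteq> 0" "c \<noteq> 0" using False xy by auto
  have pe: "prime_elem (int p)" using p by (simp add: prime_elem_iff_prime_abs)
  have p0: "real p \<noteq> 0" using p by (simp add: prime_gt_0_nat)
  have "padic_abs p (x * y) = padic_abs p (of_int (a * c) / of_int (b * b))" unfolding xy by simp
  also have "\<dots> = real p powi (int (multiplicity (int p) (b * b)) - int (multiplicity (int p) (a * c)))"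
    by (rule padic_abs_fraction[OF p]) (use ac xy in auto)
  also have "\<dots> = real p powi ((int (multiplicity (int p) b) - int (multiplicity (int p) a)) + (int (multiplicity (int p) b) - int (multiplicity (int p) c)))"
  proof -
    have "int (multiplicity (int p) (b * b)) - int (multiplicity (int p) (a * c)) =
        (int (multiplicity (int p) b) - int (multiplicity (int p) a)) + (int (multiplicity (int p) b) - int (multiplicity (int p) c))"
      using prime_elem_multiplicity_mult_distrib[OF pe] ac xy(3) by simp
    then show ?thesis by (simp only:)
  qed
  also have "\<dots> = padic_abs p x * padic_abs p y"
    unfolding xy padic_abs_fraction[OF p ac(1) xy(3)] padic_abs_fraction[OF p ac(2) xy(3)]
    by (rule power_int_add) (simp only: p0 simp_thms)
  finally show ?thesis .
qed

lemma padic_abs_add: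
  assumes p: "Factorial_Ring.prime p" shows "padic_abs p (x + y) \<le> max (padic_abs p x) (padic_abs p y)"
proof (cases "x = 0 \<or> y = 0 \<or> x + y = 0")
  case True
  then show ?thesis using padic_abs_nonneg[of p x] padic_abs_nonneg[of p y] 
    by (auto simp: padic_abs_0 le_max_iff_disj)
next
  case False
  obtain a c b where xy: "x = of_int a / of_int b" "y = of_int c / of_int b" "b \<noteq> 0" by (rule rat_common_denominator)
  have ac: "a \<noteq> 0" "c \<noteq> 0" using False xy by auto
  have s: "x + y = of_int (a + c) / of_int b" unfolding xy by (simp add: add_divide_distrib)
  then have ac2: "a + c \<noteq> 0" using False by auto
  have nu: "\<not> is_unit (int p)" using p by (auto dest: not_prime_unit)
  have p1: "real p \<ge> 1" using prime_ge_1_nat[OF p] by simp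
  let ?m = "min (multiplicity (int p) a) (multiplicity (int p) c)"
  have "int p ^ ?m dvd a + c" by (intro dvd_add multiplicity_dvd') auto
  then have m: "?m \<le> multiplicity (int p) (a + c)" by (intro multiplicity_geI nu ac2)
  have mono: "real p powi k \<le> real p powi l" if "k \<le> l" for k l
    using p1 that by (rule power_int_increasing[rotated])
  show ?thesis
    unfolding s padic_abs_fraction[OF p ac2 xy(3)]
    unfolding xy padic_abs_fraction[OF p ac(1) xy(3)] padic_abs_fraction[OF p ac(2) xy(3)] le_max_iff_disj
    using m by (cases "multiplicity (int p) a \<le> multiplicity (int p) c") (auto intro!: mono)
qed

lemma padic_abs_value:
  assumes p: "Factorial_Ring.prime p" shows "absolute_value_on UNIV (padic_abs p)"
proof -
  note nonneg = padic_abs_nonneg[of p]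
  have "padic_abs p z = 0 \<longleftrightarrow> z = 0" for z
    unfolding padic_abs_def using p by (auto split: prod.splits simp: prime_gt_0_nat)
  moreover have "padic_abs p (x + y) \<le> padic_abs p x + padic_abs p y" for x y
    using padic_abs_add[OF p, of x y] nonneg[of x] nonneg[of y] by linarith
  ultimately show ?thesis unfolding absolute_value_on_def using nonneg padic_abs_mult[OF p] by auto
qed

lemma padic_abs_of_int: 
  assumes "Factorial_Ring.prime p" "a \<noteq> 0" shows "padic_abs p (of_int a) = real p powi (- int (multiplicity (int p) a))"
  using padic_abs_fraction[OF assms, of 1] by simp

lemma padic_abs_prime:
  assumes p: "Factorial_Ring.prime p" and q: "Factorial_Ring.prime q"
  shows "padic_abs p (of_nat q) = (if p = q then 1 / real p else 1)"
proof -
  have "q \<noteq> 0" using q by auto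
  then have "padic_abs p (of_nat q) = real p powi (- int (multiplicity (int p) (int q)))"
    using padic_abs_of_int[OF p, of "int q"] by simp
  moreover have "multiplicity (int p) (int q) = (if p = q then 1 else 0)"
  proof (cases "p = q")
    case True
    then show ?thesis using p by (simp add: prime_elem_iff_prime_abs)
  next
    case False
    then have "\<not> int p dvd int q" using p q primes_dvd_imp_eq by auto
    then show ?thesis using False by (simp add: not_dvd_imp_multiplicity_0)
  qed
  ultimately show ?thesis by (simp add: power_int_minus field_simps)
qed

section \<open>The set of rational places and the product formula\<close>

definition arch_abs :: "rat \<Rightarrow> real" where "arch_abs q = of_rat \<bar>q\<bar>"

lemma rat_places_alt: "rat_places = insert arch_abs (padic_abs ` {p. Factorial_Ring.prime p})"
  unfolding rat_places_def arch_abs_def[abs_def] ..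

lemma arch_abs_value: "absolute_value_on UNIV arch_abs"
  unfolding absolute_value_on_def arch_abs_def
  by (auto simp: abs_mult of_rat_mult of_rat_add[symmetric] of_rat_less_eq abs_triangle_ineq)

lemma rat_places_nontrivial: assumes "u \<in> rat_places" shows "nontrivial_abs u"
proof -
  consider "u = arch_abs" | p where "Factorial_Ring.prime p" "u = padic_abs p" using assms unfolding rat_places_alt by auto
  then show ?thesis
  proof cases
    case 1
    have "arch_abs 2 > 1" unfolding arch_abs_def by simp
    then show ?thesis unfolding nontrivial_abs_def 1 using arch_abs_value by blast
  next
    case (2 p)
    note av = padic_abs_value[OF 2(1)]
    have p: "real p > 1" using prime_gt_1_nat[OF 2(1)] by simp
    have "padic_abs p (inverse (of_nat p)) = real p"
      using absolute_valueD(8)[OF av, of "of_nat p"] padic_abs_prime[OF 2(1) 2(1)] by simp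
    then show ?thesis unfolding nontrivial_abs_def 2 using av p by metis
  qed
qed

lemma inj_padic_abs: "inj_on padic_abs {p. Factorial_Ring.prime p}"
proof (rule inj_onI)
  fix p q assume p: "p \<in> {p. Factorial_Ring.prime p}" and q: "q \<in> {p. Factorial_Ring.prime p}" and eq: "padic_abs p = padic_abs q"
  show "p = q"
  proof (rule ccontr)
    assume "p \<noteq> q"
    then have "padic_abs p (of_nat p) = 1 / real p" "padic_abs q (of_nat p) = 1" using p q padic_abs_prime by auto
    then have "real p = 1" using eq by simp
    then show False using p by auto
  qed
qed

lemma arch_abs_not_padic: "Factorial_Ring.prime p \<Longrightarrow> arch_abs \<noteq> padic_abs p"
proof
  assume p: "Factorial_Ring.prime p" and eq: "arch_abs = padic_abs p"
  have "padic_abs p (of_nat p) \<le> 1" using padic_abs_prime[OF p p] prime_ge_1_nat[OF p] by (simp add: divide_le_eq)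
  moreover have "arch_abs (of_nat p) = real p" unfolding arch_abs_def by simp
  ultimately have "p \<le> 1" using eq by simp
  then show False using prime_gt_1_nat[OF p] by simp
qed

text \<open>The set \<open>P\<close> may contain primes that do not divide \<open>a\<close>; they
  contribute 0. Numerator and denominator of a fraction can thus be treated with the same
  \<open>P\<close>.\<close>

lemma ln_prime_factorization:
  fixes a :: int
  assumes a: "a \<noteq> 0" and P: "finite P" "\<And>p. p \<in> P \<Longrightarrow> Factorial_Ring.prime p" "\<And>p. Factorial_Ring.prime p \<Longrightarrow> int p dvd a \<Longrightarrow> p \<in> P"
  shows "(\<Sum>p\<in>P. real (multiplicity (int p) a) * ln (real p)) = ln \<bar>real_of_int a\<bar>"
proof -
  have "\<bar>a\<bar> = (\<Prod>p\<in>prime_factors a. p ^ multiplicity p a)"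
    using prod_prime_factors[OF a] by simp
  also have "\<dots> = (\<Prod>p\<in>int ` P. p ^ multiplicity p a)"
  proof (rule prod.mono_neutral_left)
    show "finite (int ` P)" using P by simp
    show "prime_factors a \<subseteq> int ` P"
    proof
      fix q assume q: "q \<in> prime_factors a"
      then have "Factorial_Ring.prime q" "q dvd a" by (auto simp: in_prime_factors_iff)
      then have "Factorial_Ring.prime (nat q)" "int (nat q) = q" by (auto simp: prime_ge_0_int)
      then show "q \<in> int ` P" using P(3)[of "nat q"] \<open>q dvd a\<close> by (intro image_eqI[of _ _ "nat q"]) auto
    qed
    show "\<forall>q\<in>int ` P - prime_factors a. q ^ multiplicity q a = 1"
      using a P(2) by (auto simp: in_prime_factors_iff not_dvd_imp_multiplicity_0)
  qed
  also have "\<dots> = (\<Prod>p\<in>P. int p ^ multiplicity (int p) a)" by (subst prod.reindex) (auto simp: inj_on_def)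
  finally have "real_of_int \<bar>a\<bar> = real_of_int (\<Prod>p\<in>P. int p ^ multiplicity (int p) a)" by (rule arg_cong)
  then have "\<bar>real_of_int a\<bar> = (\<Prod>p\<in>P. real p ^ multiplicity (int p) a)" by simp
  also have "ln \<dots> = (\<Sum>p\<in>P. ln (real p ^ multiplicity (int p) a))"
    by (rule ln_prod) (use P(1) prime_gt_0_nat[OF P(2)] in auto)
  also have "\<dots> = (\<Sum>p\<in>P. real (multiplicity (int p) a) * ln (real p))"
    by (intro sum.cong refl ln_realpow)
  finally show ?thesis by simp
qed

text \<open>For \<open>q = a / b\<close> the primes contribute the logarithm of \<open>b\<close>
  minus that of \<open>a\<close>, in absolute values, and the archimedean place contributes the
  opposite.\<close>

lemma product_formula_exact:
  assumes q: "q \<noteq> 0"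
  obtains S where "finite S" "S \<subseteq> rat_places" "\<And>u. u \<in> rat_places - S \<Longrightarrow> u q = 1" "(\<Sum>u\<in>S. ln (u q)) = 0"
proof -
  obtain a c b where ab: "q = of_int a / of_int b" "b \<noteq> 0" by (rule rat_common_denominator[of q q])
  have a: "a \<noteq> 0" using q ab by auto
  define P where "P = {p. Factorial_Ring.prime p \<and> (int p dvd a \<or> int p dvd b)}"
  have fin: "finite P"
  proof -
    have "P \<subseteq> nat ` (prime_factors a \<union> prime_factors b)"
    proof
      fix p assume "p \<in> P"
      then have "int p \<in> prime_factors a \<union> prime_factors b" unfolding P_def using a ab(2) by (auto simp: in_prime_factors_iff)
      then show "p \<in> nat ` (prime_factors a \<union> prime_factors b)" by (intro image_eqI[of _ _ "int p"]) auto
    qed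
    then show ?thesis by (rule finite_subset) simp
  qed
  let ?S = "insert arch_abs (padic_abs ` P)"
  show thesis
  proof (rule that)
    show "finite ?S" using fin by simp
    show "?S \<subseteq> rat_places" unfolding rat_places_alt P_def by auto
    fix u assume "u \<in> rat_places - ?S"
    then obtain p where p: "Factorial_Ring.prime p" "u = padic_abs p" "p \<notin> P" unfolding rat_places_alt by auto
    then have "multiplicity (int p) a = 0" "multiplicity (int p) b = 0" unfolding P_def by (auto intro: not_dvd_imp_multiplicity_0)
    then show "u q = 1" unfolding p ab padic_abs_fraction[OF p(1) a ab(2)] by simp
  next
    have "(\<Sum>u\<in>?S. ln (u q)) = ln (arch_abs q) + (\<Sum>u\<in>padic_abs ` P. ln (u q))"
      using fin arch_abs_not_padic unfolding P_def by (subst sum.insert) auto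
    also have "(\<Sum>u\<in>padic_abs ` P. ln (u q)) = (\<Sum>p\<in>P. ln (padic_abs p q))"
      by (subst sum.reindex) (auto intro: inj_on_subset[OF inj_padic_abs] simp: P_def)
    also have "\<dots> = (\<Sum>p\<in>P. real (multiplicity (int p) b) * ln (real p) - real (multiplicity (int p) a) * ln (real p))"
    proof (intro sum.cong refl)
      fix p assume "p \<in> P"
      then have p: "Factorial_Ring.prime p" unfolding P_def by simp
      have "real p > 0" using p by (simp add: prime_gt_0_nat)
      have "ln (padic_abs p q) = real_of_int (int (multiplicity (int p) b) - int (multiplicity (int p) a)) * ln (real p)"
        unfolding ab padic_abs_fraction[OF p a ab(2)] using \<open>real p > 0\<close>
        by (subst powr_real_of_int'[symmetric]) (auto simp: ln_powr)
      then show "ln (padic_abs p q) = real (multiplicity (int p) b) * ln (real p) - real (multiplicity (int p) a) * ln (real p)"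
        by (simp add: left_diff_distrib)
    qed
    also have "\<dots> = ln \<bar>real_of_int b\<bar> - ln \<bar>real_of_int a\<bar>"
      unfolding sum_subtractf using ln_prime_factorization[OF a fin] ln_prime_factorization[OF ab(2) fin] unfolding P_def by auto
    also have "ln (arch_abs q) = ln \<bar>real_of_int a\<bar> - ln \<bar>real_of_int b\<bar>"
    proof -
      have "arch_abs q = \<bar>real_of_int a\<bar> / \<bar>real_of_int b\<bar>" unfolding arch_abs_def ab by (simp add: of_rat_divide abs_divide flip: of_int_abs)
      then show ?thesis using a ab(2) by (simp add: ln_div)
    qed
    finally show "(\<Sum>u\<in>?S. ln (u q)) = 0" by simp
  qed
qed

lemma product_formula:
  assumes q: "q \<noteq> 0" and S: "finite S" "S \<subseteq> rat_places" "\<And>u. u \<in> rat_places - S \<Longrightarrow> u q = 1"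
  shows "(\<Sum>u\<in>S. ln (u q)) = 0"
proof -
  obtain T where T: "finite T" "T \<subseteq> rat_places" "\<And>u. u \<in> rat_places - T \<Longrightarrow> u q = 1" "(\<Sum>u\<in>T. ln (u q)) = 0"
    by (rule product_formula_exact[OF q]) (rule that)
  have "(\<Sum>u\<in>S. ln (u q)) = (\<Sum>u\<in>S \<union> T. ln (u q))"
  proof (rule sum.mono_neutral_left)
    show "\<forall>u\<in>S \<union> T - S. ln (u q) = 0"
    proof
      fix u assume "u \<in> S \<union> T - S"
      then have "u q = 1" using S(3)[of u] T(2) by auto
      then show "ln (u q) = 0" by simp
    qed
  qed (use S T in auto)
  also have "\<dots> = (\<Sum>u\<in>T. ln (u q))"
  proof (rule sum.mono_neutral_right)
    show "\<forall>u\<in>S \<union> T - T. ln (u q) = 0"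
    proof
      fix u assume "u \<in> S \<union> T - T"
      then have "u q = 1" using T(3)[of u] S(2) by auto
      then show "ln (u q) = 0" by simp
    qed
  qed (use S T in auto)
  finally show ?thesis using T by simp
qed

lemma finite_rat_support: assumes q: "q \<noteq> 0" shows "finite {u \<in> rat_places. u q \<noteq> 1}"
proof -
  obtain T where T: "finite T" "T \<subseteq> rat_places" "\<And>u. u \<in> rat_places - T \<Longrightarrow> u q = 1"
    by (rule product_formula_exact[OF q]) (rule that)
  then have "{u \<in> rat_places. u q \<noteq> 1} \<subseteq> T" by auto
  then show ?thesis using T(1) by (rule finite_subset)
qed

section \<open>Extensions of the rational places\<close>

definition nonarch :: "('a::field \<Rightarrow> real) \<Rightarrow> bool" where
  "nonarch w \<longleftrightarrow> (\<forall>x y. w (x + y) \<le> max (w x) (w y))"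

text \<open>Since integers have value at most 1, the binomial theorem bounds
  \<open>w (x + y) ^ n\<close> by \<open>(n + 1) * M ^ n\<close> with \<open>M\<close> the larger of
  the two values. A quotient above 1 would grow exponentially against a linear bound.\<close>

lemma nonarch_extends:
  fixes w :: "'a::field_char_0 \<Rightarrow> real"
  assumes w: "extends_abs u UNIV w" and u: "\<And>n. u (of_nat n) \<le> 1"
  shows "nonarch w"
  unfolding nonarch_def
proof (intro allI)
  fix x y
  interpret W: valued_subfield UNIV w
    using w unfolding extends_abs_def by unfold_locales (auto simp: is_subfield_def)
  define M where "M = max (w x) (w y)"
  have M0: "0 \<le> M" unfolding M_def using W.v_nonneg by (simp add: le_max_iff_disj)
  have wn: "w (of_nat k) \<le> 1" for k using w u[of k] unfolding extends_abs_def by (metis of_rat_of_nat_eq)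
  have bound: "w (x + y) ^ n \<le> real (Suc n) * M ^ n" for n
  proof -
    have "w (x + y) ^ n = w (\<Sum>k\<le>n. of_nat (n choose k) * x ^ k * y ^ (n - k))"
      unfolding binomial_ring[symmetric] by (simp add: W.v_power)
    also have "\<dots> \<le> (\<Sum>k\<le>n. w (of_nat (n choose k) * x ^ k * y ^ (n - k)))" by (rule W.v_sum_le) simp
    also have "\<dots> \<le> (\<Sum>k\<le>n. M ^ n)"
    proof (rule sum_mono)
      fix k assume "k \<in> {..n}"
      have "w (of_nat (n choose k)) * w x ^ k * w y ^ (n - k) \<le> 1 * M ^ k * M ^ (n - k)"
        using wn M0 W.v_nonneg unfolding M_def by (intro mult_mono power_mono) auto
      also have "\<dots> = M ^ n" using \<open>k \<in> {..n}\<close> by (simp add: power_add[symmetric])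
      finally show "w (of_nat (n choose k) * x ^ k * y ^ (n - k)) \<le> M ^ n" by (simp add: W.v_mult W.v_power)
    qed
    finally show ?thesis by simp
  qed
  show "w (x + y) \<le> max (w x) (w y)"
  proof (cases "M = 0")
    case True
    then show ?thesis using bound[of 1] unfolding M_def by simp
  next
    case False
    then have M: "M > 0" using M0 by simp
    show ?thesis
    proof (rule ccontr)
      assume "\<not> ?thesis"
      then have "M < w (x + y)" unfolding M_def by (simp only: not_le)
      moreover define c where "c = w (x + y) / M"
      ultimately have gt: "c > 1" using M by simp
      have "c ^ n \<le> real (Suc n)" for n
        unfolding c_def using bound[of n] M by (simp add: power_divide divide_le_eq)
      moreover have "\<forall>\<^sub>F n in sequentially. real (Suc n) < c ^ n" using gt by real_asymp
      ultimately show False by (auto simp: eventually_sequentially not_le[symmetric])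
    qed
  qed
qed

lemma padic_of_nat_le: "Factorial_Ring.prime p \<Longrightarrow> padic_abs p (of_nat n) \<le> 1"
proof (cases "n = 0")
  case True
  then show ?thesis by (simp add: padic_abs_def)
next
  case False
  assume p: "Factorial_Ring.prime p"
  have "padic_abs p (of_nat n) = real p powi (- int (multiplicity (int p) (int n)))"
    using padic_abs_of_int[OF p, of "int n"] False by simp
  also have "\<dots> \<le> real p powi 0" using prime_ge_1_nat[OF p] by (intro power_int_increasing) auto
  finally show ?thesis by simp
qed

definition place_ext :: "(rat \<Rightarrow> real) \<Rightarrow> 'a::field_char_0 \<Rightarrow> real" where
  "place_ext u = (SOME w. extends_abs u UNIV w)"

lemma nonarch_sum:
  assumes w: "absolute_value_on UNIV w" and n: "nonarch w" and f: "\<And>i. i \<in> I \<Longrightarrow> w (f i) \<le> B" and B: "0 \<le> B"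
  shows "w (\<Sum>i\<in>I. f i) \<le> B"
  using f
proof (induction I rule: infinite_finite_induct)
  case (insert i I)
  have "w (f i + (\<Sum>i\<in>I. f i)) \<le> max (w (f i)) (w (\<Sum>i\<in>I. f i))" using n unfolding nonarch_def by blast
  also have "\<dots> \<le> B" using insert by simp
  finally show ?case using insert.hyps by simp
qed (use B absolute_valueD(11)[OF w] in auto)

section \<open>Chosen extensions of the places and finiteness of supports\<close>

locale algebraic_rat =
  fixes ty :: "'a::{alg_closed_field, field_char_0} itself"
  assumes alg: "algebraic_over (\<rat> :: 'a set)"
begin

abbreviation W :: "(rat \<Rightarrow> real) \<Rightarrow> 'a \<Rightarrow> real" where "W \<equiv> place_ext"

lemma W_extends: "u \<in> rat_places \<Longrightarrow> extends_abs u UNIV (W u)"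
proof -
  assume "u \<in> rat_places"
  then have "absolute_value_on UNIV u" using rat_places_nontrivial unfolding nontrivial_abs_def by blast
  from absolute_value_extends[OF this alg] have "\<exists>w :: 'a \<Rightarrow> real. extends_abs u UNIV w" unfolding extends_abs_def .
  then show ?thesis unfolding place_ext_def by (rule someI_ex)
qed

lemma W_abs: "u \<in> rat_places \<Longrightarrow> absolute_value_on UNIV (W u)" and W_of_rat: "u \<in> rat_places \<Longrightarrow> W u (of_rat q) = u q"
  using W_extends unfolding extends_abs_def by auto

lemma W_nonarch: "Factorial_Ring.prime p \<Longrightarrow> nonarch (W (padic_abs p))"
  by (rule nonarch_extends[OF W_extends]) (auto simp: rat_places_alt padic_of_nat_le)

text \<open>Divide a rational equation of \<open>a\<close> by its leading coefficient. At a prime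
  where all coefficients have value at most 1, the ultrametric inequality would give
  \<open>W u a ^ m \<le> W u a ^ (m - 1)\<close>, which is impossible for a value above 1. This
  leaves the archimedean place and finitely many primes.\<close>

lemma W_integral_finite: assumes "a \<noteq> 0" shows "finite {u \<in> rat_places. W u a > 1}"
proof -
  obtain p where p: "p \<noteq> 0" "\<And>i. coeff p i \<in> \<rat>" "poly p a = 0" using alg unfolding algebraic_over_def by metis
  have "\<forall>i. \<exists>q. coeff p i / lead_coeff p = of_rat q" using p(2) Rats_divide Rats_cases by metis
  then obtain q where q: "\<And>i. coeff p i / lead_coeff p = of_rat (q i)" by metis
  define m where "m = degree p"
  have am: "a ^ m = - (\<Sum>i<m. of_rat (q i) * a ^ i)"
  proof -
    have "0 = (\<Sum>i\<le>m. coeff p i * a ^ i) / lead_coeff p" using p(3) unfolding poly_altdef m_def by simp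
    also have "\<dots> = (\<Sum>i\<le>m. of_rat (q i) * a ^ i)" unfolding q[symmetric] by (simp add: sum_divide_distrib)
    also have "\<dots> = (\<Sum>i<m. of_rat (q i) * a ^ i) + a ^ m"
      using p(1) unfolding lessThan_Suc_atMost[symmetric] by (simp add: q[symmetric] m_def)
    finally show ?thesis by (simp add: eq_neg_iff_add_eq_0 add.commute)
  qed
  have "{u \<in> rat_places. W u a > 1} \<subseteq> insert arch_abs (\<Union>i\<in>{i. i < m \<and> q i \<noteq> 0}. {u \<in> rat_places. u (q i) \<noteq> 1})"
  proof
    fix u assume u: "u \<in> {u \<in> rat_places. W u a > 1}"
    show "u \<in> insert arch_abs (\<Union>i\<in>{i. i < m \<and> q i \<noteq> 0}. {u \<in> rat_places. u (q i) \<noteq> 1})"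
    proof (rule ccontr)
      assume c: "u \<notin> insert arch_abs (\<Union>i\<in>{i. i < m \<and> q i \<noteq> 0}. {u \<in> rat_places. u (q i) \<noteq> 1})"
      then obtain pp where pp: "Factorial_Ring.prime pp" "u = padic_abs pp" using u unfolding rat_places_alt by auto
      have ur: "u \<in> rat_places" and gt: "W u a > 1" using u by auto
      note D = absolute_valueD[OF W_abs[OF ur]]
      have uq: "u (q i) \<le> 1" if "i < m" for i
      proof (cases "q i = 0")
        case True
        have "u 0 = 0" using W_of_rat[OF ur, of 0] D(11) by simp
        then show ?thesis using True by simp
      next
        case False
        then show ?thesis using c ur that by auto
      qed
      have "W u (\<Sum>i<m. of_rat (q i) * a ^ i) \<le> W u a ^ (m - 1)"
      proof (rule nonarch_sum[OF W_abs[OF ur]])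
        show "nonarch (W u)" unfolding pp(2) by (rule W_nonarch[OF pp(1)])
        fix i assume "i \<in> {..<m}"
        then have i: "i < m" by simp
        have "u (q i) * W u a ^ i \<le> 1 * W u a ^ (m - 1)"
          using uq[OF i] gt i D(1) by (intro mult_mono power_increasing) auto
        then show "W u (of_rat (q i) * a ^ i) \<le> W u a ^ (m - 1)" by (simp add: D(3,6) W_of_rat[OF ur])
      qed (use gt in auto)
      then have le: "W u a ^ m \<le> W u a ^ (m - 1)" using arg_cong[OF am, of "W u"] by (simp add: D(6,7))
      have "m \<noteq> 0"
      proof
        assume "m = 0"
        then have "(1::'a) = 0" using am by simp
        then show False by simp
      qed
      then have "W u a ^ (m - 1) < W u a ^ m" using gt by (intro power_strict_increasing) auto
      then show False using le by simp
    qed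
  qed
  moreover have "finite (insert arch_abs (\<Union>i\<in>{i. i < m \<and> q i \<noteq> 0}. {u \<in> rat_places. u (q i) \<noteq> 1}))"
    using finite_rat_support by auto
  ultimately show ?thesis by (rule finite_subset)
qed

text \<open>A positive value other than 1 exceeds 1 either for \<open>a\<close> or for its
  inverse.\<close>

lemma W_support_finite: assumes a: "a \<noteq> 0" shows "finite {u \<in> rat_places. W u a \<noteq> 1}"
proof (rule finite_subset)
  show "finite ({u \<in> rat_places. W u a > 1} \<union> {u \<in> rat_places. W u (inverse a) > 1})"
    using W_integral_finite a by simp
  show "{u \<in> rat_places. W u a \<noteq> 1} \<subseteq> {u \<in> rat_places. W u a > 1} \<union> {u \<in> rat_places. W u (inverse a) > 1}"
  proof
    fix u assume "u \<in> {u \<in> rat_places. W u a \<noteq> 1}"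
    then have u: "u \<in> rat_places" "W u a \<noteq> 1" by auto
    note D = absolute_valueD[OF W_abs[OF u(1)]]
    have "W u a > 0" using D(1,2)[of a] a by simp
    then have "W u a > 1 \<or> inverse (W u a) > 1" using u(2) one_less_inverse[of "W u a"] by fastforce
    then show "u \<in> {u \<in> rat_places. W u a > 1} \<union> {u \<in> rat_places. W u (inverse a) > 1}"
      using u D(8)[of a] by auto
  qed
qed

end

section \<open>Heights\<close>

lemma ln_max_power_powr:
  fixes a b s :: real
  assumes "0 \<le> a" "0 \<le> b" "0 < max a b" "0 < s"
  shows "ln (max ((a ^ t) powr s) ((b ^ t) powr s)) = s * (real t * ln (max a b))"
proof -
  have "max ((a ^ t) powr s) ((b ^ t) powr s) = (max a b ^ t) powr s"
    by (cases "a \<le> b") (use assms in \<open>auto simp: max_def power_mono powr_mono2 intro!: antisym\<close>)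
  also have "ln \<dots> = s * ln (max a b ^ t)" using assms by (simp add: ln_powr)
  also have "ln (max a b ^ t) = real t * ln (max a b)" using assms by (simp add: ln_realpow)
  finally show ?thesis .
qed

section \<open>Heights as averages over embeddings\<close>

context algebraic_rat
begin

definition max_abs :: "'a \<Rightarrow> 'a \<Rightarrow> (rat \<Rightarrow> real) \<Rightarrow> real" where
  "max_abs a b u = max (W u a) (W u b)"

definition support :: "'a \<Rightarrow> 'a \<Rightarrow> (rat \<Rightarrow> real) set" where
  "support a b = {u \<in> rat_places. max_abs a b u \<noteq> 1}"

definition total :: "'a \<Rightarrow> 'a \<Rightarrow> real" where
  "total a b = (\<Sum>u\<in>support a b. ln (max_abs a b u))"

lemma support_finite: assumes "(a, b) \<noteq> (0, 0)" shows "finite (support a b)"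
proof -
  have "support a b \<subseteq> (if a = 0 then {} else {u \<in> rat_places. W u a \<noteq> 1}) \<union> (if b = 0 then {} else {u \<in> rat_places. W u b \<noteq> 1})"
  proof
    fix u assume "u \<in> support a b"
    then have u: "u \<in> rat_places" "max (W u a) (W u b) \<noteq> 1" unfolding support_def max_abs_def by auto
    note D = absolute_valueD[OF W_abs[OF u(1)]]
    show "u \<in> (if a = 0 then {} else {u \<in> rat_places. W u a \<noteq> 1}) \<union> (if b = 0 then {} else {u \<in> rat_places. W u b \<noteq> 1})"
      using assms u D(11) D(1)[of a] D(1)[of b] by (auto simp: max_def split: if_splits)
  qed
  then show ?thesis by (rule finite_subset) (use W_support_finite in auto)
qed

lemma total_eq:
  assumes "finite S" "support a b \<subseteq> S" "S \<subseteq> rat_places"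
  shows "total a b = (\<Sum>u\<in>S. ln (max_abs a b u))"
  unfolding total_def by (rule sum.mono_neutral_left) (use assms in \<open>auto simp: support_def\<close>)

lemma number_subfield_rational_basis:
  fixes L :: "'a set"
  assumes "number_subfield L" obtains e where "rational_basis L (field_degree \<rat> L) e"
proof -
  have L: "is_subfield L" using assms subfield_type_algebra unfolding number_subfield_def by blast
  obtain e where "\<And>i. i < field_degree \<rat> L \<Longrightarrow> e i \<in> L"
    "\<And>x. x \<in> L \<Longrightarrow> \<exists>c. x = (\<Sum>i<field_degree \<rat> L. of_rat (c i) * e i)"
    "\<And>c. (\<Sum>i<field_degree \<rat> L. of_rat (c i) * e i) = 0 \<Longrightarrow> \<forall>i<field_degree \<rat> L. c i = 0"
    by (rule number_subfield_basis[OF assms]) (rule that)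
  then have "rational_basis L (field_degree \<rat> L) e" using alg L by unfold_locales auto
  then show thesis by (rule that)
qed

text \<open>By the norm computation the normalized value is \<open>v x\<close> raised to
  \<open>card T / n\<close>. The factor \<open>card T\<close> is distributed over the embeddings in
  \<open>T\<close>, each of which reproduces the value \<open>v\<close>.\<close>

lemma local_height_term:
  assumes rb: "rational_basis L n e" and n: "n = field_degree \<rat> L" and v: "v \<in> places L" and u: "u = (\<lambda>q. v (of_rat q))"
    and xy: "x \<in> L" "y \<in> L" "(x, y) \<noteq> (0, 0)"
  shows "ln (max (normalized_abs L v x) (normalized_abs L v y)) =
    (\<Sum>\<tau>\<in>{\<tau> \<in> embeddings L. \<forall>x\<in>L. W u (\<tau> x) = v x}. ln (max_abs (\<tau> x) (\<tau> y) u)) / real n"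
    "{\<tau> \<in> embeddings L. \<forall>x\<in>L. W u (\<tau> x) = v x} \<noteq> {}"
proof -
  have ur: "u \<in> rat_places" and va: "absolute_value_on L v" using v unfolding places_def u by auto
  interpret rational_basis L n e by (rule rb)
  interpret lf: local_field L n e u "W u" v
    by unfold_locales (use rat_places_nontrivial[OF ur] W_extends[OF ur] va in \<open>auto simp: extends_abs_def u\<close>)
  let ?t = "card lf.T"
  have na: "normalized_abs L v z = (v z ^ ?t) powr (1 / real n)" if "z \<in> L" for z
    unfolding normalized_abs_def lf.completion_abs_field_norm[OF that] n ..
  have "0 < max (v x) (v y)" using xy lf.V.v_pos[of x] lf.V.v_pos[of y] by (auto simp: less_max_iff_disj)
  moreover have "0 < 1 / real n"
  proof -
    have "J \<noteq> {}" using lf.T_nonempty lf.T_sub by auto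
    then have "card J > 0" using finite_embeddings by (simp add: card_gt_0_iff)
    then show ?thesis using card_embeddings by simp
  qed
  ultimately have "ln (max (normalized_abs L v x) (normalized_abs L v y)) = 1 / real n * (real ?t * ln (max (v x) (v y)))"
    unfolding na[OF xy(1)] na[OF xy(2)] using lf.V.v_nonneg xy by (intro ln_max_power_powr)
  also have "real ?t * ln (max (v x) (v y)) = (\<Sum>\<tau>\<in>lf.T. ln (max_abs (\<tau> x) (\<tau> y) u))"
    using xy by (simp add: max_abs_def lf.T_eq)
  finally show "ln (max (normalized_abs L v x) (normalized_abs L v y)) =
    (\<Sum>\<tau>\<in>{\<tau> \<in> embeddings L. \<forall>x\<in>L. W u (\<tau> x) = v x}. ln (max_abs (\<tau> x) (\<tau> y) u)) / real n"
    unfolding lf.T_def by simp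
  show "{\<tau> \<in> embeddings L. \<forall>x\<in>L. W u (\<tau> x) = v x} \<noteq> {}" using lf.T_nonempty unfolding lf.T_def .
qed

text \<open>
  Every place \<open>v\<close> over a place \<open>u\<close> of \<open>\<rat>\<close> is induced by exactly \<open>[L\<^sub>v : \<rat>\<^sub>u]\<close> embeddings, so the sum over places becomes a sum over embeddings.
\<close>

lemma height_over_embeddings:
  assumes nL: "number_subfield L" and xy: "x \<in> L" "y \<in> L" "(x, y) \<noteq> (0, 0)"
  shows "height_over L x y = (\<Sum>\<tau>\<in>embeddings L. total (\<tau> x) (\<tau> y)) / real (card (embeddings L))"
proof -
  define n where "n = field_degree \<rat> L"
  obtain e where rb: "rational_basis L n e" by (rule number_subfield_rational_basis[OF nL, folded n_def]) (rule that)
  interpret rational_basis L n e by (rule rb)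
  \<comment> \<open>The place induced by a rational place and an embedding. Its fibre over
    \<open>v\<close> is the set of embeddings that induce \<open>v\<close>, so summation over pairs
    can be grouped by places.\<close>
  define G where "G = (\<lambda>(u, \<tau>). restrict (\<lambda>x. W u (\<tau> x)) L)"
  define S where "S = (\<Union>\<tau>\<in>J. support (\<tau> x) (\<tau> y))"
  have ne: "(\<tau> x, \<tau> y) \<noteq> (0, 0)" if "\<tau> \<in> J" for \<tau> using emb(7)[OF that] xy by auto
  have S: "finite S" unfolding S_def using finite_embeddings support_finite ne by blast
  have Sr: "S \<subseteq> rat_places" unfolding S_def support_def by auto
  define F where "F v = ln (max (normalized_abs L v x) (normalized_abs L v y))" for v
  define h where "h = (\<lambda>(u, \<tau>). ln (max_abs (\<tau> x) (\<tau> y) u))"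
  have G_rat: "G (u, \<tau>) (of_rat q) = u q" if "u \<in> rat_places" "\<tau> \<in> J" for u \<tau> q
    unfolding G_def using emb(4)[OF that(2)] is_subfield_of_rat[OF L] W_of_rat[OF that(1)] by simp
  have G_place: "G (u, \<tau>) \<in> places L" if "u \<in> rat_places" "\<tau> \<in> J" for u \<tau>
  proof -
    note D = absolute_valueD[OF W_abs[OF that(1)]]
    have "absolute_value_on L (G (u, \<tau>))"
      unfolding absolute_value_on_def G_def using emb[OF that(2)] D is_subfieldD[OF L] by simp
    moreover have "(\<lambda>q. G (u, \<tau>) (of_rat q)) = u" using G_rat[OF that] by auto
    ultimately show ?thesis unfolding places_def using that(1) by (simp add: G_def)
  qed
  have fibre: "{p \<in> S \<times> J. G p = v} = (if (\<lambda>q. v (of_rat q)) \<in> S then {\<lambda>q. v (of_rat q)} \<times> {\<tau> \<in> J. \<forall>x\<in>L. W (\<lambda>q. v (of_rat q)) (\<tau> x) = v x} else {})"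
    if v: "v \<in> places L" for v
  proof (rule Set.set_eqI)
    fix p :: "(rat \<Rightarrow> real) \<times> ('a \<Rightarrow> 'a)"
    obtain u \<tau> where p: "p = (u, \<tau>)" by (cases p)
    have "G (u, \<tau>) = v \<longleftrightarrow> u = (\<lambda>q. v (of_rat q)) \<and> (\<forall>x\<in>L. W (\<lambda>q. v (of_rat q)) (\<tau> x) = v x)"
      if "u \<in> S" "\<tau> \<in> J"
    proof
      assume a: "G (u, \<tau>) = v"
      then have u: "u = (\<lambda>q. v (of_rat q))" using G_rat[of u \<tau>] that Sr by auto
      moreover have "W u (\<tau> x) = v x" if "x \<in> L" for x using a[symmetric] that unfolding G_def by simp
      ultimately show "u = (\<lambda>q. v (of_rat q)) \<and> (\<forall>x\<in>L. W (\<lambda>q. v (of_rat q)) (\<tau> x) = v x)" by simp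
    next
      assume a: "u = (\<lambda>q. v (of_rat q)) \<and> (\<forall>x\<in>L. W (\<lambda>q. v (of_rat q)) (\<tau> x) = v x)"
      show "G (u, \<tau>) = v"
        by (rule extensionalityI[of _ L]) (use a v in \<open>auto simp: G_def places_def\<close>)
    qed
    then show "p \<in> {p \<in> S \<times> J. G p = v} \<longleftrightarrow> p \<in> (if (\<lambda>q. v (of_rat q)) \<in> S then {\<lambda>q. v (of_rat q)} \<times> {\<tau> \<in> J. \<forall>x\<in>L. W (\<lambda>q. v (of_rat q)) (\<tau> x) = v x} else {})"
      unfolding p by auto
  qed
  have F_fibre: "F v = (\<Sum>p\<in>{p \<in> S \<times> J. G p = v}. h p) / real n" if v: "v \<in> places L" for v
  proof -
    let ?u = "\<lambda>q. v (of_rat q)"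
    let ?T = "{\<tau> \<in> J. \<forall>x\<in>L. W ?u (\<tau> x) = v x}"
    have ur: "?u \<in> rat_places" using v unfolding places_def by auto
    have Fv: "F v = (\<Sum>\<tau>\<in>?T. ln (max_abs (\<tau> x) (\<tau> y) ?u)) / real n"
      unfolding F_def by (rule local_height_term[OF rb n_def v refl xy])
    show ?thesis
    proof (cases "?u \<in> S")
      case True
      have "(\<Sum>p\<in>{?u} \<times> ?T. h p) = (\<Sum>\<tau>\<in>?T. h (?u, \<tau>))"
        by (subst sum.cartesian_product'[of h]) simp
      then show ?thesis unfolding Fv fibre[OF v] using True by (simp add: h_def)
    next
      case False
      have "max_abs (\<tau> x) (\<tau> y) ?u = 1" if "\<tau> \<in> ?T" for \<tau>
        using that False ur unfolding S_def support_def by auto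
      then show ?thesis unfolding Fv fibre[OF v] using False by simp
    qed
  qed
  have sub: "G ` (S \<times> J) \<subseteq> places L" using G_place Sr by auto
  have "height_over L x y = infsum F (places L)" unfolding height_over_def F_def ..
  \<comment> \<open>The infinite sum becomes finite: a place outside the image has an empty fibre,
    and \<open>F_fibre\<close> then gives \<open>F v = 0\<close>.\<close>
  also have "\<dots> = infsum F (G ` (S \<times> J))"
  proof (rule infsum_cong_neutral)
    fix v assume "v \<in> places L - G ` (S \<times> J)"
    then have v: "v \<in> places L" and "{p \<in> S \<times> J. G p = v} = {}" by auto
    then show "F v = 0" using F_fibre[OF v] by (simp only:) simp
  qed (use sub in auto)
  also have "\<dots> = (\<Sum>v\<in>G ` (S \<times> J). F v)" using S finite_embeddings by simp
  also have "\<dots> = (\<Sum>v\<in>G ` (S \<times> J). (\<Sum>p\<in>{p \<in> S \<times> J. G p = v}. h p) / real n)"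
    by (rule sum.cong[OF refl F_fibre]) (use sub in auto)
  also have "\<dots> = (\<Sum>v\<in>G ` (S \<times> J). \<Sum>p\<in>{p \<in> S \<times> J. G p = v}. h p) / real n" by (simp add: sum_divide_distrib)
  also have "(\<Sum>v\<in>G ` (S \<times> J). \<Sum>p\<in>{p \<in> S \<times> J. G p = v}. h p) = (\<Sum>p\<in>S \<times> J. h p)"
    using S finite_embeddings by (intro sum.group) auto
  also have "\<dots> = (\<Sum>\<tau>\<in>J. \<Sum>u\<in>S. ln (max_abs (\<tau> x) (\<tau> y) u))"
    unfolding h_def sum.cartesian_product[symmetric] by (rule sum.swap)
  also have "\<dots> = (\<Sum>\<tau>\<in>J. total (\<tau> x) (\<tau> y))"
    by (intro sum.cong refl total_eq[symmetric] S Sr) (auto simp: S_def)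
  finally show ?thesis using card_embeddings by simp
qed

text \<open>The average of \<open>total\<close> over the Galois orbit of the pair. It mentions no
  number field, so the comparison with it shows that \<open>height_over\<close> is independent of
  \<open>L\<close>.\<close>

definition orbit_height :: "'a \<Rightarrow> 'a \<Rightarrow> real" where
  "orbit_height x y = (\<Sum>(a, b)\<in>(\<lambda>\<sigma>. (\<sigma> x, \<sigma> y)) ` field_aut \<rat>. total a b) / real (card ((\<lambda>\<sigma>. (\<sigma> x, \<sigma> y)) ` field_aut \<rat>))"

text \<open>Evaluation at \<open>(x, y)\<close> maps the embeddings onto the orbit. All fibres have
  the same size \<open>k\<close>, since automorphisms permute the embeddings and move any fibre to
  any other; hence the two averages agree.\<close>

lemma height_over_orbit:
  assumes nL: "number_subfield L" and xy: "x \<in> L" "y \<in> L" "(x, y) \<noteq> (0, 0)"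
  shows "height_over L x y = orbit_height x y"
proof -
  obtain e where rb: "rational_basis L (field_degree \<rat> L) e" by (rule number_subfield_rational_basis[OF nL]) (rule that)
  interpret rational_basis L "field_degree \<rat> L" e by (rule rb)
  let ?O = "(\<lambda>\<sigma>. (\<sigma> x, \<sigma> y)) ` field_aut \<rat>"
  define g where "g \<tau> = (\<tau> x, \<tau> y)" for \<tau> :: "'a \<Rightarrow> 'a"
  have O: "?O = g ` J" unfolding embeddings_def g_def image_image using xy by simp
  have finO: "finite ?O" unfolding O using finite_embeddings by simp
  define k where "k = card {\<tau> \<in> J. g \<tau> = (x, y)}"
  have id: "restrict id L \<in> J" unfolding embeddings_def field_aut_def by (rule image_eqI[of _ _ id], auto)
  have "restrict id L \<in> {\<tau> \<in> J. g \<tau> = (x, y)}" using id xy by (simp add: g_def)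
  then have k0: "k > 0" unfolding k_def card_gt_0_iff using finite_embeddings by auto
  have fib: "card {\<tau> \<in> J. g \<tau> = p} = k" if p: "p \<in> ?O" for p
  proof -
    obtain \<sigma> where \<sigma>: "\<sigma> \<in> field_aut \<rat>" "p = (\<sigma> x, \<sigma> y)" using p by auto
    have inj: "\<sigma> a = \<sigma> b \<longleftrightarrow> a = b" for a b using \<sigma>(1) unfolding field_aut_def by (auto dest: bij_is_inj injD)
    note b = aut_permutes_embeddings[OF \<sigma>(1)]
    have gs: "g (restrict (\<sigma> \<circ> \<tau>) L) = p \<longleftrightarrow> g \<tau> = (x, y)" for \<tau>
      unfolding g_def \<sigma>(2) using xy by (simp add: inj)
    have "bij_betw (\<lambda>\<tau>. restrict (\<sigma> \<circ> \<tau>) L) {\<tau> \<in> J. g \<tau> = (x, y)} {\<tau> \<in> J. g \<tau> = p}"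
      unfolding bij_betw_def
    proof
      show "inj_on (\<lambda>\<tau>. restrict (\<sigma> \<circ> \<tau>) L) {\<tau> \<in> J. g \<tau> = (x, y)}"
        by (rule inj_on_subset[OF bij_betw_imp_inj_on[OF b]]) auto
      show "(\<lambda>\<tau>. restrict (\<sigma> \<circ> \<tau>) L) ` {\<tau> \<in> J. g \<tau> = (x, y)} = {\<tau> \<in> J. g \<tau> = p}" (is "?l = ?r")
      proof
        show "?l \<subseteq> ?r"
        proof (rule image_subsetI)
          fix \<tau> assume "\<tau> \<in> {\<tau> \<in> J. g \<tau> = (x, y)}"
          then show "restrict (\<sigma> \<circ> \<tau>) L \<in> ?r" using bij_betwE[OF b] gs by simp
        qed
        show "?r \<subseteq> ?l"
        proof
          fix \<rho> assume r: "\<rho> \<in> ?r"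
          then obtain \<tau> where "\<tau> \<in> J" "\<rho> = restrict (\<sigma> \<circ> \<tau>) L" using bij_betw_imp_surj_on[OF b] by blast
          then show "\<rho> \<in> ?l" using r gs by simp
        qed
      qed
    qed
    then show ?thesis unfolding k_def by (simp add: bij_betw_same_card)
  qed
  have sum: "(\<Sum>\<tau>\<in>J. f (g \<tau>)) = real k * (\<Sum>p\<in>?O. f p)" for f :: "'a \<times> 'a \<Rightarrow> real"
  proof -
    have "(\<Sum>\<tau>\<in>J. f (g \<tau>)) = (\<Sum>p\<in>?O. \<Sum>\<tau>\<in>{\<tau> \<in> J. g \<tau> = p}. f (g \<tau>))"
      by (rule sum.group[symmetric]) (use finite_embeddings finO O in auto)
    also have "\<dots> = (\<Sum>p\<in>?O. \<Sum>\<tau>\<in>{\<tau> \<in> J. g \<tau> = p}. f p)" by (intro sum.cong) auto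
    also have "\<dots> = (\<Sum>p\<in>?O. real k * f p)" by (intro sum.cong refl) (simp add: fib)
    also have "\<dots> = real k * (\<Sum>p\<in>?O. f p)" by (rule sum_distrib_left[symmetric])
    finally show ?thesis .
  qed
  have card: "real (card J) = real k * real (card ?O)" using sum[of "\<lambda>_. 1"] by (simp only: sum_constant mult_1_right of_nat_mult)
  have "height_over L x y = (\<Sum>\<tau>\<in>J. (\<lambda>(a, b). total a b) (g \<tau>)) / real (card J)"
    unfolding height_over_embeddings[OF nL xy] by (simp add: g_def)
  also have "\<dots> = orbit_height x y" unfolding sum card orbit_height_def using k0 by simp
  finally show ?thesis .
qed

text \<open>At each \<open>u\<close>, scaling by \<open>c\<close> adds the sum of
  \<open>ln (W u (\<tau> c))\<close> over the embeddings, which is \<open>ln (u N)\<close> for the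
  rational norm \<open>N\<close> of \<open>c\<close>. The product formula for \<open>N\<close> makes
  the total change 0.\<close>

lemma height_over_scale:
  fixes L :: "'a set"
  assumes nL: "number_subfield L" and xy: "x \<in> L" "y \<in> L" "(x, y) \<noteq> (0, 0)" and c: "c \<in> L" "c \<noteq> 0"
  shows "height_over L (c * x) (c * y) = height_over L x y"
proof -
  obtain e where rb: "rational_basis L (field_degree \<rat> L) e" by (rule number_subfield_rational_basis[OF nL]) (rule that)
  interpret rational_basis L "field_degree \<rat> L" e by (rule rb)
  note LD = is_subfieldD[OF L]
  have cxy: "c * x \<in> L" "c * y \<in> L" "(c * x, c * y) \<noteq> (0, 0)" using LD(4) xy c by auto
  have nz: "\<tau> c \<noteq> 0" "(\<tau> x, \<tau> y) \<noteq> (0, 0)" "(\<tau> (c * x), \<tau> (c * y)) \<noteq> (0, 0)" if "\<tau> \<in> J" for \<tau>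
    using emb(7)[OF that] xy c cxy by auto
  obtain N where N: "of_rat N = (\<Prod>\<tau>\<in>J. \<tau> c)" using norm_rational[OF c(1)] by blast
  have N0: "N \<noteq> 0"
  proof
    assume "N = 0"
    then have "(\<Prod>\<tau>\<in>J. \<tau> c) = 0" using N by simp
    then show False using nz(1) finite_embeddings by simp
  qed
  define S where "S = (\<Union>\<tau>\<in>J. support (\<tau> x) (\<tau> y) \<union> support (\<tau> (c * x)) (\<tau> (c * y))) \<union> {u \<in> rat_places. u N \<noteq> 1}"
  have S: "finite S" unfolding S_def using finite_embeddings support_finite nz finite_rat_support[OF N0] by blast
  have Sr: "S \<subseteq> rat_places" unfolding S_def support_def by auto
  have "(\<Sum>\<tau>\<in>J. total (\<tau> (c * x)) (\<tau> (c * y))) = (\<Sum>\<tau>\<in>J. \<Sum>u\<in>S. ln (max_abs (\<tau> (c * x)) (\<tau> (c * y)) u))"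
    by (intro sum.cong refl total_eq S Sr) (auto simp: S_def)
  also have "\<dots> = (\<Sum>\<tau>\<in>J. \<Sum>u\<in>S. ln (W u (\<tau> c)) + ln (max_abs (\<tau> x) (\<tau> y) u))"
  proof (intro sum.cong refl)
    fix \<tau> u assume t: "\<tau> \<in> J" and "u \<in> S"
    then have ur: "u \<in> rat_places" using Sr by auto
    note D = absolute_valueD[OF W_abs[OF ur]]
    have p: "W u (\<tau> c) > 0" using D(1,2)[of "\<tau> c"] nz(1)[OF t] by simp
    have q: "max_abs (\<tau> x) (\<tau> y) u > 0"
      using nz(2)[OF t] D(1,2)[of "\<tau> x"] D(1,2)[of "\<tau> y"] unfolding max_abs_def by (auto simp: less_max_iff_disj less_le)
    have "max_abs (\<tau> (c * x)) (\<tau> (c * y)) u = W u (\<tau> c) * max_abs (\<tau> x) (\<tau> y) u"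
      unfolding max_abs_def using emb(3)[OF t] c xy D(3) p by (simp add: max_mult_distrib_left)
    then show "ln (max_abs (\<tau> (c * x)) (\<tau> (c * y)) u) = ln (W u (\<tau> c)) + ln (max_abs (\<tau> x) (\<tau> y) u)"
      using p q by (simp add: ln_mult)
  qed
  also have "\<dots> = (\<Sum>u\<in>S. \<Sum>\<tau>\<in>J. ln (W u (\<tau> c))) + (\<Sum>\<tau>\<in>J. \<Sum>u\<in>S. ln (max_abs (\<tau> x) (\<tau> y) u))"
    unfolding sum.distrib by (subst sum.swap) simp
  also have "(\<Sum>u\<in>S. \<Sum>\<tau>\<in>J. ln (W u (\<tau> c))) = (\<Sum>u\<in>S. ln (u N))"
  proof (intro sum.cong refl)
    fix u assume "u \<in> S"
    then have ur: "u \<in> rat_places" using Sr by auto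
    note D = absolute_valueD[OF W_abs[OF ur]]
    have Wprod: "W u (\<Prod>\<tau>\<in>A. \<tau> c) = (\<Prod>\<tau>\<in>A. W u (\<tau> c))" if "finite A" for A
      using that by (induction A rule: finite_induct) (simp_all add: D(3,5))
    have "u N = W u (\<Prod>\<tau>\<in>J. \<tau> c)" using N W_of_rat[OF ur, of N] by simp
    also have "\<dots> = (\<Prod>\<tau>\<in>J. W u (\<tau> c))"
      by (rule Wprod[OF finite_embeddings])
    finally show "(\<Sum>\<tau>\<in>J. ln (W u (\<tau> c))) = ln (u N)"
      using nz(1) D(1,2) finite_embeddings by (simp add: ln_prod less_le)
  qed
  also have "(\<Sum>u\<in>S. ln (u N)) = 0" by (rule product_formula[OF N0 S Sr]) (auto simp: S_def)
  also have "(\<Sum>\<tau>\<in>J. \<Sum>u\<in>S. ln (max_abs (\<tau> x) (\<tau> y) u)) = (\<Sum>\<tau>\<in>J. total (\<tau> x) (\<tau> y))"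
    by (intro sum.cong refl total_eq[symmetric] S Sr) (auto simp: S_def)
  finally show ?thesis unfolding height_over_embeddings[OF nL xy] height_over_embeddings[OF nL cxy] by simp
qed

text \<open>After scaling to \<open>(z : 1)\<close> or \<open>(1 : 0)\<close> the value depends on
  the point alone. This makes the description in \<open>height\<close> unique.\<close>

lemma height_over_normalized:
  fixes L :: "'a set"
  assumes L: "number_subfield L" and xy: "x \<in> L" "y \<in> L" "(x, y) \<noteq> (0, 0)"
  shows "height_over L x y = (case P1_point x y of Affine z \<Rightarrow> orbit_height z 1 | Infinity \<Rightarrow> orbit_height 1 0)"
proof -
  have Ls: "is_subfield L" using L subfield_type_algebra unfolding number_subfield_def by blast
  note LD = is_subfieldD[OF Ls]
  show ?thesis
  proof (cases "y = 0")
    case True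
    then have x: "x \<noteq> 0" using xy by simp
    have "height_over L (x * 1) (x * 0) = height_over L 1 0" by (rule height_over_scale[OF L]) (use LD(1,2) xy x in auto)
    then show ?thesis using True height_over_orbit[OF L, of 1 0] LD(1,2) unfolding P1_point_def by simp
  next
    case False
    have "x / y \<in> L" using LD(8) xy by blast
    then have "height_over L (y * (x / y)) (y * 1) = height_over L (x / y) 1" by (intro height_over_scale[OF L]) (use LD(2) xy False in auto)
    then show ?thesis using False height_over_orbit[OF L, of "x / y" 1] LD(2) \<open>x / y \<in> L\<close> unfolding P1_point_def by simp
  qed
qed

theorem height_eq:
  fixes L :: "'a set"
  assumes L: "number_subfield L" and xy: "x \<in> L" "y \<in> L" "(x, y) \<noteq> (0, 0)"
  shows "height (P1_point x y) = height_over L x y"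
  unfolding height_def
proof (rule the_equality)
  show "\<exists>L' x' y'. number_subfield L' \<and> x' \<in> L' \<and> y' \<in> L' \<and> (x', y') \<noteq> (0, 0) \<and>
      P1_point x y = P1_point x' y' \<and> height_over L x y = height_over L' x' y'"
    using assms by (intro exI conjI) (rule refl | assumption)+
  fix h assume "\<exists>L' x' y'. number_subfield L' \<and> x' \<in> L' \<and> y' \<in> L' \<and> (x', y') \<noteq> (0, 0) \<and>
      P1_point x y = P1_point x' y' \<and> h = height_over L' x' y'"
  then obtain L' x' y' where h: "number_subfield L'" "x' \<in> L'" "y' \<in> L'" "(x', y') \<noteq> (0, 0)"
    "P1_point x y = P1_point x' y'" "h = height_over L' x' y'" by auto
  show "h = height_over L x y" unfolding h(6) height_over_normalized[OF h(1-4)] height_over_normalized[OF L xy] h(5) ..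
qed

end

section \<open>Functoriality of heights\<close>

lemma poly_ideal_generator:
  fixes f g :: "'a::field poly"
  assumes "f \<noteq> 0 \<or> g \<noteq> 0"
  obtains p u v where "p \<noteq> 0" "u * f + v * g = p" "p dvd f" "p dvd g"
proof -
  define D where "D = {p. p \<noteq> 0 \<and> (\<exists>u v. u * f + v * g = p)}"
  have "1 * f + 0 * g = f" "0 * f + 1 * g = g" by simp_all
  then have "\<exists>p. p \<in> D" unfolding D_def using assms by blast
  from exists_least_iff[THEN iffD1, of "\<lambda>n. \<exists>p\<in>D. degree p = n"] this
  obtain p where p: "p \<in> D" "\<And>q. q \<in> D \<Longrightarrow> degree p \<le> degree q" by (metis leI)
  then obtain u v where uv: "p \<noteq> 0" "u * f + v * g = p" unfolding D_def by blast
  have dvd: "p dvd h" if h: "h = a * f + b * g" for h a b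
  proof (rule ccontr)
    assume n: "\<not> p dvd h"
    then have nz: "h mod p \<noteq> 0" by (simp add: mod_eq_0_iff_dvd)
    have "h mod p = h - (h div p) * p" by (simp add: minus_div_mult_eq_mod)
    also have "\<dots> = (a - (h div p) * u) * f + (b - (h div p) * v) * g"
      unfolding uv(2)[symmetric] h by (simp add: algebra_simps)
    finally have "h mod p \<in> D" using nz unfolding D_def by (simp, metis)
    then show False using p(2) degree_mod_less[OF uv(1), of h] nz by fastforce
  qed
  show thesis by (rule that[OF uv]) (rule dvd[of f 1 0], simp, rule dvd[of g 0 1], simp)
qed

lemma bezout_coprime:
  fixes f g :: "'a::field poly"
  assumes "coprime f g"
  obtains u v where "u * f + v * g = 1"
proof -
  have "f \<noteq> 0 \<or> g \<noteq> 0" using assms by auto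
  then obtain p u v where p: "p \<noteq> 0" "u * f + v * g = p" "p dvd f" "p dvd g" by (rule poly_ideal_generator)
  then obtain q where q: "1 = p * q" using assms unfolding coprime_def by (metis dvdE)
  have "(q * u) * f + (q * v) * g = 1" unfolding q p(2)[symmetric] by (simp add: algebra_simps)
  then show thesis by (rule that)
qed

lemma bezout_no_common_root:
  fixes f g :: "'a::alg_closed_field poly"
  assumes "\<And>z. \<not> (poly f z = 0 \<and> poly g z = 0)"
  obtains u v where "u * f + v * g = 1"
proof -
  have "f \<noteq> 0 \<or> g \<noteq> 0" using assms[of 0] by auto
  then obtain p u v where p: "p \<noteq> 0" "u * f + v * g = p" "p dvd f" "p dvd g" by (rule poly_ideal_generator)
  have "degree p = 0"
  proof (rule ccontr)
    assume "degree p \<noteq> 0"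
    then obtain z where "poly p z = 0" using alg_closed_imp_poly_has_root[of p] by auto
    then show False using assms[of z] p(3,4) by (auto simp: dvd_def)
  qed
  then obtain c where c: "p = [:c:]" by (rule degree_eq_zeroE)
  then have "smult (inverse c) u * f + smult (inverse c) v * g = 1"
    using p(1) arg_cong[OF p(2), of "smult (inverse c)"] by (simp add: smult_add_right one_pCons)
  then show thesis by (rule that)
qed

section \<open>Binary forms and estimates of their values\<close>

definition homog :: "'a::field poly \<Rightarrow> nat \<Rightarrow> 'a \<Rightarrow> 'a \<Rightarrow> 'a" where
  "homog p d x y = (\<Sum>i\<le>d. coeff p i * x ^ i * y ^ (d - i))"

text \<open>For degree at most \<open>d\<close> this is the polynomial X^d p(1/X). It exchanges the
  two homogeneous coordinates, so that estimates proved for \<open>y\<close> become available for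
  \<open>x\<close>.\<close>

definition reflect :: "nat \<Rightarrow> 'a::field poly \<Rightarrow> 'a poly" where
  "reflect d p = (\<Sum>i\<le>d. monom (coeff p (d - i)) i)"

lemma coeff_reflect: "coeff (reflect d p) i = (if i \<le> d then coeff p (d - i) else 0)"
  unfolding reflect_def by (simp add: coeff_sum)

lemma degree_reflect: "degree (reflect d p) \<le> d"
  by (rule degree_le) (simp add: coeff_reflect)

lemma homog_affine:
  assumes "degree p \<le> d" "y \<noteq> 0" shows "homog p d x y = y ^ d * poly p (x / y)"
proof -
  have px: "poly p (x / y) = (\<Sum>i\<le>d. coeff p i * (x / y) ^ i)"
    unfolding poly_altdef by (rule sum.mono_neutral_left) (use assms in \<open>auto simp: coeff_eq_0\<close>)
  have yd: "y ^ d = y ^ i * y ^ (d - i)" if "i \<le> d" for i using that by (simp flip: power_add)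
  have "coeff p i * x ^ i * y ^ (d - i) = y ^ d * (coeff p i * (x / y) ^ i)" if "i \<le> d" for i
    unfolding yd[OF that] using assms(2) by (simp add: power_divide)
  then have "homog p d x y = (\<Sum>i\<le>d. y ^ d * (coeff p i * (x / y) ^ i))" unfolding homog_def by (intro sum.cong) auto
  then show ?thesis by (simp add: px sum_distrib_left)
qed

lemma homog_infinity: "homog p d x 0 = coeff p d * x ^ d"
proof -
  have "homog p d x 0 = (\<Sum>i\<in>{d}. coeff p i * x ^ i * 0 ^ (d - i))"
    unfolding homog_def by (rule sum.mono_neutral_right) auto
  then show ?thesis by simp
qed

lemma homog_reflect: "homog (reflect d p) d y x = homog p d x y"
proof -
  have "homog (reflect d p) d y x = (\<Sum>i\<le>d. coeff p (d - i) * y ^ i * x ^ (d - i))"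
    unfolding homog_def by (intro sum.cong) (auto simp: coeff_reflect)
  also have "\<dots> = (\<Sum>i\<le>d. coeff p i * y ^ (d - i) * x ^ i)"
    by (rule sum.reindex_bij_witness[of _ "\<lambda>i. d - i" "\<lambda>i. d - i"]) auto
  finally show ?thesis unfolding homog_def by (simp add: mult_ac)
qed

lemma homog_scale: "homog p d (c * x) (c * y) = c ^ d * homog p d x y"
proof -
  have "c ^ d = c ^ i * c ^ (d - i)" if "i \<le> d" for i using that by (simp flip: power_add)
  then show ?thesis unfolding homog_def sum_distrib_left
    by (intro sum.cong) (auto simp: power_mult_distrib mult_ac)
qed

text \<open>The homogenized identity: with cofactors as forms of degree \<open>e\<close>, a pure
  power of \<open>y\<close> lies in the ideal of the two forms.\<close>

lemma homog_bezout:
  assumes "u * f + v * g = 1" "degree f \<le> d" "degree g \<le> d" "degree u \<le> e" "degree v \<le> e" "y \<noteq> 0"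
  shows "homog u e x y * homog f d x y + homog v e x y * homog g d x y = y ^ (e + d)"
proof -
  have "homog u e x y * homog f d x y + homog v e x y * homog g d x y = y ^ (e + d) * poly (u * f + v * g) (x / y)"
    using assms(2-6) by (simp add: homog_affine power_add algebra_simps)
  then show ?thesis unfolding assms(1) by simp
qed

lemma top_coeff_nonzero:
  assumes "f \<noteq> 0 \<or> g \<noteq> 0" "max (degree f) (degree g) = d" shows "coeff f d \<noteq> 0 \<or> coeff g d \<noteq> 0"
proof (cases "f = 0 \<or> g = 0")
  case True
  then show ?thesis using assms by auto
next
  case False
  then show ?thesis using assms(2) by (cases "degree f \<le> degree g") auto
qed

lemma homog_nonzero:
  assumes fg: "u * f + v * g = 1" and d: "max (degree f) (degree g) = d" and xy: "(x, y) \<noteq> (0, 0)"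
  shows "(homog f d x y, homog g d x y) \<noteq> (0, 0)"
proof (cases "y = 0")
  case True
  have "f \<noteq> 0 \<or> g \<noteq> 0" using fg by auto
  then have "coeff f d \<noteq> 0 \<or> coeff g d \<noteq> 0"
    by (rule top_coeff_nonzero[OF _ d])
  then show ?thesis using True xy by (simp add: homog_infinity)
next
  case False
  then show ?thesis
    using homog_bezout[OF fg, of d "max (degree u) (degree v)" y x] d by auto
qed

lemma homog_in_subfield:
  assumes L: "is_subfield L" and "\<And>i. coeff p i \<in> L" "x \<in> L" "y \<in> L" shows "homog p d x y \<in> L"
  unfolding homog_def
  by (intro is_subfield_sum[OF L] is_subfieldD(4)[OF L] is_subfield_power[OF L] assms)

text \<open>The factor \<open>k\<close> pays for the number of terms. That it may be 1 in the
  ultrametric case is what lets the constants vanish at almost all places.\<close>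

lemma homog_bound:
  assumes w: "absolute_value_on UNIV w" and B: "0 \<le> B" "\<And>i. i \<le> d \<Longrightarrow> w (coeff p i) \<le> B"
    and k: "1 \<le> k" "nonarch w \<or> real d + 1 \<le> k"
  shows "w (homog p d x y) \<le> k * B * max (w x) (w y) ^ d"
proof -
  note D = absolute_valueD[OF w]
  let ?m = "max (w x) (w y)"
  have t: "w (coeff p i * x ^ i * y ^ (d - i)) \<le> B * ?m ^ d" if "i \<le> d" for i
  proof -
    have "w (coeff p i * x ^ i * y ^ (d - i)) = w (coeff p i) * (w x ^ i * w y ^ (d - i))" by (simp add: D(3,6))
    also have "\<dots> \<le> B * (?m ^ i * ?m ^ (d - i))" by (intro mult_mono power_mono B that) (use D(1) B in \<open>auto simp: le_max_iff_disj\<close>)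
    also have "?m ^ i * ?m ^ (d - i) = ?m ^ d" using that by (simp flip: power_add)
    finally show ?thesis .
  qed
  have m: "0 \<le> B * ?m ^ d" using B D(1)[of x] by (simp add: le_max_iff_disj)
  show ?thesis
  proof (cases "nonarch w")
    case True
    have "w (homog p d x y) \<le> B * ?m ^ d" unfolding homog_def by (rule nonarch_sum[OF w True]) (use t m in auto)
    also have "\<dots> \<le> k * (B * ?m ^ d)" using mult_right_mono[OF k(1) m] by simp
    finally show ?thesis by simp
  next
    case False
    have sub: "w (\<Sum>i\<in>I. h i) \<le> (\<Sum>i\<in>I. w (h i))" if "finite I" for I and h :: "nat \<Rightarrow> _"
      using that by (induction I rule: finite_induct) (auto simp: D(11) intro: order_trans[OF D(4)])
    have "w (homog p d x y) \<le> (\<Sum>i\<le>d. w (coeff p i * x ^ i * y ^ (d - i)))" unfolding homog_def by (rule sub) simp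
    also have "\<dots> \<le> (\<Sum>i\<le>d. B * ?m ^ d)" by (rule sum_mono) (use t in auto)
    also have "\<dots> = (real d + 1) * (B * ?m ^ d)" by simp
    also have "\<dots> \<le> k * (B * ?m ^ d)" by (rule mult_right_mono) (use k False m in auto)
    finally show ?thesis by simp
  qed
qed

text \<open>Reads a Bezout identity backwards: the combination \<open>z\<close> of \<open>F\<close>
  and \<open>G\<close> can be large only if \<open>F\<close> or \<open>G\<close> is.\<close>

lemma bezout_lower_bound:
  assumes w: "absolute_value_on UNIV w" and B: "0 \<le> B" "\<And>i. i \<le> e \<Longrightarrow> w (coeff u i) \<le> B" "\<And>i. i \<le> e \<Longrightarrow> w (coeff v i) \<le> B"
    and k: "1 \<le> k" "nonarch w \<or> 2 * real e + 2 \<le> k"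
    and uv: "homog u e x y * F + homog v e x y * G = z"
  shows "w z \<le> k * B * max (w x) (w y) ^ e * max (w F) (w G)"
proof -
  note D = absolute_valueD[OF w]
  let ?m = "max (w x) (w y)" let ?M = "max (w F) (w G)"
  have m: "0 \<le> ?m" "0 \<le> ?M" using D(1)[of x] D(1)[of F] by (auto simp: le_max_iff_disj)
  \<comment> \<open>Without the ultrametric inequality the two summands are added, so each may use
    only half of \<open>k\<close>.\<close>
  define k' where "k' = (if nonarch w then k else k / 2)"
  have k': "1 \<le> k'" "nonarch w \<or> real e + 1 \<le> k'" unfolding k'_def using k by auto
  have t: "w (homog u e x y * F) \<le> k' * B * ?m ^ e * ?M" "w (homog v e x y * G) \<le> k' * B * ?m ^ e * ?M"
    unfolding D(3) by (intro mult_mono homog_bound w B k'; use D(1) m B k' in simp)+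
  show ?thesis
  proof (cases "nonarch w")
    case True
    then have "w z \<le> max (w (homog u e x y * F)) (w (homog v e x y * G))" using uv unfolding nonarch_def by blast
    then show ?thesis using t True unfolding k'_def by simp
  next
    case False
    have "w z \<le> w (homog u e x y * F) + w (homog v e x y * G)" using D(4) uv by blast
    then show ?thesis using t False unfolding k'_def by simp
  qed
qed

text \<open>
  The constants depend on the absolute value only through its size on the finitely many coefficients
  of the forms and of the Bezout cofactors; hence they are trivial at almost all places.
\<close>

lemma local_functional_inequality:
  fixes f g :: "'a::alg_closed_field poly"
  assumes fg: "uf * f + ug * g = 1" and d: "max (degree f) (degree g) = d"
  obtains Z where "finite Z" "\<And>w. absolute_value_on UNIV w \<Longrightarrow> \<exists>c\<ge>0. (nonarch w \<and> (\<forall>z\<in>Z. w z \<le> 1) \<longrightarrow> c = 0) \<and>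
    (\<forall>x y. (x, y) \<noteq> (0, 0) \<longrightarrow> \<bar>ln (max (w (homog f d x y)) (w (homog g d x y))) - real d * ln (max (w x) (w y))\<bar> \<le> c)"
proof -
  have df: "degree f \<le> d" "degree g \<le> d" using d by auto
  \<comment> \<open>The identity for \<open>f\<close> and \<open>g\<close> only controls powers of
    \<open>y\<close>. The reflected polynomials give a second identity, which controls powers of
    \<open>x\<close>.\<close>
  define f' g' where "f' = reflect d f" and "g' = reflect d g"
  have df': "degree f' \<le> d" "degree g' \<le> d" unfolding f'_def g'_def by (rule degree_reflect)+
  have ncr: "\<not> (poly f' z = 0 \<and> poly g' z = 0)" for z
  proof
    assume z: "poly f' z = 0 \<and> poly g' z = 0"
    show False
    proof (cases "z = 0")
      case True
      then have "coeff f d = 0" "coeff g d = 0" using z unfolding f'_def g'_def by (simp_all add: poly_0_coeff_0 coeff_reflect)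
      moreover have "f \<noteq> 0 \<or> g \<noteq> 0" using fg by auto
      ultimately show False using top_coeff_nonzero[OF _ d] by blast
    next
      case False
      have "homog f d (1 / z) 1 = 0" "homog g d (1 / z) 1 = 0"
        using homog_scale[of f d z "1 / z" 1] homog_scale[of g d z "1 / z" 1] homog_affine[OF df'(1), of 1 z] homog_affine[OF df'(2), of 1 z]
          False z by (simp_all add: homog_reflect f'_def g'_def)
      then have "poly f (1 / z) = 0" "poly g (1 / z) = 0" using df by (simp_all add: homog_affine)
      then show False using arg_cong[OF fg, of "\<lambda>p. poly p (1 / z)"] by simp
    qed
  qed
  obtain uf' ug' where fg': "uf' * f' + ug' * g' = 1" by (rule bezout_no_common_root[OF ncr])
  define e where "e = Max {degree uf, degree ug, degree uf', degree ug'}"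
  have e: "degree uf \<le> e" "degree ug \<le> e" "degree uf' \<le> e" "degree ug' \<le> e" unfolding e_def by auto
  define P where "P = {f, g, uf, ug, uf', ug'}"
  define Z where "Z = (\<lambda>(p, i). coeff p i) ` (P \<times> {..d + e})"
  have Z: "finite Z" unfolding Z_def P_def by simp
  show thesis
  proof (rule that[OF Z])
    fix w :: "'a \<Rightarrow> real" assume w: "absolute_value_on UNIV w"
    note D = absolute_valueD[OF w]
    \<comment> \<open>Including 1 keeps \<open>ln A\<close> nonnegative, and \<open>B\<close> equals
      1 precisely if all coefficients have value at most 1.\<close>
    define B where "B = Max (insert 1 (w ` Z))"
    have B: "1 \<le> B" "\<And>z. z \<in> Z \<Longrightarrow> w z \<le> B" unfolding B_def using Z by auto
    have Bp: "w (coeff p i) \<le> B" if "p \<in> P" "i \<le> d + e" for p i by (rule B(2)) (use that in \<open>force simp: Z_def\<close>)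
    \<comment> \<open>One constant for both directions: it covers the \<open>d + 1\<close> terms of
      the upper bound and the \<open>2 * e + 2\<close> terms of the lower bound.\<close>
    define k where "k = (if nonarch w then 1 else 2 * real (d + e) + 2)"
    have k: "1 \<le> k" "nonarch w \<or> real d + 1 \<le> k" "nonarch w \<or> 2 * real e + 2 \<le> k" unfolding k_def by auto
    define A where "A = k * B"
    have A: "1 \<le> A" unfolding A_def using k(1) B(1) mult_mono[of 1 k 1 B] by simp
    show "\<exists>c\<ge>0. (nonarch w \<and> (\<forall>z\<in>Z. w z \<le> 1) \<longrightarrow> c = 0) \<and>
      (\<forall>x y. (x, y) \<noteq> (0, 0) \<longrightarrow> \<bar>ln (max (w (homog f d x y)) (w (homog g d x y))) - real d * ln (max (w x) (w y))\<bar> \<le> c)"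
    proof (intro exI[of _ "ln A"] conjI impI allI)
      show "0 \<le> ln A" using A by simp
    next
      assume n: "nonarch w \<and> (\<forall>z\<in>Z. w z \<le> 1)"
      then have "B \<le> 1" unfolding B_def using Z by auto
      then have "A = 1" unfolding A_def k_def using n B(1) by simp
      then show "ln A = 0" by simp
    next
      fix x y :: 'a assume xy: "(x, y) \<noteq> (0, 0)"
      define m M where "m = max (w x) (w y)" and "M = max (w (homog f d x y)) (w (homog g d x y))"
      have m: "0 < m" unfolding m_def using xy D(1,2)[of x] D(1,2)[of y] by (auto simp: less_max_iff_disj less_le)
      have B0: "0 \<le> B" using B(1) by simp
      have up: "M \<le> A * m ^ d" unfolding M_def m_def A_def
        by (rule max.boundedI; rule homog_bound[OF w B0 _ k(1,2)]; rule Bp) (auto simp: P_def)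
      \<comment> \<open>Applied to the coordinate of larger value, this becomes a bound for
        \<open>m ^ (e + d)\<close>, from which the factor \<open>m ^ e\<close> is cancelled.\<close>
      have "w z ^ (e + d) \<le> A * m ^ e * M" if "z = x \<or> z = y" "z \<noteq> 0" for z
      proof (cases "z = y")
        case True
        have "w (y ^ (e + d)) \<le> A * m ^ e * M" unfolding A_def m_def M_def
          by (rule bezout_lower_bound[OF w B0 _ _ k(1,3) homog_bezout[OF fg df e(1,2)]])
            (use True that in \<open>auto intro!: Bp simp: P_def\<close>)
        then show ?thesis using True by (simp add: D(6))
      next
        case False
        have "homog uf' e y x * homog f' d y x + homog ug' e y x * homog g' d y x = x ^ (e + d)"
          by (rule homog_bezout[OF fg' df' e(3,4)]) (use False that in auto)
        then have eq: "homog uf' e y x * homog f d x y + homog ug' e y x * homog g d x y = x ^ (e + d)"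
          unfolding f'_def g'_def homog_reflect .
        have "w (x ^ (e + d)) \<le> k * B * max (w y) (w x) ^ e * max (w (homog f d x y)) (w (homog g d x y))"
          by (rule bezout_lower_bound[OF w B0 _ _ k(1,3) eq]) (auto intro!: Bp simp: P_def)
        then show ?thesis using False that unfolding A_def m_def M_def by (simp add: D(6) max.commute)
      qed
      then have "m ^ (e + d) \<le> A * m ^ e * M"
        using m D(2)[of x] D(2)[of y] unfolding m_def max_def by (auto split: if_splits)
      then have "m ^ e * m ^ d \<le> m ^ e * (A * M)" by (simp add: power_add mult_ac)
      then have low: "m ^ d \<le> A * M" using m by simp
      have "0 < m ^ d" using m by simp
      then have "0 < A * M" using low by simp
      then have M: "0 < M" using A by (simp add: zero_less_mult_iff)
      have "ln M \<le> ln (A * m ^ d)" using up M by simp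
      moreover have "ln (m ^ d) \<le> ln (A * M)" by (rule ln_mono[OF low \<open>0 < m ^ d\<close>])
      ultimately have "ln M \<le> ln A + real d * ln m" "real d * ln m \<le> ln A + ln M"
        using A m M by (simp_all add: ln_mult ln_realpow)
      then show "\<bar>ln (max (w (homog f d x y)) (w (homog g d x y))) - real d * ln (max (w x) (w y))\<bar> \<le> ln A"
        unfolding m_def[symmetric] M_def[symmetric] by linarith
    qed
  qed
qed

section \<open>From local to global height inequalities\<close>

context algebraic_rat
begin

lemma W_comp_abs:
  assumes "\<sigma> \<in> field_aut \<rat>" "u \<in> rat_places" shows "absolute_value_on UNIV (\<lambda>x. W u (\<sigma> x))"
proof -
  note D = field_autD[OF assms(1) is_subfield_Rats] and A = absolute_valueD[OF W_abs[OF assms(2)]]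
  show ?thesis unfolding absolute_value_on_def by (simp add: D A)
qed

lemma W_comp_nonarch:
  assumes "\<sigma> \<in> field_aut \<rat>" "u \<in> rat_places" "u \<noteq> (\<lambda>q. of_rat \<bar>q\<bar>)" shows "nonarch (\<lambda>x. W u (\<sigma> x))"
proof -
  note D = field_autD[OF assms(1) is_subfield_Rats]
  obtain p where "Factorial_Ring.prime p" "u = padic_abs p" using assms(2,3) unfolding rat_places_def by blast
  then have "nonarch (W u)" using W_nonarch by simp
  then show ?thesis unfolding nonarch_def by (simp add: D)
qed

lemma total_functional_inequality:
  assumes fg: "uf * f + ug * g = 1" and d: "max (degree f) (degree g) = d" and \<sigma>: "\<sigma> \<in> field_aut \<rat>"
  shows "\<exists>c. \<forall>x y. (x, y) \<noteq> (0, 0) \<longrightarrow>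
    \<bar>total (\<sigma> (homog f d x y)) (\<sigma> (homog g d x y)) - real d * total (\<sigma> x) (\<sigma> y)\<bar> \<le> c"
proof -
  note D = field_autD[OF \<sigma> is_subfield_Rats]
  obtain Z where Z: "finite Z" and loc: "\<And>w. absolute_value_on UNIV w \<Longrightarrow> \<exists>c\<ge>0. (nonarch w \<and> (\<forall>z\<in>Z. w z \<le> 1) \<longrightarrow> c = 0) \<and>
    (\<forall>x y. (x, y) \<noteq> (0, 0) \<longrightarrow> \<bar>ln (max (w (homog f d x y)) (w (homog g d x y))) - real d * ln (max (w x) (w y))\<bar> \<le> c)"
    by (rule local_functional_inequality[OF fg d]) (rule that)
  have "\<forall>u\<in>rat_places. \<exists>c. 0 \<le> c \<and> (nonarch (\<lambda>x. W u (\<sigma> x)) \<and> (\<forall>z\<in>Z. W u (\<sigma> z) \<le> 1) \<longrightarrow> c = 0) \<and>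
    (\<forall>x y. (x, y) \<noteq> (0, 0) \<longrightarrow> \<bar>ln (max_abs (\<sigma> (homog f d x y)) (\<sigma> (homog g d x y)) u) - real d * ln (max_abs (\<sigma> x) (\<sigma> y) u)\<bar> \<le> c)"
    unfolding max_abs_def using loc[OF W_comp_abs[OF \<sigma>]] by blast
  from bchoice[OF this] obtain c where c: "\<And>u. u \<in> rat_places \<Longrightarrow> 0 \<le> c u"
    "\<And>u. u \<in> rat_places \<Longrightarrow> nonarch (\<lambda>x. W u (\<sigma> x)) \<Longrightarrow> (\<forall>z\<in>Z. W u (\<sigma> z) \<le> 1) \<Longrightarrow> c u = 0"
    "\<And>u x y. u \<in> rat_places \<Longrightarrow> (x, y) \<noteq> (0, 0) \<Longrightarrow>
      \<bar>ln (max_abs (\<sigma> (homog f d x y)) (\<sigma> (homog g d x y)) u) - real d * ln (max_abs (\<sigma> x) (\<sigma> y) u)\<bar> \<le> c u" by blast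
  \<comment> \<open>Outside the archimedean place and the finitely many places where a conjugate of
    some element of \<open>Z\<close> exceeds 1, the local constant is 0. The sum of the constants is
    therefore finite and independent of the point.\<close>
  define E where "E = insert (\<lambda>q. of_rat \<bar>q\<bar>) (\<Union>z\<in>Z - {0}. {u \<in> rat_places. W u (\<sigma> z) > 1})"
  have E: "finite E" unfolding E_def using Z W_integral_finite D(10) by auto
  have Er: "E \<subseteq> rat_places" unfolding E_def rat_places_def by auto
  have c0: "c u = 0" if u: "u \<in> rat_places" "u \<notin> E" for u
  proof (rule c(2)[OF u(1)])
    show "nonarch (\<lambda>x. W u (\<sigma> x))" by (rule W_comp_nonarch[OF \<sigma> u(1)]) (use u(2) in \<open>auto simp: E_def\<close>)
    show "\<forall>z\<in>Z. W u (\<sigma> z) \<le> 1"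
    proof
      fix z assume "z \<in> Z"
      then show "W u (\<sigma> z) \<le> 1" using u unfolding E_def
        by (cases "z = 0") (auto simp: D(3) absolute_valueD(11)[OF W_abs[OF u(1)]] not_less)
    qed
  qed
  have "\<bar>total (\<sigma> (homog f d x y)) (\<sigma> (homog g d x y)) - real d * total (\<sigma> x) (\<sigma> y)\<bar> \<le> (\<Sum>u\<in>E. c u)"
    if xy: "(x, y) \<noteq> (0, 0)" for x y
  proof -
    define a b where "a = homog f d x y" and "b = homog g d x y"
    have ab: "(a, b) \<noteq> (0, 0)" unfolding a_def b_def by (rule homog_nonzero[OF fg d xy])
    define S where "S = support (\<sigma> a) (\<sigma> b) \<union> support (\<sigma> x) (\<sigma> y) \<union> E"
    have fin: "finite (support (\<sigma> a) (\<sigma> b))" "finite (support (\<sigma> x) (\<sigma> y))"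
      using support_finite D(10) ab xy by auto
    have S: "finite S" unfolding S_def using E fin by simp
    have Sr: "S \<subseteq> rat_places" unfolding S_def using Er by (auto simp: support_def)
    have "total (\<sigma> a) (\<sigma> b) - real d * total (\<sigma> x) (\<sigma> y) =
      (\<Sum>u\<in>S. ln (max_abs (\<sigma> a) (\<sigma> b) u) - real d * ln (max_abs (\<sigma> x) (\<sigma> y) u))"
      unfolding sum_subtractf sum_distrib_left[symmetric]
      by (subst total_eq[OF S _ Sr], force simp: S_def, subst total_eq[OF S _ Sr], force simp: S_def, rule refl)
    also have "\<bar>\<dots>\<bar> \<le> (\<Sum>u\<in>S. c u)"
      by (rule order_trans[OF sum_abs sum_mono]) (use c(3)[OF _ xy] Sr in \<open>auto simp: a_def b_def\<close>)
    also have "\<dots> = (\<Sum>u\<in>E. c u)" by (rule sum.mono_neutral_right) (use S c0 Sr in \<open>auto simp: S_def\<close>)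
    finally show ?thesis unfolding a_def b_def .
  qed
  then show ?thesis by blast
qed

lemma height_functional_inequality:
  fixes L :: "'a set"
  assumes nL: "number_subfield L" and fg: "uf * f + ug * g = 1" and d: "max (degree f) (degree g) = d"
    and cf: "\<And>i. coeff f i \<in> L" "\<And>i. coeff g i \<in> L"
  shows "\<exists>c. \<forall>x\<in>L. \<forall>y\<in>L. (x, y) \<noteq> (0, 0) \<longrightarrow>
    \<bar>height (P1_point (homog f d x y) (homog g d x y)) - real d * height (P1_point x y)\<bar> \<le> c"
proof -
  obtain e where rb: "rational_basis L (field_degree \<rat> L) e" by (rule number_subfield_rational_basis[OF nL]) (rule that)
  interpret rational_basis L "field_degree \<rat> L" e by (rule rb)
  have "\<forall>\<tau>\<in>J. \<exists>c. \<forall>x\<in>L. \<forall>y\<in>L. (x, y) \<noteq> (0, 0) \<longrightarrow>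
    \<bar>total (\<tau> (homog f d x y)) (\<tau> (homog g d x y)) - real d * total (\<tau> x) (\<tau> y)\<bar> \<le> c"
  proof
    fix \<tau> assume "\<tau> \<in> J"
    then obtain \<sigma> where s: "\<sigma> \<in> field_aut \<rat>" "\<tau> = restrict \<sigma> L" unfolding embeddings_def by blast
    have r: "\<tau> x = \<sigma> x" if "x \<in> L" for x unfolding s(2) using that by simp
    have h: "homog f d x y \<in> L" "homog g d x y \<in> L" if "x \<in> L" "y \<in> L" for x y
      using homog_in_subfield[OF L] cf that by blast+
    show "\<exists>c. \<forall>x\<in>L. \<forall>y\<in>L. (x, y) \<noteq> (0, 0) \<longrightarrow>
      \<bar>total (\<tau> (homog f d x y)) (\<tau> (homog g d x y)) - real d * total (\<tau> x) (\<tau> y)\<bar> \<le> c"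
      using total_functional_inequality[OF fg d s(1)] by (simp add: r h) blast
  qed
  from bchoice[OF this] obtain c where c: "\<And>\<tau> x y. \<tau> \<in> J \<Longrightarrow> x \<in> L \<Longrightarrow> y \<in> L \<Longrightarrow> (x, y) \<noteq> (0, 0) \<Longrightarrow>
    \<bar>total (\<tau> (homog f d x y)) (\<tau> (homog g d x y)) - real d * total (\<tau> x) (\<tau> y)\<bar> \<le> c \<tau>" by blast
  show ?thesis
  proof (intro exI[of _ "(\<Sum>\<tau>\<in>J. c \<tau>) / real (card J)"] ballI impI)
    fix x y assume xy: "x \<in> L" "y \<in> L" "(x, y) \<noteq> (0, 0)"
    define a b where "a = homog f d x y" and "b = homog g d x y"
    have ab: "a \<in> L" "b \<in> L" "(a, b) \<noteq> (0, 0)"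
      unfolding a_def b_def by (intro homog_in_subfield[OF L] cf xy homog_nonzero[OF fg d xy(3)])+
    have "height (P1_point a b) - real d * height (P1_point x y) = (\<Sum>\<tau>\<in>J. total (\<tau> a) (\<tau> b) - real d * total (\<tau> x) (\<tau> y)) / real (card J)"
      unfolding height_eq[OF nL ab] height_eq[OF nL xy] height_over_embeddings[OF nL ab] height_over_embeddings[OF nL xy]
      by (simp add: sum_subtractf sum_distrib_left diff_divide_distrib)
    also have "\<bar>\<dots>\<bar> = \<bar>\<Sum>\<tau>\<in>J. total (\<tau> a) (\<tau> b) - real d * total (\<tau> x) (\<tau> y)\<bar> / real (card J)" by simp
    also have "\<dots> \<le> (\<Sum>\<tau>\<in>J. c \<tau>) / real (card J)"
      by (intro divide_right_mono order_trans[OF sum_abs sum_mono]) (use c[OF _ xy] in \<open>auto simp: a_def b_def\<close>)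
    finally show "\<bar>height (P1_point (homog f d x y) (homog g d x y)) - real d * height (P1_point x y)\<bar> \<le> (\<Sum>\<tau>\<in>J. c \<tau>) / real (card J)"
      unfolding a_def b_def .
  qed
qed

end

text \<open>Tate's telescoping argument: consecutive quotients differ by at most
  \<open>c / d ^ (m + 1)\<close>, a summable geometric bound.\<close>

lemma telescoping_convergent:
  fixes h :: "nat \<Rightarrow> real"
  assumes d: "2 \<le> d" and h: "\<And>m. \<bar>h (Suc m) - real d * h m\<bar> \<le> c"
  shows "convergent (\<lambda>m. h m / real d ^ m)"
proof -
  define a where "a m = h m / real d ^ m" for m
  have "summable (\<lambda>m. a (Suc m) - a m)"
  proof (rule summable_comparison_test)
    have "norm (a (Suc m) - a m) \<le> c / real d * (1 / real d) ^ m" for m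
    proof -
      have "a (Suc m) - a m = (h (Suc m) - real d * h m) / (real d * real d ^ m)"
        unfolding a_def using d by (simp add: diff_divide_distrib)
      then have "norm (a (Suc m) - a m) = \<bar>h (Suc m) - real d * h m\<bar> / (real d * real d ^ m)" by (simp add: abs_mult)
      also have "\<dots> \<le> c / (real d * real d ^ m)" by (rule divide_right_mono[OF h]) simp
      finally show ?thesis by (simp add: power_one_over)
    qed
    then show "\<exists>N. \<forall>m\<ge>N. norm (a (Suc m) - a m) \<le> c / real d * (1 / real d) ^ m" by blast
    show "summable (\<lambda>m. c / real d * (1 / real d) ^ m)" using d by (intro summable_mult summable_geometric) simp
  qed
  then show ?thesis using telescope_summable' convergent_diff_const_right_iff[of a "a 0"]
    by (simp add: summable_iff_convergent sum_lessThan_telescope a_def[symmetric])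
qed

section \<open>Polynomials over the base field\<close>

abbreviation lift :: "'k::field poly \<Rightarrow> 'k alg_closure poly" where "lift \<equiv> map_poly to_ac"

lemma coeff_lift [simp]: "coeff (lift p) i = to_ac (coeff p i)"
  by (simp add: coeff_map_poly)

lemma lift_add [simp]: "lift (p + q) = lift p + lift q"
  and lift_diff [simp]: "lift (p - q) = lift p - lift q"
  and lift_smult [simp]: "lift (smult c p) = smult (to_ac c) (lift p)"
  and lift_mult [simp]: "lift (p * q) = lift p * lift q"
  and lift_monom: "lift (monom c n) = monom (to_ac c) n"
  by (rule poly_eqI; simp add: coeff_mult to_ac_sum)+

lemma lift_uminus [simp]: "lift (- p) = - lift p"
  by (rule poly_eqI) simp

lemma lift_pCons [simp]: "lift (pCons c p) = pCons (to_ac c) (lift p)"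
  by (simp add: map_poly_pCons)

lemma lift_eq_iff [simp]: "lift p = lift q \<longleftrightarrow> p = q"
  by (auto simp: poly_eq_iff)

lemma lift_eq_0_iff [simp]: "lift p = 0 \<longleftrightarrow> p = 0"
  using lift_eq_iff[of p 0] by simp

lemma degree_lift [simp]: "degree (lift p) = degree p"
  by (simp add: degree_map_poly)

lemma lift_power [simp]: "lift (p ^ n) = lift p ^ n"
  by (induction n) simp_all

lemma lift_sum: "lift (\<Sum>i\<in>I. h i) = (\<Sum>i\<in>I. lift (h i))"
  by (induction I rule: infinite_finite_induct) simp_all

lemma coprime_lift:
  assumes "coprime f g" obtains u v where "u * lift f + v * lift g = 1"
proof -
  obtain u v where "u * f + v * g = 1" by (rule bezout_coprime[OF assms])
  then have "lift (u * f + v * g) = lift 1" by (rule arg_cong)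
  then have "lift u * lift f + lift v * lift g = 1" by simp
  then show thesis by (rule that)
qed

lemma coprime_no_common_root:
  fixes f g :: "'k::field poly"
  assumes nz: "f \<noteq> 0 \<or> g \<noteq> 0" and nr: "\<And>z. \<not> (poly (lift f) z = 0 \<and> poly (lift g) z = 0)"
  shows "coprime f g"
proof (rule coprimeI)
  fix c assume c: "c dvd f" "c dvd g"
  then have c0: "c \<noteq> 0" using nz by auto
  have "degree c = 0"
  proof (rule ccontr)
    assume "degree c \<noteq> 0"
    then obtain z where "poly (lift c) z = 0" using alg_closed_imp_poly_has_root[of "lift c"] by auto
    then show False using nr[of z] c by (auto simp: dvd_def)
  qed
  then show "is_unit c" using c0 by (simp add: is_unit_iff_degree)
qed

lemma is_subfield_range_to_ac: "is_subfield (range (to_ac :: 'k::field \<Rightarrow> 'k alg_closure))"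
  unfolding is_subfield_def
proof (intro conjI ballI)
  show "0 \<in> range (to_ac :: 'k \<Rightarrow> _)" "1 \<in> range (to_ac :: 'k \<Rightarrow> _)" by (metis to_ac_0 rangeI, metis to_ac_1 rangeI)
  fix x y assume "x \<in> range (to_ac :: 'k \<Rightarrow> _)" "y \<in> range (to_ac :: 'k \<Rightarrow> _)"
  then obtain a b where [simp]: "x = to_ac a" "y = to_ac b" by blast
  show "x + y \<in> range to_ac" "x * y \<in> range to_ac" by (metis \<open>x = _\<close> \<open>y = _\<close> to_ac_add rangeI, metis \<open>x = _\<close> \<open>y = _\<close> to_ac_mult rangeI)
next
  fix x assume "x \<in> range (to_ac :: 'k \<Rightarrow> _)"
  then obtain a where [simp]: "x = to_ac a" by blast
  show "- x \<in> range to_ac" "inverse x \<in> range to_ac" by (metis \<open>x = _\<close> to_ac_minus rangeI, metis \<open>x = _\<close> to_ac_inverse rangeI)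
qed

section \<open>Minimal polynomials and simple extensions\<close>

lemma irreducible_coprime:
  fixes p q :: "'a::algebraic_semidom"
  assumes "irreducible p" "\<not> p dvd q" shows "coprime p q"
proof (rule coprimeI)
  fix c assume c: "c dvd p" "c dvd q"
  obtain r where r: "p = c * r" using c(1) by (rule dvdE)
  have "\<not> is_unit r"
  proof
    assume "is_unit r"
    then have "p dvd c" unfolding r by (simp add: mult_unit_dvd_iff)
    then show False using c(2) assms(2) dvd_trans by blast
  qed
  then show "is_unit c" using irreducibleD[OF assms(1) r] by blast
qed

lemma minimal_poly:
  fixes \<alpha> :: "'k::field alg_closure"
  obtains p :: "'k poly" where "lead_coeff p = 1" "irreducible p" "degree p > 0"
    "\<And>q. poly (lift q) \<alpha> = 0 \<longleftrightarrow> p dvd q"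
proof -
  define D where "D = {q :: 'k poly. q \<noteq> 0 \<and> poly (lift q) \<alpha> = 0}"
  obtain q0 :: "'k poly" where "q0 \<noteq> 0" "poly (lift q0) \<alpha> = 0" by (rule alg_closure_algebraic)
  then have "\<exists>n. \<exists>q\<in>D. degree q = n" unfolding D_def by auto
  from exists_least_iff[THEN iffD1, OF this]
  obtain q1 where q1: "q1 \<in> D" "\<And>q. q \<in> D \<Longrightarrow> degree q1 \<le> degree q" by (metis leI)
  define p where "p = smult (inverse (lead_coeff q1)) q1"
  have q10: "q1 \<noteq> 0" "poly (lift q1) \<alpha> = 0" using q1 unfolding D_def by auto
  have p: "p \<noteq> 0" "lead_coeff p = 1" "poly (lift p) \<alpha> = 0" "degree p = degree q1"
    unfolding p_def using q10 by simp_all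
  have min: "degree p \<le> degree q" if "q \<noteq> 0" "poly (lift q) \<alpha> = 0" for q
    unfolding p(4) by (rule q1(2)) (use that in \<open>simp add: D_def\<close>)
  have dvd: "poly (lift q) \<alpha> = 0 \<longleftrightarrow> p dvd q" for q
  proof
    assume q: "poly (lift q) \<alpha> = 0"
    have "q mod p = q - (q div p) * p" by (simp add: minus_div_mult_eq_mod)
    then have "poly (lift (q mod p)) \<alpha> = 0" using q p(3) by simp
    then have "q mod p = 0" using min[of "q mod p"] degree_mod_less[OF p(1), of q] by force
    then show "p dvd q" by (simp add: mod_eq_0_iff_dvd)
  next
    assume "p dvd q"
    then show "poly (lift q) \<alpha> = 0" using p(3) by (auto simp: dvd_def)
  qed
  have deg: "degree p > 0"
  proof (rule ccontr)
    assume "\<not> degree p > 0"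
    then obtain c where "p = [:c:]" by (auto elim: degree_eq_zeroE)
    then show False using p by simp
  qed
  have "irreducible p"
  proof (rule irreducibleI[OF p(1)])
    show "\<not> is_unit p" using deg p(1) by (simp add: is_unit_iff_degree)
    fix a b assume ab: "p = a * b"
    then have nz: "a \<noteq> 0" "b \<noteq> 0" using p(1) by auto
    have dab: "degree p = degree a + degree b" unfolding ab by (rule degree_mult_eq[OF nz])
    have "poly (lift a) \<alpha> = 0 \<or> poly (lift b) \<alpha> = 0" using p(3) unfolding ab by simp
    then have "degree b = 0 \<or> degree a = 0" using min[of a] min[of b] nz dab by auto
    then show "is_unit a \<or> is_unit b" using nz by (auto simp: is_unit_iff_degree)
  qed
  from p(2) this deg dvd show thesis by (rule that)
qed

text \<open>The values at \<open>\<alpha>\<close> of polynomials over K already form a field: a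
  polynomial not divisible by the irreducible \<open>p\<close> is coprime to it, and the Bezout
  identity evaluated at \<open>\<alpha>\<close> gives an inverse. Division by \<open>p\<close> with
  remainder shows that the powers of \<open>\<alpha>\<close> below \<open>degree p\<close> form a
  basis.\<close>

lemma adjoin_degree:
  fixes \<alpha> :: "'k::field alg_closure"
  assumes p: "irreducible p" "degree p > 0" "\<And>q. poly (lift q) \<alpha> = 0 \<longleftrightarrow> p dvd q"
  shows "ring.dimension ring_of_type_algebra (degree p) (range (to_ac :: 'k \<Rightarrow> _)) (adjoin \<alpha>)"
proof -
  let ?R = "ring_of_type_algebra :: 'k alg_closure ring" and ?K = "range (to_ac :: 'k \<Rightarrow> _)"
  interpret R: field ?R by (rule field_from_type_algebra)
  have K: "subfield ?K ?R" using subfield_type_algebra is_subfield_range_to_ac by blast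
  define V where "V = (\<lambda>q. poly (lift q) \<alpha>) ` (UNIV :: 'k poly set)"
  have VI: "poly (lift q) \<alpha> \<in> V" for q unfolding V_def by blast
  have V: "is_subfield V" unfolding is_subfield_def
  proof (intro conjI ballI)
    show "0 \<in> V" "1 \<in> V" using VI[of 0] VI[of 1] by simp_all
    fix x assume "x \<in> V"
    then obtain q where q: "x = poly (lift q) \<alpha>" unfolding V_def by blast
    show "- x \<in> V" using VI[of "smult (- 1) q"] unfolding q by simp
    show "inverse x \<in> V"
    proof (cases "x = 0")
      case True
      then show ?thesis using VI[of 0] by simp
    next
      case False
      then have "\<not> p dvd q" using p(3) q by blast
      then have "coprime p q" by (rule irreducible_coprime[OF p(1)])
      then obtain u v where "u * p + v * q = 1" by (rule bezout_coprime)
      from arg_cong[OF this, of "\<lambda>r. poly (lift r) \<alpha>"] have "poly (lift v) \<alpha> * x = 1"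
        using p(3)[of p] q by simp
      then have "inverse x = poly (lift v) \<alpha>" by (simp add: inverse_unique mult.commute)
      then show ?thesis using VI by simp
    qed
    fix y assume "y \<in> V"
    then obtain r where r: "y = poly (lift r) \<alpha>" unfolding V_def by blast
    show "x + y \<in> V" "x * y \<in> V" using VI[of "q + r"] VI[of "q * r"] unfolding q r by simp_all
  qed
  define us where "us = map (\<lambda>i. \<alpha> ^ i) [0..<degree p]"
  have car: "set us \<subseteq> carrier ?R" by simp
  have us: "length us = degree p" "i < degree p \<Longrightarrow> us ! i = \<alpha> ^ i" for i unfolding us_def by simp_all
  define P where "P Ks = (\<Sum>i<degree p. monom (Ks ! i) i)" for Ks :: "'k list"
  have comb: "R.combine (map to_ac Ks) us = poly (lift (P Ks)) \<alpha>" if "length Ks = degree p" for Ks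
    using that unfolding P_def by (simp add: combine_type_algebra us lift_sum lift_monom poly_sum poly_monom)
  have Kl: "\<exists>Ks'. Ks = map to_ac Ks'" if "set Ks \<subseteq> ?K" for Ks
    using that by (metis ex_map_conv subsetD rangeE)
  have ind: "R.independent ?K us"
  proof (rule ccontr)
    assume "\<not> R.independent ?K us"
    then obtain Ks where Ks: "length Ks = length us" "R.combine Ks us = \<zero>\<^bsub>?R\<^esub>" "set Ks \<subseteq> ?K" "set Ks \<noteq> {\<zero>\<^bsub>?R\<^esub>}"
      by (rule R.dependent_imp_non_trivial_combine[OF K car])
    obtain Ks' where Ks': "Ks = map to_ac Ks'" using Kl[OF Ks(3)] by blast
    have len: "length Ks' = degree p" using Ks(1) us(1) Ks' by simp
    have "p dvd P Ks'" using Ks(2) comb[OF len] p(3) Ks' by simp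
    moreover have "degree (P Ks') < degree p" unfolding P_def
      by (rule degree_lessI) (use p(2) in \<open>auto simp: coeff_sum\<close>)
    ultimately have P0: "P Ks' = 0" using dvd_imp_degree_le[of p "P Ks'"] by fastforce
    have "Ks' ! i = 0" if "i < degree p" for i
      using arg_cong[OF P0, of "\<lambda>q. coeff q i"] that unfolding P_def by (simp add: coeff_sum)
    then have "\<forall>x\<in>set Ks'. x = 0" using len by (metis in_set_conv_nth)
    moreover have "Ks' \<noteq> []" using len p(2) by auto
    ultimately have "set Ks = {0}" unfolding Ks' by (cases Ks') auto
    then show False using Ks(4) by simp
  qed
  have SV: "R.Span ?K us = V"
  proof
    show "R.Span ?K us \<subseteq> V"
    proof
      fix x assume "x \<in> R.Span ?K us"
      then obtain Ks where Ks: "set Ks \<subseteq> ?K" "length Ks = length us" "x = R.combine Ks us"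
        unfolding R.Span_mem_iff_length_version[OF K car] by blast
      obtain Ks' where Ks': "Ks = map to_ac Ks'" using Kl[OF Ks(1)] by blast
      then show "x \<in> V" using comb[of Ks'] Ks us(1) VI by simp
    qed
    show "V \<subseteq> R.Span ?K us"
    proof
      fix x assume "x \<in> V"
      then obtain q where q: "x = poly (lift q) \<alpha>" unfolding V_def by blast
      define Ks where "Ks = map (coeff (q mod p)) [0..<degree p]"
      have "q mod p = 0 \<or> degree (q mod p) < degree p" by (rule degree_mod_less) (use p(2) in auto)
      then have c0: "coeff (q mod p) i = 0" if "i \<ge> degree p" for i using that by (auto intro: coeff_eq_0)
      have "P Ks = q mod p" unfolding P_def Ks_def
        by (rule poly_eqI) (use c0 in \<open>auto simp: coeff_sum\<close>)
      moreover have "q mod p = q - (q div p) * p" by (simp add: minus_div_mult_eq_mod)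
      ultimately have "poly (lift (P Ks)) \<alpha> = x" using q p(3)[of p] by simp
      then have "x = R.combine (map to_ac Ks) us" using comb[of Ks] unfolding Ks_def by simp
      then show "x \<in> R.Span ?K us" unfolding R.Span_mem_iff_length_version[OF K car]
        by (intro bexI[of _ "map to_ac Ks"] exI[of _ "map to_ac Ks"] conjI) (auto simp: Ks_def us)
    qed
  qed
  have "adjoin \<alpha> = V" unfolding adjoin_def
  proof
    have "\<alpha> \<in> V" using VI[of "monom 1 1"] by (simp add: lift_monom poly_monom)
    moreover have "to_ac a \<in> V" for a using VI[of "[:a:]"] by (simp add: map_poly_pCons)
    ultimately show "generate_field ?R (insert \<alpha> ?K) \<subseteq> V"
      by (intro R.generate_field_min_subfield1) (use V subfield_type_algebra in auto)
    have g: "is_subfield (generate_field ?R (insert \<alpha> ?K))"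
      using R.generate_field_is_subfield[of "insert \<alpha> ?K"] subfield_type_algebra by auto
    have m: "insert \<alpha> ?K \<subseteq> generate_field ?R (insert \<alpha> ?K)" by (rule subsetI, erule generate_field.incl)
    show "V \<subseteq> generate_field ?R (insert \<alpha> ?K)"
    proof
      fix x assume "x \<in> V"
      then obtain q where q: "x = poly (lift q) \<alpha>" unfolding V_def by blast
      have a: "\<alpha> \<in> generate_field ?R (insert \<alpha> ?K)" and c: "coeff (lift q) i \<in> generate_field ?R (insert \<alpha> ?K)" for i
        using m by auto
      show "x \<in> generate_field ?R (insert \<alpha> ?K)" unfolding q poly_altdef
        by (rule is_subfield_sum[OF g], rule is_subfieldD(4)[OF g c is_subfield_power[OF g a]])
    qed
  qed
  then show ?thesis using R.dimensionI[OF K ind SV] unfolding us(1) by (simp only:)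
qed

lemma field_degree_adjoin:
  fixes q :: "'k::field poly"
  assumes "q \<noteq> 0" "poly (lift q) \<alpha> = 0"
  shows "0 < field_degree (range to_ac) (adjoin \<alpha>)" "field_degree (range to_ac) (adjoin \<alpha>) \<le> degree q"
proof -
  let ?R = "ring_of_type_algebra :: 'k alg_closure ring"
  interpret R: field ?R by (rule field_from_type_algebra)
  have K: "subfield (range (to_ac :: 'k \<Rightarrow> _)) ?R" using subfield_type_algebra is_subfield_range_to_ac by blast
  obtain p :: "'k poly" where p: "irreducible p" "degree p > 0" "\<And>q. poly (lift q) \<alpha> = 0 \<longleftrightarrow> p dvd q"
    by (rule minimal_poly[of \<alpha>]) (rule that)
  have "field_degree (range (to_ac :: 'k \<Rightarrow> _)) (adjoin \<alpha>) = degree p"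
    using R.dimI[OF K adjoin_degree[OF p]] unfolding field_degree_def over_def .
  then show "0 < field_degree (range to_ac) (adjoin \<alpha>)" "field_degree (range to_ac) (adjoin \<alpha>) \<le> degree q"
    using p(2) dvd_imp_degree_le[of p q] p(3) assms by auto
qed

section \<open>Number fields inside their algebraic closure\<close>

lemma number_subfield_range_to_ac:
  assumes "number_field TYPE('k::field_char_0)"
  shows "number_subfield (range (to_ac :: 'k \<Rightarrow> _))"
proof -
  let ?R = "ring_of_type_algebra :: 'k alg_closure ring"
  interpret R: field ?R by (rule field_from_type_algebra)
  have Q: "subfield \<rat> ?R" using subfield_type_algebra is_subfield_Rats by blast
  have U: "is_subfield (UNIV :: 'k set)" unfolding is_subfield_def by simp
  have "number_subfield (UNIV :: 'k set)"
    using assms U unfolding number_subfield_def number_field_def subfield_type_algebra by blast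
  then obtain e where e: "\<And>x :: 'k. \<exists>c. x = (\<Sum>i<field_degree \<rat> (UNIV :: 'k set). of_rat (c i) * e i)"
    by (rule number_subfield_basis) (use that in blast)
  define n where "n = field_degree \<rat> (UNIV :: 'k set)"
  define us where "us = map (\<lambda>i. to_ac (e i)) [0..<n]"
  have car: "set us \<subseteq> carrier ?R" by simp
  have us: "length us = n" "i < n \<Longrightarrow> us ! i = to_ac (e i)" for i unfolding us_def by simp_all
  have of_rat: "to_ac (of_rat q :: 'k) = of_rat q" for q
    by (cases q) (simp add: of_rat_rat)
  have "R.Span \<rat> us = range to_ac"
  proof
    show "R.Span \<rat> us \<subseteq> range to_ac"
    proof
      fix x assume "x \<in> R.Span \<rat> us"
      then obtain Ks where Ks: "set Ks \<subseteq> \<rat>" "length Ks = length us" "x = R.combine Ks us"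
        unfolding R.Span_mem_iff_length_version[OF Q car] by blast
      have "Ks ! i * us ! i \<in> range to_ac" if "i < n" for i
      proof -
        have "Ks ! i \<in> \<rat>" using Ks that us(1) by (auto dest: nth_mem)
        then obtain q where "Ks ! i = of_rat q" by (rule Rats_cases)
        then have "Ks ! i * us ! i = to_ac (of_rat q * e i)" using us(2)[OF that] of_rat by simp
        then show ?thesis by (rule range_eqI)
      qed
      then show "x \<in> range to_ac" unfolding Ks(3) combine_type_algebra[OF Ks(2)] us(1)
        by (intro is_subfield_sum[OF is_subfield_range_to_ac]) auto
    qed
    show "range to_ac \<subseteq> R.Span \<rat> us"
    proof
      fix x :: "'k alg_closure" assume "x \<in> range to_ac"
      then obtain a where a: "x = to_ac a" by blast
      obtain c where c: "a = (\<Sum>i<n. of_rat (c i) * e i)" using e unfolding n_def by blast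
      define Ks where "Ks = map (\<lambda>i. of_rat (c i) :: 'k alg_closure) [0..<n]"
      have "x = R.combine Ks us"
        unfolding a c Ks_def by (simp add: combine_type_algebra us to_ac_sum of_rat)
      moreover have "set Ks \<subseteq> \<rat>" "length Ks = length us" unfolding Ks_def by (auto simp: us)
      ultimately show "x \<in> R.Span \<rat> us" unfolding R.Span_mem_iff_length_version[OF Q car] by blast
    qed
  qed
  then have "R.finite_dimension \<rat> (range (to_ac :: 'k \<Rightarrow> _))" using R.Span_finite_dimension[OF Q car] by simp
  then show ?thesis unfolding number_subfield_def subfield_type_algebra using is_subfield_range_to_ac by blast
qed

text \<open>By the tower law \<open>adjoin x\<close> has finite dimension \<open>N\<close> over
  \<open>\<rat>\<close>, so the \<open>N + 1\<close> powers of \<open>x\<close> up to exponent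
  \<open>N\<close> are dependent, which yields a rational polynomial.\<close>

lemma algebraic_rat_alg_closure:
  assumes "number_field TYPE('k::field_char_0)"
  shows "algebraic_rat TYPE('k alg_closure)"
proof
  let ?R = "ring_of_type_algebra :: 'k alg_closure ring" and ?K = "range (to_ac :: 'k \<Rightarrow> _)"
  interpret R: field ?R by (rule field_from_type_algebra)
  have Q: "subfield \<rat> ?R" and K: "subfield ?K ?R" using subfield_type_algebra is_subfield_Rats is_subfield_range_to_ac by blast+
  have finK: "R.finite_dimension \<rat> ?K" using number_subfield_range_to_ac[OF assms] unfolding number_subfield_def by blast
  show "algebraic_over (\<rat> :: 'k alg_closure set)" unfolding algebraic_over_def
  proof
    fix x :: "'k alg_closure"
    obtain p :: "'k poly" where p: "irreducible p" "degree p > 0" "\<And>q. poly (lift q) x = 0 \<longleftrightarrow> p dvd q"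
      by (rule minimal_poly[of x]) (rule that)
    have "R.finite_dimension ?K (adjoin x)" by (rule R.finite_dimensionI[OF adjoin_degree[OF p]])
    then have "R.finite_dimension \<rat> (adjoin x)" by (rule R.telescopic_base_dim(1)[OF Q K finK])
    then obtain N where N: "R.dimension N \<rat> (adjoin x)" by (rule R.finite_dimensionE')
    have A: "is_subfield (adjoin x)" unfolding adjoin_def
      using R.generate_field_is_subfield[of "insert x ?K"] subfield_type_algebra by auto
    have xA: "x \<in> adjoin x" unfolding adjoin_def by (rule generate_field.incl) simp
    define us where "us = map (\<lambda>i. x ^ i) [0..<Suc N]"
    have us: "length us = Suc N" "i < Suc N \<Longrightarrow> us ! i = x ^ i" for i unfolding us_def by (simp_all del: upt_Suc)
    have "set us \<subseteq> adjoin x" unfolding us_def using is_subfield_power[OF A xA] by auto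
    then have "\<not> R.independent \<rat> us" using R.independent_length_le_dimension[OF Q N, of us] us(1) by auto
    then obtain Ks where Ks: "length Ks = length us" "R.combine Ks us = \<zero>\<^bsub>?R\<^esub>" "set Ks \<subseteq> \<rat>" "set Ks \<noteq> {\<zero>\<^bsub>?R\<^esub>}"
      by (rule R.dependent_imp_non_trivial_combine[OF Q, of us, rotated]) auto
    define q where "q = (\<Sum>i<Suc N. monom (Ks ! i) i)"
    have cq: "coeff q i = (if i < Suc N then Ks ! i else 0)" for i unfolding q_def by (auto simp: coeff_sum)
    show "\<exists>q. q \<noteq> 0 \<and> (\<forall>i. coeff q i \<in> \<rat>) \<and> poly q x = 0"
    proof (intro exI[of _ q] conjI allI)
      show "q \<noteq> 0"
      proof
        assume q0: "q = 0"
        have "Ks ! i = 0" if "i < Suc N" for i using cq[of i] that q0 by simp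
        then have "\<forall>a\<in>set Ks. a = 0" using Ks(1) us(1) by (metis in_set_conv_nth)
        moreover have "Ks \<noteq> []" using Ks(1) us(1) by auto
        ultimately have "set Ks = {0}" by (cases Ks) auto
        then show False using Ks(4) by simp
      qed
      show "coeff q i \<in> \<rat>" for i using cq[of i] Ks(1,3) us(1) by (auto dest: nth_mem)
      have "R.combine Ks us = poly q x"
        unfolding combine_type_algebra[OF Ks(1)] us(1) q_def poly_sum poly_monom by (intro sum.cong) (auto simp: us(2))
      then show "poly q x = 0" using Ks(2) by simp
    qed
  qed
qed

section \<open>Iterates of rational maps\<close>

lemma P1_point_scale: "c \<noteq> 0 \<Longrightarrow> P1_point (c * x) (c * y) = P1_point x y"
  unfolding P1_point_def by simp

lemma P1_point_eqD: "P1_point a b = P1_point c d \<Longrightarrow> a * d = c * b"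
  unfolding P1_point_def by (auto simp: field_simps split: if_splits)

lemma to_ac_homog: "to_ac (homog f d x y) = homog (lift f) d (to_ac x) (to_ac y)"
  unfolding homog_def by (simp add: to_ac_sum)

lemma quotient_map_homog:
  assumes "max (degree f) (degree g) = d" "(x, y) \<noteq> (0, 0)"
  shows "quotient_map f g (P1_point x y) = P1_point (homog (lift f) d x y) (homog (lift g) d x y)"
proof (cases "y = 0")
  case True
  then have "homog (lift h) d x y = x ^ d * to_ac (coeff h d)" for h by (simp add: homog_infinity)
  then show ?thesis using True assms by (simp add: P1_point_def[of x 0] P1_point_scale Let_def)
next
  case False
  then have "degree (lift f) \<le> d" "degree (lift g) \<le> d" using assms(1) by auto
  then show ?thesis using False by (simp add: homog_affine P1_point_def[of x y] P1_point_scale)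
qed

lemma coeff_mult_bound:
  fixes p q :: "'a::comm_semiring_1 poly"
  assumes "degree p \<le> a" "degree q \<le> b" shows "coeff (p * q) (a + b) = coeff p a * coeff q b"
proof -
  have "coeff (p * q) (a + b) = (\<Sum>i\<le>a + b. coeff p i * coeff q (a + b - i))" by (rule coeff_mult)
  also have "\<dots> = (\<Sum>i\<in>{a}. coeff p i * coeff q (a + b - i))"
  proof (rule sum.mono_neutral_right)
    show "\<forall>i\<in>{..a + b} - {a}. coeff p i * coeff q (a + b - i) = 0"
    proof
      fix i assume "i \<in> {..a + b} - {a}"
      then have "i > a \<or> a + b - i > b" by auto
      then show "coeff p i * coeff q (a + b - i) = 0" using assms by (auto simp: coeff_eq_0)
    qed
  qed auto
  finally show ?thesis by simp
qed

lemma coeff_power_bound: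
  fixes p :: "'a::comm_semiring_1 poly"
  assumes "degree p \<le> a" shows "degree (p ^ k) \<le> k * a" "coeff (p ^ k) (k * a) = coeff p a ^ k"
proof -
  show d: "degree (p ^ k) \<le> k * a" for k
    by (rule order_trans[OF degree_power_le]) (use assms in \<open>simp add: mult.commute\<close>)
  show "coeff (p ^ k) (k * a) = coeff p a ^ k"
    by (induction k) (simp_all add: coeff_mult_bound[OF assms d])
qed

text \<open>The degree-\<open>d\<close> form of \<open>f\<close> in the polynomials \<open>p\<close>
  and \<open>q\<close>. Used for numerator and denominator with the common degree \<open>d\<close>,
  it represents the composition of f/g with p/q after clearing denominators.\<close>

definition homog_compose :: "'a::field poly \<Rightarrow> nat \<Rightarrow> 'a poly \<Rightarrow> 'a poly \<Rightarrow> 'a poly" where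
  "homog_compose f d p q = (\<Sum>i\<le>d. smult (coeff f i) (p ^ i * q ^ (d - i)))"

lemma poly_homog_compose: "poly (homog_compose f d p q) z = homog f d (poly p z) (poly q z)"
  unfolding homog_compose_def homog_def by (simp add: poly_sum mult_ac)

lemma lift_homog_compose: "lift (homog_compose f d p q) = homog_compose (lift f) d (lift p) (lift q)"
  unfolding homog_compose_def by (simp add: lift_sum)

text \<open>The coefficient at the formal degree \<open>d * D\<close> may vanish. It is recorded
  because it gives the value at infinity: the form evaluated at the image of infinity under
  p/q.\<close>

lemma homog_compose_bound:
  assumes "degree p \<le> D" "degree q \<le> D"
  shows "degree (homog_compose f d p q) \<le> d * D"
    "coeff (homog_compose f d p q) (d * D) = homog f d (coeff p D) (coeff q D)"
proof -
  have s: "d * D = i * D + (d - i) * D" if "i \<le> d" for i using that by (simp flip: add_mult_distrib)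
  have c: "coeff (p ^ i * q ^ (d - i)) (d * D) = coeff p D ^ i * coeff q D ^ (d - i)" if "i \<le> d" for i
    unfolding s[OF that] coeff_mult_bound[OF coeff_power_bound(1)[OF assms(1)] coeff_power_bound(1)[OF assms(2)]]
      coeff_power_bound(2)[OF assms(1)] coeff_power_bound(2)[OF assms(2)] ..
  have "degree (smult (coeff f i) (p ^ i * q ^ (d - i))) \<le> d * D" if "i \<le> d" for i
  proof -
    have "degree (p ^ i * q ^ (d - i)) \<le> i * D + (d - i) * D"
      by (rule order_trans[OF degree_mult_le add_mono]) (rule coeff_power_bound(1)[OF assms(1)], rule coeff_power_bound(1)[OF assms(2)])
    then show ?thesis using s[OF that] by (intro order_trans[OF degree_smult_le]) simp
  qed
  then show "degree (homog_compose f d p q) \<le> d * D"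
    unfolding homog_compose_def by (intro degree_sum_le) auto
  show "coeff (homog_compose f d p q) (d * D) = homog f d (coeff p D) (coeff q D)"
    unfolding homog_compose_def homog_def coeff_sum by (intro sum.cong) (simp_all add: c mult.assoc)
qed

text \<open>No cancellation occurs, because the two forms of \<open>f\<close> and \<open>g\<close>
  have no common zero besides \<open>(0, 0)\<close>. Used at values of \<open>p\<close> and
  \<open>q\<close> this gives coprimality, and used at their top coefficients it gives the exact
  degree.\<close>

lemma quotient_map_compose:
  fixes f g p q :: "'k::field poly"
  assumes fg: "coprime f g" "max (degree f) (degree g) = d" and pq: "coprime p q" "max (degree p) (degree q) = D"
  obtains r s where "coprime r s" "max (degree r) (degree s) = d * D" "quotient_map f g \<circ> quotient_map p q = quotient_map r s"
proof -
  obtain u v where uv: "u * lift f + v * lift g = 1" by (rule coprime_lift[OF fg(1)])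
  obtain u' v' where uv': "u' * lift p + v' * lift q = 1" by (rule coprime_lift[OF pq(1)])
  have dl: "max (degree (lift f)) (degree (lift g)) = d" "max (degree (lift p)) (degree (lift q)) = D" using fg pq by simp_all
  define r s where "r = homog_compose f d p q" and "s = homog_compose g d p q"
  have nz: "(homog (lift f) d x y, homog (lift g) d x y) \<noteq> (0, 0)" if "(x, y) \<noteq> (0, 0)" for x y
    by (rule homog_nonzero[OF uv dl(1) that])
  have pz: "(poly (lift p) z, poly (lift q) z) \<noteq> (0, 0)" for z
  proof
    assume "(poly (lift p) z, poly (lift q) z) = (0, 0)"
    then show False using arg_cong[OF uv', of "\<lambda>h. poly h z"] by simp
  qed
  have top: "(to_ac (coeff p D), to_ac (coeff q D)) \<noteq> (0 :: 'k alg_closure, 0)"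
  proof -
    have "p \<noteq> 0 \<or> q \<noteq> 0" using pq(1) by auto
    then show ?thesis using top_coeff_nonzero[OF _ pq(2)] by simp
  qed
  have dD: "degree p \<le> D" "degree q \<le> D" using pq(2) by auto
  have rs: "poly (lift r) z = homog (lift f) d (poly (lift p) z) (poly (lift q) z)"
    "poly (lift s) z = homog (lift g) d (poly (lift p) z) (poly (lift q) z)" for z
    unfolding r_def s_def lift_homog_compose poly_homog_compose by simp_all
  have crs: "to_ac (coeff r (d * D)) = homog (lift f) d (to_ac (coeff p D)) (to_ac (coeff q D))"
    "to_ac (coeff s (d * D)) = homog (lift g) d (to_ac (coeff p D)) (to_ac (coeff q D))"
    unfolding r_def s_def homog_compose_bound(2)[OF dD] to_ac_homog by simp_all
  have ctop: "coeff r (d * D) \<noteq> 0 \<or> coeff s (d * D) \<noteq> 0"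
    using nz[OF top] crs by (metis to_ac_0)
  have cop: "coprime r s"
  proof (rule coprime_no_common_root)
    show "r \<noteq> 0 \<or> s \<noteq> 0" using ctop by auto
    show "\<not> (poly (lift r) z = 0 \<and> poly (lift s) z = 0)" for z using nz[OF pz[of z]] unfolding rs by simp
  qed
  have deg: "max (degree r) (degree s) = d * D"
  proof (rule antisym)
    show "max (degree r) (degree s) \<le> d * D" unfolding r_def s_def using homog_compose_bound(1)[OF dD] by simp
    show "d * D \<le> max (degree r) (degree s)" using ctop le_degree[of r "d * D"] le_degree[of s "d * D"] by auto
  qed
  have "quotient_map f g (quotient_map p q P) = quotient_map r s P" for P
  proof (cases P)
    case (Affine z)
    show ?thesis unfolding Affine quotient_map.simps quotient_map_homog[OF fg(2) pz] rs ..
  next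
    case Infinity
    show ?thesis unfolding Infinity quotient_map.simps(2) Let_def pq(2) deg quotient_map_homog[OF fg(2) top] crs ..
  qed
  then have "quotient_map f g \<circ> quotient_map p q = quotient_map r s" by (simp add: fun_eq_iff)
  with cop deg show thesis by (rule that)
qed

lemma iterate_representation:
  fixes \<phi> :: "'k::field alg_closure P1 \<Rightarrow> 'k alg_closure P1"
  assumes "rational_map \<phi> d"
  shows "\<exists>f g. coprime f g \<and> max (degree f) (degree g) = d ^ n \<and> \<phi> ^^ n = quotient_map f g"
proof (induction n)
  case 0
  have "quotient_map [:0, 1:] 1 P = P" for P :: "'k alg_closure P1"
    by (cases P) (simp_all add: P1_point_def)
  then have "\<phi> ^^ 0 = quotient_map [:0, 1:] 1" by (simp add: fun_eq_iff)
  then show ?case by (intro exI[of _ "[:0, 1:]"] exI[of _ 1]) simp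
next
  case (Suc n)
  obtain f g where fg: "coprime f g" "max (degree f) (degree g) = d" "\<phi> = quotient_map f g"
    using assms unfolding rational_map_def by blast
  obtain p q where pq: "coprime p q" "max (degree p) (degree q) = d ^ n" "\<phi> ^^ n = quotient_map p q" using Suc by blast
  obtain r s where rs: "coprime r s" "max (degree r) (degree s) = d * d ^ n" "quotient_map f g \<circ> quotient_map p q = quotient_map r s"
    by (rule quotient_map_compose[OF fg(1,2) pq(1,2)])
  have "\<phi> ^^ Suc n = quotient_map r s" using rs(3) fg(3) pq(3) by simp
  then show ?case using rs(1,2) by (intro exI[of _ r] exI[of _ s]) simp
qed

lemma coprime_mult_dvd:
  fixes f g h :: "'a::field poly"
  assumes "coprime f g" "f dvd h * g" shows "f dvd h"
proof -
  obtain u v where uv: "u * f + v * g = 1" by (rule bezout_coprime[OF assms(1)])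
  have "h = h * (u * f + v * g)" unfolding uv by simp
  also have "\<dots> = (h * u) * f + v * (h * g)" by (simp add: algebra_simps)
  finally show ?thesis using assms(2) by (metis dvd_add dvd_mult dvd_triv_right)
qed

text \<open>Needed because \<open>iterate_fraction\<close> chooses a pair without reference to
  degrees. Equal maps give \<open>f * g' = f' * g\<close> by comparing values everywhere, and
  coprimality makes corresponding parts divide each other.\<close>

lemma quotient_map_degree_unique:
  fixes f g f' g' :: "'k::field_char_0 poly"
  assumes c: "coprime f g" "coprime f' g'" and eq: "quotient_map f g = quotient_map f' g'"
  shows "max (degree f) (degree g) = max (degree f') (degree g')"
proof -
  have "poly (lift (f * g')) z = poly (lift (f' * g)) z" for z
  proof -
    have "quotient_map f g (Affine z) = quotient_map f' g' (Affine z)" unfolding eq ..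
    then show ?thesis using P1_point_eqD by simp
  qed
  then have "lift (f * g') = lift (f' * g)" using poly_eq_poly_eq_iff by blast
  then have e: "f * g' = f' * g" using lift_eq_iff by blast
  have 1: "f dvd f'" using coprime_mult_dvd[OF c(1), of f'] e by (metis dvd_triv_left)
  have 2: "f' dvd f" using coprime_mult_dvd[OF c(2), of f] e by (metis dvd_triv_left)
  have 3: "g dvd g'" using coprime_mult_dvd[of g f g'] c(1) e by (metis coprime_commute dvd_triv_right mult.commute)
  have 4: "g' dvd g" using coprime_mult_dvd[of g' f' g] c(2) e by (metis coprime_commute dvd_triv_right mult.commute)
  have deg: "degree a = degree b" if "a dvd b" "b dvd a" for a b :: "'k poly"
  proof (cases "a = 0 \<or> b = 0")
    case True
    then show ?thesis using that by auto
  next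
    case False
    then show ?thesis using that by (intro antisym dvd_imp_degree_le) auto
  qed
  show ?thesis using deg[OF 1 2] deg[OF 3 4] by simp
qed

lemma iterate_fraction:
  fixes \<phi> :: "'k::field_char_0 alg_closure P1 \<Rightarrow> 'k alg_closure P1"
  assumes r: "rational_map \<phi> d" and fg: "iterate_fraction \<phi> n = (f, g)"
  shows "coprime f g" "\<phi> ^^ n = quotient_map f g" "max (degree f) (degree g) = d ^ n"
proof -
  obtain p q where pq: "coprime p q" "max (degree p) (degree q) = d ^ n" "\<phi> ^^ n = quotient_map p q"
    using iterate_representation[OF r] by blast
  have "coprime (fst (p, q)) (snd (p, q)) \<and> \<phi> ^^ n = quotient_map (fst (p, q)) (snd (p, q))" using pq by simp
  from someI[of "\<lambda>fg. coprime (fst fg) (snd fg) \<and> \<phi> ^^ n = quotient_map (fst fg) (snd fg)", OF this]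
  show fg': "coprime f g" "\<phi> ^^ n = quotient_map f g" using fg unfolding iterate_fraction_def by simp_all
  show "max (degree f) (degree g) = d ^ n"
    using quotient_map_degree_unique[OF fg'(1) pq(1)] fg'(2) pq(2,3) by simp
qed

section \<open>Preperiodic points and the preimage polynomial\<close>

lemma funpow_preperiodic:
  assumes "preperiodic \<phi> \<gamma>" shows "preperiodic \<phi> ((\<phi> ^^ n) \<gamma>)"
proof -
  have "range (\<lambda>m. (\<phi> ^^ m) ((\<phi> ^^ n) \<gamma>)) \<subseteq> range (\<lambda>m. (\<phi> ^^ m) \<gamma>)"
    by (auto simp flip: funpow_add comp_apply[of "_ ^^ _"])
  then show ?thesis using assms unfolding preperiodic_def by (rule finite_subset)
qed

lemma periodic_preperiodic:
  assumes "0 < n" "(\<phi> ^^ n) \<gamma> = \<gamma>" shows "preperiodic \<phi> \<gamma>"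
proof -
  have "(\<phi> ^^ m) \<gamma> = (\<phi> ^^ (m mod n)) \<gamma>" for m using funpow_mod_eq[OF assms(2)] by simp
  then have "range (\<lambda>m. (\<phi> ^^ m) \<gamma>) \<subseteq> (\<lambda>m. (\<phi> ^^ m) \<gamma>) ` {..<n}" using assms(1) by force
  then show ?thesis unfolding preperiodic_def by (rule finite_subset) simp
qed

text \<open>Coprimality excludes a common zero of \<open>f\<close> and \<open>g\<close>, so roots
  are exactly the affine preimages. If the polynomial vanished, \<open>\<beta>\<close> would be its
  own preimage and thus periodic. That infinity is a preimage means that the coefficient at
  \<open>d ^ n\<close> is 0.\<close>

lemma preimage_poly:
  fixes \<phi> :: "'k::field_char_0 alg_closure P1 \<Rightarrow> 'k alg_closure P1"
  assumes r: "rational_map \<phi> d" and n: "0 < n" and np: "\<not> preperiodic \<phi> (Affine (to_ac \<beta>))"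
  defines "F \<equiv> preimage_poly \<phi> \<beta> n"
  shows "poly (lift F) z = 0 \<longleftrightarrow> Affine z \<in> preimages \<phi> \<beta> n" "F \<noteq> 0" "degree F \<le> d ^ n"
    "Infinity \<in> preimages \<phi> \<beta> n \<Longrightarrow> degree F < d ^ n"
proof -
  obtain f g where fg: "iterate_fraction \<phi> n = (f, g)" by (cases "iterate_fraction \<phi> n")
  note I = iterate_fraction[OF r fg]
  have F: "F = f - smult \<beta> g" unfolding F_def preimage_poly_def fg by simp
  obtain u v where uv: "u * lift f + v * lift g = 1" by (rule coprime_lift[OF I(1)])
  have root: "poly (lift F) z = 0 \<longleftrightarrow> Affine z \<in> preimages \<phi> \<beta> n" for z
  proof -
    have "\<not> (poly (lift f) z = 0 \<and> poly (lift g) z = 0)" using arg_cong[OF uv, of "\<lambda>h. poly h z"] by auto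
    then show ?thesis unfolding F preimages_def I(2) by (auto simp: P1_point_def divide_eq_eq)
  qed
  show "poly (lift F) z = 0 \<longleftrightarrow> Affine z \<in> preimages \<phi> \<beta> n" by (rule root)
  show nz: "F \<noteq> 0"
  proof
    assume "F = 0"
    then have "(\<phi> ^^ n) (Affine (to_ac \<beta>)) = Affine (to_ac \<beta>)" using root[of "to_ac \<beta>"] unfolding preimages_def by simp
    then have "preperiodic \<phi> (Affine (to_ac \<beta>))" by (rule periodic_preperiodic[OF n])
    with np show False ..
  qed
  show le: "degree F \<le> d ^ n" unfolding F using I(3) degree_smult_le[of \<beta> g] by (intro degree_diff_le) auto
  assume "Infinity \<in> preimages \<phi> \<beta> n"
  then have "P1_point (to_ac (coeff f (d ^ n))) (to_ac (coeff g (d ^ n))) = Affine (to_ac \<beta>)"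
    unfolding preimages_def I(2) by (simp add: Let_def I(3))
  then have "to_ac (coeff f (d ^ n)) = to_ac (\<beta> * coeff g (d ^ n))"
    unfolding P1_point_def by (auto simp: divide_eq_eq split: if_splits)
  then have "coeff f (d ^ n) = \<beta> * coeff g (d ^ n)" by (rule to_ac_eq_iff[THEN iffD1])
  then have "coeff F (d ^ n) = 0" unfolding F by simp
  then have "degree F \<noteq> d ^ n" using nz leading_coeff_0_iff[of F] by metis
  then show "degree F < d ^ n" using le by simp
qed

section \<open>Counting preimages\<close>

text \<open>Since \<open>canonical_height\<close> is a bare \<open>lim\<close>, convergence has to
  be proved first. It holds along the orbit of \<open>\<beta>\<close>, whose points have coordinates
  in K. The orbit of \<open>\<gamma>\<close> is the same sequence delayed by \<open>n\<close> steps,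
  which divides the limit by \<open>d ^ n\<close>.\<close>

lemma canonical_height_preimage:
  fixes \<phi> :: "'k::field_char_0 alg_closure P1 \<Rightarrow> 'k alg_closure P1"
  assumes K: "number_field TYPE('k)" and r: "rational_map \<phi> d" and d: "2 \<le> d"
    and \<gamma>: "(\<phi> ^^ n) \<gamma> = Affine (to_ac \<beta>)"
  shows "canonical_height \<phi> d \<gamma> = canonical_height \<phi> d (Affine (to_ac \<beta>)) / real d ^ n"
proof -
  interpret algebraic_rat "TYPE('k alg_closure)" by (rule algebraic_rat_alg_closure[OF K])
  let ?L = "range (to_ac :: 'k \<Rightarrow> _)"
  note L = is_subfield_range_to_ac[where 'k = 'k]
  obtain f g where fg: "coprime f g" "max (degree f) (degree g) = d" "\<phi> = quotient_map f g"
    using r unfolding rational_map_def by blast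
  obtain u v where uv: "u * lift f + v * lift g = 1" by (rule coprime_lift[OF fg(1)])
  have dl: "max (degree (lift f)) (degree (lift g)) = d" using fg(2) by simp
  have cf: "coeff (lift f) i \<in> ?L" "coeff (lift g) i \<in> ?L" for i by simp_all
  obtain c where c: "\<And>x y. x \<in> ?L \<Longrightarrow> y \<in> ?L \<Longrightarrow> (x, y) \<noteq> (0, 0) \<Longrightarrow>
    \<bar>height (P1_point (homog (lift f) d x y) (homog (lift g) d x y)) - real d * height (P1_point x y)\<bar> \<le> c"
    using height_functional_inequality[OF number_subfield_range_to_ac[OF K] uv dl cf] by blast
  define P where "P m = (\<phi> ^^ m) (Affine (to_ac \<beta>))" for m
  have rational: "\<exists>x y. x \<in> ?L \<and> y \<in> ?L \<and> (x, y) \<noteq> (0, 0) \<and> P m = P1_point x y" for m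
  proof (induction m)
    case 0
    have "P 0 = P1_point (to_ac \<beta>) 1" unfolding P_def P1_point_def by simp
    then show ?case using is_subfieldD(2)[OF L] by (intro exI[of _ "to_ac \<beta>"] exI[of _ 1]) simp
  next
    case (Suc m)
    then obtain x y where xy: "x \<in> ?L" "y \<in> ?L" "(x, y) \<noteq> (0, 0)" "P m = P1_point x y" by blast
    have "P (Suc m) = P1_point (homog (lift f) d x y) (homog (lift g) d x y)"
      using quotient_map_homog[OF fg(2) xy(3)] xy(4) unfolding P_def fg(3) by simp
    then show ?case
      using homog_in_subfield[OF L cf(1) xy(1,2)] homog_in_subfield[OF L cf(2) xy(1,2)] homog_nonzero[OF uv dl xy(3)] by blast
  qed
  have "\<bar>height (P (Suc m)) - real d * height (P m)\<bar> \<le> c" for m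
  proof -
    obtain x y where xy: "x \<in> ?L" "y \<in> ?L" "(x, y) \<noteq> (0, 0)" "P m = P1_point x y" using rational by blast
    have "P (Suc m) = P1_point (homog (lift f) d x y) (homog (lift g) d x y)"
      using quotient_map_homog[OF fg(2) xy(3)] xy(4) unfolding P_def fg(3) by simp
    then show ?thesis using c[OF xy(1-3)] xy(4) by simp
  qed
  then have "convergent (\<lambda>m. height (P m) / real d ^ m)" by (rule telescoping_convergent[OF d])
  then have lim: "(\<lambda>m. height (P m) / real d ^ m) \<longlonglongrightarrow> canonical_height \<phi> d (Affine (to_ac \<beta>))"
    unfolding canonical_height_def P_def by (rule convergent_LIMSEQ_iff[THEN iffD1])
  have shift: "height ((\<phi> ^^ (m + n)) \<gamma>) / real d ^ (m + n) = height (P m) / real d ^ m / real d ^ n" for m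
    unfolding P_def \<gamma>[symmetric] by (simp add: funpow_add power_add)
  have "(\<lambda>m. height (P m) / real d ^ m / real d ^ n) \<longlonglongrightarrow> canonical_height \<phi> d (Affine (to_ac \<beta>)) / real d ^ n"
    by (intro tendsto_divide lim tendsto_const) (use d in simp)
  then have "(\<lambda>m. height ((\<phi> ^^ (m + n)) \<gamma>) / real d ^ (m + n)) \<longlonglongrightarrow> canonical_height \<phi> d (Affine (to_ac \<beta>)) / real d ^ n"
    unfolding shift .
  then have "(\<lambda>m. height ((\<phi> ^^ m) \<gamma>) / real d ^ m) \<longlonglongrightarrow> canonical_height \<phi> d (Affine (to_ac \<beta>)) / real d ^ n"
    by (rule LIMSEQ_offset)
  then show ?thesis unfolding canonical_height_def[of \<phi> d \<gamma>] by (rule limI)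
qed

text \<open>The forward orbit of \<open>\<alpha>\<close> contains \<open>\<beta>\<close>, so
  \<open>\<alpha>\<close> is not preperiodic and the Lehmer bound applies to it. Any nonzero
  polynomial over K vanishing at \<open>\<alpha>\<close> bounds its degree.\<close>

lemma preimage_root_bound:
  fixes \<phi> :: "'k::field_char_0 alg_closure P1 \<Rightarrow> 'k alg_closure P1"
  assumes K: "number_field TYPE('k)" and r: "rational_map \<phi> d" and d: "2 \<le> d" and C: "dynamical_lehmer \<phi> d C"
    and np: "\<not> preperiodic \<phi> (Affine (to_ac \<beta>))"
    and \<alpha>: "(\<phi> ^^ n) (Affine \<alpha>) = Affine (to_ac \<beta>)" and q: "q \<noteq> 0" "poly (lift q) \<alpha> = 0"
  shows "C * real d ^ n \<le> canonical_height \<phi> d (Affine (to_ac \<beta>)) * real (degree q)"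
proof -
  define k where "k = field_degree (range to_ac) (adjoin \<alpha>)"
  have k: "0 < k" "k \<le> degree q" unfolding k_def by (rule field_degree_adjoin[OF q])+
  have "\<not> preperiodic \<phi> (Affine \<alpha>)" using funpow_preperiodic[of \<phi> "Affine \<alpha>" n] np \<alpha> by auto
  then have "C / real k < canonical_height \<phi> d (Affine \<alpha>)"
    using C unfolding dynamical_lehmer_def k_def by blast
  then have "C / real k < canonical_height \<phi> d (Affine (to_ac \<beta>)) / real d ^ n"
    unfolding canonical_height_preimage[OF K r d \<alpha>] .
  moreover have C0: "0 < C" using C unfolding dynamical_lehmer_def by blast
  then have "C / real (degree q) \<le> C / real k" using C0 k by (intro divide_left_mono) auto
  ultimately have "C / real (degree q) < canonical_height \<phi> d (Affine (to_ac \<beta>)) / real d ^ n" by simp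
  moreover have "0 < real (degree q)" "0 < real d ^ n" using k d by auto
  ultimately show ?thesis by (simp add: field_simps)
qed

section \<open>Irreducible factors and their degrees\<close>

definition monic_factors :: "'k::field poly \<Rightarrow> 'k poly set" where
  "monic_factors F = {p. irreducible p \<and> lead_coeff p = 1 \<and> p dvd F}"

lemma degree_irreducible: "irreducible (p :: 'k::field poly) \<Longrightarrow> 0 < degree p"
  using irreducible_not_unit[of p] is_unit_iff_degree[of p] by (cases "p = 0") auto

lemma irreducible_dvd_mult:
  fixes p a b :: "'k::field poly"
  assumes "irreducible p" "p dvd a * b" shows "p dvd a \<or> p dvd b"
  using coprime_mult_dvd[OF irreducible_coprime[OF assms(1)], of b a] assms(2) by blast

lemma monic_irreducible_dvd:
  fixes p q :: "'k::field poly"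
  assumes p: "irreducible p" "lead_coeff p = 1" and q: "irreducible q" "lead_coeff q = 1" and dvd: "q dvd p"
  shows "q = p"
proof -
  obtain r where r: "p = q * r" using dvd by (rule dvdE)
  then have "is_unit r" using irreducibleD[OF p(1) r] irreducible_not_unit[OF q(1)] by blast
  then obtain c where c: "r = [:c:]" by (auto simp: is_unit_poly_iff)
  have pc: "p = smult c q" unfolding r c by simp
  then have "lead_coeff p = c * lead_coeff q" by (simp only: lead_coeff_smult)
  then have "c = 1" using p(2) q(2) by simp
  then show ?thesis using pc by simp
qed

text \<open>Once \<open>p\<close> is split off, a different monic irreducible factor cannot divide
  \<open>p\<close> and must divide the cofactor.\<close>

lemma prod_factors_dvd:
  fixes F :: "'k::field poly"
  assumes "finite P" "P \<subseteq> monic_factors F"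
  shows "\<Prod>P dvd F"
  using assms
proof (induction P arbitrary: F rule: finite_induct)
  case (insert p P)
  then have p: "irreducible p" "lead_coeff p = 1" and P: "P \<subseteq> monic_factors F" unfolding monic_factors_def by auto
  obtain G where G: "F = p * G" using insert.prems unfolding monic_factors_def by (auto elim: dvdE)
  have "P \<subseteq> monic_factors G"
  proof
    fix q assume "q \<in> P"
    then have q: "irreducible q" "lead_coeff q = 1" "q dvd p * G" "q \<noteq> p" using P insert.hyps(2) unfolding monic_factors_def G by auto
    then have "q dvd G" using irreducible_dvd_mult[OF q(1,3)] monic_irreducible_dvd[OF p q(1,2)] by blast
    then show "q \<in> monic_factors G" using q unfolding monic_factors_def by simp
  qed
  then have "\<Prod>P dvd G" by (rule insert.IH)
  then show ?case using insert.hyps unfolding G by simp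
qed simp

text \<open>Every finite set of monic irreducible factors has a product dividing \<open>F\<close>,
  hence at most \<open>degree F\<close> elements. This uniform bound is what proves
  finiteness.\<close>

lemma monic_factors_degree:
  fixes F :: "'k::field poly"
  assumes F: "F \<noteq> 0"
  shows "finite (monic_factors F)" "(\<Sum>p\<in>monic_factors F. degree p) \<le> degree F"
proof -
  have sub: "(\<Sum>p\<in>P. degree p) \<le> degree F" if "finite P" "P \<subseteq> monic_factors F" for P
  proof -
    have "\<forall>p\<in>P. p \<noteq> 0" using that(2) unfolding monic_factors_def by auto
    then have "(\<Sum>p\<in>P. degree p) = degree (\<Prod>P)" by (simp add: degree_prod_eq_sum_degree)
    also have "\<dots> \<le> degree F" by (rule dvd_imp_degree_le[OF prod_factors_dvd[OF that] F])
    finally show ?thesis .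
  qed
  have "card P \<le> degree F" if "finite P" "P \<subseteq> monic_factors F" for P
  proof -
    have "1 \<le> degree p" if "p \<in> P" for p
      using degree_irreducible[of p] that \<open>P \<subseteq> monic_factors F\<close> unfolding monic_factors_def by auto
    then have "(\<Sum>p\<in>P. 1) \<le> (\<Sum>p\<in>P. degree p)" by (rule sum_mono)
    then show ?thesis using sub[OF that] by simp
  qed
  then show fin: "finite (monic_factors F)" using finite_if_finite_subsets_card_bdd[of "monic_factors F" "degree F"] by blast
  show "(\<Sum>p\<in>monic_factors F. degree p) \<le> degree F" by (rule sub[OF fin subset_refl])
qed

lemma irreducible_smult:
  assumes "irreducible (p :: 'k::field poly)" "c \<noteq> 0" shows "irreducible (smult c p)"
proof -
  have "is_unit [:c:]" using assms(2) by (simp add: is_unit_iff_degree)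
  then have "irreducible ([:c:] * p)" using assms(1) irreducible_mult_unit_left by blast
  then show ?thesis by simp
qed

text \<open>Each class up to scalars is the class of its monic member, so monic factors bound the
  number of classes from above.\<close>

lemma irreducible_factors_monic:
  fixes F :: "'k::field poly"
  shows "irreducible_factors F \<subseteq> (\<lambda>p. {q. \<exists>c. c \<noteq> 0 \<and> q = smult c p}) ` monic_factors F"
proof
  fix S assume "S \<in> irreducible_factors F"
  then obtain p where p: "irreducible p" "p dvd F" "S = {q. \<exists>c. c \<noteq> 0 \<and> q = smult c p}"
    unfolding irreducible_factors_def quotient_def by auto
  define a where "a = lead_coeff p"
  have a: "a \<noteq> 0" unfolding a_def using p(1) by auto
  define p' where "p' = smult (inverse a) p"
  have "p' \<in> monic_factors F" unfolding monic_factors_def p'_def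
    using a irreducible_smult[OF p(1)] p(2) by (simp add: a_def[symmetric] smult_dvd_iff)
  moreover have "S = {q. \<exists>c. c \<noteq> 0 \<and> q = smult c p'}"
  proof -
    have "(\<exists>c. c \<noteq> 0 \<and> q = smult c p) \<longleftrightarrow> (\<exists>c. c \<noteq> 0 \<and> q = smult c p')" for q
    proof
      assume "\<exists>c. c \<noteq> 0 \<and> q = smult c p"
      then obtain c where "c \<noteq> 0" "q = smult c p" by blast
      then show "\<exists>c. c \<noteq> 0 \<and> q = smult c p'" using a unfolding p'_def by (intro exI[of _ "c * a"]) (simp add: mult.assoc)
    next
      assume "\<exists>c. c \<noteq> 0 \<and> q = smult c p'"
      then obtain c where "c \<noteq> 0" "q = smult c p'" by blast
      then show "\<exists>c. c \<noteq> 0 \<and> q = smult c p" using a unfolding p'_def by (intro exI[of _ "c * inverse a"]) simp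
    qed
    then show ?thesis unfolding p(3) by simp
  qed
  ultimately show "S \<in> (\<lambda>p. {q. \<exists>c. c \<noteq> 0 \<and> q = smult c p}) ` monic_factors F" by blast
qed

section \<open>Galois orbits as conjugacy classes of roots\<close>

lemma galois_group_field_aut: "galois_group = field_aut (range (to_ac :: 'k::field \<Rightarrow> _))"
proof (rule Set.set_eqI)
  fix \<sigma> :: "'k alg_closure \<Rightarrow> 'k alg_closure"
  have "\<sigma> 1 = 1" if "\<forall>a. \<sigma> (to_ac a) = to_ac a" using that[rule_format, of 1] by simp
  then show "\<sigma> \<in> galois_group \<longleftrightarrow> \<sigma> \<in> field_aut (range (to_ac :: 'k \<Rightarrow> _))"
    unfolding galois_group_def field_aut_def ring_iso_def Ring.ring_hom_def by auto
qed

text \<open>An irreducible \<open>p\<close> is associated to the minimal polynomial of its root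
  \<open>\<alpha>\<close>, so every polynomial over K that vanishes at \<open>\<alpha>\<close> is
  divisible by \<open>p\<close> and vanishes at \<open>\<alpha>'\<close>.\<close>

lemma conjugate_roots:
  fixes p :: "'k::field poly"
  assumes p: "irreducible p" and roots: "poly (lift p) \<alpha> = 0" "poly (lift p) \<alpha>' = 0"
  obtains \<sigma> where "\<sigma> \<in> galois_group" "\<sigma> \<alpha> = \<alpha>'"
proof -
  let ?K = "range (to_ac :: 'k \<Rightarrow> _)"
  have alg: "algebraic_over ?K" unfolding algebraic_over_def
  proof
    fix x :: "'k alg_closure"
    obtain q :: "'k poly" where "q \<noteq> 0" "poly (lift q) x = 0" by (rule alg_closure_algebraic)
    then show "\<exists>q. q \<noteq> 0 \<and> (\<forall>i. coeff q i \<in> ?K) \<and> poly q x = 0" by (intro exI[of _ "lift q"]) simp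
  qed
  have transfer: "\<forall>q. (\<forall>i. coeff q i \<in> ?K) \<longrightarrow> poly q \<alpha> = 0 \<longrightarrow> poly q \<alpha>' = 0"
  proof (intro allI impI)
    fix q :: "'k alg_closure poly" assume q: "\<forall>i. coeff q i \<in> ?K" and root: "poly q \<alpha> = 0"
    define q' where "q' = map_poly of_ac q"
    have lq: "q = lift q'" unfolding q'_def
    proof (rule poly_eqI)
      fix i
      have "of_ac (0 :: 'k alg_closure) = 0" by simp
      then show "coeff q i = coeff (lift (map_poly of_ac q)) i" using q by (simp add: coeff_map_poly to_ac_of_ac)
    qed
    obtain p0 :: "'k poly" where p0: "irreducible p0" "\<And>q. poly (lift q) \<alpha> = 0 \<longleftrightarrow> p0 dvd q"
      by (rule minimal_poly[of \<alpha>]) (rule that)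
    obtain s where s: "p = p0 * s" using p0(2)[of p] roots(1) by (auto elim: dvdE)
    then have "is_unit s" using irreducibleD[OF p s] irreducible_not_unit[OF p0(1)] by blast
    then have "p dvd p0" unfolding s by (simp add: mult_unit_dvd_iff)
    moreover have "p0 dvd q'" using p0(2) root lq by simp
    ultimately have "p dvd q'" by (rule dvd_trans)
    then show "poly q \<alpha>' = 0" unfolding lq using roots(2) by (auto elim: dvdE)
  qed
  obtain \<sigma> where "\<sigma> \<in> field_aut ?K" "\<sigma> \<alpha> = \<alpha>'"
  proof (rule conjugate_automorphism[OF is_subfield_range_to_ac alg, of \<alpha> \<alpha>'])
    show "poly q \<alpha>' = 0" if "\<And>i. coeff q i \<in> ?K" "poly q \<alpha> = 0" for q using transfer that by blast
  qed (rule that)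
  then show thesis using that unfolding galois_group_field_aut by blast
qed

lemma galois_orbit_apply:
  fixes \<sigma> :: "'k::field alg_closure \<Rightarrow> 'k alg_closure"
  assumes \<sigma>: "\<sigma> \<in> galois_group"
  shows "(\<lambda>\<tau>. map_P1 \<tau> (Affine (\<sigma> \<alpha>))) ` galois_group = (\<lambda>\<tau>. map_P1 \<tau> (Affine \<alpha>)) ` galois_group"
proof -
  note s = \<sigma>[unfolded galois_group_field_aut]
  have bij: "bij \<sigma>" using s unfolding field_aut_def by blast
  have sub: "(\<lambda>\<tau>. Affine (\<tau> (\<rho> a))) ` field_aut F \<subseteq> (\<lambda>\<tau>. Affine (\<tau> a)) ` field_aut F" if r: "\<rho> \<in> field_aut F"
    for \<rho> :: "'k alg_closure \<Rightarrow> 'k alg_closure" and a F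
  proof (rule image_subsetI)
    fix \<tau> assume "\<tau> \<in> field_aut F"
    then have "\<tau> \<circ> \<rho> \<in> field_aut F" using r by (rule field_aut_compose)
    then show "Affine (\<tau> (\<rho> a)) \<in> (\<lambda>\<tau>. Affine (\<tau> a)) ` field_aut F" by (rule rev_image_eqI) simp
  qed
  have "inv_into UNIV \<sigma> (\<sigma> \<alpha>) = \<alpha>" using bij by (simp add: bij_is_inj)
  then show ?thesis unfolding galois_group_field_aut P1.map
    using sub[OF s, of \<alpha>] sub[OF field_aut_inv[OF s], of "\<sigma> \<alpha>"] by auto
qed

text \<open>An affine orbit is determined by the minimal polynomial of any of its points, so one
  chosen root for each monic factor meets all of them. The orbit of infinity is added
  separately.\<close>

lemma galois_orbits_cover:
  fixes S :: "'k::field alg_closure P1 set"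
  assumes "F \<noteq> 0" and S: "\<And>\<alpha>. Affine \<alpha> \<in> S \<Longrightarrow> poly (lift F) \<alpha> = 0"
  defines "orbit \<equiv> \<lambda>P :: 'k alg_closure P1. (\<lambda>\<tau>. map_P1 \<tau> P) ` galois_group"
  shows "galois_orbits S \<subseteq> (\<lambda>p. orbit (Affine (SOME \<alpha>. poly (lift p) \<alpha> = 0))) ` monic_factors F \<union> (if Infinity \<in> S then {orbit Infinity} else {})"
proof
  fix O' assume "O' \<in> galois_orbits S"
  then obtain P where P: "P \<in> S" "O' = orbit P" unfolding galois_orbits_def orbit_def by blast
  show "O' \<in> (\<lambda>p. orbit (Affine (SOME \<alpha>. poly (lift p) \<alpha> = 0))) ` monic_factors F \<union> (if Infinity \<in> S then {orbit Infinity} else {})"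
  proof (cases P)
    case Infinity
    then show ?thesis using P by simp
  next
    case (Affine \<alpha>)
    obtain p :: "'k poly" where p: "lead_coeff p = 1" "irreducible p" "\<And>q. poly (lift q) \<alpha> = 0 \<longleftrightarrow> p dvd q"
      by (rule minimal_poly[of \<alpha>]) (rule that)
    have pF: "p \<in> monic_factors F" using p S P(1) Affine unfolding monic_factors_def by blast
    have root: "poly (lift p) \<alpha> = 0" using p(3) by simp
    define \<alpha>' where "\<alpha>' = (SOME \<alpha>. poly (lift p) \<alpha> = 0)"
    have root': "poly (lift p) \<alpha>' = 0" unfolding \<alpha>'_def using root by (rule someI)
    obtain \<sigma> where s: "\<sigma> \<in> galois_group" "\<sigma> \<alpha> = \<alpha>'" by (rule conjugate_roots[OF p(2) root root'])
    have "O' = orbit (Affine \<alpha>')" unfolding P(2) Affine orbit_def s(2)[symmetric] galois_orbit_apply[OF s(1)] ..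
    then show ?thesis using pF unfolding \<alpha>'_def by blast
  qed
qed

text \<open>Taken from the Lehmer bound itself, whose right-hand side is nonnegative.\<close>

lemma canonical_height_nonneg:
  assumes C: "dynamical_lehmer \<phi> d C" and np: "\<not> preperiodic \<phi> (Affine \<alpha>)"
  shows "0 \<le> canonical_height \<phi> d (Affine \<alpha>)"
proof -
  have "C / real (field_degree (range to_ac) (adjoin \<alpha>)) < canonical_height \<phi> d (Affine \<alpha>)" and "0 < C"
    using C np unfolding dynamical_lehmer_def by blast+
  moreover have "0 \<le> C / real (field_degree (range to_ac) (adjoin \<alpha>))" using \<open>0 < C\<close> by simp
  ultimately show ?thesis by linarith
qed

lemma pole_bound:
  fixes \<phi> :: "'k::field_char_0 alg_closure P1 \<Rightarrow> 'k alg_closure P1"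
  assumes K: "number_field TYPE('k)" and r: "rational_map \<phi> d" and d: "2 \<le> d" and C: "dynamical_lehmer \<phi> d C"
    and np: "\<not> preperiodic \<phi> (Affine (to_ac \<beta>))" and inf: "Infinity \<in> preimages \<phi> \<beta> n"
  shows "C * real d ^ n \<le> canonical_height \<phi> d (Affine (to_ac \<beta>))"
proof -
  obtain f g where fg: "coprime f g" "max (degree f) (degree g) = d" "\<phi> = quotient_map f g"
    using r unfolding rational_map_def by blast
  \<comment> \<open>If the denominator were constant, \<open>\<phi>\<close> would fix infinity,
    whose orbit would then never reach the affine point \<open>\<beta>\<close>. Hence an affine pole
    exists.\<close>
  have "degree g \<noteq> 0"
  proof
    assume g0: "degree g = 0"
    then have "coeff g d = 0" using d by (intro coeff_eq_0) simp
    then have "\<phi> Infinity = Infinity" unfolding fg(3) by (simp add: Let_def fg(2) P1_point_def)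
    then have "(\<phi> ^^ n) Infinity = Infinity" by (induction n) simp_all
    then show False using inf unfolding preimages_def by simp
  qed
  then obtain \<alpha> where \<alpha>: "poly (lift g) \<alpha> = 0" using alg_closed_imp_poly_has_root[of "lift g"] by auto
  then have "\<phi> (Affine \<alpha>) = Infinity" unfolding fg(3) by (simp add: P1_point_def)
  then have "(\<phi> ^^ Suc n) (Affine \<alpha>) = Affine (to_ac \<beta>)" using inf unfolding preimages_def funpow_Suc_right by simp
  moreover have g: "g \<noteq> 0" using \<open>degree g \<noteq> 0\<close> by auto
  ultimately have "C * real d ^ Suc n \<le> canonical_height \<phi> d (Affine (to_ac \<beta>)) * real (degree g)"
    by (intro preimage_root_bound[OF K r d C np _ _ \<alpha>])
  also have "\<dots> \<le> canonical_height \<phi> d (Affine (to_ac \<beta>)) * real d"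
    by (rule mult_left_mono[OF _ canonical_height_nonneg[OF C np]]) (use fg(2) in auto)
  finally show ?thesis using d by simp
qed

theorem theorem4p3:
  fixes \<phi> :: "'k::field_char_0 alg_closure P1 \<Rightarrow> 'k alg_closure P1"
    and d :: nat and C :: real and \<beta> :: 'k
  assumes "number_field TYPE('k)"
    and "rational_map \<phi> d" and "d \<ge> 2"
    and "dynamical_lehmer \<phi> d C"
    and "\<not> preperiodic \<phi> (Affine (to_ac \<beta>))"
  shows "\<forall>n\<ge>1.
    finite (irreducible_factors (preimage_poly \<phi> \<beta> n)) \<and>
    real (mu \<phi> \<beta> n) \<le> canonical_height \<phi> d (Affine (to_ac \<beta>)) / C \<and>
    finite (galois_orbits (preimages \<phi> \<beta> n)) \<and>
    real (card (galois_orbits (preimages \<phi> \<beta> n)))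
      \<le> canonical_height \<phi> d (Affine (to_ac \<beta>)) / C"
proof (intro allI impI)
  fix n :: nat assume "1 \<le> n"
  then have n: "0 < n" by simp
  define F where "F = preimage_poly \<phi> \<beta> n"
  define H where "H = canonical_height \<phi> d (Affine (to_ac \<beta>))"
  define R where "R = monic_factors F"
  define D where "D = real d ^ n"
  define S where "S = preimages \<phi> \<beta> n"
  note F = preimage_poly[OF assms(2) n assms(5), folded F_def S_def]
  have C: "0 < C" using assms(4) unfolding dynamical_lehmer_def by blast
  have D: "0 < D" unfolding D_def using assms(3) by simp
  have H: "0 \<le> H" unfolding H_def by (rule canonical_height_nonneg[OF assms(4,5)])
  have R: "finite R" "(\<Sum>p\<in>R. degree p) \<le> degree F" unfolding R_def by (rule monic_factors_degree[OF F(2)])+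
  have "C * D \<le> H * real (degree p)" if "p \<in> R" for p
  proof -
    have p: "irreducible p" "p dvd F" using that unfolding R_def monic_factors_def by auto
    then obtain \<alpha> where \<alpha>: "poly (lift p) \<alpha> = 0"
      using alg_closed_imp_poly_has_root[of "lift p"] degree_irreducible[OF p(1)] by auto
    then have "poly (lift F) \<alpha> = 0" using p(2) by (auto elim: dvdE)
    then have "(\<phi> ^^ n) (Affine \<alpha>) = Affine (to_ac \<beta>)" using F(1) unfolding S_def preimages_def by blast
    moreover have "p \<noteq> 0" using p(1) by auto
    ultimately show ?thesis unfolding D_def H_def using \<alpha> by (rule preimage_root_bound[OF assms])
  qed
  then have "(\<Sum>p\<in>R. C * D) \<le> (\<Sum>p\<in>R. H * real (degree p))" by (rule sum_mono)
  then have "real (card R) * (C * D) \<le> H * real (\<Sum>p\<in>R. degree p)" by (simp add: sum_distrib_left)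
  also have "\<dots> \<le> H * real (degree F)" by (intro mult_left_mono of_nat_mono R(2) H)
  finally have cardR: "real (card R) * (C * D) \<le> H * real (degree F)" .
  \<comment> \<open>Counts the possible orbit of infinity. One inequality for
    \<open>card R + e\<close> then serves both claims: \<open>mu\<close> is at most
    \<open>card R\<close>, and the number of orbits is at most \<open>card R + e\<close>.\<close>
  define e where "e = (if Infinity \<in> S then 1 else 0 :: nat)"
  have "(real (card R) + real e) * (C * D) \<le> H * D"
  proof (cases "Infinity \<in> S")
    case True
    \<comment> \<open>The drop in degree leaves a spare summand \<open>H\<close> in
      \<open>H * D\<close>, which \<open>pole_bound\<close> shows to be at least
      \<open>C * D\<close>, the price of one more orbit.\<close>
    have "real (degree F) + 1 \<le> D" using F(4)[OF True] unfolding D_def by (simp flip: of_nat_power)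
    then have "H * (real (degree F) + 1) \<le> H * D" using H by (rule mult_left_mono)
    moreover have "C * D \<le> H" using pole_bound[OF assms(1-5)] True unfolding S_def D_def H_def .
    ultimately show ?thesis using cardR True unfolding e_def by (simp add: algebra_simps)
  next
    case False
    have "real (degree F) \<le> D" using F(3) unfolding D_def by (simp flip: of_nat_power)
    then have "H * real (degree F) \<le> H * D" using H by (rule mult_left_mono)
    then show ?thesis using cardR False unfolding e_def by simp
  qed
  then have "((real (card R) + real e) * C) * D \<le> H * D" by (simp add: mult.assoc)
  then have "(real (card R) + real e) * C \<le> H" using D by simp
  then have bound: "real (card R) + real e \<le> H / C" using C by (simp add: pos_le_divide_eq)
  have fin1: "finite (irreducible_factors F)" and "card (irreducible_factors F) \<le> card R"
    using finite_surj[OF R(1)] surj_card_le[OF R(1)] irreducible_factors_monic[of F] unfolding R_def by blast+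
  then have mu: "real (mu \<phi> \<beta> n) \<le> H / C" using bound unfolding mu_def F_def[symmetric] by simp
  define orbit where "orbit P = (\<lambda>\<tau>. map_P1 \<tau> P) ` galois_group" for P :: "'k alg_closure P1"
  define T where "T = (\<lambda>p. orbit (Affine (SOME \<alpha>. poly (lift p) \<alpha> = 0))) ` R \<union> (if Infinity \<in> S then {orbit Infinity} else {})"
  have T: "galois_orbits S \<subseteq> T" unfolding T_def R_def orbit_def by (rule galois_orbits_cover[OF F(2)]) (use F(1) in blast)
  have finT: "finite T" unfolding T_def using R(1) by simp
  have "card T \<le> card R + e" unfolding T_def e_def
    by (rule order_trans[OF card_Un_le add_mono]) (use card_image_le[OF R(1)] in auto)
  then have "card (galois_orbits S) \<le> card R + e" using card_mono[OF finT T] by simp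
  then have "real (card (galois_orbits S)) \<le> H / C" using bound by linarith
  then show "finite (irreducible_factors (preimage_poly \<phi> \<beta> n)) \<and>
    real (mu \<phi> \<beta> n) \<le> canonical_height \<phi> d (Affine (to_ac \<beta>)) / C \<and>
    finite (galois_orbits (preimages \<phi> \<beta> n)) \<and>
    real (card (galois_orbits (preimages \<phi> \<beta> n))) \<le> canonical_height \<phi> d (Affine (to_ac \<beta>)) / C"
    using fin1 mu finite_subset[OF T finT] unfolding F_def S_def H_def by blast
qed

end
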